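(* Let $T$ be any theory such that $T$ interprets an infinite linear order. Then $T$ is not hereditarily G-compact.
   Context: Theories are complete first-order theories; structures may be many-sorted (possibly with infinitely many sorts). $T$ interprets a structure if some model of $T$ interprets it, possibly with parameters. An interpreted structure $N$ may be many-sorted: each of its sorts is a definable set modulo a definable equivalence relation, and its basic relations and functions are definable in the interpreting structure, where parameters are allowed (equivalently, up to forgetting irrelevant sorts, $N$ is a reduct of $M^{\mathrm{eq}}$ expanded by constants). Lascar distance: let $\mathfrak C$ be a monster model of a theory. For small (possibly infinite) tuples $a,b\in\mathfrak C$ write $d_L(a,b)\le n$ if there are tuples $a=a_0,a_1,\dots,a_n=b$ and small $M_1,\dots,M_n\preceq\mathfrak C$ such that $\operatorname{tp}(a_{i-1}/M_i)=\operatorname{tp}(a_i/M_i)$ for $i=1,\dots,n$. $d_L(a,b)$ is the least such $n$, or $\infty$ if there is none. A theory is G-compact if for every tuple $a$ there is an integer $n$ such that for all $b$, $d_L(a,b)<\infty$ implies $d_L(a,b)\le n$. A theory $T$ is hereditarily G-compact if for every model $M\models T$ and every structure $N$ interpreted by $M$ (with parameters), $\operatorname{Th}(N)$ is G-compact. *)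

theory Defs
  imports
    "HOL-Library.FuncSet"
    "HOL-Library.Extended_Nat"
    "HOL-Library.Infinite_Typeclass"
begin

unbundle cardinal_syntax

section \<open>Many-sorted first-order logic\<close>

text \<open>A signature selects its sorts, function symbols and relation symbols as subsets of the
  symbol types, so that purely relational signatures (and signatures with finitely many sorts)
  are available over any symbol types.\<close>

record ('s, 'f, 'r) signature =
  Sorts :: "'s set"
  Funs :: "'f set"
  Rels :: "'r set"
  fdom :: "'f \<Rightarrow> 's list"
  fcod :: "'f \<Rightarrow> 's"
  rdom :: "'r \<Rightarrow> 's list"

definition wf_signature :: "('s, 'f, 'r) signature \<Rightarrow> bool" where
  "wf_signature L \<longleftrightarrow>
     (\<forall>f\<in>Funs L. set (fdom L f) \<subseteq> Sorts L \<and> fcod L f \<in> Sorts L) \<and>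
     (\<forall>r\<in>Rels L. set (rdom L r) \<subseteq> Sorts L)"

type_synonym 's var = "'s \<times> nat"

datatype ('s, 'f) tm = Var "'s var" | App 'f "('s, 'f) tm list"

datatype ('s, 'f, 'r) fm =
    Eq "('s, 'f) tm" "('s, 'f) tm"
  | Rel 'r "('s, 'f) tm list"
  | Neg "('s, 'f, 'r) fm"
  | Conj "('s, 'f, 'r) fm" "('s, 'f, 'r) fm"
  | Ex "'s var" "('s, 'f, 'r) fm"

fun sort_of :: "('s, 'f, 'r) signature \<Rightarrow> ('s, 'f) tm \<Rightarrow> 's" where
  "sort_of L (Var x) = fst x"
| "sort_of L (App f ts) = fcod L f"

fun wf_tm :: "('s, 'f, 'r) signature \<Rightarrow> ('s, 'f) tm \<Rightarrow> bool" where
  "wf_tm L (Var x) \<longleftrightarrow> fst x \<in> Sorts L"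
| "wf_tm L (App f ts) \<longleftrightarrow>
     f \<in> Funs L \<and> map (sort_of L) ts = fdom L f \<and> (\<forall>t\<in>set ts. wf_tm L t)"

fun wf_fm :: "('s, 'f, 'r) signature \<Rightarrow> ('s, 'f, 'r) fm \<Rightarrow> bool" where
  "wf_fm L (Eq t u) \<longleftrightarrow> wf_tm L t \<and> wf_tm L u \<and> sort_of L t = sort_of L u"
| "wf_fm L (Rel r ts) \<longleftrightarrow>
     r \<in> Rels L \<and> map (sort_of L) ts = rdom L r \<and> (\<forall>t\<in>set ts. wf_tm L t)"
| "wf_fm L (Neg \<phi>) \<longleftrightarrow> wf_fm L \<phi>"
| "wf_fm L (Conj \<phi> \<psi>) \<longleftrightarrow> wf_fm L \<phi> \<and> wf_fm L \<psi>"
| "wf_fm L (Ex x \<phi>) \<longleftrightarrow> fst x \<in> Sorts L \<and> wf_fm L \<phi>"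

fun fv_tm :: "('s, 'f) tm \<Rightarrow> 's var set" where
  "fv_tm (Var x) = {x}"
| "fv_tm (App f ts) = (\<Union>t\<in>set ts. fv_tm t)"

fun fv :: "('s, 'f, 'r) fm \<Rightarrow> 's var set" where
  "fv (Eq t u) = fv_tm t \<union> fv_tm u"
| "fv (Rel r ts) = (\<Union>t\<in>set ts. fv_tm t)"
| "fv (Neg \<phi>) = fv \<phi>"
| "fv (Conj \<phi> \<psi>) = fv \<phi> \<union> fv \<psi>"
| "fv (Ex x \<phi>) = fv \<phi> - {x}"

definition sentences :: "('s, 'f, 'r) signature \<Rightarrow> ('s, 'f, 'r) fm set" where
  "sentences L = {\<phi>. wf_fm L \<phi> \<and> fv \<phi> = {}}"

text \<open>Only the values of \<open>fint\<close> and \<open>rint\<close> on tuples of the right sorts matter.  The carriers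
  of different sorts may overlap as sets; an element of a structure is therefore a pair of a
  sort and a member of its carrier.\<close>

record ('s, 'f, 'r, 'a) struct =
  carr :: "'s \<Rightarrow> 'a set"
  fint :: "'f \<Rightarrow> 'a list \<Rightarrow> 'a"
  rint :: "'r \<Rightarrow> 'a list \<Rightarrow> bool"

definition tuples :: "('s, 'f, 'r, 'a) struct \<Rightarrow> 's list \<Rightarrow> 'a list set" where
  "tuples M ss = {xs. list_all2 (\<lambda>x s. x \<in> carr M s) xs ss}"

definition elems :: "('s, 'f, 'r) signature \<Rightarrow> ('s, 'f, 'r, 'a) struct \<Rightarrow> ('s \<times> 'a) set" where
  "elems L M = (SIGMA s : Sorts L. carr M s)"

definition is_structure :: "('s, 'f, 'r) signature \<Rightarrow> ('s, 'f, 'r, 'a) struct \<Rightarrow> bool" where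
  "is_structure L M \<longleftrightarrow>
     (\<forall>s\<in>Sorts L. carr M s \<noteq> {}) \<and>
     (\<forall>f\<in>Funs L. \<forall>xs\<in>tuples M (fdom L f). fint M f xs \<in> carr M (fcod L f))"

fun eval :: "('s, 'f, 'r, 'a) struct \<Rightarrow> ('s var \<Rightarrow> 'a) \<Rightarrow> ('s, 'f) tm \<Rightarrow> 'a" where
  "eval M v (Var x) = v x"
| "eval M v (App f ts) = fint M f (map (eval M v) ts)"

fun sat :: "('s, 'f, 'r, 'a) struct \<Rightarrow> ('s var \<Rightarrow> 'a) \<Rightarrow> ('s, 'f, 'r) fm \<Rightarrow> bool" where
  "sat M v (Eq t u) \<longleftrightarrow> eval M v t = eval M v u"
| "sat M v (Rel r ts) \<longleftrightarrow> rint M r (map (eval M v) ts)"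
| "sat M v (Neg \<phi>) \<longleftrightarrow> \<not> sat M v \<phi>"
| "sat M v (Conj \<phi> \<psi>) \<longleftrightarrow> sat M v \<phi> \<and> sat M v \<psi>"
| "sat M v (Ex x \<phi>) \<longleftrightarrow> (\<exists>a\<in>carr M (fst x). sat M (v(x := a)) \<phi>)"

definition is_valuation ::
  "('s, 'f, 'r) signature \<Rightarrow> ('s, 'f, 'r, 'a) struct \<Rightarrow> ('s var \<Rightarrow> 'a) \<Rightarrow> bool" where
  "is_valuation L M v \<longleftrightarrow> (\<forall>s\<in>Sorts L. \<forall>k. v (s, k) \<in> carr M s)"

definition Th :: "('s, 'f, 'r) signature \<Rightarrow> ('s, 'f, 'r, 'a) struct \<Rightarrow> ('s, 'f, 'r) fm set" where
  "Th L M = {\<phi> \<in> sentences L. \<forall>v. is_valuation L M v \<longrightarrow> sat M v \<phi>}"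

definition is_model ::
  "('s, 'f, 'r) signature \<Rightarrow> ('s, 'f, 'r) fm set \<Rightarrow> ('s, 'f, 'r, 'a) struct \<Rightarrow> bool" where
  "is_model L T M \<longleftrightarrow> is_structure L M \<and> T \<subseteq> Th L M"

text \<open>Theories are deductively closed.  A set of sentences that is complete in the sense below and
  has a model \<open>M\<close> is equal to \<open>Th L M\<close>; consistency itself is always supplied by a model.\<close>

definition complete_theory :: "('s, 'f, 'r) signature \<Rightarrow> ('s, 'f, 'r) fm set \<Rightarrow> bool" where
  "complete_theory L T \<longleftrightarrow>
     T \<subseteq> sentences L \<and> (\<forall>\<phi>\<in>sentences L. \<phi> \<in> T \<longleftrightarrow> Neg \<phi> \<notin> T)"

section \<open>Interpretations\<close>

text \<open>\<open>assign ss xs v\<close> sends the variable \<open>(ss ! k, k)\<close> to \<open>xs ! k\<close> and every other variable to its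
  value under \<open>v\<close>; in \<open>definable\<close> the latter values are the parameters.\<close>

definition assign :: "'s list \<Rightarrow> 'a list \<Rightarrow> ('s var \<Rightarrow> 'a) \<Rightarrow> 's var \<Rightarrow> 'a" where
  "assign ss xs v = (\<lambda>(s, k). if k < length ss \<and> ss ! k = s then xs ! k else v (s, k))"

definition definable ::
  "('s, 'f, 'r) signature \<Rightarrow> ('s, 'f, 'r, 'a) struct \<Rightarrow> 's list \<Rightarrow> 'a list set \<Rightarrow> bool" where
  "definable L M ss X \<longleftrightarrow> set ss \<subseteq> Sorts L \<and>
     (\<exists>\<phi> v. wf_fm L \<phi> \<and> is_valuation L M v \<and>
            X = {xs \<in> tuples M ss. sat M (assign ss xs v) \<phi>})"

text \<open>Sort \<open>s\<close> of the interpreted structure is the quotient \<open>D s // E s\<close>, where \<open>D s\<close> is a definable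
  set of tuples of sorts \<open>ss s\<close>.  Relations, and graphs of functions, are required to be definable
  after being pulled back to representatives.\<close>

definition interpreted_in ::
  "('s, 'f, 'r) signature \<Rightarrow> ('s, 'f, 'r, 'm) struct \<Rightarrow>
   ('ns, 'nf, 'nr) signature \<Rightarrow> ('ns, 'nf, 'nr, 'm list set) struct \<Rightarrow> bool" where
  "interpreted_in L M L' N \<longleftrightarrow> is_structure L' N \<and>
     (\<exists>(ss :: 'ns \<Rightarrow> 's list) (D :: 'ns \<Rightarrow> 'm list set) (E :: 'ns \<Rightarrow> ('m list \<times> 'm list) set).
        (\<forall>s\<in>Sorts L'.
           definable L M (ss s) (D s) \<and>
           equiv (D s) (E s) \<and>
           definable L M (ss s @ ss s) {x @ y | x y. (x, y) \<in> E s} \<and>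
           carr N s = D s // E s) \<and>
        (\<forall>f\<in>Funs L'.
           definable L M (concat (map ss (fdom L' f)) @ ss (fcod L' f))
             {concat ds @ d | ds d.
                list_all2 (\<lambda>d s. d \<in> D s) ds (fdom L' f) \<and> d \<in> D (fcod L' f) \<and>
                fint N f (map2 (\<lambda>d s. E s `` {d}) ds (fdom L' f)) = E (fcod L' f) `` {d}}) \<and>
        (\<forall>r\<in>Rels L'.
           definable L M (concat (map ss (rdom L' r)))
             {concat ds | ds.
                list_all2 (\<lambda>d s. d \<in> D s) ds (rdom L' r) \<and>
                rint N r (map2 (\<lambda>d s. E s `` {d}) ds (rdom L' r))}))"

definition interprets ::
  "('s, 'f, 'r) signature \<Rightarrow> ('s, 'f, 'r) fm set \<Rightarrow>
   ('ns, 'nf, 'nr) signature \<Rightarrow> ('ns, 'nf, 'nr, 'm list set) struct \<Rightarrow> bool" where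
  "interprets L T L' N \<longleftrightarrow> (\<exists>M. is_model L T M \<and> interpreted_in L M L' N)"

definition order_signature :: "(unit, unit, unit) signature" where
  "order_signature =
     \<lparr>Sorts = {()}, Funs = {}, Rels = {()},
      fdom = (\<lambda>_. []), fcod = (\<lambda>_. ()), rdom = (\<lambda>_. [(), ()])\<rparr>"

definition infinite_linear_order :: "(unit, unit, unit, 'a) struct \<Rightarrow> bool" where
  "infinite_linear_order N \<longleftrightarrow> infinite (carr N ()) \<and>
     linear_order_on (carr N ()) {(x, y) \<in> carr N () \<times> carr N (). rint N () [x, y]}"

section \<open>Types, monster models and the Lascar distance\<close>

text \<open>A tuple of elements of \<open>C\<close> indexed by \<open>I\<close> is a member of \<open>I \<rightarrow>\<^sub>E elems L C\<close>; every coordinate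
  carries its sort.  The type of the tuple \<open>a\<close> over \<open>A\<close> consists of the true formulas whose
  free variables are substituted, via \<open>\<tau>\<close>, by coordinates of \<open>a\<close> (\<open>Inl\<close>) and elements of
  \<open>A\<close> (\<open>Inr\<close>).\<close>

definition tp ::
  "('s, 'f, 'r) signature \<Rightarrow> ('s, 'f, 'r, 'a) struct \<Rightarrow> ('s \<times> 'a) set \<Rightarrow> 'i set \<Rightarrow>
   ('i \<Rightarrow> 's \<times> 'a) \<Rightarrow> (('s, 'f, 'r) fm \<times> ('s var \<Rightarrow> 'i + 'a)) set" where
  "tp L C A I a = {(\<phi>, \<tau>). wf_fm L \<phi> \<and>
     (\<forall>x\<in>fv \<phi>. case \<tau> x of Inl i \<Rightarrow> i \<in> I \<and> fst (a i) = fst x | Inr c \<Rightarrow> (fst x, c) \<in> A) \<and>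
     sat C (\<lambda>x. case \<tau> x of Inl i \<Rightarrow> snd (a i) | Inr c \<Rightarrow> c) \<phi>}"

definition substructure_on ::
  "('s, 'f, 'r, 'a) struct \<Rightarrow> ('s \<times> 'a) set \<Rightarrow> ('s, 'f, 'r, 'a) struct" where
  "substructure_on C A = C\<lparr>carr := (\<lambda>s. {x. (s, x) \<in> A})\<rparr>"

definition elementary_submodel ::
  "('s, 'f, 'r) signature \<Rightarrow> ('s, 'f, 'r, 'a) struct \<Rightarrow> ('s \<times> 'a) set \<Rightarrow> bool" where
  "elementary_submodel L C A \<longleftrightarrow>
     A \<subseteq> elems L C \<and> is_structure L (substructure_on C A) \<and>
     (\<forall>\<phi> v. wf_fm L \<phi> \<and> is_valuation L (substructure_on C A) v \<longrightarrow>
        (sat (substructure_on C A) v \<phi> \<longleftrightarrow> sat C v \<phi>))"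

definition automorphism ::
  "('s, 'f, 'r) signature \<Rightarrow> ('s, 'f, 'r, 'a) struct \<Rightarrow> ('s \<Rightarrow> 'a \<Rightarrow> 'a) \<Rightarrow> bool" where
  "automorphism L C g \<longleftrightarrow>
     (\<forall>s\<in>Sorts L. bij_betw (g s) (carr C s) (carr C s)) \<and>
     (\<forall>f\<in>Funs L. \<forall>xs\<in>tuples C (fdom L f).
        g (fcod L f) (fint C f xs) = fint C f (map2 g (fdom L f) xs)) \<and>
     (\<forall>r\<in>Rels L. \<forall>xs\<in>tuples C (rdom L r).
        rint C r xs \<longleftrightarrow> rint C r (map2 g (rdom L r) xs))"

text \<open>In \<open>saturated\<close> a partial 1-type \<open>p\<close> of sort \<open>s\<close> over \<open>A\<close> is a set of formulas in the variable
  \<open>(s, 0)\<close>, each paired with a valuation that supplies its parameters from \<open>A\<close>.\<close>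

definition saturated ::
  "('s, 'f, 'r) signature \<Rightarrow> 'k rel \<Rightarrow> ('s, 'f, 'r, 'a) struct \<Rightarrow> bool" where
  "saturated L \<kappa> C \<longleftrightarrow>
     (\<forall>A s p. A \<subseteq> elems L C \<and> |A| <o \<kappa> \<and> s \<in> Sorts L \<and>
        p \<subseteq> {(\<phi>, v). wf_fm L \<phi> \<and> (\<forall>x\<in>fv \<phi> - {(s, 0)}. (fst x, v x) \<in> A)} \<and>
        (\<forall>q\<subseteq>p. finite q \<longrightarrow> (\<exists>c\<in>carr C s. \<forall>(\<phi>, v)\<in>q. sat C (v((s, 0) := c)) \<phi>)) \<longrightarrow>
        (\<exists>c\<in>carr C s. \<forall>(\<phi>, v)\<in>p. sat C (v((s, 0) := c)) \<phi>))"

definition strongly_homogeneous ::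
  "('s, 'f, 'r) signature \<Rightarrow> 'a rel \<Rightarrow> ('s, 'f, 'r, 'a) struct \<Rightarrow> bool" where
  "strongly_homogeneous L \<kappa> C \<longleftrightarrow>
     (\<forall>(I :: 'a set) a b. |I| <o \<kappa> \<and>
        a \<in> I \<rightarrow>\<^sub>E elems L C \<and> b \<in> I \<rightarrow>\<^sub>E elems L C \<and> tp L C {} I a = tp L C {} I b \<longrightarrow>
        (\<exists>g. automorphism L C g \<and> (\<forall>i\<in>I. b i = (fst (a i), g (fst (a i)) (snd (a i))))))"

text \<open>Smallness means cardinality below \<open>\<kappa>\<close>.  The cardinal \<open>\<kappa>\<close> exceeds the number of formulas, so
  every small set lies in a small elementary submodel and, by compactness, the Lascar distance
  depends neither on \<open>\<kappa>\<close> nor on the choice of the monster.\<close>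

definition monster ::
  "('s, 'f, 'r) signature \<Rightarrow> ('s, 'f, 'r) fm set \<Rightarrow> 'a rel \<Rightarrow> ('s, 'f, 'r, 'a) struct \<Rightarrow> bool" where
  "monster L T \<kappa> C \<longleftrightarrow>
     is_model L T C \<and> Card_order \<kappa> \<and> |{\<phi>. wf_fm L \<phi>}| <o \<kappa> \<and>
     saturated L \<kappa> C \<and> strongly_homogeneous L \<kappa> C"

definition lascar_chain ::
  "('s, 'f, 'r) signature \<Rightarrow> 'k rel \<Rightarrow> ('s, 'f, 'r, 'a) struct \<Rightarrow> 'i set \<Rightarrow>
   nat \<Rightarrow> ('i \<Rightarrow> 's \<times> 'a) \<Rightarrow> ('i \<Rightarrow> 's \<times> 'a) \<Rightarrow> bool" where
  "lascar_chain L \<kappa> C I n a b \<longleftrightarrow>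
     (\<exists>c :: nat \<Rightarrow> 'i \<Rightarrow> 's \<times> 'a. c 0 = a \<and> c n = b \<and>
        (\<forall>j\<le>n. c j \<in> I \<rightarrow>\<^sub>E elems L C) \<and>
        (\<forall>j<n. \<exists>A. |A| <o \<kappa> \<and> elementary_submodel L C A \<and>
           tp L C A I (c j) = tp L C A I (c (Suc j))))"

definition lascar_dist ::
  "('s, 'f, 'r) signature \<Rightarrow> 'k rel \<Rightarrow> ('s, 'f, 'r, 'a) struct \<Rightarrow> 'i set \<Rightarrow>
   ('i \<Rightarrow> 's \<times> 'a) \<Rightarrow> ('i \<Rightarrow> 's \<times> 'a) \<Rightarrow> enat" where
  "lascar_dist L \<kappa> C I a b = (INF n \<in> {n. lascar_chain L \<kappa> C I n a b}. enat n)"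

section \<open>G-compactness\<close>

text \<open>HOL cannot quantify over types inside a formula, so models and monsters range over the
  structures on one type attached to the language, of cardinality \<open>2 ^ |fm|\<close>.
  It is large enough: by Loewenheim-Skolem a consistent theory in the language has a model of
  cardinality at most \<open>|fm|\<close>, and such a model has a saturated and strongly homogeneous
  elementary extension, for the successor of \<open>|fm|\<close>, of cardinality at most \<open>2 ^ |fm|\<close>
  (Hodges, Model Theory, Theorem 10.2.1).\<close>

type_synonym ('s, 'f, 'r) univ = "('s, 'f, 'r) fm set"

definition G_compact :: "('s, 'f, 'r) signature \<Rightarrow> ('s, 'f, 'r) fm set \<Rightarrow> bool" where
  "G_compact L T \<longleftrightarrow>
     (\<forall>(\<kappa> :: ('s, 'f, 'r) univ rel) (C :: ('s, 'f, 'r, ('s, 'f, 'r) univ) struct).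
        monster L T \<kappa> C \<longrightarrow>
        (\<forall>(I :: ('s, 'f, 'r) univ set) a. |I| <o \<kappa> \<and> a \<in> I \<rightarrow>\<^sub>E elems L C \<longrightarrow>
           (\<exists>n :: nat. \<forall>b \<in> I \<rightarrow>\<^sub>E elems L C.
              lascar_dist L \<kappa> C I a b < \<infinity> \<longrightarrow> lascar_dist L \<kappa> C I a b \<le> enat n)))"

text \<open>The three type arguments supply the symbols of the signatures of the interpreted structures.
  The Lascar distance of two tuples exceeds \<open>n\<close> as soon as this is witnessed by finitely many
  coordinates and symbols; hence a structure whose theory is not G-compact has a countable reduct
  (in countably many sorts) of the same kind, and any infinite symbol types give the same
  notion.\<close>

definition hereditarily_G_compact ::
  "'ns itself \<Rightarrow> 'nf itself \<Rightarrow> 'nr itself \<Rightarrow>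
   ('s, 'f, 'r) signature \<Rightarrow> ('s, 'f, 'r) fm set \<Rightarrow> bool" where
  "hereditarily_G_compact _ _ _ L T \<longleftrightarrow>
     (\<forall>(M :: ('s, 'f, 'r, ('s, 'f, 'r) univ) struct)
       (L' :: ('ns, 'nf, 'nr) signature)
       (N :: ('ns, 'nf, 'nr, ('s, 'f, 'r) univ list set) struct).
        is_model L T M \<and> wf_signature L' \<and> interpreted_in L M L' N \<longrightarrow> G_compact L' (Th L' N))"

end

theory Submission
  imports Defs "HOL-Library.Countable_Set" "HOL-Library.Countable_Set_Type"
begin

text \<open>Closing up an infinite linear order \<open>K\<close> yields a circular order, whose \<open>n\<close>-fold cover has the
  points \<open>(x, i)\<close> with \<open>x \<in> K\<close> and \<open>i < n\<close> and is described by the binary relations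
  \<open>delta n (x, i) (y, j) = (j - i - [y < x]) mod n\<close>.  All these covers together form a structure
  that is interpretable in \<open>K\<close>: the sheets are named by parameters.  Two points of the \<open>n\<close>-fold cover
  with the same type over a model have \<open>delta\<close> in \<open>{0, -1}\<close>, so \<open>m\<close> Lascar steps move a point by at
  most \<open>m\<close> sheets, whereas moving up one sheet takes two steps.  Hence a tuple with one point in each
  cover has translates at arbitrarily large finite Lascar distance.

  To control types, \<open>K\<close> is chosen well inside the given order.  If that order has finite chains of
  immediate successors of every length, then an ultrapower contains a definable hyperfinite interval
  \<open>K\<close>; otherwise the points without an immediate predecessor are densely ordered, and \<open>K\<close> is an
  interval of them.  In either case the covers of an ultraproduct are covers of a lexicographic product
  \<open>K1 \<times> J\<close>, where \<open>K1\<close> is a countably saturated dense order with a least element and \<open>J\<close> is \<open>{0}\<close> or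
  \<open>\<int>\<close>.  (In the hyperfinite case, the final segment of \<open>K\<close> at finite distance from the last point is
  first moved to the bottom of the next sheet.)  By back and forth, \<open>K1\<close> may be replaced by an
  ultrapower of the rational interval \<open>[0, 1)\<close>, and all the automorphisms needed for strong homogeneity
  and for the Lascar distances are ultraproducts of explicit ones, composed with shifts of blocks.\<close>

text \<open>Saturation by itself supplies no automorphisms, and a countably saturated order may be
  too large for a back-and-forth of length the first uncountable cardinal. An ultrapower of
  \<open>Q01\<close> has enough explicit ones: finitely many points of a rational cover are moved by
  rotations and a piecewise linear map, and a diagonal choice along the ultrafilter merges such maps
  into one automorphism that treats countably many points. This is why the base is normalised to
  \<open>HQ\<close>. Only countable tuples and parameter sets occur, because the covers have
  countably many formulas; so \<open>\<kappa>\<close> can be the first uncountable cardinal. Back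
  and forth alone moves theories and saturation from an arbitrary base to \<open>HQ\<close>, while
  homogeneity is proved over \<open>HQ\<close> only. In the hyperfinite case every point has an
  immediate successor on the circle, so distances along a block are definable and types must be
  shown to record them. The models must live on the type \<open>univ\<close>. The given model is
  therefore first shrunk to the size of the language: sequences of its elements, hence its
  ultrapower, can then be coded by sets of formulas.\<close>

section \<open>A nonprincipal ultrafilter on the natural numbers\<close>

text \<open>Zorn's lemma for the proper filters below \<open>F\<close>, a smaller filter counting as
  larger. A chain is bounded by its infimum, which is proper because an event of the infimum is
  already an event of a member. A minimal proper filter decides \<open>P\<close>: unless it contains
  the complement, meeting it with \<open>P\<close> changes nothing.\<close>

lemma ex_ultrafilter_below:
  assumes "F \<noteq> bot"
  shows "\<exists>U \<le> F. U \<noteq> bot \<and> (\<forall>P. eventually P U \<or> eventually (\<lambda>k. \<not> P k) U)"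
proof -
  define S where "S = {G. G \<noteq> bot \<and> G \<le> F}"
  have "\<exists>m\<in>S. \<forall>a\<in>S. a \<le> m \<longrightarrow> a = m"
  proof (rule predicate_Zorn[of S "\<lambda>x y. y \<le> x"])
    show "partial_order_on S (relation_of (\<lambda>x y. y \<le> x) S)"
      by (rule partial_order_on_relation_ofI) auto
    fix C assume C: "C \<in> Chains (relation_of (\<lambda>x y. y \<le> x) S)"
    show "\<exists>u\<in>S. \<forall>a\<in>C. u \<le> a"
    proof (cases "C = {}")
      case True
      then show ?thesis using assms unfolding S_def by auto
    next
      case False
      have CS: "C \<subseteq> S" and tot: "\<And>a b. a \<in> C \<Longrightarrow> b \<in> C \<Longrightarrow> a \<le> b \<or> b \<le> a"
        using C unfolding Chains_def relation_of_def by auto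
      have "eventually (\<lambda>_. False) (Inf C) \<longleftrightarrow> (\<exists>b\<in>C. eventually (\<lambda>_. False) b)"
        by (rule eventually_Inf_base[OF False]) (use tot in \<open>metis inf.absorb1 inf.absorb2 order_refl\<close>)
      then have "Inf C \<noteq> bot"
        using CS unfolding S_def trivial_limit_def[symmetric] by (auto simp: trivial_limit_def)
      moreover obtain c where "c \<in> C" "c \<le> F" using False CS unfolding S_def by blast
      then have "Inf C \<le> F" by (rule Inf_lower2)
      ultimately show ?thesis unfolding S_def by (auto intro: Inf_lower)
    qed
  qed
  then obtain U where U: "U \<noteq> bot" "U \<le> F" and max: "\<And>G. G \<noteq> bot \<Longrightarrow> G \<le> U \<Longrightarrow> G = U"
    unfolding S_def by (auto dest: order_trans)
  have "eventually P U" if "\<not> eventually (\<lambda>k. \<not> P k) U" for P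
  proof -
    have "inf U (principal {k. P k}) \<noteq> bot"
      using that unfolding trivial_limit_def by (simp add: eventually_inf_principal)
    then have "inf U (principal {k. P k}) = U" by (intro max) auto
    moreover have "eventually P (inf U (principal {k. P k}))"
      by (simp add: eventually_inf_principal)
    ultimately show ?thesis by simp
  qed
  then show ?thesis using U by blast
qed

text \<open>Lying below \<open>sequentially\<close> makes the ultrafilter nonprincipal.\<close>

definition ultra :: "nat filter" ("\<U>") where
  "\<U> = (SOME U. U \<le> sequentially \<and> U \<noteq> bot \<and> (\<forall>P. eventually P U \<or> eventually (\<lambda>k. \<not> P k) U))"

lemma ultra_props:
  "\<U> \<le> sequentially" "\<U> \<noteq> bot" "eventually P \<U> \<or> eventually (\<lambda>k. \<not> P k) \<U>"
proof -
  have "\<exists>U. U \<le> sequentially \<and> U \<noteq> bot \<and> (\<forall>P. eventually P U \<or> eventually (\<lambda>k. \<not> P k) U)"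
    using ex_ultrafilter_below[of sequentially] by auto
  then have "\<U> \<le> sequentially \<and> \<U> \<noteq> bot \<and> (\<forall>P. eventually P \<U> \<or> eventually (\<lambda>k. \<not> P k) \<U>)"
    unfolding ultra_def by (rule someI_ex)
  then show "\<U> \<le> sequentially" "\<U> \<noteq> bot" "eventually P \<U> \<or> eventually (\<lambda>k. \<not> P k) \<U>" by auto
qed

lemma eventually_ultra_False [simp]: "\<not> eventually (\<lambda>_. False) \<U>"
  using ultra_props(2) by (simp add: trivial_limit_def)

lemma eventually_ultra_const [simp]: "eventually (\<lambda>_. P) \<U> \<longleftrightarrow> P"
  by (cases P) auto

lemma eventually_ultra_not: "(\<forall>\<^sub>F k in \<U>. \<not> P k) \<longleftrightarrow> \<not> (\<forall>\<^sub>F k in \<U>. P k)"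
  using ultra_props(3)[of P] eventually_conj[of P \<U> "\<lambda>k. \<not> P k"] by auto

lemma eventually_ultra_disj:
  "(\<forall>\<^sub>F k in \<U>. P k \<or> Q k) \<longleftrightarrow> (\<forall>\<^sub>F k in \<U>. P k) \<or> (\<forall>\<^sub>F k in \<U>. Q k)"
  using eventually_ultra_not[of "\<lambda>k. P k \<or> Q k"] eventually_ultra_not[of P] eventually_ultra_not[of Q]
  by (auto simp: eventually_conj_iff)

lemma eventually_ultra_ge: "\<forall>\<^sub>F k in \<U>. m \<le> k"
  using eventually_ge_at_top[of m] ultra_props(1) by (rule filter_leD[rotated])

lemma eventually_ultra_cong:
  assumes "\<forall>\<^sub>F k in \<U>. P k \<longleftrightarrow> Q k"
  shows "(\<forall>\<^sub>F k in \<U>. P k) \<longleftrightarrow> (\<forall>\<^sub>F k in \<U>. Q k)"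
proof
  assume "\<forall>\<^sub>F k in \<U>. P k"
  with assms show "\<forall>\<^sub>F k in \<U>. Q k" by eventually_elim simp
next
  assume "\<forall>\<^sub>F k in \<U>. Q k"
  with assms show "\<forall>\<^sub>F k in \<U>. P k" by eventually_elim simp
qed

lemma eventually_ultra_ex:
  "(\<forall>\<^sub>F k in \<U>. \<exists>x. P k x) \<longleftrightarrow> (\<exists>x. \<forall>\<^sub>F k in \<U>. P k (x k))"
proof
  assume "\<forall>\<^sub>F k in \<U>. \<exists>x. P k x"
  then have "\<forall>\<^sub>F k in \<U>. P k (SOME x. P k x)" by (rule eventually_mono) (rule someI_ex)
  then show "\<exists>x. \<forall>\<^sub>F k in \<U>. P k (x k)" by (rule exI[of _ "\<lambda>k. SOME x. P k x"])
next
  assume "\<exists>x. \<forall>\<^sub>F k in \<U>. P k (x k)"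
  then obtain x where "\<forall>\<^sub>F k in \<U>. P k (x k)" ..
  then show "\<forall>\<^sub>F k in \<U>. \<exists>x. P k x" by eventually_elim blast
qed

text \<open>One of finitely many alternatives is chosen by the ultrafilter. Levels of sheets and
  bounded integer functions become constants in this way.\<close>

lemma eventually_ultra_finite_ex:
  assumes "finite S" "\<forall>\<^sub>F k in \<U>. \<exists>i\<in>S. P i k"
  shows "\<exists>i\<in>S. \<forall>\<^sub>F k in \<U>. P i k"
  using assms by (induction S rule: finite_induct) (auto simp: eventually_ultra_disj)

text \<open>The combinatorial core of countable saturation. At coordinate \<open>k\<close> the value
  is chosen to satisfy as long an initial part of the conditions as possible; the clause
  \<open>m \<le> k\<close> in \<open>good\<close> bounds this length, so that a greatest one exists,
  and nonprincipality makes every fixed condition fall below it eventually.\<close>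

lemma ultra_diagonal:
  assumes "\<And>m::nat. \<forall>\<^sub>F k in \<U>. \<exists>x. \<forall>i\<le>m. Q i k x"
  shows "\<exists>x. \<forall>i. \<forall>\<^sub>F k in \<U>. Q i k (x k)"
proof -
  define good where "good = (\<lambda>k m. m \<le> k \<and> (\<exists>x. \<forall>i\<le>m. Q i k x))"
  define x where "x = (\<lambda>k. SOME x. \<forall>i \<le> (GREATEST m. good k m). Q i k x)"
  have "Q i k (x k)" if "good k i" for i k
  proof -
    have "good k (GREATEST m. good k m)"
      by (rule GreatestI_nat[where P = "good k" and k = i and b = k]) (use that in \<open>auto simp: good_def\<close>)
    then have "\<exists>x. \<forall>i \<le> (GREATEST m. good k m). Q i k x"
      by (subst (asm) (1) good_def) blast
    then have "\<forall>i \<le> (GREATEST m. good k m). Q i k (x k)"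
      unfolding x_def by (rule someI_ex)
    moreover have "i \<le> (GREATEST m. good k m)"
      by (rule Greatest_le_nat[where P = "good k" and b = k]) (use that in \<open>auto simp: good_def\<close>)
    ultimately show ?thesis by blast
  qed
  moreover have "\<forall>\<^sub>F k in \<U>. good k i" for i
    using assms[of i] eventually_ultra_ge[of i] by eventually_elim (simp add: good_def)
  ultimately have "\<forall>\<^sub>F k in \<U>. Q i k (x k)" for i
    by (rule eventually_mono[rotated])
  then show ?thesis by blast
qed

text \<open>Elements of ultraproducts are canonical representatives, so that equality in an ultraproduct
  is equality in HOL.\<close>

definition rep :: "(nat \<Rightarrow> 'a) \<Rightarrow> nat \<Rightarrow> 'a" where
  "rep x = (SOME y. \<forall>\<^sub>F k in \<U>. y k = x k)"

lemma rep_eq: "\<forall>\<^sub>F k in \<U>. rep x k = x k"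
  unfolding rep_def by (rule someI_ex[of "\<lambda>y. \<forall>\<^sub>F k in \<U>. y k = x k"]) (auto intro!: exI[of _ x])

lemma rep_cong:
  assumes "\<forall>\<^sub>F k in \<U>. x k = y k"
  shows "rep x = rep y"
proof -
  have "(\<forall>\<^sub>F k in \<U>. z k = x k) \<longleftrightarrow> (\<forall>\<^sub>F k in \<U>. z k = y k)" for z
    by (rule eventually_ultra_cong) (use assms in \<open>rule eventually_mono, simp\<close>)
  then show ?thesis unfolding rep_def by simp
qed

lemma rep_rep [simp]: "rep (rep x) = rep x"
  by (rule rep_cong) (rule rep_eq)

definition ultraproduct :: "(nat \<Rightarrow> 'a set) \<Rightarrow> (nat \<Rightarrow> 'a) set" where
  "ultraproduct P = {x. rep x = x \<and> (\<forall>\<^sub>F k in \<U>. x k \<in> P k)}"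

lemma ultraproduct_eqI:
  "x \<in> ultraproduct P \<Longrightarrow> y \<in> ultraproduct Q \<Longrightarrow> \<forall>\<^sub>F k in \<U>. x k = y k \<Longrightarrow> x = y"
  unfolding ultraproduct_def using rep_cong[of x y] by auto

lemma ultraproduct_ev: "x \<in> ultraproduct P \<Longrightarrow> \<forall>\<^sub>F k in \<U>. x k \<in> P k"
  unfolding ultraproduct_def by auto

lemma rep_in_ultraproduct:
  assumes "\<forall>\<^sub>F k in \<U>. x k \<in> P k"
  shows "rep x \<in> ultraproduct P"
proof -
  have "\<forall>\<^sub>F k in \<U>. rep x k \<in> P k"
    using assms rep_eq[of x] by eventually_elim simp
  then show ?thesis unfolding ultraproduct_def by simp
qed

section \<open>Basic facts on satisfaction\<close>

lemma eval_cong: "\<forall>x\<in>fv_tm t. v x = w x \<Longrightarrow> eval M v t = eval M w t"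
  by (induction t) (auto intro!: arg_cong[of _ _ "fint M _"])

lemma sat_cong: "\<forall>x\<in>fv \<phi>. v x = w x \<Longrightarrow> sat M v \<phi> \<longleftrightarrow> sat M w \<phi>"
proof (induction \<phi> arbitrary: v w)
  case (Eq t u)
  then show ?case using eval_cong[of t v w M] eval_cong[of u v w M] by auto
next
  case (Rel r ts)
  have "map (eval M v) ts = map (eval M w) ts"
    using Rel by (auto intro!: eval_cong)
  then show ?case by (simp only: sat.simps)
next
  case (Ex x \<phi>)
  have "sat M (v(x := a)) \<phi> \<longleftrightarrow> sat M (w(x := a)) \<phi>" for a
    by (rule Ex.IH) (use Ex.prems in auto)
  then show ?case by auto
next
  case (Conj \<phi> \<psi>)
  have "sat M v \<phi> \<longleftrightarrow> sat M w \<phi>" by (rule Conj.IH(1)) (use Conj.prems in auto)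
  moreover have "sat M v \<psi> \<longleftrightarrow> sat M w \<psi>" by (rule Conj.IH(2)) (use Conj.prems in auto)
  ultimately show ?case by simp
next
  case (Neg \<phi>)
  have "sat M v \<phi> \<longleftrightarrow> sat M w \<phi>" by (rule Neg.IH) (use Neg.prems in auto)
  then show ?case by simp
qed

lemma sat_sentence: "\<phi> \<in> sentences L \<Longrightarrow> sat M v \<phi> \<longleftrightarrow> sat M w \<phi>"
  by (rule sat_cong) (auto simp: sentences_def)

lemma finite_fv_tm [simp]: "finite (fv_tm t)"
  by (induction t) auto

lemma finite_fv [simp]: "finite (fv \<phi>)"
  by (induction \<phi>) auto

lemma fv_tm_sorts: "wf_tm L t \<Longrightarrow> x \<in> fv_tm t \<Longrightarrow> fst x \<in> Sorts L"
  by (induction t) auto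

lemma fv_sorts: "wf_fm L \<phi> \<Longrightarrow> x \<in> fv \<phi> \<Longrightarrow> fst x \<in> Sorts L"
  by (induction \<phi>) (auto dest: fv_tm_sorts)

lemma sort_of_in_Sorts: "wf_signature L \<Longrightarrow> wf_tm L t \<Longrightarrow> sort_of L t \<in> Sorts L"
  by (cases t) (auto simp: wf_signature_def)

lemma ex_valuation: "is_structure L M \<Longrightarrow> \<exists>v. is_valuation L M v"
  unfolding is_structure_def is_valuation_def
  by (rule exI[of _ "\<lambda>x. SOME a. a \<in> carr M (fst x)"]) (auto simp: some_in_eq)

lemma Th_iff:
  assumes "is_structure L M"
  shows "\<phi> \<in> Th L M \<longleftrightarrow> \<phi> \<in> sentences L \<and> sat M v \<phi>"
proof -
  obtain w where "is_valuation L M w" using ex_valuation[OF assms] by blast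
  then show ?thesis unfolding Th_def using sat_sentence[of \<phi> L M] by blast
qed

lemma tuples_eval:
  assumes "map (sort_of L) ts = ss" "\<And>t. t \<in> set ts \<Longrightarrow> eval M v t \<in> carr M (sort_of L t)"
  shows "map (eval M v) ts \<in> tuples M ss"
  using assms unfolding tuples_def by (auto simp: list_all2_conv_all_nth)

lemma eval_in_carr:
  assumes "is_structure L M" "wf_tm L t" "\<And>x. x \<in> fv_tm t \<Longrightarrow> v x \<in> carr M (fst x)"
  shows "eval M v t \<in> carr M (sort_of L t)"
  using assms(2,3)
proof (induction t)
  case (App f ts)
  have "map (eval M v) ts \<in> tuples M (fdom L f)"
    by (rule tuples_eval[of L]) (use App in auto)
  then show ?case using App.prems(1) assms(1) unfolding is_structure_def by simp
qed auto

subsection \<open>Isomorphisms\<close>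

definition isomorphism ::
  "('s, 'f, 'r) signature \<Rightarrow> ('s, 'f, 'r, 'a) struct \<Rightarrow> ('s, 'f, 'r, 'b) struct \<Rightarrow>
   ('s \<Rightarrow> 'a \<Rightarrow> 'b) \<Rightarrow> bool" where
  "isomorphism L A B g \<longleftrightarrow>
     (\<forall>s\<in>Sorts L. bij_betw (g s) (carr A s) (carr B s)) \<and>
     (\<forall>f\<in>Funs L. \<forall>xs\<in>tuples A (fdom L f).
        g (fcod L f) (fint A f xs) = fint B f (map2 g (fdom L f) xs)) \<and>
     (\<forall>r\<in>Rels L. \<forall>xs\<in>tuples A (rdom L r).
        rint A r xs \<longleftrightarrow> rint B r (map2 g (rdom L r) xs))"

lemma automorphism_isomorphism: "automorphism L C g \<longleftrightarrow> isomorphism L C C g"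
  unfolding automorphism_def isomorphism_def ..

lemma eval_isomorphism:
  assumes iso: "isomorphism L A B g" and A: "is_structure L A"
    and "wf_tm L t" "\<forall>x\<in>fv_tm t. v x \<in> carr A (fst x) \<and> w x = g (fst x) (v x)"
  shows "eval B w t = g (sort_of L t) (eval A v t)"
  using assms(3,4)
proof (induction t)
  case (App f ts)
  have tup: "map (eval A v) ts \<in> tuples A (fdom L f)"
    by (rule tuples_eval[of L]) (use App.prems in \<open>auto intro!: eval_in_carr[OF A]\<close>)
  have "eval B w t = g (sort_of L t) (eval A v t)" if "t \<in> set ts" for t
    by (rule App.IH) (use App.prems that in auto)
  then have "map (eval B w) ts = map2 g (map (sort_of L) ts) (map (eval A v) ts)"
    by (auto simp: list_eq_iff_nth_eq)
  then have "map (eval B w) ts = map2 g (fdom L f) (map (eval A v) ts)"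
    using App.prems(1) by simp
  then show ?case using iso App.prems(1) tup unfolding isomorphism_def by (simp del: map_map)
qed auto

lemma sat_isomorphism:
  assumes iso: "isomorphism L A B g" and A: "is_structure L A" and L: "wf_signature L"
    and "wf_fm L \<phi>" "\<forall>x\<in>fv \<phi>. v x \<in> carr A (fst x) \<and> w x = g (fst x) (v x)"
  shows "sat A v \<phi> \<longleftrightarrow> sat B w \<phi>"
  using assms(4,5)
proof (induction \<phi> arbitrary: v w)
  case (Eq t u)
  have "eval B w t = g (sort_of L t) (eval A v t)" "eval B w u = g (sort_of L u) (eval A v u)"
    by (rule eval_isomorphism[OF iso A]; use Eq in auto)+
  moreover have "eval A v t \<in> carr A (sort_of L t)" "eval A v u \<in> carr A (sort_of L t)"
    using eval_in_carr[OF A, of t v] eval_in_carr[OF A, of u v] Eq by auto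
  moreover have "sort_of L t \<in> Sorts L" "sort_of L t = sort_of L u"
    using sort_of_in_Sorts[OF L] Eq.prems by auto
  ultimately show ?case using iso unfolding isomorphism_def
    by (auto simp: bij_betw_def dest: inj_onD)
next
  case (Rel r ts)
  have tup: "map (eval A v) ts \<in> tuples A (rdom L r)"
    by (rule tuples_eval[of L]) (use Rel.prems in \<open>auto intro!: eval_in_carr[OF A]\<close>)
  have "eval B w t = g (sort_of L t) (eval A v t)" if "t \<in> set ts" for t
    by (rule eval_isomorphism[OF iso A]) (use Rel.prems that in auto)
  then have "map (eval B w) ts = map2 g (map (sort_of L) ts) (map (eval A v) ts)"
    by (auto simp: list_eq_iff_nth_eq)
  then have "map (eval B w) ts = map2 g (rdom L r) (map (eval A v) ts)"
    using Rel.prems(1) by simp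
  then show ?case using iso Rel.prems(1) tup unfolding isomorphism_def by (simp del: map_map)
next
  case (Conj \<phi> \<psi>)
  have "sat A v \<phi> \<longleftrightarrow> sat B w \<phi>" by (rule Conj.IH(1)) (use Conj.prems in auto)
  moreover have "sat A v \<psi> \<longleftrightarrow> sat B w \<psi>" by (rule Conj.IH(2)) (use Conj.prems in auto)
  ultimately show ?case by simp
next
  case (Neg \<phi>)
  have "sat A v \<phi> \<longleftrightarrow> sat B w \<phi>" by (rule Neg.IH) (use Neg.prems in auto)
  then show ?case by simp
next
  case (Ex x \<phi>)
  have bij: "bij_betw (g (fst x)) (carr A (fst x)) (carr B (fst x))"
    using iso Ex.prems(1) unfolding isomorphism_def by auto
  have "sat A (v(x := a)) \<phi> \<longleftrightarrow> sat B (w(x := g (fst x) a)) \<phi>" if "a \<in> carr A (fst x)" for a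
    by (rule Ex.IH) (use Ex.prems that in auto)
  then show ?case using bij_betw_imp_surj_on[OF bij, symmetric] by auto
qed

section \<open>Limits along the ultrafilter\<close>

text \<open>\<open>A\<close> is an ultraproduct of the structures \<open>B k\<close>, presented by evaluation maps \<open>ev k\<close>.\<close>

locale ultralimit =
  fixes L :: "('s, 'f, 'r) signature" and A :: "('s, 'f, 'r, 'a) struct"
    and B :: "nat \<Rightarrow> ('s, 'f, 'r, 'b) struct" and ev :: "nat \<Rightarrow> 'a \<Rightarrow> 'b"
  assumes wf: "wf_signature L"
    and carr: "s \<in> Sorts L \<Longrightarrow> a \<in> carr A s \<Longrightarrow> \<forall>\<^sub>F k in \<U>. ev k a \<in> carr (B k) s"
    and lift: "s \<in> Sorts L \<Longrightarrow> \<forall>\<^sub>F k in \<U>. x k \<in> carr (B k) s \<Longrightarrow>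
      \<exists>a\<in>carr A s. \<forall>\<^sub>F k in \<U>. ev k a = x k"
    and sep: "s \<in> Sorts L \<Longrightarrow> a \<in> carr A s \<Longrightarrow> b \<in> carr A s \<Longrightarrow>
      \<forall>\<^sub>F k in \<U>. ev k a = ev k b \<Longrightarrow> a = b"
    and funs: "f \<in> Funs L \<Longrightarrow> xs \<in> tuples A (fdom L f) \<Longrightarrow>
      fint A f xs \<in> carr A (fcod L f) \<and>
      (\<forall>\<^sub>F k in \<U>. ev k (fint A f xs) = fint (B k) f (map (ev k) xs))"
    and rels: "r \<in> Rels L \<Longrightarrow> xs \<in> tuples A (rdom L r) \<Longrightarrow>
      rint A r xs \<longleftrightarrow> (\<forall>\<^sub>F k in \<U>. rint (B k) r (map (ev k) xs))"
begin

lemma eval_ultralimit: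
  assumes "wf_tm L t" "\<forall>x\<in>fv_tm t. v x \<in> carr A (fst x)"
  shows "eval A v t \<in> carr A (sort_of L t) \<and> (\<forall>\<^sub>F k in \<U>. ev k (eval A v t) = eval (B k) (\<lambda>x. ev k (v x)) t)"
  using assms
proof (induction t)
  case (App f ts)
  have IH: "eval A v t \<in> carr A (sort_of L t)"
    "\<forall>\<^sub>F k in \<U>. ev k (eval A v t) = eval (B k) (\<lambda>x. ev k (v x)) t" if "t \<in> set ts" for t
    using App.IH[OF that] App.prems that by auto
  have tup: "map (eval A v) ts \<in> tuples A (fdom L f)"
    by (rule tuples_eval[of L]) (use App.prems IH in auto)
  have "\<forall>\<^sub>F k in \<U>. \<forall>t\<in>set ts. ev k (eval A v t) = eval (B k) (\<lambda>x. ev k (v x)) t"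
    by (rule eventually_ball_finite) (use IH in auto)
  moreover have "\<forall>\<^sub>F k in \<U>. ev k (fint A f (map (eval A v) ts)) = fint (B k) f (map (ev k) (map (eval A v) ts))"
    using funs[OF _ tup] App.prems(1) by simp
  ultimately have "\<forall>\<^sub>F k in \<U>. ev k (eval A v (App f ts)) = eval (B k) (\<lambda>x. ev k (v x)) (App f ts)"
  proof eventually_elim
    case (elim k)
    have "map (ev k) (map (eval A v) ts) = map (eval (B k) (\<lambda>x. ev k (v x))) ts"
      using elim(1) by simp
    then show ?case using elim(2) by (simp del: map_map)
  qed
  then show ?case using funs[OF _ tup] App.prems(1) by simp
qed auto

text \<open>In the quantifier case, witnesses picked in the coordinate structures form one sequence,
  which \<open>lift\<close> turns into an element of \<open>A\<close>; negation is where the filter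
  has to be an ultrafilter.\<close>

theorem Los:
  assumes "wf_fm L \<phi>" "\<forall>x\<in>fv \<phi>. v x \<in> carr A (fst x)"
  shows "sat A v \<phi> \<longleftrightarrow> (\<forall>\<^sub>F k in \<U>. sat (B k) (\<lambda>x. ev k (v x)) \<phi>)"
  using assms
proof (induction \<phi> arbitrary: v)
  case (Eq t u)
  let ?s = "sort_of L t"
  have t: "eval A v t \<in> carr A ?s" "\<forall>\<^sub>F k in \<U>. ev k (eval A v t) = eval (B k) (\<lambda>x. ev k (v x)) t"
    and u: "eval A v u \<in> carr A ?s" "\<forall>\<^sub>F k in \<U>. ev k (eval A v u) = eval (B k) (\<lambda>x. ev k (v x)) u"
    using eval_ultralimit[of t v] eval_ultralimit[of u v] Eq by auto
  have "(\<forall>\<^sub>F k in \<U>. sat (B k) (\<lambda>x. ev k (v x)) (Eq t u)) \<longleftrightarrow>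
      (\<forall>\<^sub>F k in \<U>. ev k (eval A v t) = ev k (eval A v u))"
    by (rule eventually_ultra_cong) (use t(2) u(2) in \<open>eventually_elim, simp\<close>)
  also have "\<dots> \<longleftrightarrow> eval A v t = eval A v u"
    using sep[OF sort_of_in_Sorts[OF wf, of t] t(1) u(1)] Eq.prems by auto
  finally show ?case by simp
next
  case (Rel r ts)
  have ev: "eval A v t \<in> carr A (sort_of L t)"
    "\<forall>\<^sub>F k in \<U>. ev k (eval A v t) = eval (B k) (\<lambda>x. ev k (v x)) t" if "t \<in> set ts" for t
    using eval_ultralimit[of t v] Rel.prems that by auto
  have tup: "map (eval A v) ts \<in> tuples A (rdom L r)"
    by (rule tuples_eval[of L]) (use Rel.prems ev in auto)
  have "\<forall>\<^sub>F k in \<U>. \<forall>t\<in>set ts. ev k (eval A v t) = eval (B k) (\<lambda>x. ev k (v x)) t"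
    by (rule eventually_ball_finite) (use ev in auto)
  then have "(\<forall>\<^sub>F k in \<U>. rint (B k) r (map (ev k) (map (eval A v) ts))) \<longleftrightarrow>
      (\<forall>\<^sub>F k in \<U>. sat (B k) (\<lambda>x. ev k (v x)) (Rel r ts))"
  proof (intro eventually_ultra_cong, eventually_elim)
    case (elim k)
    have "map (ev k) (map (eval A v) ts) = map (eval (B k) (\<lambda>x. ev k (v x))) ts"
      using elim by simp
    then show ?case by (simp del: map_map)
  qed
  then show ?case using rels[OF _ tup] Rel.prems(1) by simp
next
  case (Neg \<phi>)
  then show ?case by (simp add: eventually_ultra_not)
next
  case (Conj \<phi> \<psi>)
  then show ?case by (simp add: eventually_conj_iff)
next
  case (Ex x \<phi>)
  have s: "fst x \<in> Sorts L" using Ex.prems by simp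
  have upd: "(\<lambda>y. ev k ((v(x := a)) y)) = (\<lambda>y. ev k (v y))(x := ev k a)" for k a by auto
  have IH: "sat A (v(x := a)) \<phi> \<longleftrightarrow> (\<forall>\<^sub>F k in \<U>. sat (B k) ((\<lambda>y. ev k (v y))(x := ev k a)) \<phi>)"
    if "a \<in> carr A (fst x)" for a
    unfolding upd[symmetric] by (rule Ex.IH) (use Ex.prems that in auto)
  show ?case
  proof
    assume "sat A v (Ex x \<phi>)"
    then obtain a where a: "a \<in> carr A (fst x)" "sat A (v(x := a)) \<phi>" by auto
    have "\<forall>\<^sub>F k in \<U>. ev k a \<in> carr (B k) (fst x)" using carr[OF s a(1)] .
    moreover have "\<forall>\<^sub>F k in \<U>. sat (B k) ((\<lambda>y. ev k (v y))(x := ev k a)) \<phi>" using IH a by simp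
    ultimately show "\<forall>\<^sub>F k in \<U>. sat (B k) (\<lambda>x. ev k (v x)) (Ex x \<phi>)"
      by eventually_elim auto
  next
    assume "\<forall>\<^sub>F k in \<U>. sat (B k) (\<lambda>x. ev k (v x)) (Ex x \<phi>)"
    then have "\<forall>\<^sub>F k in \<U>. \<exists>b. b \<in> carr (B k) (fst x) \<and> sat (B k) ((\<lambda>y. ev k (v y))(x := b)) \<phi>"
      by eventually_elim auto
    then obtain b where b: "\<forall>\<^sub>F k in \<U>. b k \<in> carr (B k) (fst x) \<and> sat (B k) ((\<lambda>y. ev k (v y))(x := b k)) \<phi>"
      unfolding eventually_ultra_ex by blast
    then obtain a where a: "a \<in> carr A (fst x)" "\<forall>\<^sub>F k in \<U>. ev k a = b k"
      using lift[OF s, of b] by (auto simp: eventually_conj_iff)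
    have "\<forall>\<^sub>F k in \<U>. sat (B k) ((\<lambda>y. ev k (v y))(x := ev k a)) \<phi>"
      using a(2) b by eventually_elim simp
    then show "sat A v (Ex x \<phi>)" using IH a(1) by auto
  qed
qed

text \<open>Enumerate the type; finite initial parts are realised in \<open>A\<close>, hence in
  almost all \<open>B k\<close>, and \<open>ultra_diagonal\<close> combines these realisations into
  one sequence.\<close>

theorem countably_saturated:
  assumes s: "s \<in> Sorts L" and p: "countable p"
    and wfp: "\<And>\<phi> v. (\<phi>, v) \<in> p \<Longrightarrow> wf_fm L \<phi> \<and> (\<forall>x\<in>fv \<phi> - {y}. v x \<in> carr A (fst x))"
    and y: "fst y = s" and ne: "carr A s \<noteq> {}"
    and fin: "\<And>q. q \<subseteq> p \<Longrightarrow> finite q \<Longrightarrow> \<exists>c\<in>carr A s. \<forall>(\<phi>, v)\<in>q. sat A (v(y := c)) \<phi>"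
  shows "\<exists>c\<in>carr A s. \<forall>(\<phi>, v)\<in>p. sat A (v(y := c)) \<phi>"
proof (cases "p = {}")
  case True
  then show ?thesis using ne by auto
next
  case False
  define e where "e = from_nat_into p"
  have e: "p = range e" unfolding e_def using range_from_nat_into[OF False p] by simp
  have Los': "sat A ((snd (e i))(y := c)) (fst (e i)) \<longleftrightarrow>
      (\<forall>\<^sub>F k in \<U>. sat (B k) ((\<lambda>x. ev k (snd (e i) x))(y := ev k c)) (fst (e i)))"
    if "c \<in> carr A s" for i c
  proof -
    have "(fst (e i), snd (e i)) \<in> p" unfolding e by simp
    note * = wfp[OF this, THEN conjunct1] wfp[OF this, THEN conjunct2]
    have "(\<lambda>x. ev k (((snd (e i))(y := c)) x)) = (\<lambda>x. ev k (snd (e i) x))(y := ev k c)" for k by auto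
    moreover have "\<forall>x\<in>fv (fst (e i)). ((snd (e i))(y := c)) x \<in> carr A (fst x)"
      using *(2) that y by auto
    ultimately show ?thesis using Los[OF *(1), of "(snd (e i))(y := c)"] by simp
  qed
  \<comment> \<open>Membership in the carrier is part of each condition, so that the diagonal
    sequence can be lifted to \<open>A\<close>.\<close>
  define Q where "Q = (\<lambda>i k b. b \<in> carr (B k) s \<and> sat (B k) ((\<lambda>x. ev k (snd (e i) x))(y := b)) (fst (e i)))"
  have "\<exists>b. \<forall>i. \<forall>\<^sub>F k in \<U>. Q i k (b k)"
  proof (rule ultra_diagonal)
    fix m
    have "e ` {..m} \<subseteq> p" unfolding e by auto
    from fin[OF this] obtain c
      where c: "c \<in> carr A s" "\<forall>(\<phi>, v)\<in>e ` {..m}. sat A (v(y := c)) \<phi>" by auto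
    have "\<forall>\<^sub>F k in \<U>. \<forall>i\<in>{..m}. sat (B k) ((\<lambda>x. ev k (snd (e i) x))(y := ev k c)) (fst (e i))"
      by (rule eventually_ball_finite) (use c Los' in \<open>auto simp: case_prod_unfold\<close>)
    with carr[OF s c(1)] show "\<forall>\<^sub>F k in \<U>. \<exists>b. \<forall>i\<le>m. Q i k b"
      by eventually_elim (auto simp: Q_def)
  qed
  then obtain b where b: "\<And>i. \<forall>\<^sub>F k in \<U>. Q i k (b k)" by blast
  have "\<forall>\<^sub>F k in \<U>. b k \<in> carr (B k) s" using b[of 0] by eventually_elim (simp add: Q_def)
  then obtain c where c: "c \<in> carr A s" "\<forall>\<^sub>F k in \<U>. ev k c = b k" using lift[OF s] by blast
  have "sat A ((snd (e i))(y := c)) (fst (e i))" for i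
  proof -
    have "\<forall>\<^sub>F k in \<U>. sat (B k) ((\<lambda>x. ev k (snd (e i) x))(y := ev k c)) (fst (e i))"
      using c(2) b[of i] by eventually_elim (simp add: Q_def)
    then show ?thesis using Los'[OF c(1)] by blast
  qed
  then have "\<forall>(\<phi>, v)\<in>p. sat A (v(y := c)) \<phi>" unfolding e by (auto simp: case_prod_unfold)
  then show ?thesis using c(1) by blast
qed

end

section \<open>The downward Loewenheim-Skolem theorem\<close>

lemma card_of_Times_infinite_le:
  assumes "infinite S" "|X| \<le>o |S|" "|Y| \<le>o |S|"
  shows "|X \<times> Y| \<le>o |S|"
  by (rule card_of_Sigma_ordLeq_infinite) (use assms in auto)

lemma card_of_Un_infinite_le:
  assumes "infinite S" "|X| \<le>o |S|" "|Y| \<le>o |S|"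
  shows "|X \<union> Y| \<le>o |S|"
  using card_of_Un_ordLeq_infinite_Field[of "|S|" X Y] assms card_of_Card_order[of S]
  by (simp add: Field_card_of)

lemma card_of_lists_length:
  assumes "infinite (S :: 'b set)" "|X| \<le>o |S|"
  shows "|{xs. set xs \<subseteq> X \<and> length xs = n}| \<le>o |S|"
proof (induction n)
  case 0
  have eq: "{xs. set xs \<subseteq> X \<and> length xs = 0} = {[]}" by auto
  obtain s where "s \<in> S" using assms(1) by fastforce
  then have "inj_on (\<lambda>_. s) {[] :: 'a list} \<and> (\<lambda>_. s) ` {[] :: 'a list} \<subseteq> S" by auto
  then show ?case unfolding eq card_of_ordLeq[symmetric] by blast
next
  case (Suc n)
  have "{xs. set xs \<subseteq> X \<and> length xs = Suc n} = (\<lambda>(x, xs). x # xs) ` (X \<times> {xs. set xs \<subseteq> X \<and> length xs = n})"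
    by (auto simp: length_Suc_conv image_iff)
  then have "|{xs. set xs \<subseteq> X \<and> length xs = Suc n}| \<le>o |X \<times> {xs. set xs \<subseteq> X \<and> length xs = n}|"
    by (simp add: card_of_image)
  also have "|X \<times> {xs. set xs \<subseteq> X \<and> length xs = n}| \<le>o |S|"
    by (rule card_of_Times_infinite_le[OF assms Suc])
  finally show ?case .
qed

lemma card_of_lists_le:
  assumes "infinite (S :: 'b set)" "|X| \<le>o |S|"
  shows "|lists X| \<le>o |S|"
proof -
  have "lists X = (\<Union>n. {xs. set xs \<subseteq> X \<and> length xs = n})" by (auto simp: lists_eq_set)
  moreover have "|\<Union>n::nat. {xs. set xs \<subseteq> X \<and> length xs = n}| \<le>o |S|"
    by (rule card_of_UNION_ordLeq_infinite[OF assms(1)])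
      (use assms card_of_lists_length infinite_iff_card_of_nat in auto)
  ultimately show ?thesis by simp
qed

text \<open>Countably many rounds of adding one chosen witness for every existential formula and
  every list of parameters, followed by the Tarski-Vaught argument. Values of functions are obtained
  as witnesses too, since \<open>x = f(xs)\<close> is an existential demand.\<close>

lemma Loewenheim_Skolem:
  fixes M :: "('s, 'f, 'r, 'a) struct" and S :: "'b set"
  assumes L: "wf_signature L" and M: "is_structure L M" and X: "X \<subseteq> elems L M"
    and S: "infinite S" and XS: "|X| \<le>o |S|" and WS: "|{\<phi>. wf_fm L \<phi>}| \<le>o |S|"
  shows "\<exists>A. X \<subseteq> A \<and> elementary_submodel L M A \<and> |A| \<le>o |S|"
proof -
  define vars :: "('s, 'f, 'r) fm \<Rightarrow> ('s \<times> nat) list" where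
    "vars = (\<lambda>\<phi>. SOME xs. set xs = fv \<phi>)"
  have vars: "set (vars \<phi>) = fv \<phi>" for \<phi>
    unfolding vars_def using finite_list[OF finite_fv] by (rule someI_ex)
  define val :: "('s, 'f, 'r) fm \<Rightarrow> ('s \<times> 'a) list \<Rightarrow> 's \<times> nat \<Rightarrow> 'a" where
    "val = (\<lambda>\<phi> xs y. the (map_of (zip (vars \<phi>) (map snd xs)) y))"
  define wit :: "('s, 'f, 'r) fm \<Rightarrow> ('s \<times> 'a) list \<Rightarrow> 's \<times> 'a" where
    "wit = (\<lambda>\<psi> xs. case \<psi> of Ex x \<phi> \<Rightarrow> (fst x, SOME a. a \<in> carr M (fst x) \<and> sat M ((val \<phi> xs)(x := a)) \<phi>))"
  \<comment> \<open>Intersecting with \<open>elems L M\<close> discards the meaningless values of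
    \<open>wit\<close>, which come from formulas that are not existential or that have no
    witness.\<close>
  define stp where "stp = (\<lambda>Y. Y \<union> (\<lambda>(\<psi>, xs). wit \<psi> xs) ` ({\<phi>. wf_fm L \<phi>} \<times> lists Y) \<inter> elems L M)"
  have stpE: "stp Y = Y \<union> (\<lambda>(\<psi>, xs). wit \<psi> xs) ` ({\<phi>. wf_fm L \<phi>} \<times> lists Y) \<inter> elems L M" for Y
    by (simp add: stp_def)
  have stpI: "wit \<psi> xs \<in> stp Y"
    if "wf_fm L \<psi>" "xs \<in> lists Y" "wit \<psi> xs \<in> elems L M" for \<psi> xs Y
    unfolding stpE using that by (intro UnI2 IntI image_eqI[of _ _ "(\<psi>, xs)"]) auto
  define A where "A = (\<Union>n. (stp ^^ n) X)"
  have cardA: "|A| \<le>o |S|"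
    unfolding A_def
  proof (rule card_of_UNION_ordLeq_infinite[OF S])
    show "|UNIV :: nat set| \<le>o |S|" using S infinite_iff_card_of_nat by blast
    have "|(stp ^^ n) X| \<le>o |S|" for n
    proof (induction n)
      case (Suc n)
      let ?Y = "(stp ^^ n) X"
      have "|(\<lambda>(\<psi>, xs). wit \<psi> xs) ` ({\<phi>. wf_fm L \<phi>} \<times> lists ?Y)| \<le>o |{\<phi>. wf_fm L \<phi>} \<times> lists ?Y|"
        by (rule card_of_image)
      also have "|{\<phi>. wf_fm L \<phi>} \<times> lists ?Y| \<le>o |S|"
        by (rule card_of_Times_infinite_le[OF S WS card_of_lists_le[OF S Suc]])
      finally have "|(\<lambda>(\<psi>, xs). wit \<psi> xs) ` ({\<phi>. wf_fm L \<phi>} \<times> lists ?Y) \<inter> elems L M| \<le>o |S|"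
        by (rule ordLeq_transitive[OF card_of_mono1[OF Int_lower1]])
      then have "|stp ?Y| \<le>o |S|"
        unfolding stpE[of ?Y] by (rule card_of_Un_infinite_le[OF S Suc])
      then show ?case by simp
    qed (use XS in simp)
    then show "\<forall>n\<in>UNIV. |(stp ^^ n) X| \<le>o |S|" by blast
  qed
  have XA: "X \<subseteq> A" unfolding A_def by (auto intro: UN_I[of 0])
  have AM: "A \<subseteq> elems L M"
  proof -
    have "(stp ^^ n) X \<subseteq> elems L M" for n by (induction n) (use X stpE in auto)
    then show ?thesis unfolding A_def by blast
  qed
  have step_mono: "(stp ^^ m) X \<subseteq> (stp ^^ n) X" if "m \<le> n" for m n
    using that by (induction n rule: dec_induct) (use stpE in auto)
  have fin_level: "\<exists>n. F \<subseteq> (stp ^^ n) X" if "finite F" "F \<subseteq> A" for F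
    using that
  proof (induction F rule: finite_induct)
    case (insert a F)
    then obtain m n where "F \<subseteq> (stp ^^ n) X" "a \<in> (stp ^^ m) X" unfolding A_def by auto
    then have "insert a F \<subseteq> (stp ^^ max m n) X"
      using step_mono[of m "max m n"] step_mono[of n "max m n"] by auto
    then show ?case by blast
  qed auto
  have closed: "\<exists>a. (fst x, a) \<in> A \<and> sat M (w(x := a)) \<phi>"
    if wfx: "wf_fm L (Ex x \<phi>)" and wA: "\<forall>y\<in>fv \<phi> - {x}. (fst y, w y) \<in> A"
      and ex: "\<exists>a\<in>carr M (fst x). sat M (w(x := a)) \<phi>" for x \<phi> w
  proof -
    obtain n where n: "(\<lambda>y. (fst y, w y)) ` (fv \<phi> - {x}) \<subseteq> (stp ^^ n) X"
      using fin_level[of "(\<lambda>y. (fst y, w y)) ` (fv \<phi> - {x})"] wA by auto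
    show ?thesis
    proof (cases "fv \<phi> - {x} = {}")
      case True
      have *: "sat M ((val \<phi> [])(x := a)) \<phi> \<longleftrightarrow> sat M (w(x := a)) \<phi>" for a
        by (rule sat_cong) (use True in auto)
      define a where "a = (SOME a. a \<in> carr M (fst x) \<and> sat M ((val \<phi> [])(x := a)) \<phi>)"
      have a: "a \<in> carr M (fst x)" "sat M (w(x := a)) \<phi>"
      proof -
        have "\<exists>a. a \<in> carr M (fst x) \<and> sat M ((val \<phi> [])(x := a)) \<phi>" using ex * by blast
        then have "a \<in> carr M (fst x) \<and> sat M ((val \<phi> [])(x := a)) \<phi>"
          unfolding a_def by (rule someI_ex)
        then show "a \<in> carr M (fst x)" "sat M (w(x := a)) \<phi>" using * by auto
      qed
      have "wit (Ex x \<phi>) [] = (fst x, a)" by (simp add: wit_def a_def)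
      then have "(fst x, a) \<in> stp ((stp ^^ 0) X)"
        using stpI[OF wfx, of "[]"] wfx a(1) by (simp add: elems_def)
      then have "(fst x, a) \<in> (stp ^^ Suc 0) X" by simp
      then show ?thesis using a unfolding A_def by blast
    next
      case False
      then obtain y0 where y0: "y0 \<in> fv \<phi> - {x}" by blast
      \<comment> \<open>The list of parameters also has a slot for \<open>x\<close>, although its
        value is overwritten. It is filled with the value of another free variable
        \<open>y0\<close>, so that all entries lie in the current stage; without such a variable the
        empty list serves, as the stage may be empty.\<close>
      define w1 where "w1 = (\<lambda>y. if y = x then (fst y0, w y0) else (fst y, w y))"
      define xs where "xs = map w1 (vars \<phi>)"
      have xs: "xs \<in> lists ((stp ^^ n) X)"
        unfolding xs_def lists_eq_set using n y0 vars by (auto simp: w1_def)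
      have *: "sat M ((val \<phi> xs)(x := a)) \<phi> \<longleftrightarrow> sat M (w(x := a)) \<phi>" for a
      proof (rule sat_cong, rule ballI)
        fix y assume "y \<in> fv \<phi>"
        then have "map_of (zip (vars \<phi>) (map (snd \<circ> w1) (vars \<phi>))) y = Some (snd (w1 y))"
          using vars by (simp add: map_of_zip_map)
        then show "((val \<phi> xs)(x := a)) y = (w(x := a)) y"
          by (auto simp: val_def xs_def w1_def)
      qed
      define a where "a = (SOME a. a \<in> carr M (fst x) \<and> sat M ((val \<phi> xs)(x := a)) \<phi>)"
      have a: "a \<in> carr M (fst x)" "sat M (w(x := a)) \<phi>"
      proof -
        have "\<exists>a. a \<in> carr M (fst x) \<and> sat M ((val \<phi> xs)(x := a)) \<phi>" using ex * by blast
        then have "a \<in> carr M (fst x) \<and> sat M ((val \<phi> xs)(x := a)) \<phi>"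
          unfolding a_def by (rule someI_ex)
        then show "a \<in> carr M (fst x)" "sat M (w(x := a)) \<phi>" using * by auto
      qed
      have "wit (Ex x \<phi>) xs = (fst x, a)" by (simp add: wit_def a_def)
      then have "(fst x, a) \<in> stp ((stp ^^ n) X)"
        using stpI[OF wfx xs] wfx a(1) by (simp add: elems_def)
      then have "(fst x, a) \<in> (stp ^^ Suc n) X" by simp
      then show ?thesis using a unfolding A_def by blast
    qed
  qed
  let ?N = "substructure_on M A"
  have carrN: "carr ?N s = {a. (s, a) \<in> A}" for s by (simp add: substructure_on_def)
  have N: "is_structure L ?N"
    unfolding is_structure_def
  proof (intro conjI ballI)
    fix s assume s: "s \<in> Sorts L"
    then obtain a where "a \<in> carr M s" using M unfolding is_structure_def by blast
    then show "carr ?N s \<noteq> {}"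
      using closed[of "(s, 0)" "Eq (Var (s, 0)) (Var (s, 0))" "\<lambda>_. undefined"] s carrN by auto
  next
    fix f xs assume f: "f \<in> Funs L" and xs: "xs \<in> tuples ?N (fdom L f)"
    define n where "n = length xs"
    \<comment> \<open>The argument at position \<open>k\<close> is represented by a variable of
      index \<open>k\<close>, so index \<open>n\<close> is fresh for the value, and \<open>w\<close>
      needs to look only at the index.\<close>
    let ?t = "App f (map (\<lambda>(s, k). Var (s, k)) (zip (fdom L f) [0..<n])) :: ('s, 'f) tm"
    let ?x = "(fcod L f, n)"
    define w where "w = (\<lambda>y::'s \<times> nat. xs ! snd y)"
    have len: "length (fdom L f) = n" using xs unfolding n_def tuples_def by (auto simp: list_all2_lengthD)
    have xsA: "(fdom L f ! i, xs ! i) \<in> A" if "i < n" for i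
      using xs that len unfolding tuples_def carrN by (auto simp: list_all2_conv_all_nth)
    have ev: "eval M (w(?x := a)) ?t = fint M f xs" for a
    proof -
      have "map (eval M (w(?x := a)) \<circ> (\<lambda>(s, k). Var (s, k))) (zip (fdom L f) [0..<n]) = xs"
        by (rule nth_equalityI) (use len in \<open>auto simp: n_def w_def\<close>)
      then show ?thesis by simp
    qed
    have "xs \<in> tuples M (fdom L f)"
      using xs AM unfolding tuples_def carrN by (auto simp: elems_def elim!: list_all2_mono)
    then have fc: "fint M f xs \<in> carr M (fcod L f)" using M f unfolding is_structure_def by blast
    have "\<exists>a. (fst ?x, a) \<in> A \<and> sat M (w(?x := a)) (Eq (Var ?x) ?t)"
    proof (rule closed)
      show "wf_fm L (Ex ?x (Eq (Var ?x) ?t))"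
      proof -
        have "set (fdom L f) \<subseteq> Sorts L" "fcod L f \<in> Sorts L"
          using L f unfolding wf_signature_def by auto
        then show ?thesis using f len
          by (auto simp: list_eq_iff_nth_eq dest!: set_zip_leftD)
      qed
      show "\<forall>y\<in>fv (Eq (Var ?x) ?t) - {?x}. (fst y, w y) \<in> A"
        using xsA len by (auto simp: w_def set_zip)
      show "\<exists>a\<in>carr M (fst ?x). sat M (w(?x := a)) (Eq (Var ?x) ?t)"
        using fc ev by (auto simp del: eval.simps(2))
    qed
    then show "fint ?N f xs \<in> carr ?N (fcod L f)"
      unfolding carrN using ev by (auto simp: substructure_on_def simp del: eval.simps(2))
  qed
  have evN: "eval ?N v t = eval M v t" for v t
    by (induction t) (auto simp: substructure_on_def intro!: arg_cong[of _ _ "fint M _"])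
  have "sat ?N v \<phi> \<longleftrightarrow> sat M v \<phi>" if "wf_fm L \<phi>" "\<forall>y\<in>fv \<phi>. (fst y, v y) \<in> A" for \<phi> v
    using that
  proof (induction \<phi> arbitrary: v)
    case (Ex x \<phi>)
    have IH: "sat ?N (v(x := a)) \<phi> \<longleftrightarrow> sat M (v(x := a)) \<phi>" if "(fst x, a) \<in> A" for a
      by (rule Ex.IH) (use Ex.prems that in auto)
    show ?case using IH closed[of x \<phi> v] Ex.prems AM by (auto simp: carrN elems_def)
  next
    case (Rel r ts)
    have "eval ?N v = eval M v" using evN by blast
    then show ?case by (simp add: substructure_on_def)
  qed (auto simp: evN)
  moreover have "\<forall>y\<in>fv \<phi>. (fst y, v y) \<in> A" if "wf_fm L \<phi>" "is_valuation L ?N v" for \<phi> v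
    using that fv_sorts[OF that(1)] unfolding is_valuation_def carrN by (metis mem_Collect_eq prod.collapse)
  ultimately have "elementary_submodel L M A"
    unfolding elementary_submodel_def using AM N by blast
  then show ?thesis using XA cardA by blast
qed

section \<open>Definable sets\<close>

text \<open>Bound variables are renamed as well; no capture can arise, because the renamings used
  are injective and preserve sorts.\<close>

fun rename_tm :: "('s var \<Rightarrow> 's var) \<Rightarrow> ('s, 'f) tm \<Rightarrow> ('s, 'f) tm" where
  "rename_tm r (Var x) = Var (r x)"
| "rename_tm r (App f ts) = App f (map (rename_tm r) ts)"

fun rename_fm :: "('s var \<Rightarrow> 's var) \<Rightarrow> ('s, 'f, 'r) fm \<Rightarrow> ('s, 'f, 'r) fm" where
  "rename_fm r (Eq t u) = Eq (rename_tm r t) (rename_tm r u)"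
| "rename_fm r (Rel R ts) = Rel R (map (rename_tm r) ts)"
| "rename_fm r (Neg \<phi>) = Neg (rename_fm r \<phi>)"
| "rename_fm r (Conj \<phi> \<psi>) = Conj (rename_fm r \<phi>) (rename_fm r \<psi>)"
| "rename_fm r (Ex x \<phi>) = Ex (r x) (rename_fm r \<phi>)"

context
  fixes r :: "'s var \<Rightarrow> 's var"
  assumes r: "inj r" "\<And>x. fst (r x) = fst x"
begin

lemma eval_rename: "eval M v (rename_tm r t) = eval M (\<lambda>x. v (r x)) t"
proof (induction t)
  case (App f ts)
  then have "map (eval M v) (map (rename_tm r) ts) = map (eval M (\<lambda>x. v (r x))) ts" by simp
  then show ?case by (simp del: map_map)
qed simp

lemma sat_rename: "sat M v (rename_fm r \<phi>) \<longleftrightarrow> sat M (\<lambda>x. v (r x)) \<phi>"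
proof (induction \<phi> arbitrary: v)
  case (Rel R ts)
  have "map (eval M v) (map (rename_tm r) ts) = map (eval M (\<lambda>x. v (r x))) ts"
    by (simp add: eval_rename)
  then show ?case by (simp del: map_map)
next
  case (Ex x \<phi>)
  have "(\<lambda>y. (v(r x := a)) (r y)) = (\<lambda>y. v (r y))(x := a)" for a
    using r(1) by (auto simp: fun_eq_iff dest: injD)
  then show ?case using Ex r(2) by simp
qed (auto simp: eval_rename)

lemma sort_of_rename: "sort_of L (rename_tm r t) = sort_of L t"
  using r(2) by (cases t) auto

lemma wf_rename_tm: "wf_tm L t \<Longrightarrow> wf_tm L (rename_tm r t)"
proof (induction t)
  case (App f ts)
  have "map (sort_of L) (map (rename_tm r) ts) = map (sort_of L) ts" by (simp add: sort_of_rename)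
  then show ?case using App by (simp del: map_map)
qed (use r(2) in auto)

lemma wf_rename_fm: "wf_fm L \<phi> \<Longrightarrow> wf_fm L (rename_fm r \<phi>)"
proof (induction \<phi>)
  case (Rel R ts)
  have "map (sort_of L) (map (rename_tm r) ts) = map (sort_of L) ts" by (simp add: sort_of_rename)
  then show ?case using Rel by (simp add: wf_rename_tm del: map_map)
qed (use r(2) in \<open>auto simp: wf_rename_tm sort_of_rename\<close>)

end

lemma tuples_append: "xs \<in> tuples M (ss @ ts) \<longleftrightarrow> (\<exists>x\<in>tuples M ss. \<exists>y\<in>tuples M ts. xs = x @ y)"
proof
  assume "xs \<in> tuples M (ss @ ts)"
  then show "\<exists>x\<in>tuples M ss. \<exists>y\<in>tuples M ts. xs = x @ y"
    by (auto simp: tuples_def list_all2_append2)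
next
  assume "\<exists>x\<in>tuples M ss. \<exists>y\<in>tuples M ts. xs = x @ y"
  then show "xs \<in> tuples M (ss @ ts)"
    by (auto simp: tuples_def intro: list_all2_appendI)
qed

lemma tuples_single: "xs \<in> tuples M [s] \<longleftrightarrow> (\<exists>a\<in>carr M s. xs = [a])"
  unfolding tuples_def by (auto simp: list_all2_Cons2)

lemma tuples_snoc: "xs @ [a] \<in> tuples M (ss @ [s]) \<longleftrightarrow> xs \<in> tuples M ss \<and> a \<in> carr M s"
  by (auto simp: tuples_append tuples_single Bex_def)

lemma tuples_length: "xs \<in> tuples M ss \<Longrightarrow> length xs = length ss"
  unfolding tuples_def by (auto dest: list_all2_lengthD)

lemma tuples_nth: "xs \<in> tuples M ss \<Longrightarrow> i < length ss \<Longrightarrow> xs ! i \<in> carr M (ss ! i)"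
  unfolding tuples_def by (auto dest: list_all2_nthD2)

lemma tuplesI: "length xs = length ss \<Longrightarrow> (\<And>i. i < length ss \<Longrightarrow> xs ! i \<in> carr M (ss ! i)) \<Longrightarrow> xs \<in> tuples M ss"
  unfolding tuples_def by (auto simp: list_all2_conv_all_nth)

lemma definable_subset: "definable L M ss X \<Longrightarrow> X \<subseteq> tuples M ss"
  unfolding definable_def by auto

lemma definable_sorts: "definable L M ss X \<Longrightarrow> set ss \<subseteq> Sorts L"
  unfolding definable_def by auto

text \<open>Substitution into a definable set: coordinate \<open>i\<close> is read off coordinate
  \<open>j\<close> of the new tuple if \<open>c i = Inl j\<close> and is the constant
  \<open>a\<close> if \<open>c i = Inr a\<close>. No new coordinate may be read twice, since the
  substitution is carried out by an injective renaming.\<close>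

lemma definable_reindex:
  assumes S: "definable L M ss S" and ts: "set ts \<subseteq> Sorts L"
    and c: "\<And>i. i < length ss \<Longrightarrow>
      case c i of Inl j \<Rightarrow> j < length ts \<and> ts ! j = ss ! i | Inr a \<Rightarrow> a \<in> carr M (ss ! i)"
    and inj: "\<And>i i' j. i < length ss \<Longrightarrow> i' < length ss \<Longrightarrow> c i = Inl j \<Longrightarrow> c i' = Inl j \<Longrightarrow> i = i'"
  shows "definable L M ts
    {xs \<in> tuples M ts. map (\<lambda>i. case c i of Inl j \<Rightarrow> xs ! j | Inr a \<Rightarrow> a) [0..<length ss] \<in> S}"
proof -
  obtain \<phi> v where \<phi>: "wf_fm L \<phi>" and v: "is_valuation L M v"
    and S_eq: "S = {xs \<in> tuples M ss. sat M (assign ss xs v) \<phi>}"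
    using S unfolding definable_def by blast
  let ?m = "length ss" and ?n = "length ts"
  \<comment> \<open>Three zones of indices: below \<open>?n\<close> the new coordinates, from
    \<open>?n\<close> to \<open>?n + ?m\<close> the slots of the constants, above that the old
    parameters, shifted.\<close>
  define r where "r = (\<lambda>(s, k). if k < ?m \<and> ss ! k = s
    then (s, case c k of Inl j \<Rightarrow> j | Inr a \<Rightarrow> ?n + k) else (s, ?n + ?m + k))"
  define w where "w = (\<lambda>(s, k). if k < ?n then v (s, k) else if k < ?n + ?m
    then (case c (k - ?n) of Inl j \<Rightarrow> v (s, k) | Inr a \<Rightarrow> if ss ! (k - ?n) = s then a else v (s, k))
    else v (s, k - ?n - ?m))"
  have r1: "inj r"
  proof (rule injI)
    fix x y assume eq: "r x = r y"
    obtain s k s' k' where x: "x = (s, k)" and y: "y = (s', k')" by force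
    have s: "s' = s" using eq by (auto simp: r_def x y split: if_splits)
    have small: "j < ?n" if "l < ?m" "c l = Inl j" for l j using c[OF that(1)] that(2) by simp
    show "x = y"
    proof (cases "k < ?m \<and> ss ! k = s"; cases "k' < ?m \<and> ss ! k' = s")
      assume k: "k < ?m \<and> ss ! k = s" and k': "k' < ?m \<and> ss ! k' = s"
      then have "k = k'"
        using eq inj[of k k'] small[of k] small[of k'] by (cases "c k"; cases "c k'") (auto simp: r_def x y s)
      then show ?thesis by (simp add: x y s)
    next
      assume k: "k < ?m \<and> ss ! k = s" and k': "\<not> (k' < ?m \<and> ss ! k' = s)"
      then show ?thesis using eq small[of k] by (cases "c k") (auto simp: r_def x y s)
    next
      assume k: "\<not> (k < ?m \<and> ss ! k = s)" and k': "k' < ?m \<and> ss ! k' = s"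
      then show ?thesis using eq small[of k'] by (cases "c k'") (auto simp: r_def x y s)
    next
      assume k: "\<not> (k < ?m \<and> ss ! k = s)" and k': "\<not> (k' < ?m \<and> ss ! k' = s)"
      then show ?thesis using eq by (auto simp: r_def x y s split: if_splits)
    qed
  qed
  have r2: "fst (r x) = fst x" for x by (cases x) (auto simp: r_def)
  have w: "is_valuation L M w"
    unfolding is_valuation_def
  proof (intro ballI allI)
    fix s k assume s: "s \<in> Sorts L"
    have vs: "v (s, k) \<in> carr M s" for k using v s unfolding is_valuation_def by blast
    show "w (s, k) \<in> carr M s"
    proof (cases "k < ?n \<or> \<not> k < ?n + ?m")
      case True
      then show ?thesis using vs by (auto simp: w_def)
    next
      case False
      then show ?thesis using vs c[of "k - ?n"] by (cases "c (k - ?n)") (auto simp: w_def)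
    qed
  qed
  let ?ys = "\<lambda>xs. map (\<lambda>i. case c i of Inl j \<Rightarrow> xs ! j | Inr a \<Rightarrow> a) [0..<?m]"
  have ys: "?ys xs \<in> tuples M ss" if "xs \<in> tuples M ts" for xs
  proof (rule tuplesI)
    fix i assume "i < ?m"
    then show "?ys xs ! i \<in> carr M (ss ! i)"
      using c[of i] tuples_nth[OF that] by (cases "c i") force+
  qed simp
  have "(\<lambda>x. assign ts xs w (r x)) = assign ss (?ys xs) v" if "xs \<in> tuples M ts" for xs
  proof
    fix x
    show "assign ts xs w (r x) = assign ss (?ys xs) v x"
    proof (cases "snd x < ?m \<and> ss ! snd x = fst x")
      case True
      then show ?thesis using c[of "snd x"]
        by (cases x; cases "c (snd x)") (auto simp: r_def assign_def w_def)
    next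
      case False
      then show ?thesis by (cases x) (auto simp: r_def assign_def w_def)
    qed
  qed
  then have "{xs \<in> tuples M ts. ?ys xs \<in> S} = {xs \<in> tuples M ts. sat M (assign ts xs w) (rename_fm r \<phi>)}"
    using ys unfolding S_eq by (auto simp: sat_rename[OF r1 r2])
  then show ?thesis
    unfolding definable_def using ts wf_rename_fm[OF r1 r2 \<phi>] w by blast
qed

lemma definable_Diff:
  assumes "definable L M ss X"
  shows "definable L M ss (tuples M ss - X)"
proof -
  obtain \<phi> v where "wf_fm L \<phi>" "is_valuation L M v" "X = {xs \<in> tuples M ss. sat M (assign ss xs v) \<phi>}"
    using assms unfolding definable_def by blast
  then have "wf_fm L (Neg \<phi>)" "is_valuation L M v"
    "tuples M ss - X = {xs \<in> tuples M ss. sat M (assign ss xs v) (Neg \<phi>)}" by auto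
  then show ?thesis using definable_sorts[OF assms] unfolding definable_def by blast
qed

lemma definable_Int:
  assumes X: "definable L M ss X" and Y: "definable L M ss Y"
  shows "definable L M ss (X \<inter> Y)"
proof -
  obtain \<phi> v where \<phi>: "wf_fm L \<phi>" "is_valuation L M v" "X = {xs \<in> tuples M ss. sat M (assign ss xs v) \<phi>}"
    using X unfolding definable_def by blast
  obtain \<psi> w where \<psi>: "wf_fm L \<psi>" "is_valuation L M w" "Y = {xs \<in> tuples M ss. sat M (assign ss xs w) \<psi>}"
    using Y unfolding definable_def by blast
  let ?m = "length ss"
  \<comment> \<open>The two formulas may give different parameter values to the same variable. Their
    parameters are moved to even and odd places above \<open>?m\<close>.\<close>
  define r where "r = (\<lambda>b (s, k). if k < ?m \<and> ss ! k = s then (s, k) else (s, ?m + 2 * k + b))"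
  define u where "u = (\<lambda>(s, k). if k < ?m then v (s, k) else if even (k - ?m) then v (s, (k - ?m) div 2)
     else w (s, (k - ?m) div 2))"
  have r1: "inj (r b)" for b by (rule injI) (auto simp: r_def split: if_splits)
  have r2: "fst (r b x) = fst x" for b x by (cases x) (auto simp: r_def)
  have u: "is_valuation L M u" using \<phi>(2) \<psi>(2) unfolding is_valuation_def u_def by auto
  have "(\<lambda>x. assign ss xs u (r 0 x)) = assign ss xs v" "(\<lambda>x. assign ss xs u (r 1 x)) = assign ss xs w" for xs
    by (auto simp: fun_eq_iff r_def assign_def u_def)
  then have "X \<inter> Y = {xs \<in> tuples M ss. sat M (assign ss xs u) (Conj (rename_fm (r 0) \<phi>) (rename_fm (r 1) \<psi>))}"
    unfolding \<phi>(3) \<psi>(3) by (auto simp: sat_rename[OF r1 r2])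
  moreover have "wf_fm L (Conj (rename_fm (r 0) \<phi>) (rename_fm (r 1) \<psi>))"
    using wf_rename_fm[OF r1 r2 \<phi>(1)] wf_rename_fm[OF r1 r2 \<psi>(1)] by simp
  ultimately show ?thesis using u definable_sorts[OF X] unfolding definable_def by blast
qed

lemma definable_Un:
  assumes X: "definable L M ss X" and Y: "definable L M ss Y"
  shows "definable L M ss (X \<union> Y)"
proof -
  have "X \<union> Y = tuples M ss - (tuples M ss - X) \<inter> (tuples M ss - Y)"
    using definable_subset[OF X] definable_subset[OF Y] by auto
  then show ?thesis using definable_Diff[OF definable_Int[OF definable_Diff[OF X] definable_Diff[OF Y]]] by simp
qed

lemma definable_ex1:
  assumes "definable L M (ss @ [s]) S"
  shows "definable L M ss {xs \<in> tuples M ss. \<exists>a\<in>carr M s. xs @ [a] \<in> S}"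
proof -
  obtain \<phi> v where \<phi>: "wf_fm L \<phi>" "is_valuation L M v"
    "S = {xs \<in> tuples M (ss @ [s]). sat M (assign (ss @ [s]) xs v) \<phi>}"
    using assms unfolding definable_def by blast
  have s: "set ss \<subseteq> Sorts L" "s \<in> Sorts L" using definable_sorts[OF assms] by auto
  have "assign (ss @ [s]) (xs @ [a]) v = (assign ss xs v)((s, length ss) := a)" if "length xs = length ss" for xs a
    using that by (auto simp: fun_eq_iff assign_def nth_append less_Suc_eq)
  moreover have "xs @ [a] \<in> tuples M (ss @ [s]) \<longleftrightarrow> xs \<in> tuples M ss \<and> a \<in> carr M s" for xs a
    by (rule tuples_snoc)
  ultimately have "{xs \<in> tuples M ss. \<exists>a\<in>carr M s. xs @ [a] \<in> S} =
      {xs \<in> tuples M ss. sat M (assign ss xs v) (Ex (s, length ss) \<phi>)}"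
    unfolding \<phi>(3) by (auto simp: tuples_length)
  moreover have "wf_fm L (Ex (s, length ss) \<phi>)" using \<phi>(1) s by simp
  ultimately show ?thesis using s(1) \<phi>(2) unfolding definable_def by blast
qed

lemma definable_ex:
  assumes "definable L M (ss @ ts) S"
  shows "definable L M ss {xs \<in> tuples M ss. \<exists>ys\<in>tuples M ts. xs @ ys \<in> S}"
  using assms
proof (induction ts arbitrary: S rule: rev_induct)
  case Nil
  have "{xs \<in> tuples M ss. \<exists>ys\<in>tuples M []. xs @ ys \<in> S} = S"
    using definable_subset[OF Nil] by (auto simp: tuples_def)
  then show ?case using Nil by simp
next
  case (snoc t ts)
  have "definable L M (ss @ ts) {xs \<in> tuples M (ss @ ts). \<exists>a\<in>carr M t. xs @ [a] \<in> S}"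
    by (rule definable_ex1) (use snoc.prems in simp)
  from snoc.IH[OF this]
  have "definable L M ss {xs \<in> tuples M ss. \<exists>ys\<in>tuples M ts. xs @ ys \<in> tuples M (ss @ ts) \<and> (\<exists>a\<in>carr M t. xs @ ys @ [a] \<in> S)}"
    by simp
  moreover have "{xs \<in> tuples M ss. \<exists>ys\<in>tuples M ts. xs @ ys \<in> tuples M (ss @ ts) \<and> (\<exists>a\<in>carr M t. xs @ ys @ [a] \<in> S)} =
     {xs \<in> tuples M ss. \<exists>ys\<in>tuples M (ts @ [t]). xs @ ys \<in> S}"
  proof -
    have "(\<exists>ys\<in>tuples M ts. xs @ ys \<in> tuples M (ss @ ts) \<and> (\<exists>a\<in>carr M t. xs @ ys @ [a] \<in> S)) \<longleftrightarrow>
      (\<exists>ys\<in>tuples M (ts @ [t]). xs @ ys \<in> S)" if "xs \<in> tuples M ss" for xs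
    proof
      assume "\<exists>ys\<in>tuples M (ts @ [t]). xs @ ys \<in> S"
      then obtain ys a where "ys \<in> tuples M ts" "a \<in> carr M t" "xs @ ys @ [a] \<in> S"
        by (auto simp: tuples_append tuples_single)
      then show "\<exists>ys\<in>tuples M ts. xs @ ys \<in> tuples M (ss @ ts) \<and> (\<exists>a\<in>carr M t. xs @ ys @ [a] \<in> S)"
        using that unfolding tuples_append by blast
    next
      assume "\<exists>ys\<in>tuples M ts. xs @ ys \<in> tuples M (ss @ ts) \<and> (\<exists>a\<in>carr M t. xs @ ys @ [a] \<in> S)"
      then obtain ys a where *: "ys \<in> tuples M ts" "a \<in> carr M t" "xs @ ys @ [a] \<in> S" by auto
      then have "ys @ [a] \<in> tuples M (ts @ [t])"
        unfolding tuples_snoc by simp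
      then show "\<exists>ys\<in>tuples M (ts @ [t]). xs @ ys \<in> S" using * by blast
    qed
    then show ?thesis by blast
  qed
  ultimately show ?case by simp
qed

subsection \<open>Binary relations on tuples\<close>

definition definable_rel ::
  "('s, 'f, 'r) signature \<Rightarrow> ('s, 'f, 'r, 'a) struct \<Rightarrow> 's list \<Rightarrow> ('a list \<times> 'a list) set \<Rightarrow> bool" where
  "definable_rel L M ss R \<longleftrightarrow> R \<subseteq> tuples M ss \<times> tuples M ss \<and>
     definable L M (ss @ ss) {x @ y | x y. (x, y) \<in> R}"

lemma definable_rel_mem:
  assumes "definable_rel L M ss R" "length x = length ss"
  shows "x @ y \<in> {x @ y | x y. (x, y) \<in> R} \<longleftrightarrow> (x, y) \<in> R"
proof
  assume "x @ y \<in> {x @ y | x y. (x, y) \<in> R}"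
  then obtain x' y' where *: "x @ y = x' @ y'" "(x', y') \<in> R" by blast
  then have "length x' = length ss" using assms(1) tuples_length unfolding definable_rel_def by blast
  then show "(x, y) \<in> R" using * assms(2) by simp
qed blast

abbreviation block :: "'s list \<Rightarrow> nat \<Rightarrow> 'a list \<Rightarrow> 'a list" where
  "block ss p xs \<equiv> take (length ss) (drop p xs)"

definition is_block :: "'s list \<Rightarrow> 's list \<Rightarrow> nat \<Rightarrow> bool" where
  "is_block ss ts p \<longleftrightarrow> p + length ss \<le> length ts \<and> (\<forall>i<length ss. ts ! (p + i) = ss ! i)"

text \<open>Disjointness of the two blocks is what makes the reindexing injective.\<close>

lemma definable_rel_blocks:
  assumes R: "definable_rel L M ss R" and ts: "set ts \<subseteq> Sorts L"
    and p: "is_block ss ts p" and q: "is_block ss ts q"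
    and pq: "p + length ss \<le> q \<or> q + length ss \<le> p"
  shows "definable L M ts {xs \<in> tuples M ts. (block ss p xs, block ss q xs) \<in> R}"
proof -
  let ?m = "length ss" and ?c = "\<lambda>i. Inl (if i < length ss then p + i else q + (i - length ss))"
  let ?f = "\<lambda>xs. map (\<lambda>i. case ?c i of Inl j \<Rightarrow> xs ! j | Inr a \<Rightarrow> a) [0..<length (ss @ ss)]"
  let ?S = "{x @ y | x y. (x, y) \<in> R}"
  have "definable L M ts {xs \<in> tuples M ts. ?f xs \<in> ?S}"
  proof (rule definable_reindex)
    show "definable L M (ss @ ss) ?S" using R unfolding definable_rel_def by simp
    show "case ?c i of Inl j \<Rightarrow> j < length ts \<and> ts ! j = (ss @ ss) ! i | Inr a \<Rightarrow> a \<in> carr M ((ss @ ss) ! i)"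
      if "i < length (ss @ ss)" for i
    proof (cases "i < ?m")
      case True
      then show ?thesis using p unfolding is_block_def by (simp add: nth_append)
    next
      case False
      then obtain j where "i = ?m + j" using le_Suc_ex by (metis not_less)
      then show ?thesis using q that unfolding is_block_def by simp
    qed
    show "i = i'" if "i < length (ss @ ss)" "i' < length (ss @ ss)" "?c i = Inl j" "?c i' = Inl j" for i i' j
      using that pq by (simp split: if_splits; arith)
  qed (rule ts)
  moreover have "?f xs \<in> ?S \<longleftrightarrow> (block ss p xs, block ss q xs) \<in> R" if "xs \<in> tuples M ts" for xs
  proof -
    have len: "length xs = length ts" using tuples_length[OF that] .
    have "?f xs = block ss p xs @ block ss q xs"
      by (rule nth_equalityI) (use p q len in \<open>auto simp: nth_append is_block_def\<close>)
    moreover have "length (block ss p xs) = ?m" using p len unfolding is_block_def by (simp, arith)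
    ultimately show ?thesis using definable_rel_mem[OF R] by simp
  qed
  ultimately show ?thesis by (simp cong: conj_cong)
qed

lemma definable_rel_block_param:
  assumes R: "definable_rel L M ss R" and ts: "set ts \<subseteq> Sorts L"
    and p: "is_block ss ts p" and e: "e \<in> tuples M ss"
  shows "definable L M ts {xs \<in> tuples M ts. (block ss p xs, e) \<in> R}"
    and "definable L M ts {xs \<in> tuples M ts. (e, block ss p xs) \<in> R}"
proof -
  let ?m = "length ss" and ?S = "{x @ y | x y. (x, y) \<in> R}"
  let ?c = "\<lambda>i. if i < length ss then Inl (p + i) else Inr (e ! (i - length ss))"
  let ?d = "\<lambda>i. if i < length ss then Inr (e ! i) else Inl (p + (i - length ss))"
  let ?f = "\<lambda>c xs. map (\<lambda>i. case c i of Inl j \<Rightarrow> xs ! j | Inr a \<Rightarrow> a) [0..<length (ss @ ss)]"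
  have el: "length e = ?m" using tuples_length[OF e] .
  have D: "definable L M (ss @ ss) ?S" using R unfolding definable_rel_def by simp
  have len: "length (block ss p xs) = ?m" if "xs \<in> tuples M ts" for xs
    using tuples_length[OF that] p unfolding is_block_def by (simp, arith)
  have "definable L M ts {xs \<in> tuples M ts. ?f ?c xs \<in> ?S}"
  proof (rule definable_reindex[OF D ts])
    show "case ?c i of Inl j \<Rightarrow> j < length ts \<and> ts ! j = (ss @ ss) ! i | Inr a \<Rightarrow> a \<in> carr M ((ss @ ss) ! i)"
      if "i < length (ss @ ss)" for i
      using p that tuples_nth[OF e, of "i - ?m"] unfolding is_block_def by (simp add: nth_append)
    show "i = i'" if "i < length (ss @ ss)" "i' < length (ss @ ss)" "?c i = Inl j" "?c i' = Inl j" for i i' j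
      using that by (simp split: if_splits)
  qed
  moreover have "?f ?c xs \<in> ?S \<longleftrightarrow> (block ss p xs, e) \<in> R" if "xs \<in> tuples M ts" for xs
  proof -
    have "?f ?c xs = block ss p xs @ e"
      by (rule nth_equalityI) (use p el tuples_length[OF that] in \<open>auto simp: nth_append is_block_def\<close>)
    then show ?thesis using definable_rel_mem[OF R len[OF that]] by simp
  qed
  ultimately show "definable L M ts {xs \<in> tuples M ts. (block ss p xs, e) \<in> R}"
    by (simp cong: conj_cong)
  have "definable L M ts {xs \<in> tuples M ts. ?f ?d xs \<in> ?S}"
  proof (rule definable_reindex[OF D ts])
    show "case ?d i of Inl j \<Rightarrow> j < length ts \<and> ts ! j = (ss @ ss) ! i | Inr a \<Rightarrow> a \<in> carr M ((ss @ ss) ! i)"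
      if "i < length (ss @ ss)" for i
    proof (cases "i < ?m")
      case True
      then show ?thesis using tuples_nth[OF e] by (simp add: nth_append)
    next
      case False
      then obtain j where "i = ?m + j" using le_Suc_ex by (metis not_less)
      then show ?thesis using p that unfolding is_block_def by simp
    qed
    show "i = i'" if "i < length (ss @ ss)" "i' < length (ss @ ss)" "?d i = Inl j" "?d i' = Inl j" for i i' j
      using that by (simp split: if_splits)
  qed
  moreover have "?f ?d xs \<in> ?S \<longleftrightarrow> (e, block ss p xs) \<in> R" if "xs \<in> tuples M ts" for xs
  proof -
    have "?f ?d xs = e @ block ss p xs"
      by (rule nth_equalityI) (use p el tuples_length[OF that] in \<open>auto simp: nth_append is_block_def\<close>)
    then show ?thesis using definable_rel_mem[OF R el] by simp
  qed
  ultimately show "definable L M ts {xs \<in> tuples M ts. (e, block ss p xs) \<in> R}"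
    by (simp cong: conj_cong)
qed

section \<open>A dichotomy for infinite linear orders\<close>

definition strict_part :: "'a rel \<Rightarrow> 'a rel" where
  "strict_part R = {(x, y). (x, y) \<in> R \<and> (y, x) \<notin> R}"

definition covers :: "'a rel \<Rightarrow> 'a rel" where
  "covers R = {(x, y). (x, y) \<in> strict_part R \<and> \<not> (\<exists>z. (x, z) \<in> strict_part R \<and> (z, y) \<in> strict_part R)}"

definition initial_points :: "'a rel \<Rightarrow> 'a set" where
  "initial_points R = {x. (x, x) \<in> R \<and> (\<forall>y. (y, x) \<notin> covers R)}"

text \<open>Preorders instead of orders, because an interpreted order lives on classes of tuples.
  The field is \<open>{x. (x, x) \<in> R}\<close>, and two points name the same element if each is
  below the other.\<close>

locale total_preorder =
  fixes R :: "'a rel"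
  assumes refl: "(x, y) \<in> R \<Longrightarrow> (x, x) \<in> R \<and> (y, y) \<in> R"
    and trans: "(x, y) \<in> R \<Longrightarrow> (y, z) \<in> R \<Longrightarrow> (x, z) \<in> R"
    and total: "(x, x) \<in> R \<Longrightarrow> (y, y) \<in> R \<Longrightarrow> (x, y) \<in> R \<or> (y, x) \<in> R"
begin

abbreviation le (infix "\<preceq>" 50) where "x \<preceq> y \<equiv> (x, y) \<in> R"
abbreviation lt (infix "\<prec>" 50) where "x \<prec> y \<equiv> (x, y) \<in> strict_part R"
abbreviation cov (infix "\<lhd>" 50) where "x \<lhd> y \<equiv> (x, y) \<in> covers R"

lemma lt_def: "x \<prec> y \<longleftrightarrow> x \<preceq> y \<and> \<not> y \<preceq> x"
  by (simp add: strict_part_def)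

lemma cov_def: "x \<lhd> y \<longleftrightarrow> x \<prec> y \<and> \<not> (\<exists>z. x \<prec> z \<and> z \<prec> y)"
  by (simp add: covers_def)

lemma le_lt_trans: "x \<preceq> y \<Longrightarrow> y \<prec> z \<Longrightarrow> x \<prec> z"
  and lt_le_trans: "x \<prec> y \<Longrightarrow> y \<preceq> z \<Longrightarrow> x \<prec> z"
  unfolding lt_def using trans by blast+

lemma lt_trans: "x \<prec> y \<Longrightarrow> y \<prec> z \<Longrightarrow> x \<prec> z"
  using le_lt_trans lt_def by blast

lemma lt_cases: "x \<preceq> x \<Longrightarrow> y \<preceq> y \<Longrightarrow> x \<prec> y \<or> y \<preceq> x"
  unfolding lt_def using total by blast

lemma cov_cong: "x \<lhd> y \<Longrightarrow> x' \<preceq> x \<Longrightarrow> x \<preceq> x' \<Longrightarrow> y' \<preceq> y \<Longrightarrow> y \<preceq> y' \<Longrightarrow> x' \<lhd> y'"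
  unfolding cov_def using le_lt_trans lt_le_trans by metis

lemma cov_refl: "x \<lhd> y \<Longrightarrow> x \<preceq> x \<and> y \<preceq> y"
  unfolding cov_def lt_def using refl by blast

lemma chain_le: "(f, w) \<in> covers R ^^ j \<Longrightarrow> f \<preceq> f \<Longrightarrow> f \<preceq> w"
proof (induction j arbitrary: w)
  case (Suc j)
  then obtain u where "(f, u) \<in> covers R ^^ j" "u \<lhd> w" by auto
  then have "f \<preceq> u" "u \<preceq> w" using Suc by (auto simp: cov_def lt_def)
  then show ?case by (rule trans)
qed auto

text \<open>A finite chain of covers exhausts the interval that it spans: \<open>z\<close> is
  equivalent to one of its links, and the following link covers it.\<close>

lemma chain_successor:
  "(f, w) \<in> covers R ^^ j \<Longrightarrow> f \<preceq> z \<Longrightarrow> z \<prec> w \<Longrightarrow> \<exists>s. z \<lhd> s \<and> s \<preceq> w"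
proof (induction j arbitrary: w)
  case 0
  then show ?case by (auto simp: lt_def)
next
  case (Suc j)
  from Suc.prems(1) obtain u where u: "(f, u) \<in> covers R ^^ j" "u \<lhd> w" by auto
  have D: "z \<preceq> z" "u \<preceq> u" "u \<preceq> w" "w \<preceq> w" using Suc.prems cov_refl[OF u(2)] refl u(2) by (auto simp: cov_def lt_def)
  show ?case
  proof (cases "z \<prec> u")
    case True
    then show ?thesis using Suc.IH[OF u(1) Suc.prems(2)] D(3) trans by blast
  next
    case False
    then have "u \<preceq> z" using lt_cases D by blast
    moreover have "z \<preceq> u" using u(2) Suc.prems(3) lt_cases[OF D(2,1)] unfolding cov_def by blast
    ultimately have "z \<lhd> w" using cov_cong[OF u(2)] D by blast
    then show ?thesis using D by blast
  qed
qed

lemma chain_predecessor: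
  "(f, w) \<in> covers R ^^ j \<Longrightarrow> f \<prec> x \<Longrightarrow> x \<preceq> w \<Longrightarrow> \<exists>p. p \<lhd> x"
proof (induction j arbitrary: w)
  case 0
  then show ?case by (auto simp: lt_def)
next
  case (Suc j)
  from Suc.prems(1) obtain u where u: "(f, u) \<in> covers R ^^ j" "u \<lhd> w" by auto
  have D: "x \<preceq> x" "u \<preceq> u" "w \<preceq> w" using Suc.prems cov_refl[OF u(2)] refl by blast+
  show ?case
  proof (cases "x \<preceq> u")
    case True
    then show ?thesis using Suc.IH[OF u(1) Suc.prems(2)] by blast
  next
    case False
    then have "u \<prec> x" using lt_cases D by blast
    then have "w \<preceq> x" using u(2) lt_cases[OF D(1,3)] unfolding cov_def by blast
    then show ?thesis using cov_cong[OF u(2)] D Suc.prems(3) by blast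
  qed
qed

text \<open>Descend through immediate predecessors until an initial point is met or \<open>m\<close>
  steps have been made.\<close>

lemma chain_from_initial:
  assumes "x \<preceq> x"
  shows "(\<exists>f\<in>initial_points R. \<exists>j\<le>m. (f, x) \<in> covers R ^^ j) \<or> (\<exists>y. y \<preceq> y \<and> (y, x) \<in> covers R ^^ m)"
proof (induction m)
  case 0
  then show ?case using assms by auto
next
  case (Suc m)
  then show ?case
  proof
    assume "\<exists>y. y \<preceq> y \<and> (y, x) \<in> covers R ^^ m"
    then obtain y where y: "y \<preceq> y" "(y, x) \<in> covers R ^^ m" by blast
    show ?thesis
    proof (cases "y \<in> initial_points R")
      case True
      then show ?thesis using y le_Suc_eq by blast
    next
      case False
      then obtain y' where "y' \<lhd> y" using y unfolding initial_points_def by blast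
      then show ?thesis using cov_refl relpow_Suc_I2 y(2) by metis
    qed
  qed (use le_Suc_eq in blast)
qed

lemma chain_functional:
  "(f, x) \<in> covers R ^^ j \<Longrightarrow> (f', x') \<in> covers R ^^ j \<Longrightarrow> f \<preceq> f' \<Longrightarrow> f' \<preceq> f \<Longrightarrow> x \<preceq> x' \<and> x' \<preceq> x"
proof (induction j arbitrary: x x')
  case (Suc j)
  from Suc.prems obtain u u' where u: "(f, u) \<in> covers R ^^ j" "u \<lhd> x" "(f', u') \<in> covers R ^^ j" "u' \<lhd> x'"
    by auto
  have uu: "u \<preceq> u'" "u' \<preceq> u" using Suc.IH[OF u(1,3) Suc.prems(3,4)] by auto
  have D: "x \<preceq> x" "x' \<preceq> x'" using cov_refl u by blast+
  have "u' \<prec> x" "u \<prec> x'" using u(2,4) uu le_lt_trans unfolding cov_def by blast+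
  then have "\<not> x \<prec> x'" "\<not> x' \<prec> x" using u(2,4) unfolding cov_def by blast+
  then show ?case using lt_cases D by blast
qed auto

text \<open>With chains of bounded length, every point is reached from an initial point in at most
  \<open>k\<close> steps. If all initial points were equivalent, the step number would separate the
  infinitely many classes of the \<open>d i\<close>, against the pigeonhole principle. If no initial
  point lay between the initial points \<open>x\<close> and \<open>y\<close>, a chain could be
  climbed forever from \<open>x\<close>: a link \<open>z\<close> below \<open>y\<close> is not
  covered by \<open>y\<close>, so some \<open>w\<close> lies in between, and the chain that leads to
  \<open>w\<close> from its initial point starts at or below \<open>x\<close>, hence passes
  \<open>z\<close> and provides a successor of it.\<close>

theorem discrete_or_dense:
  assumes inf: "\<And>i. d i \<preceq> d i" "\<And>i j. i \<noteq> j \<Longrightarrow> \<not> (d (i::nat) \<preceq> d j \<and> d j \<preceq> d i)"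
    and bounded: "\<And>x y. (x, y) \<notin> covers R ^^ k"
  shows "\<exists>a\<in>initial_points R. \<exists>b\<in>initial_points R. a \<prec> b"
    and "x \<in> initial_points R \<Longrightarrow> y \<in> initial_points R \<Longrightarrow> x \<prec> y \<Longrightarrow> \<exists>z\<in>initial_points R. x \<prec> z \<and> z \<prec> y"
proof -
  let ?F = "initial_points R"
  have FD: "f \<preceq> f" if "f \<in> ?F" for f using that unfolding initial_points_def by blast
  have from_F: "\<exists>f\<in>?F. \<exists>j\<le>k. (f, x) \<in> covers R ^^ j" if "x \<preceq> x" for x
    using chain_from_initial[OF that, of k] bounded by blast
  show "\<exists>a\<in>?F. \<exists>b\<in>?F. a \<prec> b"
  proof (rule ccontr)
    assume none: "\<not> (\<exists>a\<in>?F. \<exists>b\<in>?F. a \<prec> b)"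
    have "\<forall>i. \<exists>f j. f \<in> ?F \<and> j \<le> k \<and> (f, d i) \<in> covers R ^^ j" using from_F[OF inf(1)] by blast
    then obtain f j where fj: "\<And>i. f i \<in> ?F \<and> j i \<le> k \<and> (f i, d i) \<in> covers R ^^ (j i)" by metis
    have "finite (range j)" by (rule finite_subset[of _ "{..k}"]) (use fj in auto)
    then have "\<not> inj j" using finite_imageD infinite_UNIV_nat by blast
    then obtain i i' where "i \<noteq> i'" "j i = j i'" unfolding inj_def by blast
    moreover have "f i \<preceq> f i'" "f i' \<preceq> f i" using none fj FD lt_cases by blast+
    ultimately show False using chain_functional[of "f i" "d i" "j i" "f i'" "d i'"] fj inf(2) by metis
  qed
  show "\<exists>z\<in>?F. x \<prec> z \<and> z \<prec> y" if x: "x \<in> ?F" and y: "y \<in> ?F" and xy: "x \<prec> y"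
  proof (rule ccontr)
    assume none: "\<not> (\<exists>z\<in>?F. x \<prec> z \<and> z \<prec> y)"
    have "\<exists>z. (x, z) \<in> covers R ^^ m \<and> x \<preceq> z \<and> z \<prec> y" for m
    proof (induction m)
      case 0
      then show ?case using xy FD[OF x] by auto
    next
      case (Suc m)
      then obtain z where z: "(x, z) \<in> covers R ^^ m" "x \<preceq> z" "z \<prec> y" by blast
      then have "\<not> z \<lhd> y" using y unfolding initial_points_def by blast
      then obtain w where w: "z \<prec> w" "w \<prec> y" using z(3) unfolding cov_def by blast
      obtain f j where f: "f \<in> ?F" "(f, w) \<in> covers R ^^ j"
        using from_F[of w] w(1) refl unfolding lt_def by blast
      have xw: "x \<preceq> w" using z(2) w(1) trans unfolding lt_def by blast
      have fw: "f \<preceq> w"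
      proof -
        have "f \<preceq> w \<or> w \<preceq> f" using total FD[OF f(1)] refl w(1) unfolding lt_def by blast
        then show ?thesis using f FD chain_le by blast
      qed
      have "\<not> x \<prec> f" using none f(1) le_lt_trans[OF fw w(2)] by blast
      moreover have "\<not> f \<prec> x" using chain_predecessor[OF f(2) _ xw] x unfolding initial_points_def by blast
      ultimately have "f \<preceq> x" using lt_cases FD x f(1) by blast
      then obtain s where s: "z \<lhd> s" "s \<preceq> w" using chain_successor[OF f(2) _ w(1)] z(2) trans by blast
      have "x \<preceq> s" using s(1) z(2) trans unfolding cov_def lt_def by blast
      then show ?case using s z(1) le_lt_trans[OF s(2) w(2)] relpow_Suc_I by metis
    qed
    then show False using bounded by blast
  qed
qed

end

section \<open>Linear orders\<close>

definition linear_strict :: "'a set \<Rightarrow> ('a \<Rightarrow> 'a \<Rightarrow> bool) \<Rightarrow> bool" where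
  "linear_strict K lt \<longleftrightarrow> (\<forall>x\<in>K. \<not> lt x x) \<and> (\<forall>x\<in>K. \<forall>y\<in>K. \<forall>z\<in>K. lt x y \<longrightarrow> lt y z \<longrightarrow> lt x z) \<and>
     (\<forall>x\<in>K. \<forall>y\<in>K. x = y \<or> lt x y \<or> lt y x)"

definition dense_min :: "'a set \<Rightarrow> ('a \<Rightarrow> 'a \<Rightarrow> bool) \<Rightarrow> bool" where
  "dense_min K lt \<longleftrightarrow> linear_strict K lt \<and> (\<exists>m\<in>K. \<forall>x\<in>K. x = m \<or> lt m x) \<and>
     (\<forall>x\<in>K. \<exists>y\<in>K. lt x y) \<and> (\<forall>x\<in>K. \<forall>y\<in>K. lt x y \<longrightarrow> (\<exists>z\<in>K. lt x z \<and> lt z y))"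

text \<open>The case \<open>B = {}\<close> says that no countable subset is cofinal.\<close>

definition eta_min :: "'a set \<Rightarrow> ('a \<Rightarrow> 'a \<Rightarrow> bool) \<Rightarrow> bool" where
  "eta_min K lt \<longleftrightarrow> linear_strict K lt \<and> (\<exists>m\<in>K. \<forall>x\<in>K. x = m \<or> lt m x) \<and>
     (\<forall>A\<subseteq>K. \<forall>B\<subseteq>K. countable A \<longrightarrow> countable B \<longrightarrow> A \<noteq> {} \<longrightarrow> (\<forall>a\<in>A. \<forall>b\<in>B. lt a b) \<longrightarrow>
        (\<exists>x\<in>K. (\<forall>a\<in>A. lt a x) \<and> (\<forall>b\<in>B. lt x b)))"

definition ultra_less :: "(nat \<Rightarrow> 'a \<Rightarrow> 'a \<Rightarrow> bool) \<Rightarrow> (nat \<Rightarrow> 'a) \<Rightarrow> (nat \<Rightarrow> 'a) \<Rightarrow> bool" where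
  "ultra_less lt x y \<longleftrightarrow> (\<forall>\<^sub>F k in \<U>. lt k (x k) (y k))"

lemma ultra_less_rep [simp]: "ultra_less lt (rep x) y \<longleftrightarrow> ultra_less lt x y" "ultra_less lt x (rep y) \<longleftrightarrow> ultra_less lt x y"
proof -
  show "ultra_less lt (rep x) y \<longleftrightarrow> ultra_less lt x y" unfolding ultra_less_def
    by (rule eventually_ultra_cong) (use rep_eq[of x] in \<open>eventually_elim, simp\<close>)
  show "ultra_less lt x (rep y) \<longleftrightarrow> ultra_less lt x y" unfolding ultra_less_def
    by (rule eventually_ultra_cong) (use rep_eq[of y] in \<open>eventually_elim, simp\<close>)
qed

lemma linear_strict_ultra:
  assumes "\<And>k. linear_strict (P k) (lt k)"
  shows "linear_strict (ultraproduct P) (ultra_less lt)"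
proof -
  have irr: "\<not> lt k x x" if "x \<in> P k" for k x
    using assms[of k] that unfolding linear_strict_def by blast
  have tr: "lt k x z" if "x \<in> P k" "y \<in> P k" "z \<in> P k" "lt k x y" "lt k y z" for k x y z
    using assms[of k] that unfolding linear_strict_def by blast
  have tot: "x = y \<or> lt k x y \<or> lt k y x" if "x \<in> P k" "y \<in> P k" for k x y
    using assms[of k] that unfolding linear_strict_def by blast
  show ?thesis
    unfolding linear_strict_def
  proof (intro conjI ballI impI)
    fix x assume x: "x \<in> ultraproduct P"
    have "\<forall>\<^sub>F k in \<U>. \<not> lt k (x k) (x k)"
      using ultraproduct_ev[OF x] by eventually_elim (use irr in blast)
    then show "\<not> ultra_less lt x x" unfolding ultra_less_def eventually_ultra_not .
  next
    fix x y z assume x: "x \<in> ultraproduct P" and y: "y \<in> ultraproduct P" and z: "z \<in> ultraproduct P"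
      and xy: "ultra_less lt x y" and yz: "ultra_less lt y z"
    show "ultra_less lt x z" unfolding ultra_less_def
      using ultraproduct_ev[OF x] ultraproduct_ev[OF y] ultraproduct_ev[OF z]
        xy[unfolded ultra_less_def] yz[unfolded ultra_less_def]
      by eventually_elim (use tr in blast)
  next
    fix x y assume x: "x \<in> ultraproduct P" and y: "y \<in> ultraproduct P"
    have "\<forall>\<^sub>F k in \<U>. x k = y k \<or> lt k (x k) (y k) \<or> lt k (y k) (x k)"
      using ultraproduct_ev[OF x] ultraproduct_ev[OF y] by eventually_elim (use tot in blast)
    then show "x = y \<or> ultra_less lt x y \<or> ultra_less lt y x"
      using ultraproduct_eqI[OF x y] unfolding ultra_less_def eventually_ultra_disj by blast
  qed
qed

lemma linear_strict_finite_between: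
  assumes "dense_min K lt" "finite A" "finite B" "A \<subseteq> K" "B \<subseteq> K" "A \<noteq> {}" "\<forall>a\<in>A. \<forall>b\<in>B. lt a b"
  shows "\<exists>x\<in>K. (\<forall>a\<in>A. lt a x) \<and> (\<forall>b\<in>B. lt x b)"
proof -
  have tr: "lt x z" if "x \<in> K" "y \<in> K" "z \<in> K" "lt x y" "lt y z" for x y z
    using assms(1) that unfolding dense_min_def linear_strict_def by blast
  have tot: "x = y \<or> lt x y \<or> lt y x" if "x \<in> K" "y \<in> K" for x y
    using assms(1) that unfolding dense_min_def linear_strict_def by blast
  have max: "\<exists>m\<in>A. \<forall>a\<in>A. a = m \<or> lt a m"
    using assms(2,6,4)
  proof (induction A rule: finite_ne_induct)
    case (insert x F)
    then obtain m where m: "m \<in> F" "\<forall>a\<in>F. a = m \<or> lt a m" by auto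
    show ?case
    proof (cases "lt m x")
      case True
      have "lt a x" if "a \<in> F" for a
        using m that insert.prems tr[of a m x] True by (cases "a = m") auto
      then have "\<forall>a\<in>insert x F. a = x \<or> lt a x" by blast
      then show ?thesis by blast
    next
      case False
      then have "x = m \<or> lt x m" using m(1) insert.prems tot[of x m] by blast
      then have "\<forall>a\<in>insert x F. a = m \<or> lt a m" using m by blast
      then show ?thesis using m(1) by blast
    qed
  qed auto
  then obtain m where m: "m \<in> A" "\<forall>a\<in>A. a = m \<or> lt a m" by blast
  have mK: "m \<in> K" using m assms(4) by blast
  show ?thesis
  proof (cases "B = {}")
    case True
    obtain x where "x \<in> K" "lt m x" using assms(1) mK unfolding dense_min_def by blast
    moreover have "lt a x" if "a \<in> A" for a
      using m that \<open>x \<in> K\<close> \<open>lt m x\<close> tr[of a m x] mK assms(4) by (cases "a = m") auto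
    ultimately show ?thesis using True by blast
  next
    case False
    have "\<exists>n\<in>B. \<forall>b\<in>B. b = n \<or> lt n b"
      using assms(3) False assms(5)
    proof (induction B rule: finite_ne_induct)
      case (insert x F)
      then obtain n where n: "n \<in> F" "\<forall>a\<in>F. a = n \<or> lt n a" by auto
      show ?case
      proof (cases "lt x n")
        case True
        have "lt x a" if "a \<in> F" for a
          using n that insert.prems tr[of x n a] True by (cases "a = n") auto
        then have "\<forall>a\<in>insert x F. a = x \<or> lt x a" by blast
        then show ?thesis by blast
      next
        case False
        then have "x = n \<or> lt n x" using n(1) insert.prems tot[of x n] by blast
        then have "\<forall>a\<in>insert x F. a = n \<or> lt n a" using n by blast
        then show ?thesis using n(1) by blast
      qed
    qed auto
    then obtain n where n: "n \<in> B" "\<forall>b\<in>B. b = n \<or> lt n b" by blast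
    have nK: "n \<in> K" using n assms(5) by blast
    obtain x where x: "x \<in> K" "lt m x" "lt x n"
      using assms(1,7) m(1) n(1) mK nK unfolding dense_min_def by blast
    have "lt a x" if "a \<in> A" for a using m that x tr[of a m x] mK assms(4) by (cases "a = m") auto
    moreover have "lt x b" if "b \<in> B" for b using n that x tr[of x n b] nK assms(5) by (cases "b = n") auto
    ultimately show ?thesis using x by blast
  qed
qed

text \<open>Lying between two countable sets amounts to countably many conditions. Finitely many of
  them are solvable in \<open>K\<close> by density and the absence of a last point, and
  \<open>ultra_diagonal\<close> does the rest.\<close>

lemma eta_min_ultrapower:
  assumes K: "dense_min K lt"
  shows "eta_min (ultraproduct (\<lambda>_. K)) (ultra_less (\<lambda>_. lt))"
proof -
  let ?P = "ultraproduct (\<lambda>_. K)" and ?lt = "ultra_less (\<lambda>_. lt)"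
  obtain m where m: "m \<in> K" "\<forall>x\<in>K. x = m \<or> lt m x" using K unfolding dense_min_def by blast
  have lin: "linear_strict ?P ?lt"
    by (rule linear_strict_ultra) (use K in \<open>simp add: dense_min_def\<close>)
  have "\<exists>m\<in>?P. \<forall>x\<in>?P. x = m \<or> ?lt m x"
  proof (intro bexI ballI)
    show mP: "rep (\<lambda>_. m) \<in> ?P" by (rule rep_in_ultraproduct) (use m in simp)
    fix x assume x: "x \<in> ?P"
    have "\<forall>\<^sub>F k in \<U>. x k = rep (\<lambda>_. m) k \<or> lt m (x k)"
      using ultraproduct_ev[OF x] rep_eq[of "\<lambda>_. m"] by eventually_elim (use m in auto)
    then show "x = rep (\<lambda>_. m) \<or> ?lt (rep (\<lambda>_. m)) x"
      using ultraproduct_eqI[OF x mP] unfolding eventually_ultra_disj by (auto simp: ultra_less_def[of _ "\<lambda>_. m"])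
  qed
  moreover have "\<exists>x\<in>?P. (\<forall>a\<in>A. ?lt a x) \<and> (\<forall>b\<in>B. ?lt x b)"
    if A: "A \<subseteq> ?P" "countable A" "A \<noteq> {}" and B: "B \<subseteq> ?P" "countable B" and AB: "\<forall>a\<in>A. \<forall>b\<in>B. ?lt a b" for A B
  proof -
    define a where "a = from_nat_into A"
    have a: "range a = A" unfolding a_def by (rule range_from_nat_into[OF A(3,2)])
    define b where "b = from_nat_into B"
    \<comment> \<open>The guard disables the enumeration \<open>b\<close> when there are no upper
      bounds.\<close>
    define Q where "Q = (\<lambda>i k x. x \<in> K \<and> lt (a i k) x \<and> (B \<noteq> {} \<longrightarrow> lt x (b i k)))"
    have b: "range b = B" if "B \<noteq> {}" unfolding b_def by (rule range_from_nat_into[OF that B(2)])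
    have aK: "\<forall>\<^sub>F k in \<U>. a i k \<in> K" for i
      by (rule ultraproduct_ev) (use a A(1) in blast)
    have bK: "\<forall>\<^sub>F k in \<U>. b i k \<in> K" if "B \<noteq> {}" for i
      by (rule ultraproduct_ev) (use b[OF that] B(1) in blast)
    have ab: "\<forall>\<^sub>F k in \<U>. lt (a i k) (b j k)" if "B \<noteq> {}" for i j
    proof -
      have "a i \<in> A" "b j \<in> B" using a b[OF that] by auto
      then show ?thesis using AB unfolding ultra_less_def by blast
    qed
    have "\<exists>x. \<forall>i. \<forall>\<^sub>F k in \<U>. Q i k (x k)"
    proof (rule ultra_diagonal)
      fix n
      have "\<forall>\<^sub>F k in \<U>. \<forall>i\<in>{..n}. a i k \<in> K"
        by (rule eventually_ball_finite) (use aK in auto)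
      moreover have "\<forall>\<^sub>F k in \<U>. \<forall>i\<in>{..n}. B \<noteq> {} \<longrightarrow> b i k \<in> K"
        by (rule eventually_ball_finite) (use bK in \<open>cases "B = {}"; simp\<close>)+
      moreover have "\<forall>\<^sub>F k in \<U>. \<forall>(i,j)\<in>{..n}\<times>{..n}. B \<noteq> {} \<longrightarrow> lt (a i k) (b j k)"
      proof (rule eventually_ball_finite)
        show "\<forall>y\<in>{..n} \<times> {..n}. \<forall>\<^sub>F k in \<U>. case y of (i, j) \<Rightarrow> B \<noteq> {} \<longrightarrow> lt (a i k) (b j k)"
          using ab by (cases "B = {}") auto
      qed simp
      ultimately show "\<forall>\<^sub>F k in \<U>. \<exists>x. \<forall>i\<le>n. Q i k x"
      proof eventually_elim
        case (elim k)
        let ?A = "(\<lambda>i. a i k) ` {..n}" and ?B = "if B = {} then {} else (\<lambda>i. b i k) ` {..n}"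
        have "\<exists>x\<in>K. (\<forall>a\<in>?A. lt a x) \<and> (\<forall>b\<in>?B. lt x b)"
          by (rule linear_strict_finite_between[OF K]) (use elim in auto)
        then obtain x where "x \<in> K" "\<forall>a\<in>?A. lt a x" "\<forall>b\<in>?B. lt x b" by blast
        then have "\<forall>i\<le>n. Q i k x" unfolding Q_def by (cases "B = {}") auto
        then show ?case by blast
      qed
    qed
    then obtain x where x: "\<And>i. \<forall>\<^sub>F k in \<U>. Q i k (x k)" by blast
    have "rep x \<in> ?P" by (rule rep_in_ultraproduct) (use x[of 0] in \<open>eventually_elim, simp add: Q_def\<close>)
    moreover have "?lt (a i) x" for i
      unfolding ultra_less_def using x[of i] by eventually_elim (simp add: Q_def)
    moreover have "?lt x (b i)" if "B \<noteq> {}" for i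
      unfolding ultra_less_def using x[of i] by eventually_elim (use that in \<open>simp add: Q_def\<close>)
    ultimately have "rep x \<in> ?P \<and> (\<forall>a\<in>A. ?lt a (rep x)) \<and> (\<forall>b\<in>B. ?lt (rep x) b)"
      unfolding a[symmetric] using b by (cases "B = {}") auto
    then show ?thesis by blast
  qed
  ultimately show ?thesis unfolding eta_min_def using lin by blast
qed

section \<open>Finite covers of circular orders\<close>

text \<open>The points of the \<open>n\<close>-fold cover of the circular order obtained by closing up a linear order
  \<open>K\<close> are the pairs in \<open>K \<times> {..<n}\<close>, where \<open>(x, i)\<close> lies in the \<open>i\<close>-th copy of \<open>K\<close>.
  Let \<open>f\<close> be the rotation of order \<open>n\<close> that moves each copy to the next one.  Then
  \<open>delta n lt u v = j\<close> means that \<open>v\<close> lies in the half-open arc from \<open>f\<^sup>j u\<close> to \<open>f\<^sup>j\<^sup>+\<^sup>1 u\<close>.\<close>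

definition delta :: "nat \<Rightarrow> ('k \<Rightarrow> 'k \<Rightarrow> bool) \<Rightarrow> 'k \<times> nat \<Rightarrow> 'k \<times> nat \<Rightarrow> int" where
  "delta n lt u v = (int (snd v) - int (snd u) - of_bool (lt (fst v) (fst u))) mod int n"

lemma delta_range: "n > 0 \<Longrightarrow> 0 \<le> delta n lt u v \<and> delta n lt u v < int n"
  unfolding delta_def by simp

lemma mod_eq_small:
  fixes a b m :: int
  assumes "(c - a) mod m = (c - b) mod m" "\<bar>a - b\<bar> < m"
  shows "a = b"
proof -
  have "m dvd (c - a) - (c - b)" using assms(1) by (simp add: mod_eq_dvd_iff)
  moreover have "(c - a) - (c - b) = - (a - b)" by simp
  ultimately have "m dvd a - b" by (simp only: dvd_minus_iff)
  then show ?thesis using assms(2) dvd_imp_le_int[of "a - b" m] by (cases "a = b") auto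
qed

text \<open>The two truth values differ by at most one, so equality modulo \<open>n \<ge> 2\<close>
  makes them equal. In a cover of degree one \<open>delta\<close> would carry no information at
  all.\<close>

lemma delta_less_iff:
  assumes "n \<ge> 2" "delta n lt u v = delta n lt' u' v'" "int (snd v) - int (snd u) = int (snd v') - int (snd u')"
  shows "lt (fst v) (fst u) \<longleftrightarrow> lt' (fst v') (fst u')"
proof -
  have "(of_bool (lt (fst v) (fst u)) :: int) = of_bool (lt' (fst v') (fst u'))"
    by (rule mod_eq_small[of "int (snd v) - int (snd u)" _ "int n"])
      (use assms in \<open>auto simp: delta_def\<close>)
  then show ?thesis by (cases "lt (fst v) (fst u)"; cases "lt' (fst v') (fst u')") auto
qed

text \<open>On the way there and back the levels cancel. What remains is minus the number of strict
  comparisons that hold, which is zero over one point and one otherwise.\<close>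

lemma delta_fst_eq_iff:
  assumes "linear_strict K lt" "n \<ge> 2" "fst u \<in> K" "fst v \<in> K"
  shows "fst u = fst v \<longleftrightarrow> (delta n lt u v + delta n lt v u) mod int n = 0"
proof -
  have irr: "\<not> lt x x" if "x \<in> K" for x
    using assms(1) that unfolding linear_strict_def by blast
  have asym: "\<not> (lt x y \<and> lt y x)" if "x \<in> K" "y \<in> K" for x y
    using assms(1) that irr unfolding linear_strict_def by blast
  have tot: "x = y \<or> lt x y \<or> lt y x" if "x \<in> K" "y \<in> K" for x y
    using assms(1) that unfolding linear_strict_def by blast
  have *: "(delta n lt u v + delta n lt v u) mod int n =
      (- (of_bool (lt (fst v) (fst u)) + of_bool (lt (fst u) (fst v)))) mod int n"
    unfolding delta_def by (simp add: mod_add_eq)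
  show ?thesis
  proof (cases "fst u = fst v")
    case True
    then show ?thesis unfolding * using irr assms by simp
  next
    case False
    then have "(of_bool (lt (fst v) (fst u)) + of_bool (lt (fst u) (fst v)) :: int) = 1"
      using tot[of "fst u" "fst v"] asym[of "fst u" "fst v"] assms by auto
    moreover have "(-1) mod int n \<noteq> 0" using assms(2) by (simp add: zmod_minus1)
    ultimately show ?thesis unfolding * using False by simp
  qed
qed

definition cover_aut :: "nat \<Rightarrow> 'k set \<Rightarrow> ('k \<Rightarrow> 'k \<Rightarrow> bool) \<Rightarrow> ('k \<times> nat \<Rightarrow> 'k \<times> nat) \<Rightarrow> bool" where
  "cover_aut n K lt g \<longleftrightarrow> bij_betw g (K \<times> {..<n}) (K \<times> {..<n}) \<and>
     (\<forall>u\<in>K \<times> {..<n}. \<forall>v\<in>K \<times> {..<n}. delta n lt (g u) (g v) = delta n lt u v)"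

lemma cover_aut_bij: "cover_aut n K lt g \<Longrightarrow> bij_betw g (K \<times> {..<n}) (K \<times> {..<n})"
  unfolding cover_aut_def by blast

lemma cover_aut_mem: "cover_aut n K lt g \<Longrightarrow> u \<in> K \<times> {..<n} \<Longrightarrow> g u \<in> K \<times> {..<n}"
  using cover_aut_bij bij_betwE by blast

lemma cover_aut_delta:
  "cover_aut n K lt g \<Longrightarrow> u \<in> K \<times> {..<n} \<Longrightarrow> v \<in> K \<times> {..<n} \<Longrightarrow> delta n lt (g u) (g v) = delta n lt u v"
  unfolding cover_aut_def by blast

lemma cover_autI:
  assumes "bij_betw g (K \<times> {..<n}) (K \<times> {..<n})"
    and "\<And>u v. u \<in> K \<times> {..<n} \<Longrightarrow> v \<in> K \<times> {..<n} \<Longrightarrow> delta n lt (g u) (g v) = delta n lt u v"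
  shows "cover_aut n K lt g"
  unfolding cover_aut_def using assms by blast

lemma cover_aut_comp:
  assumes g: "cover_aut n K lt g" and h: "cover_aut n K lt h"
  shows "cover_aut n K lt (g \<circ> h)"
  using bij_betw_trans[OF cover_aut_bij[OF h] cover_aut_bij[OF g]]
  by (rule cover_autI)
    (simp only: comp_apply cover_aut_delta[OF g] cover_aut_delta[OF h] cover_aut_mem[OF h])

subsection \<open>Homogeneity of the covers of the circle of rationals\<close>

abbreviation Q01 :: "rat set" where "Q01 \<equiv> {0..<1}"

lemma dense_min_Q01: "dense_min Q01 (<)"
proof -
  have "\<exists>y\<in>Q01. x < y" if "x \<in> Q01" for x
    using dense[of x 1] that by (auto intro: order_trans[OF _ less_imp_le])
  moreover have "\<exists>z\<in>Q01. x < z \<and> z < y" if "x \<in> Q01" "y \<in> Q01" "x < y" for x y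
    using dense[OF that(3)] that by (meson atLeastLessThan_iff less_imp_le order_le_less_trans order_less_trans)
  ultimately show ?thesis
    unfolding dense_min_def linear_strict_def by (auto intro!: bexI[of _ 0])
qed

text \<open>The identity up to \<open>s\<close>, then linear from \<open>[s, c]\<close> onto
  \<open>[s, b]\<close> and from \<open>[c, 1)\<close> onto \<open>[b, 1)\<close>. Exchanging
  \<open>c\<close> and \<open>b\<close> gives the inverse.\<close>

lemma stretch_Q01:
  assumes "0 \<le> s" "s < c" "s < b" "c < 1" "b < (1::rat)"
  shows "\<exists>\<tau>. bij_betw \<tau> Q01 Q01 \<and> strict_mono_on Q01 \<tau> \<and> (\<forall>x\<le>s. \<tau> x = x) \<and> \<tau> c = b"
proof -
  define P where "P = (\<lambda>c b. (b - s) / (c - s))"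
  define R where "R = (\<lambda>c b. (1 - b) / (1 - c :: rat))"
  define T where "T = (\<lambda>c b x. if x \<le> s then x else if x \<le> c then s + (x - s) * P c b
      else b + (x - c) * R c b)"
  have range: "T c b x \<in> Q01" and mono: "y \<in> Q01 \<Longrightarrow> x < y \<Longrightarrow> T c b x < T c b y"
    and inv: "T b c (T c b x) = x"
    if c: "s < c" "s < b" "c < 1" "b < 1" "x \<in> Q01" for c b x y
  proof -
    have pos: "P c b > 0" "R c b > 0" using c by (auto simp: P_def R_def)
    have end_eq: "(c - s) * P c b = b - s" "(1 - c) * R c b = 1 - b" using c by (auto simp: P_def R_def)
    have inv_eq: "P c b * P b c = 1" "R c b * R b c = 1" using c by (auto simp: P_def R_def)
    have mid: "s < s + (x - s) * P c b" "s + (x - s) * P c b \<le> b" if x: "s < x" "x \<le> c" for x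
      using mult_pos_pos[of "x - s" "P c b"] mult_right_mono[of "x - s" "c - s" "P c b"] x pos end_eq by auto
    have top: "b < b + (x - c) * R c b" "b + (x - c) * R c b < 1" if x: "c < x" "x < 1" for x
      using mult_pos_pos[of "x - c" "R c b"] mult_strict_right_mono[of "x - c" "1 - c" "R c b"] x pos end_eq by auto
    consider (low) "x \<le> s" | (mid) "s < x" "x \<le> c" | (top) "c < x" "x < 1" using c by fastforce
    note x_cases = this
    show "T c b x \<in> Q01"
      using x_cases
    proof cases
      case low
      then show ?thesis using c by (simp add: T_def)
    next
      case m: mid
      then show ?thesis using mid[OF m] c assms(1) by (simp add: T_def)
    next
      case t: top
      then show ?thesis using top[OF t] c assms(1) by (simp add: T_def)
    qed
    show "T b c (T c b x) = x"
      using x_cases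
    proof cases
      case m: mid
      have "T b c (T c b x) = s + (x - s) * (P c b * P b c)" using mid[OF m] m by (simp add: T_def)
      then show ?thesis unfolding inv_eq by simp
    next
      case t: top
      have "T b c (T c b x) = c + (x - c) * (R c b * R b c)" using top[OF t] t c by (simp add: T_def)
      then show ?thesis unfolding inv_eq by simp
    qed (simp add: T_def)
    show "T c b x < T c b y" if y: "y \<in> Q01" "x < y"
      using x_cases
    proof cases
      case low
      have "y \<le> s \<or> s < T c b y"
        using mid[of y] top[of y] y c by (cases "y \<le> c") (auto simp: T_def)
      then show ?thesis using low y by (auto simp: T_def)
    next
      case m: mid
      show ?thesis
      proof (cases "y \<le> c")
        case True
        then show ?thesis using m y pos mult_strict_right_mono[of "x - s" "y - s" "P c b"] by (simp add: T_def)
      next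
        case False
        then show ?thesis using m y mid[OF m] top[of y] c by (simp add: T_def)
      qed
    next
      case t: top
      then show ?thesis using y pos c mult_strict_right_mono[of "x - c" "y - c" "R c b"] by (simp add: T_def)
    qed
  qed
  have "bij_betw (T c b) Q01 Q01"
    by (rule bij_betwI[where g = "T b c"])
      (use range[of c b] range[of b c] inv[of c b] inv[of b c] assms in auto)
  moreover have "strict_mono_on Q01 (T c b)"
    unfolding strict_mono_on_def using mono assms by blast
  moreover have "T c b c = b" using assms by (simp add: T_def P_def)
  ultimately show ?thesis by (intro exI[of _ "T c b"]) (auto simp: T_def)
qed

text \<open>Points are added in increasing order. The map for the smaller points sends the new point
  \<open>a\<close> somewhere above their images, and \<open>stretch_Q01\<close>, which fixes
  everything up to the largest of these images, corrects the value. Prescribing \<open>0\<close>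
  keeps that largest image defined and nonnegative.\<close>

lemma finite_order_iso_extends:
  assumes "finite X" "X \<subseteq> Q01" "h ` X \<subseteq> Q01" "strict_mono_on (insert 0 X) h" "h 0 = 0"
  shows "\<exists>\<tau>. bij_betw \<tau> Q01 Q01 \<and> strict_mono_on Q01 \<tau> \<and> (\<forall>x\<in>insert 0 X. \<tau> x = h x)"
  using assms
proof (induction X rule: finite_linorder_max_induct)
  case empty
  then show ?case by (intro exI[of _ "\<lambda>x. x"]) (auto simp: strict_mono_on_def bij_betw_def inj_on_def)
next
  case (insert a X)
  have "\<exists>\<tau>. bij_betw \<tau> Q01 Q01 \<and> strict_mono_on Q01 \<tau> \<and> (\<forall>x\<in>insert 0 X. \<tau> x = h x)"
    by (rule insert.IH) (use insert.prems in \<open>auto simp: strict_mono_on_def\<close>)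
  then obtain \<tau> where \<tau>: "bij_betw \<tau> Q01 Q01" "strict_mono_on Q01 \<tau>" "\<forall>x\<in>insert 0 X. \<tau> x = h x" by blast
  show ?case
  proof (cases "a = 0")
    case True
    then show ?thesis using \<tau> by (intro exI[of _ \<tau>]) auto
  next
    case False
    then have a: "a \<in> Q01" "0 < a" using insert.prems(1) by auto
    define s where "s = Max (h ` insert 0 X)"
    have Y: "finite (h ` insert 0 X)" "h ` insert 0 X \<noteq> {}" using insert.hyps by auto
    have le_s: "h x \<le> s" if "x \<in> insert 0 X" for x
      unfolding s_def using Y that by (intro Max_ge) auto
    obtain x0 where x0: "x0 \<in> insert 0 X" "s = h x0" using Max_in[OF Y] unfolding s_def by auto
    have x0a: "x0 < a" "x0 \<in> Q01" using x0 insert.hyps(2) insert.prems(1) a by auto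
    have sb: "s < h a"
      using insert.prems(3) x0 x0a(1) unfolding strict_mono_on_def by auto
    have sc: "s < \<tau> a"
    proof -
      have "\<tau> x0 < \<tau> a" using \<tau>(2) x0a a unfolding strict_mono_on_def by blast
      moreover have "\<tau> x0 = h x0" using \<tau>(3) x0(1) by blast
      ultimately show ?thesis using x0(2) by simp
    qed
    have s0: "0 \<le> s" using le_s[of 0] insert.prems(4) by simp
    have "\<tau> a < 1" "h a < 1" using bij_betwE[OF \<tau>(1)] a insert.prems(2) by auto
    from stretch_Q01[OF s0 sc sb this] obtain \<rho> where \<rho>:
      "bij_betw \<rho> Q01 Q01" "strict_mono_on Q01 \<rho>" "\<forall>x\<le>s. \<rho> x = x" "\<rho> (\<tau> a) = h a" by blast
    have "bij_betw (\<rho> \<circ> \<tau>) Q01 Q01" using bij_betw_trans[OF \<tau>(1) \<rho>(1)] .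
    moreover have "strict_mono_on Q01 (\<rho> \<circ> \<tau>)"
      using \<tau>(2) \<rho>(2) bij_betwE[OF \<tau>(1)] unfolding strict_mono_on_def by auto
    moreover have "\<forall>x\<in>insert 0 (insert a X). (\<rho> \<circ> \<tau>) x = h x"
      using \<rho>(3,4) \<tau>(3) le_s by auto
    ultimately show ?thesis by blast
  qed
qed

text \<open>The \<open>n\<close> sheets laid end to end form a circle of circumference
  \<open>n\<close>. In the other direction \<open>at_position n\<close> wraps the rational line
  around it.\<close>

definition position :: "rat \<times> nat \<Rightarrow> rat" where
  "position p = fst p + of_nat (snd p)"

definition at_position :: "nat \<Rightarrow> rat \<Rightarrow> rat \<times> nat" where
  "at_position n x = (let y = x - of_nat n * of_int \<lfloor>x / of_nat n\<rfloor> in (frac y, nat \<lfloor>y\<rfloor>))"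

lemma at_position_mem:
  assumes "n > 0"
  shows "at_position n x \<in> Q01 \<times> {..<n}"
    and "position (at_position n x) = x - of_nat n * of_int \<lfloor>x / of_nat n\<rfloor>"
proof -
  define y where "y = x - of_nat n * of_int \<lfloor>x / of_nat n\<rfloor>"
  have fl: "of_int \<lfloor>x / of_nat n\<rfloor> \<le> x / of_nat n" "x / of_nat n < of_int \<lfloor>x / of_nat n\<rfloor> + 1" by linarith+
  have "of_nat n * of_int \<lfloor>x / of_nat n\<rfloor> \<le> of_nat n * (x / of_nat n)"
    by (rule mult_left_mono[OF fl(1)]) simp
  moreover have "of_nat n * (x / of_nat n) < of_nat n * (of_int \<lfloor>x / of_nat n\<rfloor> + 1)"
    by (rule mult_strict_left_mono[OF fl(2)]) (use assms in simp)
  ultimately have "of_nat n * of_int \<lfloor>x / of_nat n\<rfloor> \<le> x" "x < of_nat n * (of_int \<lfloor>x / of_nat n\<rfloor> + 1)"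
    using assms by simp_all
  then have y: "0 \<le> y" "y < of_nat n" unfolding y_def by (simp_all add: algebra_simps)
  then have fl: "0 \<le> \<lfloor>y\<rfloor>" "\<lfloor>y\<rfloor> < int n" by (simp_all add: floor_less_iff)
  have at: "at_position n x = (frac y, nat \<lfloor>y\<rfloor>)" unfolding at_position_def y_def by (simp add: Let_def)
  show "at_position n x \<in> Q01 \<times> {..<n}"
    unfolding at using fl frac_lt_1[of y] by (auto simp: nat_less_iff)
  show "position (at_position n x) = x - of_nat n * of_int \<lfloor>x / of_nat n\<rfloor>"
    unfolding at position_def using fl by (simp add: frac_def flip: y_def)
qed

lemma at_position_position:
  assumes "n > 0" "p \<in> Q01 \<times> {..<n}"
  shows "at_position n (position p + of_nat n * of_int k) = p"
proof -
  obtain q l where p: "p = (q, l)" "0 \<le> q" "q < 1" "l < n" using assms(2) by auto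
  have "\<lfloor>(q + of_nat l) / of_nat n\<rfloor> = 0"
  proof -
    have "of_nat (Suc l) \<le> (of_nat n :: rat)" using p(4) by (simp only: of_nat_le_iff Suc_le_eq)
    then have "q + of_nat l < of_nat n" using p(3) by simp
    then show ?thesis using p assms(1) by (simp add: floor_eq_iff)
  qed
  moreover have "(q + of_nat l + of_nat n * of_int k) / of_nat n = (q + of_nat l) / of_nat n + of_int k"
    using assms(1) by (simp add: field_simps)
  ultimately have "\<lfloor>(q + of_nat l + of_nat n * of_int k) / of_nat n\<rfloor> = k" by simp
  moreover have "\<lfloor>q + of_nat l\<rfloor> = int l" using p by (simp add: floor_eq_iff)
  ultimately show ?thesis
    unfolding at_position_def position_def p(1) by (simp add: Let_def frac_def)
qed

text \<open>On this circle \<open>delta\<close> is the integral part of the distance, so it is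
  invariant under every rotation and not only under those by whole sheets.\<close>

lemma delta_position:
  assumes "p \<in> Q01 \<times> {..<n}" "p' \<in> Q01 \<times> {..<n}"
  shows "delta n (<) p p' = \<lfloor>position p' - position p\<rfloor> mod int n"
proof -
  have "\<lfloor>position p' - position p\<rfloor> = int (snd p') - int (snd p) - of_bool (fst p' < fst p)"
    using assms by (cases p; cases p') (auto simp: position_def floor_eq_iff)
  then show ?thesis unfolding delta_def by simp
qed

definition rotate_by :: "nat \<Rightarrow> rat \<Rightarrow> rat \<times> nat \<Rightarrow> rat \<times> nat" where
  "rotate_by n c p = at_position n (position p + c)"

lemma rotate_by_inverse:
  assumes "n > 0" "p \<in> Q01 \<times> {..<n}"
  shows "rotate_by n (- c) (rotate_by n c p) = p"
proof -
  have "position (rotate_by n c p) - c = position p + of_nat n * of_int (- \<lfloor>(position p + c) / of_nat n\<rfloor>)"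
    unfolding rotate_by_def at_position_mem(2)[OF assms(1)] by simp
  then show ?thesis
    using at_position_position[OF assms] unfolding rotate_by_def by (metis diff_conv_add_uminus)
qed

lemma cover_aut_rotate_by:
  assumes "n > 0"
  shows "cover_aut n Q01 (<) (rotate_by n c)"
proof -
  have mem: "rotate_by n c p \<in> Q01 \<times> {..<n}" for p c
    unfolding rotate_by_def by (rule at_position_mem(1)[OF assms])
  have "bij_betw (rotate_by n c) (Q01 \<times> {..<n}) (Q01 \<times> {..<n})"
    by (rule bij_betwI[where g = "rotate_by n (- c)"])
      (use mem rotate_by_inverse[OF assms, of _ c] rotate_by_inverse[OF assms, of _ "- c"] in \<open>auto simp del: mem_Sigma_iff\<close>)
  moreover have "delta n (<) (rotate_by n c p) (rotate_by n c p') = delta n (<) p p'"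
    if p: "p \<in> Q01 \<times> {..<n}" "p' \<in> Q01 \<times> {..<n}" for p p'
  proof -
    let ?k = "\<lfloor>(position p + c) / of_nat n\<rfloor> - \<lfloor>(position p' + c) / of_nat n\<rfloor>"
    have "position (rotate_by n c p') - position (rotate_by n c p) = (position p' - position p) + of_int (int n * ?k)"
      unfolding rotate_by_def at_position_mem(2)[OF assms] by (simp add: algebra_simps)
    then have "\<lfloor>position (rotate_by n c p') - position (rotate_by n c p)\<rfloor> = \<lfloor>position p' - position p\<rfloor> + int n * ?k"
      by (metis floor_add_int)
    then show ?thesis
      unfolding delta_position[OF p] delta_position[OF mem mem] by simp
  qed
  ultimately show ?thesis by (rule cover_autI)
qed

text \<open>Rotate both tuples until the entry with index \<open>i0\<close> is at the origin. Values
  of \<open>delta\<close> from the origin are levels, so the levels of the two tuples agree;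
  \<open>delta_less_iff\<close> then shows that the first coordinates are ordered alike. An order
  automorphism of \<open>Q01\<close> applied in every sheet matches them, and a rotation returns to
  the second tuple.\<close>

lemma finite_cover_homogeneous:
  assumes n: "n \<ge> 2" and I: "finite I" and u: "u ` I \<subseteq> Q01 \<times> {..<n}" and v: "v ` I \<subseteq> Q01 \<times> {..<n}"
    and uv: "\<And>i j. i \<in> I \<Longrightarrow> j \<in> I \<Longrightarrow> delta n (<) (u i) (u j) = delta n (<) (v i) (v j)"
  shows "\<exists>g. cover_aut n Q01 (<) g \<and> (\<forall>i\<in>I. g (u i) = v i)"
proof (cases "I = {}")
  case True
  then show ?thesis using cover_aut_rotate_by[of n 0] n by auto
next
  case False
  then obtain i0 where i0: "i0 \<in> I" by blast
  let ?W = "Q01 \<times> {..<n}"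
  have n0: "n > 0" using n by simp
  define ru where "ru = rotate_by n (- position (u i0))"
  define rv where "rv = rotate_by n (- position (v i0))"
  have ru: "cover_aut n Q01 (<) ru" and rv: "cover_aut n Q01 (<) rv"
    unfolding ru_def rv_def by (rule cover_aut_rotate_by[OF n0])+
  have uW: "u i \<in> ?W" "v i \<in> ?W" if "i \<in> I" for i using u v that by auto
  have rW: "ru (u i) \<in> ?W" "rv (v i) \<in> ?W" if "i \<in> I" for i
    by (rule cover_aut_mem[OF ru uW(1)[OF that]], rule cover_aut_mem[OF rv uW(2)[OF that]])
  have zero: "ru (u i0) = (0, 0)" "rv (v i0) = (0, 0)"
    using at_position_position[OF n0, of "(0, 0)" 0] n0 by (simp_all add: ru_def rv_def rotate_by_def position_def)
  have d: "delta n (<) (ru (u i)) (ru (u j)) = delta n (<) (rv (v i)) (rv (v j))" if "i \<in> I" "j \<in> I" for i j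
    by (simp only: cover_aut_delta[OF ru] cover_aut_delta[OF rv] uW that uv)
  have lev: "delta n (<) (0, 0) p = int (snd p)" if "p \<in> ?W" for p
    using that by (auto simp: delta_def)
  have snd: "snd (ru (u i)) = snd (rv (v i))" if "i \<in> I" for i
    using d[OF i0 that] lev[OF rW(1)[OF that]] lev[OF rW(2)[OF that]] zero by simp
  have less: "fst (ru (u i)) < fst (ru (u j)) \<longleftrightarrow> fst (rv (v i)) < fst (rv (v j))" if "i \<in> I" "j \<in> I" for i j
    by (rule delta_less_iff[OF n d[OF that(2,1)]]) (use snd that in simp)
  then have eq: "fst (ru (u i)) = fst (ru (u j)) \<longleftrightarrow> fst (rv (v i)) = fst (rv (v j))" if "i \<in> I" "j \<in> I" for i j
    using less[OF that] less[OF that(2,1)] by (metis linorder_less_linear less_irrefl)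
  \<comment> \<open>The image of \<open>x\<close> is read off an arbitrary index whose first
    coordinate is \<open>x\<close>; \<open>eq\<close> makes the choice immaterial.\<close>
  define h where "h = (\<lambda>x. fst (rv (v (SOME i. i \<in> I \<and> fst (ru (u i)) = x))))"
  have h: "h (fst (ru (u i))) = fst (rv (v i))" if "i \<in> I" for i
  proof -
    define j where "j = (SOME j. j \<in> I \<and> fst (ru (u j)) = fst (ru (u i)))"
    have "\<exists>j. j \<in> I \<and> fst (ru (u j)) = fst (ru (u i))" using that by blast
    then have "j \<in> I \<and> fst (ru (u j)) = fst (ru (u i))" unfolding j_def by (rule someI_ex)
    then have "fst (rv (v j)) = fst (rv (v i))" using eq[of j i] that by simp
    then show ?thesis unfolding h_def j_def .
  qed
  define X where "X = (\<lambda>i. fst (ru (u i))) ` I"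
  have X0: "0 \<in> X" unfolding X_def using i0 zero by force
  have "\<exists>\<tau>. bij_betw \<tau> Q01 Q01 \<and> strict_mono_on Q01 \<tau> \<and> (\<forall>x\<in>insert 0 X. \<tau> x = h x)"
  proof (rule finite_order_iso_extends)
    show "finite X" unfolding X_def using I by simp
    show "X \<subseteq> Q01" unfolding X_def using rW(1) by (auto simp: mem_Times_iff)
    show "h ` X \<subseteq> Q01" unfolding X_def using h rW(2) by (auto simp: mem_Times_iff)
    show "h 0 = 0" using h[OF i0] zero by simp
    show "strict_mono_on (insert 0 X) h"
      unfolding insert_absorb[OF X0] unfolding strict_mono_on_def X_def using h less by auto
  qed
  then obtain \<tau> where \<tau>: "bij_betw \<tau> Q01 Q01" "strict_mono_on Q01 \<tau>" "\<forall>x\<in>insert 0 X. \<tau> x = h x" by blast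
  have "cover_aut n Q01 (<) (map_prod \<tau> id)"
  proof -
    have "bij_betw (map_prod \<tau> id) ?W ?W"
      using \<tau>(1) bij_betw_map_prod[OF \<tau>(1), of id "{..<n}" "{..<n}"] by simp
    moreover have "\<tau> x < \<tau> y \<longleftrightarrow> x < y" if "x \<in> Q01" "y \<in> Q01" for x y
      using strict_mono_on_less[OF \<tau>(2) that] .
    then have "delta n (<) (map_prod \<tau> id p) (map_prod \<tau> id p') = delta n (<) p p'" if "p \<in> ?W" "p' \<in> ?W" for p p'
      using that unfolding delta_def by auto
    ultimately show ?thesis by (intro cover_autI) blast+
  qed
  note T = cover_aut_comp[OF this ru]
  let ?g = "rotate_by n (position (v i0)) \<circ> (map_prod \<tau> id \<circ> ru)"
  have "cover_aut n Q01 (<) ?g" by (rule cover_aut_comp[OF cover_aut_rotate_by[OF n0] T])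
  moreover have "?g (u i) = v i" if "i \<in> I" for i
  proof -
    have "map_prod \<tau> id (ru (u i)) = rv (v i)"
      using \<tau>(3) h[OF that] snd[OF that] that unfolding X_def by (simp add: prod_eq_iff)
    then show ?thesis
      using rotate_by_inverse[OF n0 uW(2)[OF that], of "- position (v i0)"] by (simp add: rv_def)
  qed
  ultimately show ?thesis by blast
qed

subsection \<open>Homogeneity in the ultrapower\<close>

lemma delta_ultra:
  "\<forall>\<^sub>F k in \<U>. delta n (lt k) (x k, i) (y k, j) = delta n (ultra_less lt) (x, i) (y, j)"
proof (cases "ultra_less lt y x")
  case True
  then have "\<forall>\<^sub>F k in \<U>. lt k (y k) (x k)" unfolding ultra_less_def .
  then show ?thesis by eventually_elim (simp add: delta_def True)
next
  case False
  then have "\<forall>\<^sub>F k in \<U>. \<not> lt k (y k) (x k)" unfolding ultra_less_def eventually_ultra_not .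
  then show ?thesis by eventually_elim (simp add: delta_def False)
qed

abbreviation HQ :: "(nat \<Rightarrow> rat) set" where "HQ \<equiv> ultraproduct (\<lambda>_. Q01)"
abbreviation hless :: "(nat \<Rightarrow> rat) \<Rightarrow> (nat \<Rightarrow> rat) \<Rightarrow> bool" where "hless \<equiv> ultra_less (\<lambda>_. (<))"

text \<open>The automorphisms below are internal: ultraproducts of automorphisms of the standard cover.\<close>

lemma cover_HQ_homogeneous:
  assumes n: "n \<ge> 2" and I: "countable I" and u: "u ` I \<subseteq> HQ \<times> {..<n}" and v: "v ` I \<subseteq> HQ \<times> {..<n}"
    and uv: "\<And>i j. i \<in> I \<Longrightarrow> j \<in> I \<Longrightarrow> delta n hless (u i) (u j) = delta n hless (v i) (v j)"
  shows "\<exists>g. cover_aut n HQ hless g \<and> (\<forall>i\<in>I. g (u i) = v i)"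
proof (cases "I = {}")
  case True
  have "cover_aut n HQ hless id" by (rule cover_autI) auto
  then show ?thesis using True by blast
next
  case False
  let ?W = "Q01 \<times> {..<n}" and ?H = "HQ \<times> {..<n}"
  define e where "e = from_nat_into I"
  have e: "range e = I" unfolding e_def by (rule range_from_nat_into[OF False I])
  have eI: "e i \<in> I" for i using e by blast
  have ueH: "u (e i) \<in> ?H" "v (e i) \<in> ?H" for i using u v eI[of i] by auto
  \<comment> \<open>The level does not vary with \<open>k\<close>: a sequence of levels below
    \<open>n\<close> is almost everywhere constant, as the proof of \<open>ev_surj\<close>
    shows.\<close>
  define ev where "ev = (\<lambda>k (p :: (nat \<Rightarrow> rat) \<times> nat). (fst p k, snd p))"
  have evW: "\<forall>\<^sub>F k in \<U>. ev k p \<in> ?W" if "p \<in> ?H" for p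
  proof -
    have "fst p \<in> HQ" "snd p < n" using that by auto
    from ultraproduct_ev[OF this(1)] show ?thesis
      by eventually_elim (use \<open>snd p < n\<close> in \<open>simp add: ev_def\<close>)
  qed
  have ev_inj: "p = p'" if "p \<in> ?H" "p' \<in> ?H" "\<forall>\<^sub>F k in \<U>. ev k p = ev k p'" for p p'
  proof -
    have "\<forall>\<^sub>F k in \<U>. fst p k = fst p' k" using that(3) by eventually_elim (simp add: ev_def)
    moreover have "\<forall>\<^sub>F k in \<U>. snd p = snd p'" using that(3) by eventually_elim (simp add: ev_def)
    ultimately show ?thesis using ultraproduct_eqI[of "fst p" _ "fst p'"] that(1,2) by (auto simp: prod_eq_iff)
  qed
  have ev_delta: "\<forall>\<^sub>F k in \<U>. delta n (<) (ev k p) (ev k p') = delta n hless p p'" for p p'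
    using delta_ultra[of n "\<lambda>_. (<)" "fst p" "snd p" "fst p'" "snd p'"] by (simp add: ev_def)
  have ev_surj: "\<exists>p\<in>?H. \<forall>\<^sub>F k in \<U>. ev k p = w k" if "\<forall>\<^sub>F k in \<U>. w k \<in> ?W" for w
  proof -
    have "\<forall>\<^sub>F k in \<U>. \<exists>l\<in>{..<n}. snd (w k) = l" using that by eventually_elim (auto simp: mem_Times_iff)
    from eventually_ultra_finite_ex[OF _ this] obtain l where l: "l < n" "\<forall>\<^sub>F k in \<U>. snd (w k) = l" by auto
    have "rep (\<lambda>k. fst (w k)) \<in> HQ"
      by (rule rep_in_ultraproduct) (use that in \<open>eventually_elim, auto simp: mem_Times_iff\<close>)
    moreover have "\<forall>\<^sub>F k in \<U>. ev k (rep (\<lambda>k. fst (w k)), l) = w k"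
      using l(2) rep_eq[of "\<lambda>k. fst (w k)"] by eventually_elim (auto simp: ev_def)
    ultimately show ?thesis using l(1) by (intro bexI[of _ "(rep (\<lambda>k. fst (w k)), l)"]) auto
  qed
  define Q where "Q = (\<lambda>i k g. cover_aut n Q01 (<) g \<and> g (ev k (u (e i))) = ev k (v (e i)))"
  have "\<exists>g. \<forall>i. \<forall>\<^sub>F k in \<U>. Q i k (g k)"
  proof (rule ultra_diagonal)
    fix m
    have "\<forall>\<^sub>F k in \<U>. \<forall>i\<in>{..m}. ev k (u (e i)) \<in> ?W \<and> ev k (v (e i)) \<in> ?W"
      by (rule eventually_ball_finite) (use evW ueH in \<open>auto simp: eventually_conj_iff simp del: mem_Sigma_iff\<close>)
    moreover have "\<forall>\<^sub>F k in \<U>. \<forall>p\<in>{..m} \<times> {..m}.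
        delta n (<) (ev k (u (e (fst p)))) (ev k (u (e (snd p)))) = delta n (<) (ev k (v (e (fst p)))) (ev k (v (e (snd p))))"
    proof (rule eventually_ball_finite)
      show "\<forall>p\<in>{..m} \<times> {..m}. \<forall>\<^sub>F k in \<U>.
        delta n (<) (ev k (u (e (fst p)))) (ev k (u (e (snd p)))) = delta n (<) (ev k (v (e (fst p)))) (ev k (v (e (snd p))))"
      proof
        fix p
        show "\<forall>\<^sub>F k in \<U>. delta n (<) (ev k (u (e (fst p)))) (ev k (u (e (snd p)))) =
          delta n (<) (ev k (v (e (fst p)))) (ev k (v (e (snd p))))"
          using ev_delta[of "u (e (fst p))" "u (e (snd p))"] ev_delta[of "v (e (fst p))" "v (e (snd p))"]
          by eventually_elim (simp add: uv[OF eI eI])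
      qed
    qed simp
    ultimately show "\<forall>\<^sub>F k in \<U>. \<exists>g. \<forall>i\<le>m. Q i k g"
    proof eventually_elim
      case (elim k)
      have "\<exists>g. cover_aut n Q01 (<) g \<and> (\<forall>i\<in>{..m}. g (ev k (u (e i))) = ev k (v (e i)))"
      proof (rule finite_cover_homogeneous[OF n])
        show "(\<lambda>i. ev k (u (e i))) ` {..m} \<subseteq> ?W" "(\<lambda>i. ev k (v (e i))) ` {..m} \<subseteq> ?W"
          unfolding image_subset_iff using elim(1) by blast+
        show "delta n (<) (ev k (u (e i))) (ev k (u (e j))) = delta n (<) (ev k (v (e i))) (ev k (v (e j)))"
          if "i \<in> {..m}" "j \<in> {..m}" for i j
          using bspec[OF elim(2), of "(i, j)"] that by simp
      qed simp
      then show ?case unfolding Q_def by auto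
    qed
  qed
  then obtain g where g: "\<And>i. \<forall>\<^sub>F k in \<U>. Q i k (g k)" by blast
  have aut: "\<forall>\<^sub>F k in \<U>. cover_aut n Q01 (<) (g k)" using g[of 0] by eventually_elim (simp add: Q_def)
  \<comment> \<open>The ultraproduct of the maps \<open>g k\<close>. Bijectivity and invariance of
    \<open>delta\<close> hold in almost all coordinates and descend to it.\<close>
  define \<sigma> where "\<sigma> = (\<lambda>p. SOME q. q \<in> ?H \<and> (\<forall>\<^sub>F k in \<U>. ev k q = g k (ev k p)))"
  have \<sigma>: "\<sigma> p \<in> ?H" "\<forall>\<^sub>F k in \<U>. ev k (\<sigma> p) = g k (ev k p)" if "p \<in> ?H" for p
  proof -
    have "\<forall>\<^sub>F k in \<U>. g k (ev k p) \<in> ?W"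
      using aut evW[OF that] by eventually_elim (rule cover_aut_mem)
    from ev_surj[OF this] have "\<exists>q. q \<in> ?H \<and> (\<forall>\<^sub>F k in \<U>. ev k q = g k (ev k p))" by blast
    from someI_ex[OF this] show "\<sigma> p \<in> ?H" "\<forall>\<^sub>F k in \<U>. ev k (\<sigma> p) = g k (ev k p)"
      unfolding \<sigma>_def by blast+
  qed
  have "cover_aut n HQ hless \<sigma>"
  proof (rule cover_autI)
    show "bij_betw \<sigma> ?H ?H"
    proof (rule bij_betw_imageI)
      show "inj_on \<sigma> ?H"
      proof (rule inj_onI)
        fix p p' assume p: "p \<in> ?H" "p' \<in> ?H" "\<sigma> p = \<sigma> p'"
        have "\<forall>\<^sub>F k in \<U>. ev k p = ev k p'"
          using aut \<sigma>(2)[OF p(1)] \<sigma>(2)[OF p(2)] evW[OF p(1)] evW[OF p(2)]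
        proof eventually_elim
          case (elim k)
          then have "g k (ev k p) = g k (ev k p')" using p(3) by simp
          then show ?case
            by (rule inj_onD[OF bij_betw_imp_inj_on[OF cover_aut_bij[OF elim(1)]] _ elim(4) elim(5)])
        qed
        then show "p = p'" by (rule ev_inj[OF p(1,2)])
      qed
      show "\<sigma> ` ?H = ?H"
      proof (intro equalityI subsetI)
        fix q assume q: "q \<in> ?H"
        have "\<forall>\<^sub>F k in \<U>. \<exists>w. w \<in> ?W \<and> g k w = ev k q"
          using aut evW[OF q]
        proof eventually_elim
          case (elim k)
          then have "ev k q \<in> g k ` ?W" using bij_betw_imp_surj_on[OF cover_aut_bij[OF elim(1)]] by simp
          then obtain w where "ev k q = g k w" "w \<in> ?W" by (rule imageE)
          then show ?case by metis
        qed
        then obtain w where w: "\<forall>\<^sub>F k in \<U>. w k \<in> ?W \<and> g k (w k) = ev k q"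
          unfolding eventually_ultra_ex by blast
        then have "\<forall>\<^sub>F k in \<U>. w k \<in> ?W" by eventually_elim blast
        from ev_surj[OF this] obtain p where p: "p \<in> ?H" "\<forall>\<^sub>F k in \<U>. ev k p = w k" by blast
        have "\<forall>\<^sub>F k in \<U>. ev k (\<sigma> p) = ev k q"
          using w p(2) \<sigma>(2)[OF p(1)] by eventually_elim simp
        then have "\<sigma> p = q" by (rule ev_inj[OF \<sigma>(1)[OF p(1)] q])
        then show "q \<in> \<sigma> ` ?H" using p(1) by blast
      qed (use \<sigma>(1) in blast)
    qed
    fix p p' assume p: "p \<in> ?H" "p' \<in> ?H"
    have "\<forall>\<^sub>F k::nat in \<U>. delta n hless (\<sigma> p) (\<sigma> p') = delta n hless p p'"
      using aut evW[OF p(1)] evW[OF p(2)] \<sigma>(2)[OF p(1)] \<sigma>(2)[OF p(2)] ev_delta[of p p'] ev_delta[of "\<sigma> p" "\<sigma> p'"]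
    proof eventually_elim
      case (elim k)
      then show ?case using cover_aut_delta[OF elim(1,2,3)] by simp
    qed
    then show "delta n hless (\<sigma> p) (\<sigma> p') = delta n hless p p'" by simp
  qed
  moreover have "\<sigma> (u (e i)) = v (e i)" for i
  proof (rule ev_inj[OF \<sigma>(1)[OF ueH(1)] ueH(2)])
    show "\<forall>\<^sub>F k in \<U>. ev k (\<sigma> (u (e i))) = ev k (v (e i))"
      using g[of i] \<sigma>(2)[OF ueH(1)[of i]] by eventually_elim (simp add: Q_def)
  qed
  ultimately show ?thesis unfolding e[symmetric] by blast
qed

subsection \<open>Replacing points by blocks\<close>

definition lex_less :: "('k \<Rightarrow> 'k \<Rightarrow> bool) \<Rightarrow> 'k \<times> int \<Rightarrow> 'k \<times> int \<Rightarrow> bool" where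
  "lex_less lt x y \<longleftrightarrow> lt (fst x) (fst y) \<or> fst x = fst y \<and> snd x < snd y"

definition base :: "('k \<times> int) \<times> nat \<Rightarrow> 'k \<times> nat" where
  "base u = (fst (fst u), snd u)"

definition offset :: "('k \<times> int) \<times> nat \<Rightarrow> int" where
  "offset u = snd (fst u)"

lemma delta_lex_less:
  assumes "linear_strict K lt" "fst (base u) \<in> K" "fst (base v) \<in> K"
  shows "delta n (lex_less lt) u v =
    (delta n lt (base u) (base v) - of_bool (fst (base u) = fst (base v) \<and> offset v < offset u)) mod int n"
proof -
  have "\<not> lt x x" if "x \<in> K" for x using assms(1) that unfolding linear_strict_def by blast
  then have "(of_bool (lex_less lt (fst v) (fst u)) :: int) = of_bool (lt (fst (base v)) (fst (base u))) +
      of_bool (fst (base u) = fst (base v) \<and> offset v < offset u)"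
    using assms(2,3) unfolding lex_less_def base_def offset_def by auto
  then show ?thesis unfolding delta_def by (simp add: base_def mod_diff_left_eq algebra_simps)
qed

lemma linear_strict_lex_less:
  assumes "linear_strict K lt"
  shows "linear_strict (K \<times> J) (lex_less lt)"
proof -
  have irr: "\<not> lt x x" if "x \<in> K" for x
    using assms that unfolding linear_strict_def by blast
  have tr: "lt x z" if "x \<in> K" "y \<in> K" "z \<in> K" "lt x y" "lt y z" for x y z
    using assms that unfolding linear_strict_def by blast
  have tot: "x = y \<or> lt x y \<or> lt y x" if "x \<in> K" "y \<in> K" for x y
    using assms that unfolding linear_strict_def by blast
  show ?thesis unfolding linear_strict_def
  proof (intro conjI ballI impI)
    fix x assume "x \<in> K \<times> J"
    then show "\<not> lex_less lt x x" using irr by (auto simp: lex_less_def)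
  next
    fix x y z assume "x \<in> K \<times> J" "y \<in> K \<times> J" "z \<in> K \<times> J" "lex_less lt x y" "lex_less lt y z"
    then show "lex_less lt x z" using tr[of "fst x" "fst y" "fst z"] unfolding lex_less_def by (auto simp: mem_Times_iff)
  next
    fix x y assume "x \<in> K \<times> J" "y \<in> K \<times> J"
    then show "x = y \<or> lex_less lt x y \<or> lex_less lt y x"
      using tot[of "fst x" "fst y"] unfolding lex_less_def by (auto simp: mem_Times_iff prod_eq_iff)
  qed
qed

text \<open>The base points are moved by an automorphism of the cover of \<open>HQ\<close>, and each
  block is in addition shifted by a constant. The shift is prescribed where the block meets the
  tuple and is zero elsewhere; it depends on the block alone and is the same in all sheets. The
  hypothesis on offsets makes it well defined.\<close>

theorem cover_blocks_homogeneous: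
  assumes n: "n \<ge> 2" and I: "countable I" and J: "J = {0} \<or> J = (UNIV :: int set)"
    and u: "u ` I \<subseteq> (HQ \<times> J) \<times> {..<n}" and v: "v ` I \<subseteq> (HQ \<times> J) \<times> {..<n}"
    and uv: "\<And>i j. i \<in> I \<Longrightarrow> j \<in> I \<Longrightarrow>
      delta n hless (base (u i)) (base (u j)) = delta n hless (base (v i)) (base (v j))"
    and off: "\<And>i j. i \<in> I \<Longrightarrow> j \<in> I \<Longrightarrow> fst (base (u i)) = fst (base (u j)) \<Longrightarrow>
      offset (u j) - offset (u i) = offset (v j) - offset (v i)"
  shows "\<exists>g. cover_aut n (HQ \<times> J) (lex_less hless) g \<and> (\<forall>i\<in>I. g (u i) = v i)"
proof -
  let ?H = "HQ \<times> {..<n}" and ?B = "(HQ \<times> J) \<times> {..<n}"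
  have lin: "linear_strict HQ hless"
    by (rule linear_strict_ultra) (use dense_min_Q01 in \<open>simp add: dense_min_def\<close>)
  have base: "base p \<in> ?H" if "p \<in> ?B" for p using that by (auto simp: base_def)
  have "\<exists>\<sigma>. cover_aut n HQ hless \<sigma> \<and> (\<forall>i\<in>I. \<sigma> (base (u i)) = base (v i))"
  proof (rule cover_HQ_homogeneous[OF n I])
    show "(\<lambda>i. base (u i)) ` I \<subseteq> ?H" "(\<lambda>i. base (v i)) ` I \<subseteq> ?H"
      using u v base by (meson image_subset_iff)+
  qed (rule uv)
  then obtain \<sigma> where \<sigma>: "cover_aut n HQ hless \<sigma>" and \<sigma>u: "\<And>i. i \<in> I \<Longrightarrow> \<sigma> (base (u i)) = base (v i)" by blast
  define t where "t = (\<lambda>q. if \<exists>i\<in>I. fst (base (u i)) = q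
    then (let i = (SOME i. i \<in> I \<and> fst (base (u i)) = q) in offset (v i) - offset (u i)) else 0)"
  have t: "t (fst (base (u i))) = offset (v i) - offset (u i)" if "i \<in> I" for i
  proof -
    define j where "j = (SOME j. j \<in> I \<and> fst (base (u j)) = fst (base (u i)))"
    have "\<exists>j. j \<in> I \<and> fst (base (u j)) = fst (base (u i))" using that by blast
    then have "j \<in> I \<and> fst (base (u j)) = fst (base (u i))" unfolding j_def by (rule someI_ex)
    then have "offset (v j) - offset (u j) = offset (v i) - offset (u i)"
      using off[of j i] that by simp
    moreover have "t (fst (base (u i))) = offset (v j) - offset (u j)"
      unfolding t_def j_def using that by (auto simp: Let_def)
    ultimately show ?thesis by simp
  qed
  \<comment> \<open>If \<open>J = {0}\<close>, all offsets are zero and hence all shifts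
    vanish.\<close>
  have tJ: "z + t q \<in> J" "z - t q \<in> J" if "z \<in> J" for z q
  proof -
    have "t q = 0" if "J = {0}"
    proof (cases "\<exists>i\<in>I. fst (base (u i)) = q")
      case True
      then obtain i where i: "i \<in> I" "q = fst (base (u i))" by blast
      have "offset (u i) = 0" "offset (v i) = 0" using u v i(1) that by (auto simp: offset_def image_subset_iff mem_Times_iff)
      then show ?thesis using t[OF i(1)] i(2) by simp
    qed (simp add: t_def)
    then show "z + t q \<in> J" "z - t q \<in> J" using J that by auto
  qed
  define g where "g = (\<lambda>p. ((fst (\<sigma> (base p)), offset p + t (fst (base p))), snd (\<sigma> (base p))))"
  have base_g: "base (g p) = \<sigma> (base p)" and off_g: "offset (g p) = offset p + t (fst (base p))" for p
    by (simp_all add: g_def base_def offset_def)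
  have gB: "g p \<in> ?B" if "p \<in> ?B" for p
    using cover_aut_mem[OF \<sigma> base[OF that]] tJ(1)[of "offset p"] that
    by (auto simp: g_def mem_Times_iff offset_def)
  have eqI: "p = q" if "base p = base q" "offset p = offset q" for p q :: "((nat \<Rightarrow> rat) \<times> int) \<times> nat"
    using that by (auto simp: base_def offset_def prod_eq_iff)
  \<comment> \<open>Lying in one block is expressible by \<open>delta\<close>, hence preserved by
    \<open>\<sigma>\<close>; otherwise the comparison of offsets could apply on one side
    only.\<close>
  have fst_iff: "fst (\<sigma> p) = fst (\<sigma> q) \<longleftrightarrow> fst p = fst q" if "p \<in> ?H" "q \<in> ?H" for p q
    using that cover_aut_mem[OF \<sigma> that(1)] cover_aut_mem[OF \<sigma> that(2)]
      delta_fst_eq_iff[OF lin n, of p q] delta_fst_eq_iff[OF lin n, of "\<sigma> p" "\<sigma> q"]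
      cover_aut_delta[OF \<sigma> that] cover_aut_delta[OF \<sigma> that(2,1)]
    by (simp add: mem_Times_iff)
  have "cover_aut n (HQ \<times> J) (lex_less hless) g"
  proof (rule cover_autI)
    show "bij_betw g ?B ?B"
    proof (rule bij_betw_imageI)
      show "inj_on g ?B"
      proof (rule inj_onI)
        fix p q assume p: "p \<in> ?B" "q \<in> ?B" "g p = g q"
        have "\<sigma> (base p) = \<sigma> (base q)" using base_g[of p] base_g[of q] p(3) by simp
        then have b: "base p = base q"
          by (rule inj_onD[OF bij_betw_imp_inj_on[OF cover_aut_bij[OF \<sigma>]] _ base[OF p(1)] base[OF p(2)]])
        then show "p = q" using off_g[of p] off_g[of q] p(3) by (intro eqI) auto
      qed
      show "g ` ?B = ?B"
      proof (intro equalityI subsetI)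
        fix q assume q: "q \<in> ?B"
        have "base q \<in> \<sigma> ` ?H"
          unfolding bij_betw_imp_surj_on[OF cover_aut_bij[OF \<sigma>]] by (rule base[OF q])
        then obtain p0 where p0: "p0 \<in> ?H" "\<sigma> p0 = base q" by auto
        let ?p = "((fst p0, offset q - t (fst p0)), snd p0)"
        have "?p \<in> ?B" using p0(1) tJ(2)[of "offset q"] q by (auto simp: offset_def mem_Times_iff)
        moreover have "g ?p = q"
          by (rule eqI) (use p0 in \<open>simp_all add: base_g off_g\<close>, simp_all add: base_def offset_def)
        ultimately show "q \<in> g ` ?B" by (intro image_eqI[of q g ?p]) simp_all
      qed (use gB in blast)
    qed
    fix p q assume p: "p \<in> ?B" and q: "q \<in> ?B"
    have m: "fst (base p) \<in> HQ" "fst (base q) \<in> HQ" "fst (base (g p)) \<in> HQ" "fst (base (g q)) \<in> HQ"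
      using base[OF p] base[OF q] base[OF gB[OF p]] base[OF gB[OF q]] by (simp_all add: mem_Times_iff)
    show "delta n (lex_less hless) (g p) (g q) = delta n (lex_less hless) p q"
      unfolding delta_lex_less[OF lin m(1,2)] delta_lex_less[OF lin m(3,4)] base_g off_g
        cover_aut_delta[OF \<sigma> base[OF p] base[OF q]] fst_iff[OF base[OF p] base[OF q]]
      by (cases "fst (base p) = fst (base q)") simp_all
  qed
  moreover have "g (u i) = v i" if "i \<in> I" for i
    by (rule eqI) (use \<sigma>u[OF that] t[OF that] in \<open>simp_all add: base_g off_g\<close>)
  ultimately show ?thesis by blast
qed

section \<open>The theory of all the covers\<close>

definition sg :: "nat \<Rightarrow> 'a::infinite" where
  "sg = (SOME f. inj f)"

lemma inj_sg: "inj (sg :: nat \<Rightarrow> 'a::infinite)"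
proof -
  have "\<exists>f :: nat \<Rightarrow> 'a. inj f"
    using infinite_countable_subset[OF infinite_UNIV] by blast
  then show ?thesis unfolding sg_def by (rule someI_ex)
qed

lemma sg_eq_iff [simp]: "(sg m :: 'a::infinite) = sg n \<longleftrightarrow> m = n"
  using inj_sg by (auto dest: injD)

lemma inv_sg [simp]: "inv (sg :: nat \<Rightarrow> 'a::infinite) (sg n) = n"
  by (rule inv_f_f[OF inj_sg])

definition rl :: "nat \<Rightarrow> nat \<Rightarrow> 'r::infinite" where
  "rl n j = sg (prod_encode (n, j))"

text \<open>Sort \<open>sg n\<close> carries a cover of degree \<open>n + 2\<close>, and \<open>rl n j\<close> is the relation
  \<open>delta (n + 2) _ u v = j\<close> on it.\<close>

definition osig :: "('s::infinite, 'f, 'r::infinite) signature" where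
  "osig = \<lparr>Sorts = range sg, Funs = {}, Rels = range (\<lambda>(n, j). rl n j), fdom = (\<lambda>_. []), fcod = (\<lambda>_. sg 0),
    rdom = (\<lambda>r. let s = sg (fst (prod_decode (inv sg r))) in [s, s])\<rparr>"

lemma osig_simps [simp]:
  "Sorts osig = range sg" "Funs osig = {}" "Rels osig = range (\<lambda>(n, j). rl n j)"
  "rdom osig (rl n j) = [sg n, sg n]"
  by (simp_all add: osig_def rl_def Let_def)

lemma wf_osig: "wf_signature osig"
  by (auto simp: wf_signature_def)

lemma wf_tm_osig: "wf_tm osig t \<longleftrightarrow> (\<exists>n k. t = Var (sg n, k))"
  by (cases t) auto

lemma wf_Rel_osig:
  fixes ts :: "('s::infinite, 'f) tm list" and r :: "'r::infinite"
  shows "wf_fm osig (Rel r ts) \<longleftrightarrow> (\<exists>n j k l. r = rl n j \<and> ts = [Var (sg n, k), Var (sg n, l)])"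
proof
  assume "wf_fm osig (Rel r ts)"
  then have "r \<in> range (\<lambda>(n, j). rl n j)"
    and ts: "map (sort_of (osig :: ('s, 'f, 'r) signature)) ts = rdom (osig :: ('s, 'f, 'r) signature) r"
      "\<forall>t\<in>set ts. wf_tm (osig :: ('s, 'f, 'r) signature) t"
    unfolding wf_fm.simps osig_simps(3) by blast+
  then obtain n j where r: "r = rl n j" by auto
  with ts have ts: "map (sort_of (osig :: ('s, 'f, 'r) signature)) ts = [sg n, sg n]"
    "\<forall>t\<in>set ts. wf_tm (osig :: ('s, 'f, 'r) signature) t" by simp_all
  then obtain t u where "ts = [t, u]" by (auto simp: map_eq_Cons_conv)
  then show "\<exists>n j k l. r = rl n j \<and> ts = [Var (sg n, k), Var (sg n, l)]"
    using r ts by (auto simp: wf_tm_osig)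
qed (auto simp: wf_tm_osig)

lemma tuples_pair: "xs \<in> tuples M [s, t] \<longleftrightarrow> (\<exists>a\<in>carr M s. \<exists>b\<in>carr M t. xs = [a, b])"
  unfolding tuples_def by (auto simp: list_all2_Cons2)

instance tm :: (countable, countable) countable by countable_datatype

instance fm :: (countable, countable, countable) countable by countable_datatype

text \<open>The symbol types may be huge, but only countably many symbols are selected: every
  well-formed formula is the image of one over the symbol types \<open>nat\<close>,
  \<open>unit\<close> and \<open>nat\<close>.\<close>

lemma countable_wf_osig: "countable {\<phi> :: ('s::infinite, 'f, 'r::infinite) fm. wf_fm osig \<phi>}"
proof -
  let ?m = "map_fm sg (\<lambda>_::unit. undefined) sg :: (nat, unit, nat) fm \<Rightarrow> ('s, 'f, 'r) fm"
  have "wf_fm osig \<phi> \<Longrightarrow> \<phi> \<in> range ?m" for \<phi> :: "('s, 'f, 'r) fm"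
  proof (induction \<phi>)
    case (Eq t u)
    then obtain n k m l where "t = Var (sg n, k)" "u = Var (sg m, l)" by (auto simp: wf_tm_osig)
    then have "Eq t u = ?m (Eq (Var (n, k)) (Var (m, l)))" by simp
    then show ?case by blast
  next
    case (Rel r ts)
    then obtain n j k l where "r = rl n j" "ts = [Var (sg n, k), Var (sg n, l)]"
      unfolding wf_Rel_osig by blast
    then have "Rel r ts = ?m (Rel (prod_encode (n, j)) [Var (n, k), Var (n, l)])" by (simp add: rl_def)
    then show ?case by blast
  next
    case (Neg \<phi>)
    then obtain \<psi> where "\<phi> = ?m \<psi>" by auto
    then have "Neg \<phi> = ?m (Neg \<psi>)" by simp
    then show ?case by blast
  next
    case (Conj \<phi>1 \<phi>2)
    then obtain \<psi>1 \<psi>2 where "\<phi>1 = ?m \<psi>1" "\<phi>2 = ?m \<psi>2" by auto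
    then have "Conj \<phi>1 \<phi>2 = ?m (Conj \<psi>1 \<psi>2)" by simp
    then show ?case by blast
  next
    case (Ex x \<phi>)
    then obtain \<psi> n k where "\<phi> = ?m \<psi>" "x = (sg n, k)" by (cases x) auto
    then have "Ex x \<phi> = ?m (Ex (n, k) \<psi>)" by simp
    then show ?case by blast
  qed
  then have "{\<phi> :: ('s, 'f, 'r) fm. wf_fm osig \<phi>} \<subseteq> range ?m" by blast
  then show ?thesis by (rule countable_subset) simp
qed

text \<open>Coordinates \<open>cd\<close> allow a structure on any carrier, in particular a
  quotient, to be treated as a system of covers of \<open>K\<close>.\<close>

definition cover_model ::
  "('s::infinite, 'f, 'r::infinite, 'a) struct \<Rightarrow> ('s \<Rightarrow> 'a \<Rightarrow> 'k \<times> nat) \<Rightarrow> 'k set \<Rightarrow> ('k \<Rightarrow> 'k \<Rightarrow> bool) \<Rightarrow> bool" where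
  "cover_model A cd K lt \<longleftrightarrow> K \<noteq> {} \<and>
     (\<forall>n. bij_betw (cd (sg n)) (carr A (sg n)) (K \<times> {..<n + 2}) \<and>
       (\<forall>j. \<forall>u\<in>carr A (sg n). \<forall>v\<in>carr A (sg n).
          rint A (rl n j) [u, v] \<longleftrightarrow> delta (n + 2) lt (cd (sg n) u) (cd (sg n) v) = int j))"

lemma cover_model_bij: "cover_model A cd K lt \<Longrightarrow> bij_betw (cd (sg n)) (carr A (sg n)) (K \<times> {..<n + 2})"
  unfolding cover_model_def by blast

lemma cover_model_mem: "cover_model A cd K lt \<Longrightarrow> a \<in> carr A (sg n) \<Longrightarrow> cd (sg n) a \<in> K \<times> {..<n + 2}"
  using cover_model_bij bij_betwE by blast

lemma cover_model_surj:
  assumes "cover_model A cd K lt" "p \<in> K \<times> {..<n + 2}"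
  shows "\<exists>a\<in>carr A (sg n). cd (sg n) a = p"
proof -
  have "p \<in> cd (sg n) ` carr A (sg n)" using bij_betw_imp_surj_on[OF cover_model_bij[OF assms(1)]] assms(2) by blast
  then show ?thesis by blast
qed

lemma cover_model_inj:
  assumes "cover_model A cd K lt" "a \<in> carr A (sg n)" "b \<in> carr A (sg n)" "cd (sg n) a = cd (sg n) b"
  shows "a = b"
  by (rule inj_onD[OF bij_betw_imp_inj_on[OF cover_model_bij[OF assms(1)]] assms(4,2,3)])

lemma cover_model_rint:
  "cover_model A cd K lt \<Longrightarrow> u \<in> carr A (sg n) \<Longrightarrow> v \<in> carr A (sg n) \<Longrightarrow>
    rint A (rl n j) [u, v] \<longleftrightarrow> delta (n + 2) lt (cd (sg n) u) (cd (sg n) v) = int j"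
  unfolding cover_model_def by blast

lemma cover_model_structure:
  assumes "cover_model A cd K lt"
  shows "is_structure osig A"
proof -
  obtain x where "x \<in> K" using assms unfolding cover_model_def by blast
  then have "\<exists>a. a \<in> carr A (sg n)" for n using cover_model_surj[OF assms, of "(x, 0)" n] by auto
  then show ?thesis unfolding is_structure_def by auto
qed

lemma cover_model_isomorphism:
  assumes A: "cover_model A cdA K lt" and B: "cover_model B cdB K' lt'"
    and G: "\<And>n. bij_betw (G n) (K \<times> {..<n + 2}) (K' \<times> {..<n + 2})"
    and d: "\<And>n u v. u \<in> K \<times> {..<n + 2} \<Longrightarrow> v \<in> K \<times> {..<n + 2} \<Longrightarrow>
      delta (n + 2) lt' (G n u) (G n v) = delta (n + 2) lt u v"
  shows "\<exists>g. isomorphism osig A B g \<and> (\<forall>n. \<forall>a\<in>carr A (sg n). g (sg n) a \<in> carr B (sg n) \<and> cdB (sg n) (g (sg n) a) = G n (cdA (sg n) a))"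
proof -
  define g where "g = (\<lambda>s a. inv_into (carr B s) (cdB s) (G (inv sg s) (cdA s a)))"
  have bij: "bij_betw (g (sg n)) (carr A (sg n)) (carr B (sg n))" for n
    using bij_betw_trans[OF bij_betw_trans[OF cover_model_bij[OF A] G] bij_betw_inv_into[OF cover_model_bij[OF B]]]
    by (simp add: g_def comp_def)
  have cd: "cdB (sg n) (g (sg n) a) = G n (cdA (sg n) a)" if "a \<in> carr A (sg n)" for n a
  proof -
    have "G n (cdA (sg n) a) \<in> cdB (sg n) ` carr B (sg n)"
      unfolding bij_betw_imp_surj_on[OF cover_model_bij[OF B]]
      by (rule bij_betwE[OF G, rule_format, OF cover_model_mem[OF A that]])
    then show ?thesis unfolding g_def by (simp add: f_inv_into_f)
  qed
  have mem: "g (sg n) a \<in> carr B (sg n)" if "a \<in> carr A (sg n)" for n a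
    by (rule bij_betwE[OF bij, rule_format, OF that])
  have "rint A (rl n j) [a, b] \<longleftrightarrow> rint B (rl n j) [g (sg n) a, g (sg n) b]"
    if "a \<in> carr A (sg n)" "b \<in> carr A (sg n)" for n j a b
    unfolding cover_model_rint[OF A that] cover_model_rint[OF B mem[OF that(1)] mem[OF that(2)]]
      cd[OF that(1)] cd[OF that(2)] d[OF cover_model_mem[OF A that(1)] cover_model_mem[OF A that(2)]] ..
  then have "isomorphism osig A B g"
    unfolding isomorphism_def using bij by (auto simp: tuples_pair)
  then show ?thesis using cd mem by blast
qed

lemma Th_isomorphism:
  assumes "isomorphism L A B g" "is_structure L A" "is_structure L B" "wf_signature L"
  shows "Th L A = Th L B"
proof -
  obtain v where v: "is_valuation L A v" using ex_valuation[OF assms(2)] by blast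
  have "\<phi> \<in> Th L A \<longleftrightarrow> \<phi> \<in> Th L B" for \<phi>
    unfolding Th_iff[OF assms(2), of \<phi> v] Th_iff[OF assms(3), of \<phi> "\<lambda>x. g (fst x) (v x)"]
    using sat_isomorphism[OF assms(1,2,4), of \<phi> v "\<lambda>x. g (fst x) (v x)"] by (auto simp: sentences_def)
  then show ?thesis by blast
qed

subsection \<open>Back and forth\<close>

lemma eta_min_between:
  assumes "eta_min K lt" "A \<subseteq> K" "B \<subseteq> K" "countable A" "countable B" "A \<noteq> {}" "\<forall>a\<in>A. \<forall>b\<in>B. lt a b"
  shows "\<exists>x\<in>K. (\<forall>a\<in>A. lt a x) \<and> (\<forall>b\<in>B. lt x b)"
proof -
  have "\<forall>A\<subseteq>K. \<forall>B\<subseteq>K. countable A \<longrightarrow> countable B \<longrightarrow> A \<noteq> {} \<longrightarrow> (\<forall>a\<in>A. \<forall>b\<in>B. lt a b) \<longrightarrow>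
      (\<exists>x\<in>K. (\<forall>a\<in>A. lt a x) \<and> (\<forall>b\<in>B. lt x b))"
    using assms(1) unfolding eta_min_def by (elim conjE)
  then show ?thesis using assms(2-7) by simp
qed

definition least_of :: "'k set \<Rightarrow> ('k \<Rightarrow> 'k \<Rightarrow> bool) \<Rightarrow> 'k \<Rightarrow> bool" where
  "least_of K lt m \<longleftrightarrow> m \<in> K \<and> (\<forall>x\<in>K. x = m \<or> lt m x)"

lemma eta_min_linear: "eta_min K lt \<Longrightarrow> linear_strict K lt"
  by (simp add: eta_min_def)

lemma eta_min_least:
  assumes "eta_min K lt"
  shows "\<exists>m. least_of K lt m"
proof -
  have "\<exists>m\<in>K. \<forall>x\<in>K. x = m \<or> lt m x" using assms by (simp add: eta_min_def)
  then show ?thesis unfolding least_of_def by blast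
qed

text \<open>Containing the pair of least points guarantees that every further point has a point of
  the domain below it; the gap property in \<open>eta_min\<close> asks for a nonempty lower
  set.\<close>

definition partial_iso ::
  "'k set \<Rightarrow> ('k \<Rightarrow> 'k \<Rightarrow> bool) \<Rightarrow> 'l set \<Rightarrow> ('l \<Rightarrow> 'l \<Rightarrow> bool) \<Rightarrow> ('k \<times> 'l) set \<Rightarrow> bool" where
  "partial_iso K lt K' lt' P \<longleftrightarrow> countable P \<and> P \<subseteq> K \<times> K' \<and>
     (\<exists>m m'. (m, m') \<in> P \<and> least_of K lt m \<and> least_of K' lt' m') \<and>
     (\<forall>p\<in>P. \<forall>q\<in>P. (lt (fst p) (fst q) \<longleftrightarrow> lt' (snd p) (snd q)) \<and> (fst p = fst q \<longleftrightarrow> snd p = snd q))"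

lemma partial_isoD:
  assumes "partial_iso K lt K' lt' P"
  shows "countable P" "P \<subseteq> K \<times> K'" "\<exists>m m'. (m, m') \<in> P \<and> least_of K lt m \<and> least_of K' lt' m'"
    "p \<in> P \<Longrightarrow> q \<in> P \<Longrightarrow> (lt (fst p) (fst q) \<longleftrightarrow> lt' (snd p) (snd q)) \<and> (fst p = fst q \<longleftrightarrow> snd p = snd q)"
  using assms by (simp_all add: partial_iso_def)

lemma partial_isoI:
  assumes "countable P" "P \<subseteq> K \<times> K'" "(m, m') \<in> P" "least_of K lt m" "least_of K' lt' m'"
    "\<And>p q. p \<in> P \<Longrightarrow> q \<in> P \<Longrightarrow> (lt (fst p) (fst q) \<longleftrightarrow> lt' (snd p) (snd q)) \<and> (fst p = fst q \<longleftrightarrow> snd p = snd q)"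
  shows "partial_iso K lt K' lt' P"
  using assms unfolding partial_iso_def by blast

lemma partial_iso_converse: "partial_iso K lt K' lt' P \<Longrightarrow> partial_iso K' lt' K lt (P\<inverse>)"
proof -
  assume P: "partial_iso K lt K' lt' P"
  have "P\<inverse> = prod.swap ` P" by force
  then have "countable (P\<inverse>)" using P unfolding partial_iso_def by simp
  moreover have "\<forall>p\<in>P\<inverse>. \<forall>q\<in>P\<inverse>. (lt' (fst p) (fst q) \<longleftrightarrow> lt (snd p) (snd q)) \<and> (fst p = fst q \<longleftrightarrow> snd p = snd q)"
  proof (intro ballI)
    fix p q assume "p \<in> P\<inverse>" "q \<in> P\<inverse>"
    then have "(snd p, fst p) \<in> P" "(snd q, fst q) \<in> P" by auto
    then show "(lt' (fst p) (fst q) \<longleftrightarrow> lt (snd p) (snd q)) \<and> (fst p = fst q \<longleftrightarrow> snd p = snd q)"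
      using P unfolding partial_iso_def by fastforce
  qed
  ultimately show "partial_iso K' lt' K lt (P\<inverse>)" using P unfolding partial_iso_def by blast
qed

text \<open>The images of the points below and above \<open>x\<close> form a countable cut of
  \<open>K'\<close>, and \<open>eta_min\<close> provides a point in it.\<close>

lemma partial_iso_extend:
  assumes K: "linear_strict K lt" and K': "eta_min K' lt'" and P: "partial_iso K lt K' lt' P" and x: "x \<in> K"
  shows "\<exists>y. partial_iso K lt K' lt' (insert (x, y) P)"
proof (cases "\<exists>y. (x, y) \<in> P")
  case True
  then obtain y where "insert (x, y) P = P" by blast
  then show ?thesis using P by (intro exI[of _ y]) simp
next
  case False
  obtain m m' where m: "(m, m') \<in> P" "least_of K lt m" "least_of K' lt' m'" using partial_isoD(3)[OF P] by blast
  have tot: "lt a b \<or> lt b a" if "a \<in> K" "b \<in> K" "a \<noteq> b" for a b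
    using K that unfolding linear_strict_def by blast
  have asym: "\<not> (lt a b \<and> lt b a)" "\<not> lt a a" if "a \<in> K" "b \<in> K" for a b
    using K that unfolding linear_strict_def by blast+
  have tr: "lt a c" if "a \<in> K" "b \<in> K" "c \<in> K" "lt a b" "lt b c" for a b c
    using K that unfolding linear_strict_def by blast
  have lin': "linear_strict K' lt'" by (rule eta_min_linear[OF K'])
  have asym': "\<not> (lt' a b \<and> lt' b a)" "\<not> lt' a a" if "a \<in> K'" "b \<in> K'" for a b
    using lin' that unfolding linear_strict_def by blast+
  have PK: "a \<in> K" "b \<in> K'" if "(a, b) \<in> P" for a b using partial_isoD(2)[OF P] that by blast+
  have Piso: "lt a b \<longleftrightarrow> lt' a' b'" if "(a, a') \<in> P" "(b, b') \<in> P" for a b a' b'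
    using partial_isoD(4)[OF P that(1) that(2)] by simp
  let ?A = "snd ` {p \<in> P. lt (fst p) x}" and ?B = "snd ` {p \<in> P. lt x (fst p)}"
  have "x \<noteq> m" using m(1) False by blast
  then have "lt m x" using m(2) x unfolding least_of_def by blast
  then have "?A \<noteq> {}" using m by force
  moreover have "countable ?A" "countable ?B"
    using partial_isoD(1)[OF P] by (auto intro: countable_subset[of _ P])
  moreover have "?A \<subseteq> K'" "?B \<subseteq> K'" using PK by auto
  moreover have "\<forall>a\<in>?A. \<forall>b\<in>?B. lt' a b"
  proof (intro ballI)
    fix a' b' assume "a' \<in> ?A" "b' \<in> ?B"
    then obtain a b where "(a, a') \<in> P" "lt a x" "(b, b') \<in> P" "lt x b" by auto
    then show "lt' a' b'" using Piso tr[of a x b] PK x by blast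
  qed
  ultimately have "\<exists>y\<in>K'. (\<forall>a\<in>?A. lt' a y) \<and> (\<forall>b\<in>?B. lt' y b)"
    by (intro eta_min_between[OF K'])
  then obtain y where y: "y \<in> K'" "\<forall>a\<in>?A. lt' a y" "\<forall>b\<in>?B. lt' y b" by blast
  have cmp: "lt a x \<and> lt' a' y \<and> \<not> lt x a \<and> \<not> lt' y a' \<or> lt x a \<and> lt' y a' \<and> \<not> lt a x \<and> \<not> lt' a' y"
    if "(a, a') \<in> P" for a a'
  proof -
    have "a \<noteq> x" using that False by blast
    then have "lt a x \<or> lt x a" using tot[OF PK(1)[OF that] x] by blast
    then consider "lt a x" | "lt x a" by blast
    then show ?thesis
    proof cases
      case 1
      then have "a' \<in> ?A" using that by (intro image_eqI[of _ _ "(a, a')"]) auto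
      then have "lt' a' y" by (rule bspec[OF y(2)])
      then show ?thesis using 1 asym(1)[OF PK(1)[OF that] x] asym'(1)[OF PK(2)[OF that] y(1)] by simp
    next
      case 2
      then have "a' \<in> ?B" using that by (intro image_eqI[of _ _ "(a, a')"]) auto
      then have "lt' y a'" by (rule bspec[OF y(3)])
      then show ?thesis using 2 asym(1)[OF PK(1)[OF that] x] asym'(1)[OF PK(2)[OF that] y(1)] by simp
    qed
  qed
  have ne: "a \<noteq> x \<and> a' \<noteq> y" if "(a, a') \<in> P" for a a'
    using cmp[OF that] asym(2)[OF x x] asym'(2)[OF y(1) y(1)] by auto
  have "partial_iso K lt K' lt' (insert (x, y) P)"
  proof (rule partial_isoI[of _ K K' m m'])
    show "countable (insert (x, y) P)" using partial_isoD(1)[OF P] by simp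
    show "insert (x, y) P \<subseteq> K \<times> K'" using partial_isoD(2)[OF P] x y(1) by simp
    fix p q assume p: "p \<in> insert (x, y) P" and q: "q \<in> insert (x, y) P"
    obtain a a' b b' where pq: "p = (a, a')" "q = (b, b')" by fastforce
    consider "p \<in> P" "q \<in> P" | "p = (x, y)" "q \<in> P" | "p \<in> P" "q = (x, y)" | "p = (x, y)" "q = (x, y)"
      using p q by blast
    then have "(lt a b \<longleftrightarrow> lt' a' b') \<and> (a = b \<longleftrightarrow> a' = b')"
    proof cases
      case 1
      then show ?thesis using partial_isoD(4)[OF P] pq by fastforce
    next
      case 2
      then show ?thesis using cmp[of b b'] ne[of b b'] pq by auto
    next
      case 3
      then show ?thesis using cmp[of a a'] ne[of a a'] pq by auto
    next
      case 4
      then show ?thesis using asym(2)[OF x x] asym'(2)[OF y(1) y(1)] pq by auto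
    qed
    then show "(lt (fst p) (fst q) \<longleftrightarrow> lt' (snd p) (snd q)) \<and> (fst p = fst q \<longleftrightarrow> snd p = snd q)"
      using pq by simp
  qed (use m in auto)
  then show ?thesis by blast
qed

text \<open>Starting from the pair of least points, the members of an enumeration of
  \<open>Y\<close> are added one by one; the union of the increasing sequence is still
  countable.\<close>

lemma partial_iso_covering:
  assumes K: "eta_min K lt" and K': "eta_min K' lt'" and Y: "countable Y" "Y \<subseteq> K"
  shows "\<exists>P. partial_iso K lt K' lt' P \<and> Y \<subseteq> fst ` P"
proof -
  obtain m m' where m: "least_of K lt m" "least_of K' lt' m'"
    using eta_min_least K K' by metis
  note lin = eta_min_linear[OF K] eta_min_linear[OF K']
  define e where "e = from_nat_into (insert m Y)"
  have e: "range e = insert m Y" unfolding e_def by (rule range_from_nat_into) (use Y in auto)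
  have mK: "m \<in> K" "m' \<in> K'" using m by (simp_all add: least_of_def)
  have eK: "e n \<in> K" for n
  proof -
    have "e n \<in> insert m Y" unfolding e[symmetric] by (rule rangeI)
    then show ?thesis using Y(2) mK(1) by auto
  qed
  have base: "partial_iso K lt K' lt' {(m, m')}"
  proof (rule partial_isoI[OF _ _ _ m])
    show "{(m, m')} \<subseteq> K \<times> K'" using mK by simp
    show "(lt (fst p) (fst q) \<longleftrightarrow> lt' (snd p) (snd q)) \<and> (fst p = fst q \<longleftrightarrow> snd p = snd q)"
      if "p \<in> {(m, m')}" "q \<in> {(m, m')}" for p q
      using that mK lin by (simp add: linear_strict_def)
  qed auto
  have "\<exists>f. f 0 = {(m, m')} \<and> (\<forall>n. partial_iso K lt K' lt' (f n)) \<and> (\<forall>n. \<exists>y. f (Suc n) = insert (e n, y) (f n))"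
  proof -
    have "\<exists>f. \<forall>n. (partial_iso K lt K' lt' (f n) \<and> (n = 0 \<longrightarrow> f n = {(m, m')})) \<and> (\<exists>y. f (Suc n) = insert (e n, y) (f n))"
    proof (rule dependent_nat_choice)
      show "\<exists>x. partial_iso K lt K' lt' x \<and> (0 = (0::nat) \<longrightarrow> x = {(m, m')})" using base by blast
      show "\<exists>Q. (partial_iso K lt K' lt' Q \<and> (Suc n = 0 \<longrightarrow> Q = {(m, m')})) \<and> (\<exists>y. Q = insert (e n, y) P)"
        if "partial_iso K lt K' lt' P \<and> (n = 0 \<longrightarrow> P = {(m, m')})" for P n
        using partial_iso_extend[OF lin(1) K' conjunct1[OF that] eK[of n]] by auto
    qed
    then show ?thesis by blast
  qed
  then obtain f where f0: "f 0 = {(m, m')}" and f: "\<And>n. partial_iso K lt K' lt' (f n)" "\<And>n. \<exists>y. f (Suc n) = insert (e n, y) (f n)" by blast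
  have mono: "f i \<subseteq> f j" if "i \<le> j" for i j
  proof (rule lift_Suc_mono_le[OF _ that])
    show "f n \<subseteq> f (Suc n)" for n using f(2)[of n] by auto
  qed
  let ?P = "\<Union>n. f n"
  have "partial_iso K lt K' lt' ?P"
  proof (rule partial_isoI[of _ K K' m m'])
    show "countable ?P" using partial_isoD(1)[OF f(1)] by (intro countable_UN) auto
    show "?P \<subseteq> K \<times> K'" using partial_isoD(2)[OF f(1)] by (intro UN_least)
    show "(m, m') \<in> ?P" using f0 by blast
    fix p q assume "p \<in> ?P" "q \<in> ?P"
    then obtain i j where "p \<in> f i" "q \<in> f j" by blast
    then have "p \<in> f (max i j)" "q \<in> f (max i j)" using mono[of i "max i j"] mono[of j "max i j"] by auto
    then show "(lt (fst p) (fst q) \<longleftrightarrow> lt' (snd p) (snd q)) \<and> (fst p = fst q \<longleftrightarrow> snd p = snd q)"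
      by (rule partial_isoD(4)[OF f(1)])
  qed (use m in auto)
  moreover have "e n \<in> fst ` ?P" for n
  proof -
    obtain y where "(e n, y) \<in> f (Suc n)" using f(2) by blast
    then show ?thesis by force
  qed
  then have "range e \<subseteq> fst ` ?P" by (rule image_subsetI)
  then have "Y \<subseteq> fst ` ?P" unfolding e by simp
  ultimately show ?thesis by blast
qed

text \<open>A partial isomorphism of the base orders induces a correspondence of cover points that
  copies offset and level.\<close>

definition matched where
  "matched A cdA B cdB P s a b \<longleftrightarrow> a \<in> carr A s \<and> b \<in> carr B s \<and>
     (fst (base (cdA s a)), fst (base (cdB s b))) \<in> P \<and> offset (cdA s a) = offset (cdB s b) \<and> snd (cdA s a) = snd (cdB s b)"

lemma matched_converse: "matched A cdA B cdB P s a b \<Longrightarrow> matched B cdB A cdA (P\<inverse>) s b a"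
  unfolding matched_def by auto

lemma matched_mono: "matched A cdA B cdB P s a b \<Longrightarrow> P \<subseteq> Q \<Longrightarrow> matched A cdA B cdB Q s a b"
  unfolding matched_def by auto

lemma matched_forth:
  assumes A: "cover_model A cdA (K \<times> J) (lex_less lt)" and B: "cover_model B cdB (K' \<times> J) (lex_less lt')"
    and K: "eta_min K lt" and K': "eta_min K' lt'"
    and P: "partial_iso K lt K' lt' P" and a: "a \<in> carr A (sg n)"
  shows "\<exists>Q b. P \<subseteq> Q \<and> partial_iso K lt K' lt' Q \<and> matched A cdA B cdB Q (sg n) a b"
proof -
  have ca: "cdA (sg n) a \<in> (K \<times> J) \<times> {..<n + 2}" by (rule cover_model_mem[OF A a])
  then have x: "fst (base (cdA (sg n) a)) \<in> K" by (auto simp: base_def)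
  have "linear_strict K lt" by (rule eta_min_linear[OF K])
  from partial_iso_extend[OF this K' P x] obtain y
    where y: "partial_iso K lt K' lt' (insert (fst (base (cdA (sg n) a)), y) P)" by blast
  then have "y \<in> K'" using partial_isoD(2)[OF y] by blast
  then have "((y, offset (cdA (sg n) a)), snd (cdA (sg n) a)) \<in> (K' \<times> J) \<times> {..<n + 2}"
    using ca by (auto simp: offset_def)
  from cover_model_surj[OF B this] obtain b where b: "b \<in> carr B (sg n)"
    "cdB (sg n) b = ((y, offset (cdA (sg n) a)), snd (cdA (sg n) a))" by blast
  then have "matched A cdA B cdB (insert (fst (base (cdA (sg n) a)), y) P) (sg n) a b"
    using a unfolding matched_def by (simp add: base_def offset_def)
  then show ?thesis using y by blast
qed

lemma block_point_eq_iff: "u = u' \<longleftrightarrow> fst (base u) = fst (base u') \<and> offset u = offset u' \<and> snd u = snd u'"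
  by (cases u; cases u') (auto simp: base_def offset_def)

lemma matched_delta:
  assumes P: "partial_iso K lt K' lt' P"
    and a: "matched A cdA B cdB P s a b" and a': "matched A cdA B cdB P s a' b'"
  shows "delta n (lex_less lt) (cdA s a) (cdA s a') = delta n (lex_less lt') (cdB s b) (cdB s b')"
    and "cdA s a = cdA s a' \<longleftrightarrow> cdB s b = cdB s b'"
proof -
  let ?p = "(fst (base (cdA s a)), fst (base (cdB s b)))" and ?q = "(fst (base (cdA s a')), fst (base (cdB s b')))"
  have "?p \<in> P" "?q \<in> P" using a a' unfolding matched_def by blast+
  then have *: "(lt (fst ?q) (fst ?p) \<longleftrightarrow> lt' (snd ?q) (snd ?p)) \<and> (fst ?q = fst ?p \<longleftrightarrow> snd ?q = snd ?p)"
    using partial_isoD(4)[OF P] by blast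
  have **: "offset (cdA s a) = offset (cdB s b)" "snd (cdA s a) = snd (cdB s b)"
    "offset (cdA s a') = offset (cdB s b')" "snd (cdA s a') = snd (cdB s b')"
    using a a' unfolding matched_def by blast+
  have "lex_less lt (fst (cdA s a')) (fst (cdA s a)) \<longleftrightarrow> lex_less lt' (fst (cdB s b')) (fst (cdB s b))"
    using * ** unfolding lex_less_def base_def offset_def by simp
  then show "delta n (lex_less lt) (cdA s a) (cdA s a') = delta n (lex_less lt') (cdB s b) (cdB s b')"
    unfolding delta_def using ** by simp
  show "cdA s a = cdA s a' \<longleftrightarrow> cdB s b = cdB s b'"
    unfolding block_point_eq_iff ** using *[unfolded fst_conv snd_conv] by metis
qed

text \<open>Equality and \<open>delta\<close> depend only on the order of the base points, on
  offsets and on levels, so matched points satisfy the same atomic formulas. A quantifier is handled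
  by adding the base point of the witness to the countable partial isomorphism.\<close>

theorem back_and_forth:
  assumes A: "cover_model A cdA (K \<times> J) (lex_less lt)" and B: "cover_model B cdB (K' \<times> J) (lex_less lt')"
    and K: "eta_min K lt" and K': "eta_min K' lt'"
    and "partial_iso K lt K' lt' P" "wf_fm osig \<phi>"
    and "\<forall>x\<in>fv \<phi>. matched A cdA B cdB P (fst x) (v x) (w x)"
  shows "sat A v \<phi> \<longleftrightarrow> sat B w \<phi>"
  using assms(5-7)
proof (induction \<phi> arbitrary: v w P)
  case (Eq t u)
  from Eq.prems(2) obtain n k l where t: "t = Var (sg n, k)" "u = Var (sg n, l)" by (auto simp: wf_tm_osig)
  have m: "matched A cdA B cdB P (sg n) (v (sg n, k)) (w (sg n, k))" "matched A cdA B cdB P (sg n) (v (sg n, l)) (w (sg n, l))"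
    using Eq.prems(3) t by auto
  have c: "v (sg n, k) \<in> carr A (sg n)" "v (sg n, l) \<in> carr A (sg n)" "w (sg n, k) \<in> carr B (sg n)" "w (sg n, l) \<in> carr B (sg n)"
    using m by (simp_all add: matched_def)
  have "v (sg n, k) = v (sg n, l) \<longleftrightarrow> cdA (sg n) (v (sg n, k)) = cdA (sg n) (v (sg n, l))"
    using cover_model_inj[OF A c(1,2)] by auto
  moreover have "w (sg n, k) = w (sg n, l) \<longleftrightarrow> cdB (sg n) (w (sg n, k)) = cdB (sg n) (w (sg n, l))"
    using cover_model_inj[OF B c(3,4)] by auto
  ultimately show ?case using matched_delta(2)[OF Eq.prems(1) m] t by simp
next
  case (Rel r ts)
  from Rel.prems(2) obtain n j k l where r: "r = rl n j" "ts = [Var (sg n, k), Var (sg n, l)]"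
    unfolding wf_Rel_osig by blast
  have m: "matched A cdA B cdB P (sg n) (v (sg n, k)) (w (sg n, k))" "matched A cdA B cdB P (sg n) (v (sg n, l)) (w (sg n, l))"
    using Rel.prems(3) r by auto
  have "v (sg n, k) \<in> carr A (sg n)" "v (sg n, l) \<in> carr A (sg n)" "w (sg n, k) \<in> carr B (sg n)" "w (sg n, l) \<in> carr B (sg n)"
    using m unfolding matched_def by auto
  then show ?case unfolding r
    using cover_model_rint[OF A] cover_model_rint[OF B] matched_delta(1)[OF Rel.prems(1) m, of "n + 2"] by simp
next
  case (Neg \<phi>)
  have "sat A v \<phi> \<longleftrightarrow> sat B w \<phi>" by (rule Neg.IH[OF Neg.prems(1)]) (use Neg.prems in auto)
  then show ?case by simp
next
  case (Conj \<phi> \<psi>)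
  have "sat A v \<phi> \<longleftrightarrow> sat B w \<phi>" by (rule Conj.IH(1)[OF Conj.prems(1)]) (use Conj.prems in auto)
  moreover have "sat A v \<psi> \<longleftrightarrow> sat B w \<psi>" by (rule Conj.IH(2)[OF Conj.prems(1)]) (use Conj.prems in auto)
  ultimately show ?case by simp
next
  case (Ex x \<phi>)
  from Ex.prems(2) obtain n where n: "fst x = sg n" by auto
  have step: "sat A (v(x := a)) \<phi> \<longleftrightarrow> sat B (w(x := b)) \<phi>"
    if "P \<subseteq> Q" "partial_iso K lt K' lt' Q" "matched A cdA B cdB Q (sg n) a b" for Q a b
  proof (rule Ex.IH[OF that(2)])
    show "wf_fm osig \<phi>" using Ex.prems(2) by simp
    show "\<forall>y\<in>fv \<phi>. matched A cdA B cdB Q (fst y) ((v(x := a)) y) ((w(x := b)) y)"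
    proof
      fix y assume "y \<in> fv \<phi>"
      then show "matched A cdA B cdB Q (fst y) ((v(x := a)) y) ((w(x := b)) y)"
        using that(3) n matched_mono[OF bspec[OF Ex.prems(3), of y] that(1)] by (cases "y = x") simp_all
    qed
  qed
  show ?case
  proof
    assume "sat A v (Ex x \<phi>)"
    then obtain a where a: "a \<in> carr A (sg n)" "sat A (v(x := a)) \<phi>" using n by auto
    from matched_forth[OF A B K K' Ex.prems(1) a(1)] obtain Q b
      where Q: "P \<subseteq> Q" "partial_iso K lt K' lt' Q" "matched A cdA B cdB Q (sg n) a b" by blast
    then show "sat B w (Ex x \<phi>)" using step[OF Q] a(2) n unfolding matched_def by auto
  next
    assume "sat B w (Ex x \<phi>)"
    then obtain b where b: "b \<in> carr B (sg n)" "sat B (w(x := b)) \<phi>" using n by auto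
    from matched_forth[OF B A K' K partial_iso_converse[OF Ex.prems(1)] b(1)] obtain Q a
      where Q: "P\<inverse> \<subseteq> Q" "partial_iso K' lt' K lt Q" "matched B cdB A cdA Q (sg n) b a" by blast
    have "P \<subseteq> Q\<inverse>" using Q(1) by auto
    from step[OF this partial_iso_converse[OF Q(2)] matched_converse[OF Q(3)]]
    show "sat A v (Ex x \<phi>)" using b(2) n Q(3) unfolding matched_def by auto
  qed
qed

lemma cover_model_Th_eq:
  assumes A: "cover_model A cdA (K \<times> J) (lex_less lt)" and B: "cover_model B cdB (K' \<times> J) (lex_less lt')"
    and K: "eta_min K lt" and K': "eta_min K' lt'"
  shows "Th osig A = Th osig B"
proof -
  obtain P where P: "partial_iso K lt K' lt' P" using partial_iso_covering[OF K K', of "{}"] by auto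
  have "sat A v \<phi> \<longleftrightarrow> sat B w \<phi>" if "\<phi> \<in> sentences osig" for \<phi> v w
    by (rule back_and_forth[OF A B K K' P]) (use that in \<open>auto simp: sentences_def\<close>)
  then show ?thesis
    using Th_iff[OF cover_model_structure[OF A]] Th_iff[OF cover_model_structure[OF B]] by blast
qed

subsection \<open>Saturation\<close>

lemma countable_PiE_finite:
  assumes "finite S" "countable B"
  shows "countable (PiE S (\<lambda>_. B))"
proof -
  obtain xs where xs: "set xs = S" using finite_list[OF assms(1)] by blast
  have "(\<lambda>f. map f xs) ` PiE S (\<lambda>_. B) \<subseteq> lists B"
    using xs by (auto simp: lists_eq_set)
  then have "countable ((\<lambda>f. map f xs) ` PiE S (\<lambda>_. B))"
    using countable_lists[OF assms(2)] by (rule countable_subset)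
  moreover have "inj_on (\<lambda>f. map f xs) (PiE S (\<lambda>_. B))"
  proof (rule inj_onI)
    fix f g assume fg: "f \<in> PiE S (\<lambda>_. B)" "g \<in> PiE S (\<lambda>_. B)" "map f xs = map g xs"
    show "f = g" by (rule PiE_ext[OF fg(1,2)]) (use fg(3) xs in auto)
  qed
  ultimately show ?thesis by (rule countable_image_inj_on)
qed

definition countably_saturated_struct ::
  "('s, 'f, 'r) signature \<Rightarrow> ('s, 'f, 'r, 'a) struct \<Rightarrow> bool" where
  "countably_saturated_struct L A \<longleftrightarrow>
     (\<forall>y p. fst y \<in> Sorts L \<longrightarrow> countable p \<longrightarrow>
        (\<forall>(\<phi>, v)\<in>p. wf_fm L \<phi> \<and> (\<forall>x\<in>fv \<phi> - {y}. v x \<in> carr A (fst x))) \<longrightarrow>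
        (\<forall>q\<subseteq>p. finite q \<longrightarrow> (\<exists>c\<in>carr A (fst y). \<forall>(\<phi>, v)\<in>q. sat A (v(y := c)) \<phi>)) \<longrightarrow>
        (\<exists>c\<in>carr A (fst y). \<forall>(\<phi>, v)\<in>p. sat A (v(y := c)) \<phi>))"

text \<open>Countably many parameters meet countably many blocks, so a single partial isomorphism
  carries all of them to \<open>A\<close>. The translated type is finitely satisfiable and therefore
  realised there, and one more forth step brings the realisation back.\<close>

lemma saturated_transfer:
  fixes A :: "('s::infinite, 'f, 'r::infinite, 'a) struct" and B :: "('s, 'f, 'r, 'b) struct"
  assumes A: "cover_model A cdA (K \<times> J) (lex_less lt)" and B: "cover_model B cdB (K' \<times> J) (lex_less lt')"
    and K: "eta_min K lt" and K': "eta_min K' lt'" and sat: "countably_saturated_struct osig A"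
    and \<kappa>: "\<And>X :: ('s \<times> 'b) set. |X| <o \<kappa> \<Longrightarrow> countable X"
  shows "saturated osig \<kappa> B"
  unfolding saturated_def
proof (intro allI impI)
  fix Z :: "('s \<times> 'b) set" and s and p :: "(('s, 'f, 'r) fm \<times> ('s var \<Rightarrow> 'b)) set"
  assume "Z \<subseteq> elems osig B \<and> |Z| <o \<kappa> \<and> s \<in> Sorts osig \<and>
    p \<subseteq> {(\<phi>, v). wf_fm osig \<phi> \<and> (\<forall>x\<in>fv \<phi> - {(s, 0)}. (fst x, v x) \<in> Z)} \<and>
    (\<forall>q\<subseteq>p. finite q \<longrightarrow> (\<exists>c\<in>carr B s. \<forall>(\<phi>, v)\<in>q. sat B (v((s, 0) := c)) \<phi>))"
  then have Z: "Z \<subseteq> elems osig B" "countable Z" and s: "s \<in> Sorts (osig :: ('s, 'f, 'r) signature)"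
    and p: "\<And>\<phi> v. (\<phi>, v) \<in> p \<Longrightarrow> wf_fm osig \<phi> \<and> (\<forall>x\<in>fv \<phi> - {(s, 0)}. (fst x, v x) \<in> Z)"
    and fin: "\<And>q. q \<subseteq> p \<Longrightarrow> finite q \<Longrightarrow> \<exists>c\<in>carr B s. \<forall>(\<phi>, v)\<in>q. sat B (v((s, 0) := c)) \<phi>"
    using \<kappa> by auto
  obtain n where n: "s = sg n" using s by auto
  let ?y = "(s, 0::nat)"
  define Y where "Y = (\<lambda>(t, b). fst (base (cdB t b))) ` Z"
  have Y: "countable Y" "Y \<subseteq> K'"
  proof -
    show "countable Y" unfolding Y_def using Z(2) by (rule countable_image)
    have "fst (base (cdB t b)) \<in> K'" if tb: "(t, b) \<in> Z" for t b
    proof -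
      obtain m where "t = sg m" "b \<in> carr B (sg m)" using Z(1) tb by (auto simp: elems_def)
      then show ?thesis using cover_model_mem[OF B, of b m] by (auto simp: base_def)
    qed
    then show "Y \<subseteq> K'" unfolding Y_def by auto
  qed
  from partial_iso_covering[OF K' K Y] obtain P0
    where P0: "partial_iso K' lt' K lt P0" "Y \<subseteq> fst ` P0" by blast
  define P where "P = P0\<inverse>"
  have P: "partial_iso K lt K' lt' P" unfolding P_def by (rule partial_iso_converse[OF P0(1)])
  have ex: "\<exists>a. matched A cdA B cdB P t a b" if tb: "(t, b) \<in> Z" for t b
  proof -
    obtain m where m: "t = sg m" "b \<in> carr B (sg m)" using Z(1) tb by (auto simp: elems_def)
    have cb: "cdB (sg m) b \<in> (K' \<times> J) \<times> {..<m + 2}" by (rule cover_model_mem[OF B m(2)])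
    have "fst (base (cdB t b)) \<in> Y" unfolding Y_def using tb by (intro image_eqI[of _ _ "(t, b)"]) auto
    then have "fst (base (cdB t b)) \<in> fst ` P0" using P0(2) by (rule subsetD[rotated])
    then obtain x where x: "(fst (base (cdB t b)), x) \<in> P0" by auto
    then have "x \<in> K" using partial_isoD(2)[OF P0(1)] by blast
    then have "((x, offset (cdB t b)), snd (cdB t b)) \<in> (K \<times> J) \<times> {..<m + 2}"
      using cb m(1) by (auto simp: offset_def)
    from cover_model_surj[OF A this] obtain a where "a \<in> carr A (sg m)"
      "cdA (sg m) a = ((x, offset (cdB t b)), snd (cdB t b))" by blast
    then have "matched A cdA B cdB P t a b" using m x
      by (auto simp: matched_def P_def base_def offset_def)
    then show ?thesis by blast
  qed
  define \<tau> where "\<tau> = (\<lambda>t b. SOME a. matched A cdA B cdB P t a b)"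
  have \<tau>: "matched A cdA B cdB P t (\<tau> t b) b" if "(t, b) \<in> Z" for t b
    unfolding \<tau>_def using ex[OF that] by (rule someI_ex)
  \<comment> \<open>The translated valuation is \<open>undefined\<close> off the parameters, so it
    depends only on the restriction of \<open>v\<close> to finitely many variables. Thus
    \<open>T\<close> maps even an uncountable \<open>p\<close> onto a countable set.\<close>
  define T where "T = (\<lambda>(\<phi> :: ('s, 'f, 'r) fm, v). (\<phi>, \<lambda>x. if x \<in> fv \<phi> - {?y} then \<tau> (fst x) (v x) else undefined))"
  have step: "sat A ((snd (T (\<phi>, v)))(?y := a)) \<phi> \<longleftrightarrow> sat B (v(?y := b)) \<phi>"
    if "(\<phi>, v) \<in> p" and Q: "P \<subseteq> Q" "partial_iso K lt K' lt' Q" "matched A cdA B cdB Q s a b" for \<phi> v Q a b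
  proof (rule back_and_forth[OF A B K K' Q(2)])
    show "wf_fm osig \<phi>" using p[OF that(1)] by blast
    show "\<forall>x\<in>fv \<phi>. matched A cdA B cdB Q (fst x) (((snd (T (\<phi>, v)))(?y := a)) x) ((v(?y := b)) x)"
    proof
      fix x assume x: "x \<in> fv \<phi>"
      show "matched A cdA B cdB Q (fst x) (((snd (T (\<phi>, v)))(?y := a)) x) ((v(?y := b)) x)"
      proof (cases "x = ?y")
        case True
        then show ?thesis using Q(3) by simp
      next
        case False
        then have "(fst x, v x) \<in> Z" using p[OF that(1)] x by blast
        then show ?thesis using matched_mono[OF \<tau> Q(1)] x False by (simp add: T_def)
      qed
    qed
  qed
  have count: "countable (T ` p)"
  proof -
    define r where "r = (\<lambda>(\<phi> :: ('s, 'f, 'r) fm, v :: 's var \<Rightarrow> 'b). (\<phi>, restrict v (fv \<phi> - {?y})))"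
    have "r ` p \<subseteq> (SIGMA \<phi> : {\<phi>. wf_fm osig \<phi>}. PiE (fv \<phi> - {?y}) (\<lambda>_. snd ` Z))"
    proof
      fix w assume "w \<in> r ` p"
      then obtain \<phi> v where v: "(\<phi>, v) \<in> p" "w = (\<phi>, restrict v (fv \<phi> - {?y}))" by (auto simp: r_def)
      have "v x \<in> snd ` Z" if "x \<in> fv \<phi> - {?y}" for x
        using p[OF v(1)] that by (intro image_eqI[of _ _ "(fst x, v x)"]) auto
      then show "w \<in> (SIGMA \<phi> : {\<phi>. wf_fm osig \<phi>}. PiE (fv \<phi> - {?y}) (\<lambda>_. snd ` Z))"
        using v p[OF v(1)] by auto
    qed
    moreover have "countable (SIGMA \<phi> : {\<phi> :: ('s, 'f, 'r) fm. wf_fm osig \<phi>}. PiE (fv \<phi> - {?y}) (\<lambda>_. snd ` Z))"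
      by (intro countable_SIGMA countable_wf_osig countable_PiE_finite) (use Z(2) in auto)
    ultimately have "countable (r ` p)" by (rule countable_subset)
    then have "countable (T ` (r ` p))" by (rule countable_image)
    moreover have "T (r w) = T w" for w by (cases w) (auto simp: T_def r_def fun_eq_iff)
    then have "T ` (r ` p) = T ` p" by (simp add: image_image)
    ultimately show ?thesis by simp
  qed
  have wfT: "\<forall>(\<phi>, v)\<in>T ` p. wf_fm osig \<phi> \<and> (\<forall>x\<in>fv \<phi> - {?y}. v x \<in> carr A (fst x))"
  proof -
    have "wf_fm osig (fst (T (\<phi>, v))) \<and> (\<forall>x\<in>fv (fst (T (\<phi>, v))) - {?y}. snd (T (\<phi>, v)) x \<in> carr A (fst x))"
      if "(\<phi>, v) \<in> p" for \<phi> v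
      using p[OF that] \<tau> by (auto simp: T_def matched_def)
    then show ?thesis by (auto simp: case_prod_unfold)
  qed
  have finT: "\<exists>c\<in>carr A (fst ?y). \<forall>(\<phi>, v)\<in>q. sat A (v(?y := c)) \<phi>" if q: "q \<subseteq> T ` p" "finite q" for q
  proof -
    obtain q0 where q0: "q0 \<subseteq> p" "finite q0" "q = T ` q0" using finite_subset_image[OF q(2,1)] by blast
    obtain b where b: "b \<in> carr B s" "\<forall>(\<phi>, v)\<in>q0. sat B (v(?y := b)) \<phi>" using fin[OF q0(1,2)] by blast
    from matched_forth[OF B A K' K partial_iso_converse[OF P] b(1)[unfolded n]] obtain Q a
      where Q: "P\<inverse> \<subseteq> Q" "partial_iso K' lt' K lt Q" "matched B cdB A cdA Q (sg n) b a" by blast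
    have PQ: "P \<subseteq> Q\<inverse>" using Q(1) by auto
    have "sat A ((snd (T (\<phi>, v)))(?y := a)) \<phi>" if "(\<phi>, v) \<in> q0" for \<phi> v
      using step[OF _ PQ partial_iso_converse[OF Q(2)], of \<phi> v a b] matched_converse[OF Q(3)] b(2) that q0(1) n by auto
    then have "\<forall>(\<phi>, v)\<in>q. sat A (v(?y := a)) \<phi>" unfolding q0(3) by (auto simp: T_def)
    moreover have "a \<in> carr A s" using Q(3) n by (simp add: matched_def)
    ultimately show ?thesis by auto
  qed
  have "\<exists>c\<in>carr A (fst ?y). \<forall>(\<phi>, v)\<in>T ` p. sat A (v(?y := c)) \<phi>"
    using sat[unfolded countably_saturated_struct_def, rule_format, of ?y "T ` p"] s count wfT finT by simp
  then obtain a where a: "a \<in> carr A (sg n)" "\<forall>(\<phi>, v)\<in>T ` p. sat A (v(?y := a)) \<phi>" using n by auto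
  from matched_forth[OF A B K K' P a(1)] obtain Q b
    where Q: "P \<subseteq> Q" "partial_iso K lt K' lt' Q" "matched A cdA B cdB Q (sg n) a b" by blast
  have "sat B (v(?y := b)) \<phi>" if "(\<phi>, v) \<in> p" for \<phi> v
  proof -
    have "T (\<phi>, v) \<in> T ` p" using that by (rule imageI)
    then have "sat A ((snd (T (\<phi>, v)))(?y := a)) \<phi>" using a(2) by (auto simp: T_def)
    then show ?thesis using step[OF that Q(1,2), of a b] Q(3) n by simp
  qed
  moreover have "b \<in> carr B s" using Q(3) n by (simp add: matched_def)
  ultimately show "\<exists>c\<in>carr B s. \<forall>(\<phi>, v)\<in>p. sat B (v(?y := c)) \<phi>" by blast
qed

section \<open>The first uncountable cardinal inside a given type\<close>

text \<open>The power set of the naturals is at least as large as the successor of the countable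
  cardinal, and it embeds into the type; some subset therefore has exactly that cardinality, and its
  cardinal order is \<open>\<kappa>\<close>.\<close>

lemma ex_aleph1:
  assumes "inj (f :: nat set \<Rightarrow> 'x)"
  shows "\<exists>\<kappa> :: 'x rel. Card_order \<kappa> \<and> \<kappa> =o cardSuc natLeq"
proof -
  have "natLeq <o |UNIV :: nat set set|"
    using ordIso_ordLess_trans[OF ordIso_symmetric[OF card_of_nat] card_of_Pow[of "UNIV :: nat set"]] by simp
  then have "cardSuc natLeq \<le>o |UNIV :: nat set set|"
    by (rule cardSuc_least[OF natLeq_Card_order card_of_Card_order])
  moreover have "|UNIV :: nat set set| \<le>o |UNIV :: 'x set|"
    using assms card_of_ordLeq[of "UNIV :: nat set set" "UNIV :: 'x set"] by blast
  ultimately have le: "cardSuc natLeq \<le>o |UNIV :: 'x set|" by (rule ordLeq_transitive)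
  have *: "|Field (cardSuc natLeq)| =o cardSuc natLeq"
    by (rule card_of_Field_ordIso[OF cardSuc_Card_order[OF natLeq_Card_order]])
  from internalize_card_of_ordLeq[THEN iffD1, OF ordIso_ordLeq_trans[OF * le]]
  obtain S :: "'x set" where S: "|Field (cardSuc natLeq)| =o |S|" by (elim exE conjE)
  have "|S| =o cardSuc natLeq" by (rule ordIso_transitive[OF ordIso_symmetric[OF S] *])
  then show ?thesis by (intro exI[of _ "|S|"] conjI card_of_Card_order)
qed

lemma aleph1_countable:
  assumes "\<kappa> =o cardSuc natLeq"
  shows "|X| <o \<kappa> \<longleftrightarrow> countable X"
proof -
  have "|X| <o \<kappa> \<longleftrightarrow> |X| <o cardSuc natLeq"
    using ordLess_ordIso_trans[OF _ assms] ordLess_ordIso_trans[OF _ ordIso_symmetric[OF assms]] by (rule iffI)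
  also have "\<dots> \<longleftrightarrow> |X| \<le>o natLeq"
    by (rule cardSuc_ordLeq_ordLess[OF natLeq_Card_order card_of_Card_order])
  finally show ?thesis by (simp add: countable_card_le_natLeq)
qed

subsection \<open>Definable distances\<close>

text \<open>The integer in question is at least \<open>- n\<close> and less than \<open>n\<close>,
  so divisibility leaves only the values \<open>0\<close> and \<open>- n\<close>.\<close>

lemma int_mod_zero_iff:
  assumes "(i::nat) < n" "j < n" "n \<ge> 2"
  shows "(int j - int i - of_bool b) mod int n = 0 \<longleftrightarrow> (j = i \<and> \<not> b) \<or> (b \<and> (j = Suc i \<or> Suc i = n \<and> j = 0))"
proof -
  have "(int j - int i - of_bool b) mod int n = 0 \<longleftrightarrow> int n dvd (int j - int i - of_bool b)" by (simp add: dvd_eq_mod_eq_0)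
  also have "\<dots> \<longleftrightarrow> int j - int i - of_bool b = 0 \<or> int j - int i - of_bool b = - int n"
  proof
    assume "int n dvd (int j - int i - of_bool b)"
    then obtain c where c: "int j - int i - of_bool b = int n * c" by (auto elim: dvdE)
    have "int n * (-1) \<le> int n * c" "int n * c < int n * 1" using assms unfolding c[symmetric] by auto
    then have "-1 \<le> c" "c < 1" using assms(3) by (auto simp only: mult_le_cancel_left mult_less_cancel_left)
    then have "c = 0 \<or> c = -1" by linarith
    then show "int j - int i - of_bool b = 0 \<or> int j - int i - of_bool b = - int n" using c by auto
  qed auto
  also have "\<dots> \<longleftrightarrow> (j = i \<and> \<not> b) \<or> (b \<and> (j = Suc i \<or> Suc i = n \<and> j = 0))"
    using assms by (cases b) auto
  finally show ?thesis .
qed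

lemma linear_strict_HQ: "linear_strict HQ hless"
  by (rule linear_strict_ultra) (use dense_min_Q01 in \<open>simp add: dense_min_def\<close>)

lemma eta_min_HQ: "eta_min HQ hless"
  by (rule eta_min_ultrapower[OF dense_min_Q01])

text \<open>The second point arises from the first by rotating through \<open>j\<close> sheets and
  moving \<open>k\<close> places along the block.\<close>

definition same_block_shift :: "nat \<Rightarrow> nat \<Rightarrow> int \<Rightarrow> ('k \<times> int) \<times> nat \<Rightarrow> ('k \<times> int) \<times> nat \<Rightarrow> bool" where
  "same_block_shift n j k u v \<longleftrightarrow>
     fst (base v) = fst (base u) \<and> snd v = (snd u + j) mod n \<and> offset v = offset u + k"

lemma delta_eq_zero_iff:
  assumes "n \<ge> 2" "snd u < n" "snd v < n"
  shows "delta n lt u v = 0 \<longleftrightarrow> (snd v = snd u \<and> \<not> lt (fst v) (fst u)) \<or>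
     (lt (fst v) (fst u) \<and> (snd v = Suc (snd u) \<or> Suc (snd u) = n \<and> snd v = 0))"
  unfolding delta_def using int_mod_zero_iff[OF assms(2,3,1)] by simp

lemma linear_strict_irrefl: "linear_strict K lt \<Longrightarrow> x \<in> K \<Longrightarrow> \<not> lt x x"
  unfolding linear_strict_def by blast

lemma linear_strict_trans:
  "linear_strict K lt \<Longrightarrow> x \<in> K \<Longrightarrow> y \<in> K \<Longrightarrow> z \<in> K \<Longrightarrow> lt x y \<Longrightarrow> lt y z \<Longrightarrow> lt x z"
  unfolding linear_strict_def by blast

lemma linear_strict_asym: "linear_strict K lt \<Longrightarrow> lt x y \<Longrightarrow> x \<in> K \<Longrightarrow> y \<in> K \<Longrightarrow> \<not> lt y x"
  using linear_strict_irrefl linear_strict_trans by metis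

lemma linear_strict_total: "linear_strict K lt \<Longrightarrow> x \<in> K \<Longrightarrow> y \<in> K \<Longrightarrow> x = y \<or> lt x y \<or> lt y x"
  unfolding linear_strict_def by blast

text \<open>On the left stands the definable notion of an immediate successor on the circle, with
  \<open>delta\<close> zero as the betweenness relation. Since the base order is dense and has no
  last point, gaps occur only inside blocks. For \<open>J = {0}\<close> both sides are
  false.\<close>

lemma successor_iff:
  assumes n: "n \<ge> 2" and J: "J = {0} \<or> J = (UNIV :: int set)"
    and K: "eta_min K lt"
    and u: "u \<in> (K \<times> J) \<times> {..<n}" and w: "w \<in> (K \<times> J) \<times> {..<n}"
  shows "(u \<noteq> w \<and> delta n (lex_less lt) u w = 0 \<and>
      \<not> (\<exists>t\<in>(K \<times> J) \<times> {..<n}. t \<noteq> u \<and> t \<noteq> w \<and> delta n (lex_less lt) u t = 0 \<and> delta n (lex_less lt) t w = 0))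
    \<longleftrightarrow> same_block_shift n 0 1 u w"
proof -
  have lin: "linear_strict K lt" by (rule eta_min_linear[OF K])
  note irr = linear_strict_irrefl[OF lin] and asym = linear_strict_asym[OF lin]
    and tot = linear_strict_total[OF lin]
  obtain q z l where u': "u = ((q, z), l)" by (metis surj_pair)
  obtain q' z' l' where w': "w = ((q', z'), l')" by (metis surj_pair)
  have uK: "q \<in> K" "z \<in> J" "l < n" and wK: "q' \<in> K" "z' \<in> J" "l' < n" using u w u' w' by auto
  have d0: "delta n (lex_less lt) a b = 0 \<longleftrightarrow> (snd b = snd a \<and> \<not> lex_less lt (fst b) (fst a)) \<or>
     (lex_less lt (fst b) (fst a) \<and> (snd b = Suc (snd a) \<or> Suc (snd a) = n \<and> snd b = 0))"
    if "a \<in> (K \<times> J) \<times> {..<n}" "b \<in> (K \<times> J) \<times> {..<n}" for a b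
    by (rule delta_eq_zero_iff[OF n]) (use that in auto)
  show ?thesis
  proof
    assume "same_block_shift n 0 1 u w"
    then have eq: "q' = q" "l' = l" "z' = z + 1" using uK by (auto simp: same_block_shift_def base_def offset_def u' w')
    have "\<not> (t \<noteq> u \<and> t \<noteq> w \<and> delta n (lex_less lt) u t = 0 \<and> delta n (lex_less lt) t w = 0)"
      if t: "t \<in> (K \<times> J) \<times> {..<n}" for t
    proof -
      obtain p y m where t': "t = ((p, y), m)" by (metis surj_pair)
      have tK: "p \<in> K" "y \<in> J" "m < n" using t t' by auto
      show ?thesis
        unfolding d0[OF u t] d0[OF t w]
        using tot[OF uK(1) tK(1)] irr[OF uK(1)] asym[of q p] asym[of p q] uK tK n
        by (auto simp: u' w' t' eq lex_less_def)
    qed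
    moreover have "u \<noteq> w" using eq by (simp add: u' w')
    moreover have "delta n (lex_less lt) u w = 0"
      unfolding d0[OF u w] using irr[OF uK(1)] by (simp add: u' w' eq lex_less_def)
    ultimately show "u \<noteq> w \<and> delta n (lex_less lt) u w = 0 \<and>
      \<not> (\<exists>t\<in>(K \<times> J) \<times> {..<n}. t \<noteq> u \<and> t \<noteq> w \<and> delta n (lex_less lt) u t = 0 \<and> delta n (lex_less lt) t w = 0)"
      by blast
  next
    assume L: "u \<noteq> w \<and> delta n (lex_less lt) u w = 0 \<and>
      \<not> (\<exists>t\<in>(K \<times> J) \<times> {..<n}. t \<noteq> u \<and> t \<noteq> w \<and> delta n (lex_less lt) u t = 0 \<and> delta n (lex_less lt) t w = 0)"
    show "same_block_shift n 0 1 u w"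
    proof (rule ccontr)
      assume no: "\<not> same_block_shift n 0 1 u w"
      have uw: "(l' = l \<and> \<not> lex_less lt (q', z') (q, z)) \<or> (lex_less lt (q', z') (q, z) \<and> (l' = Suc l \<or> Suc l = n \<and> l' = 0))"
        using L d0[OF u w] by (simp add: u' w')
      have between: False if t: "((p, y), m) \<in> (K \<times> J) \<times> {..<n}" "((p, y), m) \<noteq> u" "((p, y), m) \<noteq> w"
        "delta n (lex_less lt) u ((p, y), m) = 0" "delta n (lex_less lt) ((p, y), m) w = 0" for p y m
        using L t by blast
      consider (block) "l' = l" "q' = q" "z < z'" | (level) "l' = l" "lt q q'"
        | (wrap) "lex_less lt (q', z') (q, z)" "l' = Suc l \<or> Suc l = n \<and> l' = 0"
        using uw tot[OF uK(1) wK(1)] L by (auto simp: lex_less_def u' w')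
      then show False
      proof cases
        case block
        have "J = UNIV" using J block(3) uK(2) wK(2) by auto
        moreover have "z' \<noteq> z + 1" using no block uK(3) by (auto simp: same_block_shift_def base_def offset_def u' w')
        ultimately have t: "((q, z + 1), l) \<in> (K \<times> J) \<times> {..<n}" using uK by simp
        show False
        proof (rule between[OF t])
          show "delta n (lex_less lt) u ((q, z + 1), l) = 0" unfolding d0[OF u t] using irr[OF uK(1)] by (simp add: lex_less_def u')
          show "delta n (lex_less lt) ((q, z + 1), l) w = 0" unfolding d0[OF t w]
            using irr[OF uK(1)] block by (simp add: lex_less_def w')
        qed (use block \<open>z' \<noteq> z + 1\<close> in \<open>auto simp: u' w'\<close>)
      next
        case level
        obtain p where p: "p \<in> K" "lt q p" "lt p q'"
          using eta_min_between[OF K, of "{q}" "{q'}"] level(2) uK(1) wK(1) by auto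
        have np: "\<not> lt p q" "\<not> lt q' p" using asym[OF p(2)] asym[OF p(3)] p(1) uK(1) wK(1) by blast+
        have ne: "p \<noteq> q" "p \<noteq> q'" using p irr uK(1) wK(1) by blast+
        have t: "((p, z), l) \<in> (K \<times> J) \<times> {..<n}" using p uK by simp
        show False
        proof (rule between[OF t])
          show "delta n (lex_less lt) u ((p, z), l) = 0" unfolding d0[OF u t]
            using np ne by (auto simp: lex_less_def u')
          show "delta n (lex_less lt) ((p, z), l) w = 0" unfolding d0[OF t w]
            using np ne level(1) by (auto simp: lex_less_def w')
        qed (use ne in \<open>auto simp: u' w'\<close>)
      next
        case wrap
        \<comment> \<open>Here \<open>w\<close> lies in the sheet after that of \<open>u\<close>. A
          point of the sheet of \<open>u\<close> above \<open>q\<close> comes before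
          \<open>w\<close>; it exists because no last point does.\<close>
        obtain p where p: "p \<in> K" "lt q p"
          using eta_min_between[OF K, of "{q}" "{}"] uK(1) by auto
        have qp: "lt q' p"
          using wrap(1) p linear_strict_trans[OF lin wK(1) uK(1) p(1)] unfolding lex_less_def by auto
        have np: "\<not> lt p q" using asym[OF p(2)] p(1) uK(1) by blast
        have ne: "p \<noteq> q" "p \<noteq> q'" using p qp irr uK(1) wK(1) by blast+
        have t: "((p, z), l) \<in> (K \<times> J) \<times> {..<n}" using p uK by simp
        show False
        proof (rule between[OF t])
          show "delta n (lex_less lt) u ((p, z), l) = 0" unfolding d0[OF u t]
            using np ne by (auto simp: lex_less_def u')
          show "delta n (lex_less lt) ((p, z), l) w = 0" unfolding d0[OF t w]
            using qp wrap(2) by (auto simp: lex_less_def w')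
        qed (use ne in \<open>auto simp: u' w'\<close>)
      qed
    qed
  qed
qed

text \<open>The two values add up to zero modulo \<open>n\<close>, which by
  \<open>delta_fst_eq_iff\<close> happens only over a single point. So rotation by \<open>j\<close>
  sheets is defined by a pair of basic relations.\<close>

lemma rotation_iff:
  assumes lin: "linear_strict K lt" and n: "n \<ge> 2" and j: "j < n"
    and u: "u \<in> K \<times> {..<n}" and w: "w \<in> K \<times> {..<n}"
  shows "delta n lt u w = int j \<and> delta n lt w u = int ((n - j) mod n) \<longleftrightarrow>
    fst w = fst u \<and> snd w = (snd u + j) mod n"
proof -
  note irr = linear_strict_irrefl[OF lin]
  have nj: "int ((n - j) mod n) = (- int j) mod int n"
    using j by (simp add: zmod_int of_nat_diff)
  show ?thesis
  proof
    assume L: "delta n lt u w = int j \<and> delta n lt w u = int ((n - j) mod n)"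
    then have "(delta n lt u w + delta n lt w u) mod int n = 0" unfolding nj by (simp add: mod_simps)
    then have eq: "fst u = fst w" using delta_fst_eq_iff[OF lin n] u w by (simp add: mem_Times_iff)
    then have "(int (snd w) - int (snd u)) mod int n = int j"
      using L irr u by (auto simp: delta_def mem_Times_iff)
    then have "(int (snd u) + int j) mod int n = int (snd w) mod int n"
      by (metis add_diff_cancel_left' add.commute diff_add_cancel mod_add_right_eq)
    then have "(snd u + j) mod n = snd w" using w by (auto simp: zmod_int[symmetric] simp flip: of_nat_add)
    then show "fst w = fst u \<and> snd w = (snd u + j) mod n" using eq by simp
  next
    assume R: "fst w = fst u \<and> snd w = (snd u + j) mod n"
    then have "delta n lt u w = int j mod int n" "delta n lt w u = (- int j) mod int n"
      using irr u by (auto simp: delta_def mem_Times_iff zmod_int mod_simps)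
    then show "delta n lt u w = int j \<and> delta n lt w u = int ((n - j) mod n)"
      unfolding nj using j by simp
  qed
qed

section \<open>Formulas for rotations and for distances within a block\<close>

definition delta_fm :: "nat \<Rightarrow> nat \<Rightarrow> nat \<Rightarrow> nat \<Rightarrow> ('s::infinite, 'f, 'r::infinite) fm" where
  "delta_fm n j x y = Rel (rl n j) [Var (sg n, x), Var (sg n, y)]"

definition succ_fm :: "nat \<Rightarrow> nat \<Rightarrow> nat \<Rightarrow> ('s::infinite, 'f, 'r::infinite) fm" where
  "succ_fm n x y = Conj (Neg (Eq (Var (sg n, x)) (Var (sg n, y)))) (Conj (delta_fm n 0 x y)
     (Neg (Ex (sg n, 1) (Conj (Neg (Eq (Var (sg n, 1)) (Var (sg n, x)))) (Conj (Neg (Eq (Var (sg n, 1)) (Var (sg n, y))))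
       (Conj (delta_fm n 0 x 1) (delta_fm n 0 1 y)))))))"

text \<open>Variable \<open>0\<close> is the \<open>k\<close>-th successor of variable
  \<open>k + 2\<close>. Index \<open>1\<close> is reserved for the quantifier inside
  \<open>succ_fm\<close>, so the chain of variables starts at \<open>2\<close>.\<close>

fun dist_fm :: "nat \<Rightarrow> nat \<Rightarrow> ('s::infinite, 'f, 'r::infinite) fm" where
  "dist_fm n 0 = Eq (Var (sg n, 2)) (Var (sg n, 0))"
| "dist_fm n (Suc k) = Ex (sg n, k + 2) (Conj (succ_fm n (k + 3) (k + 2)) (dist_fm n k))"

text \<open>Variable \<open>k + 3\<close> is first rotated by \<open>j\<close> sheets; variable
  \<open>0\<close> is the \<open>k\<close>-th successor of the result.\<close>

definition shift_fm :: "nat \<Rightarrow> nat \<Rightarrow> nat \<Rightarrow> ('s::infinite, 'f, 'r::infinite) fm" where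
  "shift_fm n j k = Ex (sg n, k + 2) (Conj (Conj (delta_fm n j (k + 3) (k + 2))
     (delta_fm n ((n + 2 - j) mod (n + 2)) (k + 2) (k + 3))) (dist_fm n k))"

lemma fv_fms:
  "fv (delta_fm n j x y) = {(sg n, x), (sg n, y)}"
  "fv (succ_fm n x y) \<subseteq> {(sg n, x), (sg n, y)}"
  "fv (dist_fm n k) \<subseteq> {(sg n, k + 2), (sg n, 0)}"
  "fv (shift_fm n j k) \<subseteq> {(sg n, k + 3), (sg n, 0)}"
proof -
  show a: "fv (delta_fm n j x y) = {(sg n, x), (sg n, y)}" for n j x y by (auto simp: delta_fm_def)
  show b: "fv (succ_fm n x y) \<subseteq> {(sg n, x), (sg n, y)}" for x y by (auto simp: succ_fm_def a)
  show c: "fv (dist_fm n k) \<subseteq> {(sg n, k + 2), (sg n, 0)}" for k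
  proof (induction k)
    case (Suc k)
    then show ?case using b[of "k + 3" "k + 2"] by auto
  qed auto
  show "fv (shift_fm n j k) \<subseteq> {(sg n, k + 3), (sg n, 0)}"
    using c[of k] by (auto simp: shift_fm_def a)
qed

lemma wf_fms:
  "wf_fm osig (delta_fm n j x y)" "wf_fm osig (succ_fm n x y)" "wf_fm osig (dist_fm n k)" "wf_fm osig (shift_fm n j k)"
proof -
  show a: "wf_fm osig (delta_fm n j x y)" for n j x y by (auto simp: delta_fm_def)
  show b: "wf_fm osig (succ_fm n x y)" for x y by (auto simp: succ_fm_def a)
  show c: "wf_fm osig (dist_fm n k)" for k by (induction k) (auto simp: b)
  show "wf_fm osig (shift_fm n j k)" by (auto simp: shift_fm_def a c)
qed

context
  fixes C :: "('s::infinite, 'f, 'r::infinite, 'b) struct" and cd K lt J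
  assumes C: "cover_model C cd (K \<times> J) (lex_less lt)" and K: "eta_min K lt"
    and J: "J = {0} \<or> J = (UNIV :: int set)"
begin

lemma sat_delta_fm:
  "v (sg n, x) \<in> carr C (sg n) \<Longrightarrow> v (sg n, y) \<in> carr C (sg n) \<Longrightarrow>
    sat C v (delta_fm n j x y) \<longleftrightarrow> delta (n + 2) (lex_less lt) (cd (sg n) (v (sg n, x))) (cd (sg n) (v (sg n, y))) = int j"
  unfolding delta_fm_def using cover_model_rint[OF C] by simp

lemma sat_succ_fm:
  assumes "v (sg n, x) \<in> carr C (sg n)" "v (sg n, y) \<in> carr C (sg n)" "x \<noteq> 1" "y \<noteq> 1"
  shows "sat C v (succ_fm n x y) \<longleftrightarrow> same_block_shift (n + 2) 0 1 (cd (sg n) (v (sg n, x))) (cd (sg n) (v (sg n, y)))"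
proof -
  let ?c = "cd (sg n)" and ?W = "(K \<times> J) \<times> {..<n + 2}" and ?d = "delta (n + 2) (lex_less lt)"
  let ?u = "v (sg n, x)" and ?w = "v (sg n, y)"
  have inj: "a = b \<longleftrightarrow> ?c a = ?c b" if "a \<in> carr C (sg n)" "b \<in> carr C (sg n)" for a b
    using cover_model_inj[OF C that] by auto
  have "sat C v (succ_fm n x y) \<longleftrightarrow> ?u \<noteq> ?w \<and> ?d (?c ?u) (?c ?w) = 0 \<and>
     \<not> (\<exists>a\<in>carr C (sg n). a \<noteq> ?u \<and> a \<noteq> ?w \<and> ?d (?c ?u) (?c a) = 0 \<and> ?d (?c a) (?c ?w) = 0)"
    using assms by (simp add: succ_fm_def sat_delta_fm)
  also have "\<dots> \<longleftrightarrow> ?c ?u \<noteq> ?c ?w \<and> ?d (?c ?u) (?c ?w) = 0 \<and>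
     \<not> (\<exists>a\<in>carr C (sg n). ?c a \<noteq> ?c ?u \<and> ?c a \<noteq> ?c ?w \<and> ?d (?c ?u) (?c a) = 0 \<and> ?d (?c a) (?c ?w) = 0)"
    using inj assms(1,2) by simp
  also have "\<dots> \<longleftrightarrow> ?c ?u \<noteq> ?c ?w \<and> ?d (?c ?u) (?c ?w) = 0 \<and>
     \<not> (\<exists>t\<in>?W. t \<noteq> ?c ?u \<and> t \<noteq> ?c ?w \<and> ?d (?c ?u) t = 0 \<and> ?d t (?c ?w) = 0)"
    unfolding bij_betw_imp_surj_on[OF cover_model_bij[OF C, of n], symmetric] by simp
  also have "\<dots> \<longleftrightarrow> same_block_shift (n + 2) 0 1 (?c ?u) (?c ?w)"
    by (rule successor_iff[OF _ J K cover_model_mem[OF C assms(1)] cover_model_mem[OF C assms(2)]]) simp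
  finally show ?thesis .
qed

lemma sat_dist_fm:
  assumes "v (sg n, k + 2) \<in> carr C (sg n)" "v (sg n, 0) \<in> carr C (sg n)"
  shows "sat C v (dist_fm n k) \<longleftrightarrow> same_block_shift (n + 2) 0 (int k) (cd (sg n) (v (sg n, k + 2))) (cd (sg n) (v (sg n, 0)))"
  using assms
proof (induction k arbitrary: v)
  case 0
  have "v (sg n, 2) = v (sg n, 0) \<longleftrightarrow> cd (sg n) (v (sg n, 2)) = cd (sg n) (v (sg n, 0))"
    using cover_model_inj[OF C, of "v (sg n, 2)" n "v (sg n, 0)"] 0 by (auto simp: numeral_2_eq_2)
  also have "\<dots> \<longleftrightarrow> same_block_shift (n + 2) 0 0 (cd (sg n) (v (sg n, 2))) (cd (sg n) (v (sg n, 0)))"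
    using cover_model_mem[OF C, of "v (sg n, 2)" n] 0
    unfolding block_point_eq_iff same_block_shift_def by (auto simp: numeral_2_eq_2 mem_Times_iff)
  finally show ?case by (simp add: numeral_2_eq_2)
next
  case (Suc k)
  let ?u = "cd (sg n) (v (sg n, k + 3))" and ?v = "cd (sg n) (v (sg n, 0))"
  have c: "v (sg n, k + 3) \<in> carr C (sg n)" "v (sg n, 0) \<in> carr C (sg n)" using Suc.prems by (simp_all add: numeral_3_eq_3)
  have uW: "?u \<in> (K \<times> J) \<times> {..<n + 2}" "?v \<in> (K \<times> J) \<times> {..<n + 2}"
    by (rule cover_model_mem[OF C c(1)], rule cover_model_mem[OF C c(2)])
  have "sat C v (dist_fm n (Suc k)) \<longleftrightarrow> (\<exists>a\<in>carr C (sg n).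
      same_block_shift (n + 2) 0 1 ?u (cd (sg n) a) \<and> same_block_shift (n + 2) 0 (int k) (cd (sg n) a) ?v)"
  proof -
    have "sat C (v((sg n, k + 2) := a)) (Conj (succ_fm n (k + 3) (k + 2)) (dist_fm n k)) \<longleftrightarrow>
      same_block_shift (n + 2) 0 1 ?u (cd (sg n) a) \<and> same_block_shift (n + 2) 0 (int k) (cd (sg n) a) ?v"
      if "a \<in> carr C (sg n)" for a
    proof -
      define w where "w = v((sg n, k + 2) := a)"
      have w: "w (sg n, k + 2) = a" "w (sg n, k + 3) = v (sg n, k + 3)" "w (sg n, 0) = v (sg n, 0)"
        by (simp_all add: w_def)
      have "sat C w (dist_fm n k) \<longleftrightarrow> same_block_shift (n + 2) 0 (int k) (cd (sg n) a) ?v"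
        using Suc.IH[of w] that c unfolding w by blast
      moreover have "sat C w (succ_fm n (k + 3) (k + 2)) \<longleftrightarrow> same_block_shift (n + 2) 0 1 ?u (cd (sg n) a)"
        using sat_succ_fm[of w n "k + 3" "k + 2"] that c unfolding w by simp
      ultimately show ?thesis unfolding w_def[symmetric] by simp
    qed
    then show ?thesis by simp
  qed
  also have "\<dots> \<longleftrightarrow> (\<exists>t\<in>(K \<times> J) \<times> {..<n + 2}. same_block_shift (n + 2) 0 1 ?u t \<and> same_block_shift (n + 2) 0 (int k) t ?v)"
    unfolding bij_betw_imp_surj_on[OF cover_model_bij[OF C, of n], symmetric] by simp
  also have "\<dots> \<longleftrightarrow> same_block_shift (n + 2) 0 (int (Suc k)) ?u ?v"
  proof
    assume "\<exists>t\<in>(K \<times> J) \<times> {..<n + 2}. same_block_shift (n + 2) 0 1 ?u t \<and> same_block_shift (n + 2) 0 (int k) t ?v"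
    then show "same_block_shift (n + 2) 0 (int (Suc k)) ?u ?v" by (auto simp: same_block_shift_def)
  next
    assume R: "same_block_shift (n + 2) 0 (int (Suc k)) ?u ?v"
    let ?t = "((fst (base ?u), offset ?u + 1), snd ?u)"
    have "offset ?u \<in> J" "offset ?v \<in> J" using uW by (auto simp: offset_def)
    \<comment> \<open>The two offsets differ, which excludes \<open>J = {0}\<close>.\<close>
    then have "offset ?u + 1 \<in> J" using J R by (auto simp: same_block_shift_def)
    then have "?t \<in> (K \<times> J) \<times> {..<n + 2}" using uW by (auto simp: base_def)
    moreover have "same_block_shift (n + 2) 0 1 ?u ?t" "same_block_shift (n + 2) 0 (int k) ?t ?v"
      using R uW by (auto simp: same_block_shift_def base_def offset_def)
    ultimately show "\<exists>t\<in>(K \<times> J) \<times> {..<n + 2}. same_block_shift (n + 2) 0 1 ?u t \<and> same_block_shift (n + 2) 0 (int k) t ?v"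
      by blast
  qed
  finally show ?case by (simp add: numeral_3_eq_3)
qed

lemma sat_shift_fm:
  assumes "v (sg n, k + 3) \<in> carr C (sg n)" "v (sg n, 0) \<in> carr C (sg n)" "j < n + 2"
  shows "sat C v (shift_fm n j k) \<longleftrightarrow> same_block_shift (n + 2) j (int k) (cd (sg n) (v (sg n, k + 3))) (cd (sg n) (v (sg n, 0)))"
proof -
  let ?u = "cd (sg n) (v (sg n, k + 3))" and ?v = "cd (sg n) (v (sg n, 0))" and ?W = "(K \<times> J) \<times> {..<n + 2}"
  let ?d = "delta (n + 2) (lex_less lt)"
  have lin: "linear_strict (K \<times> J) (lex_less lt)" by (rule linear_strict_lex_less[OF eta_min_linear[OF K]])
  have uW: "?u \<in> ?W" "?v \<in> ?W"
    by (rule cover_model_mem[OF C assms(1)], rule cover_model_mem[OF C assms(2)])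
  have "sat C v (shift_fm n j k) \<longleftrightarrow> (\<exists>a\<in>carr C (sg n).
     (?d ?u (cd (sg n) a) = int j \<and> ?d (cd (sg n) a) ?u = int ((n + 2 - j) mod (n + 2))) \<and>
     same_block_shift (n + 2) 0 (int k) (cd (sg n) a) ?v)"
  proof -
    have "sat C (v((sg n, k + 2) := a)) (Conj (Conj (delta_fm n j (k + 3) (k + 2))
     (delta_fm n ((n + 2 - j) mod (n + 2)) (k + 2) (k + 3))) (dist_fm n k)) \<longleftrightarrow>
      (?d ?u (cd (sg n) a) = int j \<and> ?d (cd (sg n) a) ?u = int ((n + 2 - j) mod (n + 2))) \<and>
      same_block_shift (n + 2) 0 (int k) (cd (sg n) a) ?v" if "a \<in> carr C (sg n)" for a
    proof -
      define w where "w = v((sg n, k + 2) := a)"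
      have w: "w (sg n, k + 2) = a" "w (sg n, k + 3) = v (sg n, k + 3)" "w (sg n, 0) = v (sg n, 0)"
        by (simp_all add: w_def)
      have "sat C w (dist_fm n k) \<longleftrightarrow> same_block_shift (n + 2) 0 (int k) (cd (sg n) a) ?v"
        using sat_dist_fm[of w n k] that assms unfolding w by blast
      moreover have "sat C w (delta_fm n j (k + 3) (k + 2)) \<longleftrightarrow> ?d ?u (cd (sg n) a) = int j"
        "sat C w (delta_fm n j' (k + 2) (k + 3)) \<longleftrightarrow> ?d (cd (sg n) a) ?u = int j'" for j j'
        using sat_delta_fm[of w n "k + 3" "k + 2" j] sat_delta_fm[of w n "k + 2" "k + 3" j'] that assms
        unfolding w by blast+
      ultimately show ?thesis unfolding w_def[symmetric] by simp
    qed
    then show ?thesis unfolding shift_fm_def by simp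
  qed
  also have "\<dots> \<longleftrightarrow> (\<exists>t\<in>?W. (?d ?u t = int j \<and> ?d t ?u = int ((n + 2 - j) mod (n + 2))) \<and> same_block_shift (n + 2) 0 (int k) t ?v)"
    unfolding bij_betw_imp_surj_on[OF cover_model_bij[OF C, of n], symmetric] by simp
  also have "\<dots> \<longleftrightarrow> (\<exists>t\<in>?W. (fst t = fst ?u \<and> snd t = (snd ?u + j) mod (n + 2)) \<and> same_block_shift (n + 2) 0 (int k) t ?v)"
    using rotation_iff[OF lin _ assms(3) uW(1)] by (intro bex_cong) auto
  also have "\<dots> \<longleftrightarrow> same_block_shift (n + 2) j (int k) ?u ?v"
  proof
    assume "same_block_shift (n + 2) j (int k) ?u ?v"
    moreover have "(fst ?u, (snd ?u + j) mod (n + 2)) \<in> ?W" using uW(1) by (simp add: mem_Times_iff)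
    ultimately show "\<exists>t\<in>?W. (fst t = fst ?u \<and> snd t = (snd ?u + j) mod (n + 2)) \<and> same_block_shift (n + 2) 0 (int k) t ?v"
      by (intro bexI[of _ "(fst ?u, (snd ?u + j) mod (n + 2))"]) (auto simp: same_block_shift_def base_def offset_def)
  qed (auto simp: same_block_shift_def base_def offset_def)
  finally show ?thesis .
qed

end

subsection \<open>Strong homogeneity\<close>

lemma tp_eqD:
  assumes eq: "tp L C {} I a = tp L C {} I b" and "wf_fm L \<phi>"
    and \<tau>: "\<And>x. x \<in> fv \<phi> \<Longrightarrow> \<tau> x \<in> I \<and> fst (a (\<tau> x)) = fst x"
    and "sat C (\<lambda>x. snd (a (\<tau> x))) \<phi>"
  shows "(\<forall>x\<in>fv \<phi>. fst (b (\<tau> x)) = fst x) \<and> sat C (\<lambda>x. snd (b (\<tau> x))) \<phi>"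
proof -
  have "(\<phi>, \<lambda>x. Inl (\<tau> x)) \<in> tp L C {} I a" unfolding tp_def using assms by simp
  then have "(\<phi>, \<lambda>x. Inl (\<tau> x)) \<in> tp L C {} I b" unfolding eq .
  then show ?thesis unfolding tp_def by simp
qed

text \<open>The trivial formula \<open>x = x\<close>, with \<open>x\<close> of the sort of
  \<open>a i\<close>, can be in the type of \<open>b\<close> only if \<open>b i\<close> has that
  sort.\<close>

lemma tp_eq_sort:
  assumes eq: "tp L C A I a = tp L C A I b" and "i \<in> I" "fst (a i) \<in> Sorts L"
  shows "fst (b i) = fst (a i)"
proof -
  let ?\<phi> = "Eq (Var (fst (a i), 0)) (Var (fst (a i), 0))"
  have "(?\<phi>, \<lambda>x. Inl i) \<in> tp L C A I a" unfolding tp_def using assms by simp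
  then have "(?\<phi>, \<lambda>x. Inl i) \<in> tp L C A I b" unfolding eq .
  then show ?thesis unfolding tp_def by simp
qed

lemma same_block_shift_delta:
  assumes "linear_strict K lt" "fst (base u) \<in> K" "snd u < n" "snd v < n" "j < n" "same_block_shift n j k u v"
  shows "delta n lt (base u) (base v) = int j" "delta n lt (base v) (base u) = (- int j) mod int n"
proof -
  have eq: "fst (base v) = fst (base u)" "int (snd v) = (int (snd u) + int j) mod int n"
    using assms(6) by (simp_all add: same_block_shift_def zmod_int)
  have irr: "\<not> lt (fst (base u)) (fst (base u))" by (rule linear_strict_irrefl[OF assms(1,2)])
  have s: "snd (base u) = snd u" "snd (base v) = snd v" by (simp_all add: base_def)
  have "delta n lt (base u) (base v) = int j mod int n"
    unfolding delta_def s eq using irr by (simp add: mod_simps)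
  then show "delta n lt (base u) (base v) = int j" using assms(5) by simp
  show "delta n lt (base v) (base u) = (- int j) mod int n"
    unfolding delta_def s eq using irr by (simp add: mod_simps)
qed

lemma same_block_cases:
  assumes "fst (base u) = fst (base v)" "snd u < n" "snd v < n"
  shows "\<exists>j<n. \<exists>k. same_block_shift n j (int k) u v \<or> same_block_shift n j (int k) v u"
proof -
  have lev: "\<exists>j<n. y = (x + j) mod n" if "x < n" "y < n" for x y
  proof (intro exI conjI)
    show "(y + (n - x)) mod n < n" using that by simp
    have "(x + (y + (n - x)) mod n) mod n = (y + (x + (n - x))) mod n" by (simp add: mod_simps add_ac)
    also have "\<dots> = y" using that by simp
    finally show "y = (x + (y + (n - x)) mod n) mod n" by simp
  qed
  show ?thesis
  proof (cases "offset u \<le> offset v")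
    case True
    obtain j where "j < n" "snd v = (snd u + j) mod n" using lev[OF assms(2,3)] by blast
    then have "same_block_shift n j (int (nat (offset v - offset u))) u v"
      using True assms(1) by (simp add: same_block_shift_def)
    then show ?thesis using \<open>j < n\<close> by blast
  next
    case False
    obtain j where "j < n" "snd u = (snd v + j) mod n" using lev[OF assms(3,2)] by blast
    then have "same_block_shift n j (int (nat (offset u - offset v))) v u"
      using False assms(1) by (simp add: same_block_shift_def)
    then show ?thesis using \<open>j < n\<close> by blast
  qed
qed

context
  fixes C :: "('s::infinite, 'f, 'r::infinite, 'b) struct" and cd J
  assumes C: "cover_model C cd (HQ \<times> J) (lex_less hless)"
    and J: "J = {0} \<or> J = (UNIV :: int set)"
begin

text \<open>The formulas \<open>delta_fm\<close> and \<open>shift_fm\<close>, applied to two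
  coordinates of the tuple, transfer \<open>delta\<close> and the position within a block.\<close>

lemma same_type_same_position:
  assumes eq: "tp osig C {} I a = tp osig C {} I b" and i: "i \<in> I" and j: "j \<in> I"
    and ai: "fst (a i) = sg n" "snd (a i) \<in> carr C (sg n)" and aj: "fst (a j) = sg n" "snd (a j) \<in> carr C (sg n)"
    and bi: "snd (b i) \<in> carr C (sg n)" and bj: "snd (b j) \<in> carr C (sg n)"
  defines "u \<equiv> cd (sg n) (snd (a i))" and "u' \<equiv> cd (sg n) (snd (a j))"
    and "v \<equiv> cd (sg n) (snd (b i))" and "v' \<equiv> cd (sg n) (snd (b j))"
  shows "delta (n + 2) (lex_less hless) v v' = delta (n + 2) (lex_less hless) u u'"
    and "k < n + 2 \<Longrightarrow> same_block_shift (n + 2) k (int m) u u' \<Longrightarrow> same_block_shift (n + 2) k (int m) v v'"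
proof -
  define \<tau> where "\<tau> = (\<lambda>x :: 's var. if snd x = 0 then j else i)"
  let ?d = "nat (delta (n + 2) (lex_less hless) u u')"
  have d: "int ?d = delta (n + 2) (lex_less hless) u u'" using delta_range[of "n + 2" "lex_less hless" u u'] by simp
  have "(\<forall>x\<in>fv (delta_fm n ?d 1 0 :: ('s, 'f, 'r) fm). fst (b (\<tau> x)) = fst x) \<and> sat C (\<lambda>x. snd (b (\<tau> x))) (delta_fm n ?d 1 0)"
  proof (rule tp_eqD[OF eq])
    show "\<tau> x \<in> I \<and> fst (a (\<tau> x)) = fst x" if "x \<in> fv (delta_fm n ?d 1 0 :: ('s, 'f, 'r) fm)" for x
      using that i j ai aj by (auto simp: fv_fms \<tau>_def)
    show "sat C (\<lambda>x. snd (a (\<tau> x))) (delta_fm n ?d 1 0)"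
      using sat_delta_fm[OF C eta_min_HQ J, of "\<lambda>x. snd (a (\<tau> x))" n 1 0] ai aj d by (simp add: \<tau>_def u_def u'_def)
  qed (rule wf_fms)
  then show "delta (n + 2) (lex_less hless) v v' = delta (n + 2) (lex_less hless) u u'"
    using sat_delta_fm[OF C eta_min_HQ J, of "\<lambda>x. snd (b (\<tau> x))" n 1 0 ?d] bi bj d by (simp add: \<tau>_def v_def v'_def)
  assume k: "k < n + 2" and s: "same_block_shift (n + 2) k (int m) u u'"
  have "(\<forall>x\<in>fv (shift_fm n k m :: ('s, 'f, 'r) fm). fst (b (\<tau> x)) = fst x) \<and> sat C (\<lambda>x. snd (b (\<tau> x))) (shift_fm n k m)"
  proof (rule tp_eqD[OF eq])
    show "\<tau> x \<in> I \<and> fst (a (\<tau> x)) = fst x" if "x \<in> fv (shift_fm n k m :: ('s, 'f, 'r) fm)" for x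
    proof -
      have "x \<in> {(sg n, m + 3), (sg n, 0)}" using that fv_fms(4)[of n k m] by blast
      then show ?thesis using i j ai aj by (auto simp: \<tau>_def)
    qed
    show "sat C (\<lambda>x. snd (a (\<tau> x))) (shift_fm n k m)"
      using sat_shift_fm[OF C eta_min_HQ J, of "\<lambda>x. snd (a (\<tau> x))" n m k] ai aj s k by (simp add: \<tau>_def u_def u'_def)
  qed (rule wf_fms)
  then show "same_block_shift (n + 2) k (int m) v v'"
    using sat_shift_fm[OF C eta_min_HQ J, of "\<lambda>x. snd (b (\<tau> x))" n m k] bi bj k by (simp add: \<tau>_def v_def v'_def)
qed

text \<open>No relation links different sorts, so each sort is treated on its own. The type records
  whether two coordinates share a block, in that case their rotation and signed distance, and
  otherwise \<open>delta\<close> of the base points; these are the data that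
  \<open>cover_blocks_homogeneous\<close> asks for.\<close>

lemma cover_homogeneous:
  assumes I: "countable I" and a: "a \<in> I \<rightarrow>\<^sub>E elems osig C" and b: "b \<in> I \<rightarrow>\<^sub>E elems osig C"
    and eq: "tp osig C {} I a = tp osig C {} I b"
  shows "\<exists>g. automorphism osig C g \<and> (\<forall>i\<in>I. b i = (fst (a i), g (fst (a i)) (snd (a i))))"
proof -
  let ?lex = "lex_less hless"
  have am: "fst (a i) \<in> range sg" "snd (a i) \<in> carr C (fst (a i))"
    and bm: "snd (b i) \<in> carr C (fst (b i))" if "i \<in> I" for i
    using PiE_mem[OF a that] PiE_mem[OF b that] by (cases "a i", cases "b i", auto simp: elems_def)+
  have sort: "fst (b i) = fst (a i)" if "i \<in> I" for i
    by (rule tp_eq_sort[OF eq that]) (use am(1)[OF that] in simp)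
  have "\<exists>g. cover_aut (n + 2) (HQ \<times> J) ?lex g \<and>
      (\<forall>i\<in>{i\<in>I. fst (a i) = sg n}. g (cd (sg n) (snd (a i))) = cd (sg n) (snd (b i)))" for n
  proof -
    let ?I = "{i\<in>I. fst (a i) = sg n}"
    let ?u = "\<lambda>i. cd (sg n) (snd (a i))" and ?v = "\<lambda>i. cd (sg n) (snd (b i))" and ?W = "(HQ \<times> J) \<times> {..<n + 2}"
    have c: "snd (a i) \<in> carr C (sg n)" "snd (b i) \<in> carr C (sg n)" if "i \<in> ?I" for i
      using am[of i] bm[of i] sort[of i] that by auto
    have W: "?u i \<in> ?W" "?v i \<in> ?W" if "i \<in> ?I" for i
      by (rule cover_model_mem[OF C c(1)[OF that]], rule cover_model_mem[OF C c(2)[OF that]])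
    have B: "fst (base w) \<in> HQ" "snd w < n + 2" if "w \<in> ?W" for w using that by (auto simp: base_def)
    have I_D: "i \<in> I" "fst (a i) = sg n" "fst (b i) = sg n" if "i \<in> ?I" for i using that sort[of i] by auto
    have pos: "delta (n + 2) ?lex (?v i) (?v j) = delta (n + 2) ?lex (?u i) (?u j)" if ij: "i \<in> ?I" "j \<in> ?I" for i j
      by (rule same_type_same_position(1)[OF eq I_D(1)[OF ij(1)] I_D(1)[OF ij(2)] I_D(2)[OF ij(1)] c(1)[OF ij(1)]
        I_D(2)[OF ij(2)] c(1)[OF ij(2)] c(2)[OF ij(1)] c(2)[OF ij(2)]])
    have uv: "same_block_shift (n + 2) k (int m) (?v i) (?v j)"
      if ij: "i \<in> ?I" "j \<in> ?I" "k < n + 2" "same_block_shift (n + 2) k (int m) (?u i) (?u j)" for i j k m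
      by (rule same_type_same_position(2)[OF eq I_D(1)[OF ij(1)] I_D(1)[OF ij(2)] I_D(2)[OF ij(1)] c(1)[OF ij(1)]
        I_D(2)[OF ij(2)] c(1)[OF ij(2)] c(2)[OF ij(1)] c(2)[OF ij(2)] ij(3,4)])
    have vu: "same_block_shift (n + 2) k (int m) (?u i) (?u j)"
      if ij: "i \<in> ?I" "j \<in> ?I" "k < n + 2" "same_block_shift (n + 2) k (int m) (?v i) (?v j)" for i j k m
      by (rule same_type_same_position(2)[OF eq[symmetric] I_D(1)[OF ij(1)] I_D(1)[OF ij(2)] I_D(3)[OF ij(1)] c(2)[OF ij(1)]
        I_D(3)[OF ij(2)] c(2)[OF ij(2)] c(1)[OF ij(1)] c(1)[OF ij(2)] ij(3,4)])
    note lin = linear_strict_HQ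
    \<comment> \<open>The formulas describe only nonnegative shifts, so a pair within one block is
      read in whichever direction has this form.\<close>
    have both: "delta (n + 2) hless (base (?u i)) (base (?u j)) = delta (n + 2) hless (base (?v i)) (base (?v j)) \<and>
       offset (?u j) - offset (?u i) = offset (?v j) - offset (?v i)"
      if ij: "i \<in> ?I" "j \<in> ?I" and k: "k < n + 2"
        and s: "same_block_shift (n + 2) k (int m) (?u i) (?u j) \<or> same_block_shift (n + 2) k (int m) (?u j) (?u i)" for i j k m
      using s
    proof
      assume s: "same_block_shift (n + 2) k (int m) (?u i) (?u j)"
      note s' = uv[OF ij k s]
      show ?thesis
        using same_block_shift_delta(1)[OF lin B(1)[OF W(1)[OF ij(1)]] B(2)[OF W(1)[OF ij(1)]] B(2)[OF W(1)[OF ij(2)]] k s]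
          same_block_shift_delta(1)[OF lin B(1)[OF W(2)[OF ij(1)]] B(2)[OF W(2)[OF ij(1)]] B(2)[OF W(2)[OF ij(2)]] k s'] s s'
        by (simp add: same_block_shift_def)
    next
      assume s: "same_block_shift (n + 2) k (int m) (?u j) (?u i)"
      note s' = uv[OF ij(2,1) k s]
      show ?thesis
        using same_block_shift_delta(2)[OF lin B(1)[OF W(1)[OF ij(2)]] B(2)[OF W(1)[OF ij(2)]] B(2)[OF W(1)[OF ij(1)]] k s]
          same_block_shift_delta(2)[OF lin B(1)[OF W(2)[OF ij(2)]] B(2)[OF W(2)[OF ij(2)]] B(2)[OF W(2)[OF ij(1)]] k s'] s s'
        by (simp add: same_block_shift_def)
    qed
    have fst_iff: "fst (base (?u i)) = fst (base (?u j)) \<longleftrightarrow> fst (base (?v i)) = fst (base (?v j))"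
      if ij: "i \<in> ?I" "j \<in> ?I" for i j
    proof
      assume "fst (base (?u i)) = fst (base (?u j))"
      from same_block_cases[OF this B(2)[OF W(1)[OF ij(1)]] B(2)[OF W(1)[OF ij(2)]]] obtain k m
        where "k < n + 2" "same_block_shift (n + 2) k (int m) (?u i) (?u j) \<or> same_block_shift (n + 2) k (int m) (?u j) (?u i)" by blast
      then have "same_block_shift (n + 2) k (int m) (?v i) (?v j) \<or> same_block_shift (n + 2) k (int m) (?v j) (?v i)"
        using uv[OF ij] uv[OF ij(2,1)] by blast
      then show "fst (base (?v i)) = fst (base (?v j))" by (auto simp: same_block_shift_def)
    next
      assume "fst (base (?v i)) = fst (base (?v j))"
      from same_block_cases[OF this B(2)[OF W(2)[OF ij(1)]] B(2)[OF W(2)[OF ij(2)]]] obtain k m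
        where "k < n + 2" "same_block_shift (n + 2) k (int m) (?v i) (?v j) \<or> same_block_shift (n + 2) k (int m) (?v j) (?v i)" by blast
      then have "same_block_shift (n + 2) k (int m) (?u i) (?u j) \<or> same_block_shift (n + 2) k (int m) (?u j) (?u i)"
        using vu[OF ij] vu[OF ij(2,1)] by blast
      then show "fst (base (?u i)) = fst (base (?u j))" by (auto simp: same_block_shift_def)
    qed
    show ?thesis
    proof (rule cover_blocks_homogeneous[OF _ _ J])
      show "countable ?I" using I by simp
      show "?u ` ?I \<subseteq> ?W" "?v ` ?I \<subseteq> ?W" using W by blast+
      fix i j assume ij: "i \<in> ?I" "j \<in> ?I"
      note Bu = B(1)[OF W(1)[OF ij(1)]] B(1)[OF W(1)[OF ij(2)]] and Bv = B(1)[OF W(2)[OF ij(1)]] B(1)[OF W(2)[OF ij(2)]]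
      show "delta (n + 2) hless (base (?u i)) (base (?u j)) = delta (n + 2) hless (base (?v i)) (base (?v j))"
      proof (cases "fst (base (?u i)) = fst (base (?u j))")
        case True
        from same_block_cases[OF this B(2)[OF W(1)[OF ij(1)]] B(2)[OF W(1)[OF ij(2)]]]
        show ?thesis using both[OF ij] by blast
      next
        case False
        \<comment> \<open>For different blocks the offsets have no influence: \<open>delta\<close>
          of the points is already \<open>delta\<close> of their base points.\<close>
        have f: "fst (base (?v i)) \<noteq> fst (base (?v j))" using False fst_iff[OF ij] by simp
        have idem: "delta (n + 2) hless x y mod int (n + 2) = delta (n + 2) hless x y" for x y
          by (simp add: delta_def)
        have "delta (n + 2) ?lex (?u i) (?u j) = delta (n + 2) hless (base (?u i)) (base (?u j))"
          unfolding delta_lex_less[OF lin Bu] using False idem by simp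
        moreover have "delta (n + 2) ?lex (?v i) (?v j) = delta (n + 2) hless (base (?v i)) (base (?v j))"
          unfolding delta_lex_less[OF lin Bv] using f idem by simp
        ultimately show ?thesis using pos[OF ij] by simp
      qed
      assume eqf: "fst (base (?u i)) = fst (base (?u j))"
      from same_block_cases[OF this B(2)[OF W(1)[OF ij(1)]] B(2)[OF W(1)[OF ij(2)]]]
      show "offset (?u j) - offset (?u i) = offset (?v j) - offset (?v i)" using both[OF ij] by blast
    qed simp
  qed
  then obtain G where G: "\<And>n. cover_aut (n + 2) (HQ \<times> J) ?lex (G n)"
    and Gab: "\<And>n i. i \<in> I \<Longrightarrow> fst (a i) = sg n \<Longrightarrow> G n (cd (sg n) (snd (a i))) = cd (sg n) (snd (b i))"
    by (atomize_elim, unfold all_conj_distrib[symmetric]) (rule choice, blast)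
  from cover_model_isomorphism[OF C C cover_aut_bij[OF G] cover_aut_delta[OF G]] obtain g
    where g: "isomorphism osig C C g"
      and gG: "\<forall>n. \<forall>a\<in>carr C (sg n). g (sg n) a \<in> carr C (sg n) \<and> cd (sg n) (g (sg n) a) = G n (cd (sg n) a)" by blast
  have "b i = (fst (a i), g (fst (a i)) (snd (a i)))" if i: "i \<in> I" for i
  proof -
    obtain n where n: "fst (a i) = sg n" using am(1)[OF i] by blast
    have ca: "snd (a i) \<in> carr C (sg n)" and cb: "snd (b i) \<in> carr C (sg n)"
      using am(2)[OF i] bm[OF i] sort[OF i] n by auto
    have "snd (b i) = g (sg n) (snd (a i))"
      by (rule cover_model_inj[OF C cb]) (use gG ca Gab[OF i n] in auto)
    then show ?thesis using n sort[OF i] by (simp add: prod_eq_iff)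
  qed
  then show ?thesis using g unfolding automorphism_isomorphism by blast
qed

end

subsection \<open>The monster model\<close>

text \<open>A function is stored as its graph: each value is tagged with its argument, so the range
  determines the function. The resulting set of naturals becomes a set of iterated
  negations.\<close>

definition univ_code :: "((nat \<Rightarrow> rat) \<times> int) \<times> nat \<Rightarrow> ('s, 'f, 'r) univ" where
  "univ_code p = (\<lambda>m. (Neg ^^ m) (Eq (Var undefined) (Var undefined))) ` range (\<lambda>n. to_nat (n, fst (fst p) n, snd (fst p), snd p))"

text \<open>Infinitely many formulas that are available over any symbol types.\<close>

lemma inj_Neg_power: "inj (\<lambda>m. (Neg ^^ m) (Eq t u))"
proof (rule injI)
  fix m n :: nat
  show "(Neg ^^ m) (Eq t u) = (Neg ^^ n) (Eq t u) \<Longrightarrow> m = n"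
  proof (induction m arbitrary: n)
    case 0
    then show ?case by (cases n) auto
  next
    case (Suc m)
    then show ?case by (cases n) auto
  qed
qed

lemma inj_univ_code: "inj univ_code"
proof (rule injI)
  fix p q :: "((nat \<Rightarrow> rat) \<times> int) \<times> nat"
  assume "univ_code p = univ_code q"
  then have eq: "range (\<lambda>n. to_nat (n, fst (fst p) n, snd (fst p), snd p)) = range (\<lambda>n. to_nat (n, fst (fst q) n, snd (fst q), snd q))"
    unfolding univ_code_def inj_image_eq_iff[OF inj_Neg_power] .
  have "fst (fst p) n = fst (fst q) n \<and> snd (fst p) = snd (fst q) \<and> snd p = snd q" for n
  proof -
    have "to_nat (n, fst (fst p) n, snd (fst p), snd p) \<in> range (\<lambda>n. to_nat (n, fst (fst q) n, snd (fst q), snd q))"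
      unfolding eq[symmetric] by (rule rangeI)
    then obtain m where "(n, fst (fst p) n, snd (fst p), snd p) = (m, fst (fst q) m, snd (fst q), snd q)"
      by (auto dest: injD[OF inj_to_nat])
    then show ?thesis by auto
  qed
  then show "p = q" by (simp add: prod_eq_iff fun_eq_iff)
qed

definition monster_struct :: "int set \<Rightarrow> ('s::infinite, 'f, 'r::infinite, ('s, 'f, 'r) univ) struct" where
  "monster_struct J = \<lparr>carr = (\<lambda>s. univ_code ` ((HQ \<times> J) \<times> {..<inv sg s + 2})), fint = (\<lambda>_ _. {}),
     rint = (\<lambda>r us. delta (fst (prod_decode (inv sg r)) + 2) (lex_less hless) (inv univ_code (us ! 0)) (inv univ_code (us ! 1))
        = int (snd (prod_decode (inv sg r))))\<rparr>"

lemma zero_HQ: "least_of HQ hless (rep (\<lambda>_. 0))"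
proof -
  have "rep (\<lambda>_. 0 :: rat) \<in> HQ" by (rule rep_in_ultraproduct) simp
  moreover have "x = rep (\<lambda>_. 0) \<or> hless (rep (\<lambda>_. 0)) x" if x: "x \<in> HQ" for x
  proof -
    have "\<forall>\<^sub>F k in \<U>. x k = rep (\<lambda>_. 0) k \<or> 0 < x k"
      using ultraproduct_ev[OF x] rep_eq[of "\<lambda>_. 0 :: rat"] by eventually_elim auto
    then have "(\<forall>\<^sub>F k in \<U>. x k = rep (\<lambda>_. 0) k) \<or> hless (\<lambda>_. 0) x"
      unfolding eventually_ultra_disj ultra_less_def .
    then show ?thesis
      using ultraproduct_eqI[OF x \<open>rep (\<lambda>_. 0) \<in> HQ\<close>] ultra_less_rep(1)[of "\<lambda>_. (<)" "\<lambda>_. 0" x] by blast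
  qed
  ultimately show ?thesis unfolding least_of_def by blast
qed

lemma monster_struct_cover:
  assumes "J \<noteq> {}"
  shows "cover_model (monster_struct J :: ('s::infinite, 'f, 'r::infinite, _) struct) (\<lambda>_. inv univ_code) (HQ \<times> J) (lex_less hless)"
proof -
  have "HQ \<times> J \<noteq> {}" using zero_HQ assms unfolding least_of_def by blast
  moreover have "bij_betw (inv univ_code) ((univ_code :: _ \<Rightarrow> ('s, 'f, 'r) univ) ` W) W" for W
    by (rule bij_betw_byWitness[where f' = univ_code]) (auto simp: inv_f_f[OF inj_univ_code])
  ultimately show ?thesis
    unfolding cover_model_def monster_struct_def by (simp add: rl_def)
qed

text \<open>The work is divided: saturation and the theory come from \<open>A\<close> by back and
  forth, and strong homogeneity is the property of \<open>HQ\<close>.\<close>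

lemma monster_monster:
  fixes A :: "('s::infinite, 'f, 'r::infinite, 'a) struct" and \<kappa> :: "('s, 'f, 'r) univ rel"
  assumes A: "cover_model A cdA (K \<times> J) (lex_less lt)" and K: "eta_min K lt" and sat: "countably_saturated_struct osig A"
    and J: "J = {0} \<or> J = (UNIV :: int set)" and \<kappa>: "Card_order \<kappa>" "\<kappa> =o cardSuc natLeq"
  shows "monster osig (Th osig A) \<kappa> (monster_struct J)"
proof -
  let ?C = "monster_struct J :: ('s, 'f, 'r, ('s, 'f, 'r) univ) struct"
  have C: "cover_model ?C (\<lambda>_. inv univ_code) (HQ \<times> J) (lex_less hless)" by (rule monster_struct_cover) (use J in auto)
  have "is_model osig (Th osig A) ?C"
    unfolding is_model_def using cover_model_structure[OF C] cover_model_Th_eq[OF A C K eta_min_HQ] by simp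
  moreover have "|{\<phi> :: ('s, 'f, 'r) fm. wf_fm osig \<phi>}| <o \<kappa>"
    unfolding aleph1_countable[OF \<kappa>(2)] by (rule countable_wf_osig)
  moreover have "saturated osig \<kappa> ?C"
    by (rule saturated_transfer[OF A C K eta_min_HQ sat]) (simp add: aleph1_countable[OF \<kappa>(2)])
  moreover have "strongly_homogeneous osig \<kappa> ?C"
    unfolding strongly_homogeneous_def aleph1_countable[OF \<kappa>(2)]
    using cover_homogeneous[OF C J] by blast
  ultimately show ?thesis unfolding monster_def using \<kappa>(1) by blast
qed

section \<open>The Lascar distance in the monster model\<close>

subsection \<open>Lower bound\<close>

lemma mod_add3_eq: "(a mod n + b mod n + c) mod n = (a + b + c) mod (n :: int)"
  by (metis mod_add_eq mod_add_left_eq)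

text \<open>The error is a carry: going from \<open>u\<close> to \<open>w\<close> by way of
  \<open>v\<close> drops to a smaller first coordinate at most once more than going directly, and
  never less often.\<close>

lemma delta_triangle:
  assumes lin: "linear_strict K lt" and "fst u \<in> K" "fst v \<in> K" "fst w \<in> K"
  shows "\<exists>s\<in>{0, 1}. delta n lt u w = (delta n lt u v + delta n lt v w + s) mod int n"
proof -
  let ?s = "of_bool (lt (fst v) (fst u)) + of_bool (lt (fst w) (fst v)) - of_bool (lt (fst w) (fst u)) :: int"
  have s: "?s \<in> {0, 1}"
    using linear_strict_trans[OF lin assms(4,3,2)] linear_strict_total[OF lin assms(2,3)] linear_strict_total[OF lin assms(3,4)]
      linear_strict_trans[OF lin assms(4,2,3)] linear_strict_trans[OF lin assms(3,4,2)] linear_strict_asym[OF lin _ assms(4,2)]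
    by (cases "lt (fst v) (fst u)"; cases "lt (fst w) (fst v)"; cases "lt (fst w) (fst u)") auto
  have "(delta n lt u v + delta n lt v w + ?s) mod int n = delta n lt u w"
    unfolding delta_def mod_add3_eq by (rule arg_cong[of _ _ "\<lambda>x. x mod int n"]) simp
  then show ?thesis using s by metis
qed

text \<open>Both points lie in the same arc between two consecutive rotations of \<open>e\<close>,
  so going from \<open>u\<close> to \<open>v\<close> covers less than one turn of the base circle,
  forwards or backwards.\<close>

lemma delta_same_arc:
  assumes lin: "linear_strict K lt" and K: "fst e \<in> K" "fst u \<in> K" "fst v \<in> K"
    and eq: "delta n lt e u = delta n lt e v"
  shows "\<exists>t\<in>{-1, 0}. delta n lt u v = t mod int n"
proof -
  let ?t = "of_bool (lt (fst v) (fst e)) - of_bool (lt (fst u) (fst e)) - of_bool (lt (fst v) (fst u)) :: int"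
  have "(int (snd u) - int (snd e) - of_bool (lt (fst u) (fst e))) mod int n =
      (int (snd v) - int (snd e) - of_bool (lt (fst v) (fst e))) mod int n"
    using eq by (simp add: delta_def)
  then have "int n dvd (int (snd u) - int (snd e) - of_bool (lt (fst u) (fst e)))
      - (int (snd v) - int (snd e) - of_bool (lt (fst v) (fst e)))"
    by (simp add: mod_eq_dvd_iff)
  moreover have "(int (snd u) - int (snd e) - of_bool (lt (fst u) (fst e)))
      - (int (snd v) - int (snd e) - of_bool (lt (fst v) (fst e)))
    = ?t - (int (snd v) - int (snd u) - of_bool (lt (fst v) (fst u)))" by simp
  ultimately have "?t mod int n = (int (snd v) - int (snd u) - of_bool (lt (fst v) (fst u))) mod int n"
    by (simp add: mod_eq_dvd_iff)
  then have "delta n lt u v = ?t mod int n" by (simp add: delta_def)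
  moreover have "?t \<in> {-1, 0}"
    using linear_strict_trans[OF lin K(3,1,2)] linear_strict_total[OF lin K(1,2)] linear_strict_total[OF lin K(1,3)]
      linear_strict_total[OF lin K(2,3)] linear_strict_trans[OF lin K(3,2,1)] linear_strict_asym[OF lin _ K(3,1)]
      linear_strict_irrefl[OF lin K(1)]
    by (cases "lt (fst v) (fst e)"; cases "lt (fst u) (fst e)"; cases "lt (fst v) (fst u)") auto
  ultimately show ?thesis by blast
qed

text \<open>A model has a point \<open>e\<close> in every sort, and the type over the model fixes
  \<open>delta\<close> from \<open>e\<close>; \<open>delta_same_arc\<close> applies.\<close>

lemma lascar_step_lower:
  fixes C :: "('s::infinite, 'f, 'r::infinite, 'b) struct"
  assumes C: "cover_model C cd K lt" and lin: "linear_strict K lt"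
    and A: "elementary_submodel osig C A" and eq: "tp osig C A I c = tp osig C A I c'"
    and i: "i \<in> I" "fst (c i) = sg n" "snd (c i) \<in> carr C (sg n)" "snd (c' i) \<in> carr C (sg n)"
  shows "fst (c' i) = sg n" "\<exists>t\<in>{-1, 0}. delta (n + 2) lt (cd (sg n) (snd (c i))) (cd (sg n) (snd (c' i))) = t mod int (n + 2)"
proof -
  show s: "fst (c' i) = sg n" using tp_eq_sort[OF eq i(1)] i(2) by simp
  have "carr (substructure_on C A) (sg n) \<noteq> {}"
    using A unfolding elementary_submodel_def is_structure_def by simp
  then obtain e where eA: "(sg n, e) \<in> A" by (auto simp: substructure_on_def)
  then have e: "e \<in> carr C (sg n)" using A unfolding elementary_submodel_def elems_def by auto
  let ?d = "nat (delta (n + 2) lt (cd (sg n) e) (cd (sg n) (snd (c i))))"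
  have d: "int ?d = delta (n + 2) lt (cd (sg n) e) (cd (sg n) (snd (c i)))"
    using delta_range[of "n + 2" lt "cd (sg n) e" "cd (sg n) (snd (c i))"] by simp
  define \<tau> where "\<tau> = (\<lambda>x :: 's var. if snd x = 0 then Inr e else Inl i)"
  let ?\<phi> = "delta_fm n ?d 0 1 :: ('s, 'f, 'r) fm"
  have "(?\<phi>, \<tau>) \<in> tp osig C A I c"
    unfolding tp_def using i e eA d cover_model_rint[OF C e i(3), of ?d] wf_fms(1)[of n ?d 0 1]
    by (auto simp: \<tau>_def fv_fms delta_fm_def)
  then have "(?\<phi>, \<tau>) \<in> tp osig C A I c'" unfolding eq .
  then have "rint C (rl n ?d) [e, snd (c' i)]" unfolding tp_def by (auto simp: \<tau>_def delta_fm_def)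
  then have "delta (n + 2) lt (cd (sg n) e) (cd (sg n) (snd (c' i))) = int ?d"
    using cover_model_rint[OF C e i(4)] by simp
  then have "delta (n + 2) lt (cd (sg n) e) (cd (sg n) (snd (c i))) = delta (n + 2) lt (cd (sg n) e) (cd (sg n) (snd (c' i)))"
    using d by simp
  moreover have "fst (cd (sg n) e) \<in> K" "fst (cd (sg n) (snd (c i))) \<in> K" "fst (cd (sg n) (snd (c' i))) \<in> K"
    using cover_model_mem[OF C e] cover_model_mem[OF C i(3)] cover_model_mem[OF C i(4)] by (auto simp: mem_Times_iff)
  ultimately show "\<exists>t\<in>{-1, 0}. delta (n + 2) lt (cd (sg n) (snd (c i))) (cd (sg n) (snd (c' i))) = t mod int (n + 2)"
    by (intro delta_same_arc[OF lin])
qed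

text \<open>A step contributes \<open>-1\<close> or \<open>0\<close> and the carry of
  \<open>delta_triangle\<close> contributes \<open>0\<close> or \<open>1\<close>. Together they
  change the total by at most one in absolute value.\<close>

lemma lascar_chain_lower:
  assumes C: "cover_model C cd K lt" and lin: "linear_strict K lt"
    and chain: "lascar_chain osig \<kappa> C I m a b" and i: "i \<in> I" "fst (a i) = sg n"
  shows "\<exists>t. \<bar>t\<bar> \<le> int m \<and> delta (n + 2) lt (cd (sg n) (snd (a i))) (cd (sg n) (snd (b i))) = t mod int (n + 2)"
proof -
  obtain c where c: "c 0 = a" "c m = b" "\<And>j. j \<le> m \<Longrightarrow> c j \<in> I \<rightarrow>\<^sub>E elems osig C"
    and st: "\<And>j. j < m \<Longrightarrow> \<exists>A. |A| <o \<kappa> \<and> elementary_submodel osig C A \<and> tp osig C A I (c j) = tp osig C A I (c (Suc j))"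
    using chain unfolding lascar_chain_def by blast
  let ?p = "\<lambda>j. cd (sg n) (snd (c j i))"
  have "j \<le> m \<Longrightarrow> fst (c j i) = sg n \<and> (\<exists>t. \<bar>t\<bar> \<le> int j \<and> delta (n + 2) lt (?p 0) (?p j) = t mod int (n + 2))" for j
  proof (induction j)
    case 0
    have "snd (a i) \<in> carr C (sg n)" using PiE_mem[OF c(3)[of 0] i(1)] c(1) i(2) by (cases "a i") (auto simp: elems_def)
    then have "fst (?p 0) \<in> K" using cover_model_mem[OF C] c(1) by (auto simp: mem_Times_iff)
    then have "delta (n + 2) lt (?p 0) (?p 0) = 0" using linear_strict_irrefl[OF lin] by (simp add: delta_def)
    then show ?case using c(1) i(2) by (intro conjI exI[of _ 0]) auto
  next
    case (Suc j)
    then obtain t where f: "fst (c j i) = sg n" and t: "\<bar>t\<bar> \<le> int j" "delta (n + 2) lt (?p 0) (?p j) = t mod int (n + 2)"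
      by auto
    obtain A where A: "elementary_submodel osig C A" "tp osig C A I (c j) = tp osig C A I (c (Suc j))"
      using st[of j] Suc.prems by auto
    have "fst (c (Suc j) i) = sg n" using tp_eq_sort[OF A(2) i(1)] f by simp
    moreover have mem: "snd (c l i) \<in> carr C (sg n)" if "l \<le> m" "fst (c l i) = sg n" for l
      using PiE_mem[OF c(3)[OF that(1)] i(1)] that(2) by (cases "c l i") (auto simp: elems_def)
    moreover have f0: "fst (c 0 i) = sg n" using c(1) i(2) by simp
    ultimately have m: "snd (c 0 i) \<in> carr C (sg n)" "snd (c j i) \<in> carr C (sg n)" "snd (c (Suc j) i) \<in> carr C (sg n)"
      using Suc.prems f by auto
    obtain t' where t': "t' \<in> {-1, 0}" "delta (n + 2) lt (?p j) (?p (Suc j)) = t' mod int (n + 2)"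
      using lascar_step_lower(2)[OF C lin A i(1) f m(2,3)] by blast
    have K: "fst (?p 0) \<in> K" "fst (?p j) \<in> K" "fst (?p (Suc j)) \<in> K"
      using cover_model_mem[OF C m(1)] cover_model_mem[OF C m(2)] cover_model_mem[OF C m(3)] by (auto simp: mem_Times_iff)
    obtain s where s: "s \<in> {0, 1}" "delta (n + 2) lt (?p 0) (?p (Suc j)) = (delta (n + 2) lt (?p 0) (?p j) + delta (n + 2) lt (?p j) (?p (Suc j)) + s) mod int (n + 2)"
      using delta_triangle[OF lin K] by blast
    have "delta (n + 2) lt (?p 0) (?p (Suc j)) = (t + t' + s) mod int (n + 2)"
      unfolding s(2) t(2) t'(2) by (rule mod_add3_eq)
    moreover have "\<bar>t + t' + s\<bar> \<le> int (Suc j)" using t(1) t'(1) s(1) by auto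
    ultimately show ?case using \<open>fst (c (Suc j) i) = sg n\<close> by blast
  qed
  from this[of m] show ?thesis unfolding c(1,2) by blast
qed

subsection \<open>Upper bound\<close>

lemma tp_automorphism:
  assumes L: "wf_signature L" and C: "is_structure L C" and g: "automorphism L C g"
    and A: "A \<subseteq> elems L C" and fixes_A: "\<And>s a. (s, a) \<in> A \<Longrightarrow> g s a = a"
    and c: "c \<in> I \<rightarrow>\<^sub>E elems L C" and c': "\<And>i. i \<in> I \<Longrightarrow> c' i = (fst (c i), g (fst (c i)) (snd (c i)))"
  shows "tp L C A I c = tp L C A I c'"
proof -
  have "(\<phi>, \<tau>) \<in> tp L C A I c \<longleftrightarrow> (\<phi>, \<tau>) \<in> tp L C A I c'" for \<phi> \<tau>
  proof -
    let ?ok = "\<lambda>c. wf_fm L \<phi> \<and> (\<forall>x\<in>fv \<phi>. case \<tau> x of Inl i \<Rightarrow> i \<in> I \<and> fst (c i) = fst x | Inr c \<Rightarrow> (fst x, c) \<in> A)"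
    have ok: "?ok c \<longleftrightarrow> ?ok c'" using c' by (auto split: sum.splits)
    have "sat C (\<lambda>x. case \<tau> x of Inl i \<Rightarrow> snd (c i) | Inr c \<Rightarrow> c) \<phi> \<longleftrightarrow>
        sat C (\<lambda>x. case \<tau> x of Inl i \<Rightarrow> snd (c' i) | Inr c \<Rightarrow> c) \<phi>" if "?ok c"
    proof (rule sat_isomorphism[OF g[unfolded automorphism_isomorphism] C L])
      show "wf_fm L \<phi>" using that by blast
      show "\<forall>x\<in>fv \<phi>. (case \<tau> x of Inl i \<Rightarrow> snd (c i) | Inr c \<Rightarrow> c) \<in> carr C (fst x) \<and>
        (case \<tau> x of Inl i \<Rightarrow> snd (c' i) | Inr c \<Rightarrow> c) = g (fst x) (case \<tau> x of Inl i \<Rightarrow> snd (c i) | Inr c \<Rightarrow> c)"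
      proof
        fix x assume x: "x \<in> fv \<phi>"
        show "(case \<tau> x of Inl i \<Rightarrow> snd (c i) | Inr c \<Rightarrow> c) \<in> carr C (fst x) \<and>
          (case \<tau> x of Inl i \<Rightarrow> snd (c' i) | Inr c \<Rightarrow> c) = g (fst x) (case \<tau> x of Inl i \<Rightarrow> snd (c i) | Inr c \<Rightarrow> c)"
        proof (cases "\<tau> x")
          case (Inl i)
          then have i: "i \<in> I" "fst (c i) = fst x" using that x by auto
          have "snd (c i) \<in> carr C (fst x)" using PiE_mem[OF c i(1)] i(2) by (cases "c i") (auto simp: elems_def)
          then show ?thesis using Inl c'[OF i(1)] i(2) by simp
        next
          case (Inr d)
          then have d: "(fst x, d) \<in> A" using that x by auto
          then have "d \<in> carr C (fst x)" using A by (auto simp: elems_def)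
          then show ?thesis using Inr fixes_A[OF d] by simp
        qed
      qed
    qed
    then show ?thesis unfolding tp_def using ok by auto
  qed
  then show ?thesis by auto
qed

lemma elementary_submodel_image:
  fixes C :: "('s::infinite, 'f, 'r::infinite, 'b) struct"
  assumes C: "is_structure osig C" and h: "automorphism osig C h" and A: "elementary_submodel osig C A"
  shows "elementary_submodel osig C ((\<lambda>(s, a). (s, h s a)) ` A)"
proof -
  let ?A' = "(\<lambda>(s, a). (s, h s a)) ` A"
  let ?S = "substructure_on C A" and ?S' = "substructure_on C ?A'"
  have AC: "A \<subseteq> elems osig C" and S: "is_structure osig ?S"
    and el: "\<And>\<phi> v. wf_fm osig \<phi> \<Longrightarrow> is_valuation osig ?S v \<Longrightarrow> sat ?S v \<phi> \<longleftrightarrow> sat C v \<phi>"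
    using A unfolding elementary_submodel_def by blast+
  have bij: "bij_betw (h (sg n)) (carr C (sg n)) (carr C (sg n))" for n
    using h unfolding automorphism_def by simp
  have carr': "carr ?S' s = h s ` carr ?S s" for s
    by (auto simp: substructure_on_def image_iff) force
  have sub: "carr ?S (sg n) \<subseteq> carr C (sg n)" for n using AC by (auto simp: substructure_on_def elems_def)
  have inj: "inj_on (h (sg n)) (carr ?S (sg n))" for n
    by (rule inj_on_subset[OF bij_betw_imp_inj_on[OF bij] sub])
  have iso: "isomorphism osig ?S ?S' h"
  proof -
    have "rint C (rl n j) [a, b] \<longleftrightarrow> rint C (rl n j) [h (sg n) a, h (sg n) b]"
      if "a \<in> carr ?S (sg n)" "b \<in> carr ?S (sg n)" for n j a b
    proof -
      have "[a, b] \<in> tuples C (rdom osig (rl n j :: 'r))" using that sub by (auto simp: tuples_pair)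
      then show ?thesis using h unfolding automorphism_def by fastforce
    qed
    moreover have "rint ?S = rint C" "rint ?S' = rint C" by (simp_all add: substructure_on_def)
    ultimately show ?thesis
      unfolding isomorphism_def using inj carr' by (auto simp: tuples_pair bij_betw_def)
  qed
  have "is_structure osig ?S'" using S unfolding is_structure_def carr' by simp
  moreover have "?A' \<subseteq> elems osig C"
    using AC bij_betwE[OF bij] by (auto simp: elems_def)
  moreover have "sat ?S' w \<phi> \<longleftrightarrow> sat C w \<phi>" if \<phi>: "wf_fm osig \<phi>" and w: "is_valuation osig ?S' w" for \<phi> w
  proof -
    define v where "v = (\<lambda>x. inv_into (carr ?S (fst x)) (h (fst x)) (w x))"
    have wS: "w (sg n, k) \<in> h (sg n) ` carr ?S (sg n)" for n k using w unfolding is_valuation_def carr' by simp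
    have v: "v (sg n, k) \<in> carr ?S (sg n)" "h (sg n) (v (sg n, k)) = w (sg n, k)" for n k
      using inv_into_into[OF wS] f_inv_into_f[OF wS] by (simp_all add: v_def)
    have vv: "is_valuation osig ?S v" unfolding is_valuation_def using v(1) by auto
    have fvs: "\<exists>n k. x = (sg n, k)" if "x \<in> fv \<phi>" for x
      using fv_sorts[OF \<phi> that] by (cases x) auto
    have "sat ?S v \<phi> \<longleftrightarrow> sat ?S' w \<phi>"
      by (rule sat_isomorphism[OF iso S wf_osig \<phi>]) (use fvs v in force)
    moreover have "sat C v \<phi> \<longleftrightarrow> sat C w \<phi>"
      by (rule sat_isomorphism[OF h[unfolded automorphism_isomorphism] C wf_osig \<phi>]) (use fvs v sub in force)
    ultimately show ?thesis using el[OF \<phi> vv] by simp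
  qed
  ultimately show ?thesis unfolding elementary_submodel_def by blast
qed

lemma cover_aut_inverse:
  assumes g: "cover_aut n K lt g"
  shows "cover_aut n K lt (inv_into (K \<times> {..<n}) g)"
proof (rule cover_autI)
  let ?W = "K \<times> {..<n}"
  show b: "bij_betw (inv_into ?W g) ?W ?W" by (rule bij_betw_inv_into[OF cover_aut_bij[OF g]])
  fix u v assume u: "u \<in> ?W" and v: "v \<in> ?W"
  have m: "inv_into ?W g u \<in> ?W" "inv_into ?W g v \<in> ?W" using bij_betwE[OF b] u v by blast+
  have "g (inv_into ?W g u) = u" "g (inv_into ?W g v) = v"
    using bij_betw_inv_into_right[OF cover_aut_bij[OF g]] u v by blast+
  then show "delta n lt (inv_into ?W g u) (inv_into ?W g v) = delta n lt u v"
    using cover_aut_delta[OF g m] by simp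
qed

context
  fixes C :: "('s::infinite, 'f, 'r::infinite, 'b) struct" and cd J
  assumes C: "cover_model C cd (HQ \<times> J) (lex_less hless)"
    and J: "J = {0} \<or> J = (UNIV :: int set)"
begin

text \<open>Relations never involve two sorts, so an automorphism of one cover extends by the
  identity on the others.\<close>

lemma one_sort_automorphism:
  assumes g: "cover_aut (n + 2) (HQ \<times> J) (lex_less hless) g"
  shows "\<exists>G. automorphism osig C G \<and> (\<forall>a\<in>carr C (sg n). cd (sg n) (G (sg n) a) = g (cd (sg n) a)) \<and>
    (\<forall>m a. m \<noteq> n \<longrightarrow> a \<in> carr C (sg m) \<longrightarrow> G (sg m) a = a)"
proof -
  define H where "H = (\<lambda>m. if m = n then g else id)"
  have H: "cover_aut (m + 2) (HQ \<times> J) (lex_less hless) (H m)" for m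
    using g by (auto simp: H_def intro: cover_autI)
  from cover_model_isomorphism[OF C C cover_aut_bij[OF H] cover_aut_delta[OF H]] obtain G
    where G: "isomorphism osig C C G"
      and GH: "\<forall>m. \<forall>a\<in>carr C (sg m). G (sg m) a \<in> carr C (sg m) \<and> cd (sg m) (G (sg m) a) = H m (cd (sg m) a)" by blast
  have "G (sg m) a = a" if "m \<noteq> n" "a \<in> carr C (sg m)" for m a
    by (rule cover_model_inj[OF C]) (use GH that in \<open>auto simp: H_def\<close>)
  moreover have "\<forall>a\<in>carr C (sg n). cd (sg n) (G (sg n) a) = g (cd (sg n) a)" using GH by (simp add: H_def)
  ultimately show ?thesis using G unfolding automorphism_isomorphism by blast
qed

text \<open>Above all blocks that meet a countable model there are points \<open>q\<close> and
  \<open>q'\<close>. They have the same position relative to every point of the model, so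
  homogeneity moves one to the other over the model.\<close>

lemma ex_moving_automorphism:
  "\<exists>A q q' g. countable A \<and> elementary_submodel osig C A \<and> q \<in> HQ \<and> q' \<in> HQ \<and> hless q q' \<and>
    cover_aut (n + 2) (HQ \<times> J) (lex_less hless) g \<and> g ((q, 0), 0) = ((q', 0), 0) \<and>
    (\<forall>a. (sg n, a) \<in> A \<longrightarrow> g (cd (sg n) a) = cd (sg n) a)"
proof -
  note lin = linear_strict_HQ
  have "\<exists>A. {} \<subseteq> A \<and> elementary_submodel osig C A \<and> |A| \<le>o |UNIV :: nat set|"
  proof (rule Loewenheim_Skolem[OF wf_osig cover_model_structure[OF C]])
    show "|{\<phi> :: ('s, 'f, 'r) fm. wf_fm osig \<phi>}| \<le>o |UNIV :: nat set|"
      using countable_wf_osig unfolding countable_card_of_nat .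
  qed (auto simp: card_of_empty)
  then obtain A where A: "elementary_submodel osig C A" and "|A| \<le>o |UNIV :: nat set|" by blast
  then have cA: "countable A" unfolding countable_card_of_nat by blast
  define Y where "Y = {p. \<exists>a. (sg n, a) \<in> A \<and> p = cd (sg n) a}"
  have cY: "countable Y"
  proof -
    have "Y \<subseteq> (\<lambda>(s, a). cd (sg n) a) ` A" unfolding Y_def by force
    then show ?thesis using countable_image[OF cA] by (rule countable_subset)
  qed
  have YW: "Y \<subseteq> (HQ \<times> J) \<times> {..<n + 2}"
  proof
    fix p assume "p \<in> Y"
    then obtain a where "(sg n, a) \<in> A" "p = cd (sg n) a" unfolding Y_def by blast
    then show "p \<in> (HQ \<times> J) \<times> {..<n + 2}"
      using A cover_model_mem[OF C, of a n] unfolding elementary_submodel_def elems_def by blast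
  qed
  \<comment> \<open>The least point is added to have a nonempty lower set for
    \<open>eta_min_between\<close>.\<close>
  define B where "B = insert (rep (\<lambda>_. 0)) ((\<lambda>p. fst (base p)) ` Y)"
  have B: "B \<subseteq> HQ" "countable B" "B \<noteq> {}"
    using YW zero_HQ cY unfolding B_def least_of_def by (auto simp: base_def)
  obtain q where q: "q \<in> HQ" "\<forall>b\<in>B. hless b q"
    using eta_min_between[OF eta_min_HQ B(1) empty_subsetI B(2) countable_empty B(3)] by auto
  have "\<exists>q'\<in>HQ. (\<forall>b\<in>{q}. hless b q') \<and> (\<forall>b\<in>{}. hless q' b)"
    by (rule eta_min_between[OF eta_min_HQ]) (use q in auto)
  then obtain q' where q': "q' \<in> HQ" "hless q q'" by auto
  have Bq: "hless (fst (base p)) q" "hless (fst (base p)) q'" "\<not> hless q (fst (base p))" "\<not> hless q' (fst (base p))"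
    "fst (base p) \<noteq> q" "fst (base p) \<noteq> q'" if "p \<in> Y" for p
  proof -
    have pB: "fst (base p) \<in> B" using that unfolding B_def by blast
    then have pH: "fst (base p) \<in> HQ" using B(1) by blast
    show 1: "hless (fst (base p)) q" using q(2) pB by blast
    show 2: "hless (fst (base p)) q'" by (rule linear_strict_trans[of HQ hless _ q, OF lin pH q(1) q'(1) 1 q'(2)])
    show "\<not> hless q (fst (base p))" by (rule linear_strict_asym[of HQ hless, OF lin 1 pH q(1)])
    show "\<not> hless q' (fst (base p))" by (rule linear_strict_asym[of HQ hless, OF lin 2 pH q'(1)])
    show "fst (base p) \<noteq> q" using 1 linear_strict_irrefl[OF lin q(1)] by metis
    show "fst (base p) \<noteq> q'" using 2 linear_strict_irrefl[OF lin q'(1)] by metis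
  qed
  \<comment> \<open>The index \<open>None\<close> belongs to the point that is moved,
    \<open>Some p\<close> to a point \<open>p\<close> that is fixed.\<close>
  define I where "I = insert None (Some ` Y)"
  define u where "u = (\<lambda>i. case i of None \<Rightarrow> ((q, 0 :: int), 0 :: nat) | Some p \<Rightarrow> p)"
  define v where "v = (\<lambda>i. case i of None \<Rightarrow> ((q', 0 :: int), 0 :: nat) | Some p \<Rightarrow> p)"
  have J0: "0 \<in> J" using J by auto
  have "\<exists>g. cover_aut (n + 2) (HQ \<times> J) (lex_less hless) g \<and> (\<forall>i\<in>I. g (u i) = v i)"
  proof (rule cover_blocks_homogeneous[OF _ _ J])
    show "countable I" unfolding I_def using cY by simp
    show "u ` I \<subseteq> (HQ \<times> J) \<times> {..<n + 2}" "v ` I \<subseteq> (HQ \<times> J) \<times> {..<n + 2}"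
      unfolding I_def u_def v_def using YW q(1) q'(1) J0 by auto
    fix i j assume i: "i \<in> I" and j: "j \<in> I"
    consider "i = None" "j = None" | p where "p \<in> Y" "i = Some p" "j = None" | p where "p \<in> Y" "i = None" "j = Some p"
      | p p' where "i = Some p" "j = Some p'" using i j unfolding I_def by auto
    note cs = this
    show "delta (n + 2) hless (base (u i)) (base (u j)) = delta (n + 2) hless (base (v i)) (base (v j))"
      using cs
    proof cases
      case 1
      then show ?thesis using linear_strict_irrefl[OF lin q(1)] linear_strict_irrefl[OF lin q'(1)]
        by (simp add: u_def v_def base_def delta_def)
    next
      case (2 p)
      then show ?thesis using Bq[OF 2(1)] by (simp add: u_def v_def delta_def base_def)
    next
      case (3 p)
      then show ?thesis using Bq[OF 3(1)] by (simp add: u_def v_def delta_def base_def)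
    next
      case (4 p p')
      then show ?thesis by (simp add: u_def v_def)
    qed
    show "offset (u j) - offset (u i) = offset (v j) - offset (v i)" if "fst (base (u i)) = fst (base (u j))"
      using cs
    proof cases
      case 1
      then show ?thesis by (simp add: u_def v_def)
    next
      case (2 p)
      then show ?thesis using that Bq(5)[OF 2(1)] by (simp add: u_def base_def)
    next
      case (3 p)
      then show ?thesis using that Bq(5)[OF 3(1)] by (simp add: u_def base_def)
    next
      case (4 p p')
      then show ?thesis by (simp add: u_def v_def)
    qed
  qed simp
  then obtain g where g: "cover_aut (n + 2) (HQ \<times> J) (lex_less hless) g" "\<forall>i\<in>I. g (u i) = v i" by blast
  have "g ((q, 0), 0) = ((q', 0), 0)" using g(2) by (simp add: I_def u_def v_def)
  moreover have "g (cd (sg n) a) = cd (sg n) a" if "(sg n, a) \<in> A" for a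
  proof -
    have "Some (cd (sg n) a) \<in> I" unfolding I_def Y_def using that by blast
    then show ?thesis using g(2) by (force simp: u_def v_def)
  qed
  ultimately show ?thesis using cA A q(1) q' g(1) by blast
qed

text \<open>Two points in different blocks with \<open>delta\<close> zero are in the same relative
  position as \<open>q\<close> and \<open>q'\<close>, so an automorphism \<open>h\<close> takes one
  pair to the other. Conjugating the moving automorphism by \<open>h\<close> gives one that sends
  \<open>a\<close> to \<open>b\<close> and fixes the image of the model under
  \<open>h\<close>.\<close>

lemma lascar_step_upper:
  assumes c: "c \<in> I \<rightarrow>\<^sub>E elems osig C" and i: "i \<in> I" "c i = (sg n, a)"
    and others: "\<And>j. j \<in> I \<Longrightarrow> j \<noteq> i \<Longrightarrow> fst (c j) \<noteq> sg n"
    and a: "a \<in> carr C (sg n)" "cd (sg n) a = ((x, 0), l)" and b: "b \<in> carr C (sg n)" "cd (sg n) b = ((y, 0), l')"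
    and xy: "x \<noteq> y" "delta (n + 2) hless (x, l) (y, l') = 0"
  shows "\<exists>A. countable A \<and> elementary_submodel osig C A \<and> tp osig C A I c = tp osig C A I (c(i := (sg n, b)))"
proof -
  note lin = linear_strict_HQ
  let ?W = "(HQ \<times> J) \<times> {..<n + 2}"
  from ex_moving_automorphism[of n] obtain A q q' g where A: "countable A" "elementary_submodel osig C A"
    and q: "q \<in> HQ" "q' \<in> HQ" "hless q q'" and g: "cover_aut (n + 2) (HQ \<times> J) (lex_less hless) g"
    "g ((q, 0), 0) = ((q', 0), 0)" "\<forall>a. (sg n, a) \<in> A \<longrightarrow> g (cd (sg n) a) = cd (sg n) a" by blast
  have J0: "0 \<in> J" using J by auto
  have xyH: "x \<in> HQ" "y \<in> HQ" "l < n + 2" "l' < n + 2"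
    using cover_model_mem[OF C a(1)] cover_model_mem[OF C b(1)] a(2) b(2) by auto
  have qq: "q \<noteq> q'" using q linear_strict_irrefl[OF lin q(1)] by metis
  have d0: "delta (n + 2) hless (q, 0) (q', 0) = 0"
    using linear_strict_asym[OF lin q(3,1,2)] by (simp add: delta_def)
  \<comment> \<open>The backward value is forced, being congruent to \<open>-1\<close> modulo
    \<open>n + 2\<close>. So the single hypothesis \<open>delta = 0\<close> settles the relative
    position of the two base points.\<close>
  have reverse: "delta (n + 2) hless w v = int (n + 1)"
    if "fst v \<in> HQ" "fst w \<in> HQ" "fst v \<noteq> fst w" "delta (n + 2) hless v w = 0" for v w
  proof -
    have "(of_bool (hless (fst w) (fst v)) + of_bool (hless (fst v) (fst w)) :: int) = 1"
      using linear_strict_total[OF lin that(1,2)] linear_strict_asym[OF lin _ that(1,2)] that(3) by auto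
    then have "(delta (n + 2) hless v w + delta (n + 2) hless w v) mod int (n + 2) = (-1) mod int (n + 2)"
      unfolding delta_def mod_add_eq by (simp add: algebra_simps)
    then have "delta (n + 2) hless w v mod int (n + 2) = int (n + 1)" using that(4) by (simp add: zmod_minus1)
    then show ?thesis by (simp add: delta_def)
  qed
  define u where "u = (\<lambda>i :: bool. if i then ((q, 0 :: int), 0 :: nat) else ((q', 0), 0))"
  define v where "v = (\<lambda>i :: bool. if i then ((x, 0 :: int), l) else ((y, 0), l'))"
  have "\<exists>h. cover_aut (n + 2) (HQ \<times> J) (lex_less hless) h \<and> (\<forall>i\<in>UNIV. h (u i) = v i)"
  proof (rule cover_blocks_homogeneous[OF _ _ J])
    show "u ` UNIV \<subseteq> ?W" "v ` UNIV \<subseteq> ?W" using q xyH J0 by (auto simp: u_def v_def)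
    fix i j :: bool
    have "delta (n + 2) hless (q', 0) (q, 0) = delta (n + 2) hless (y, l') (x, l)"
      using reverse[of "(q, 0)" "(q', 0)"] reverse[of "(x, l)" "(y, l')"] q xyH qq xy d0 by simp
    then show "delta (n + 2) hless (base (u i)) (base (u j)) = delta (n + 2) hless (base (v i)) (base (v j))"
      using d0 xy(2) linear_strict_irrefl[OF lin] q xyH
      by (cases i; cases j) (simp_all add: u_def v_def base_def, simp_all add: delta_def)
    show "offset (u j) - offset (u i) = offset (v j) - offset (v i)"
      by (simp add: u_def v_def offset_def)
  qed simp_all
  then obtain h where h: "cover_aut (n + 2) (HQ \<times> J) (lex_less hless) h" "h (u True) = v True" "h (u False) = v False" by blast
  let ?hi = "inv_into ?W h"
  let ?k = "h \<circ> (g \<circ> ?hi)"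
  have k: "cover_aut (n + 2) (HQ \<times> J) (lex_less hless) ?k"
    by (rule cover_aut_comp[OF h(1) cover_aut_comp[OF g(1) cover_aut_inverse[OF h(1)]]])
  have hi: "?hi (h w) = w" if "w \<in> ?W" for w
    by (rule bij_betw_inv_into_left[OF cover_aut_bij[OF h(1)] that])
  from one_sort_automorphism[OF h(1)] obtain H where H: "automorphism osig C H"
    "\<forall>a\<in>carr C (sg n). cd (sg n) (H (sg n) a) = h (cd (sg n) a)" by blast
  from one_sort_automorphism[OF k] obtain G where G: "automorphism osig C G"
    "\<forall>a\<in>carr C (sg n). cd (sg n) (G (sg n) a) = ?k (cd (sg n) a)"
    "\<forall>m a. m \<noteq> n \<longrightarrow> a \<in> carr C (sg m) \<longrightarrow> G (sg m) a = a" by blast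
  have Gn: "G (sg n) a \<in> carr C (sg n)" "H (sg n) a \<in> carr C (sg n)" if "a \<in> carr C (sg n)" for a
  proof -
    have "bij_betw (G (sg n)) (carr C (sg n)) (carr C (sg n))" "bij_betw (H (sg n)) (carr C (sg n)) (carr C (sg n))"
      using G(1) H(1) unfolding automorphism_def by simp_all
    then show "G (sg n) a \<in> carr C (sg n)" "H (sg n) a \<in> carr C (sg n)" using that bij_betwE by blast+
  qed
  let ?A' = "(\<lambda>(s, a). (s, H s a)) ` A"
  have A': "elementary_submodel osig C ?A'" by (rule elementary_submodel_image[OF cover_model_structure[OF C] H(1) A(2)])
  have A'C: "?A' \<subseteq> elems osig C" using A' unfolding elementary_submodel_def by blast
  have AC: "A \<subseteq> elems osig C" using A(2) unfolding elementary_submodel_def by blast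
  have "tp osig C ?A' I c = tp osig C ?A' I (c(i := (sg n, b)))"
  proof (rule tp_automorphism[OF wf_osig cover_model_structure[OF C] G(1) A'C _ c])
    fix s a' assume "(s, a') \<in> ?A'"
    then obtain a0 where a0: "(s, a0) \<in> A" "a' = H s a0" by auto
    then have "s \<in> range sg" "a0 \<in> carr C s" using AC by (auto simp: elems_def)
    then obtain m where m: "s = sg m" "a0 \<in> carr C (sg m)" by blast
    have a': "a' \<in> carr C (sg m)" using a0 m A'C by (auto simp: elems_def)
    show "G s a' = a'"
    proof (cases "m = n")
      case True
      have a0n: "a0 \<in> carr C (sg n)" using m True by simp
      have w: "cd (sg n) a0 \<in> ?W" by (rule cover_model_mem[OF C a0n])
      have "cd (sg n) a' = h (cd (sg n) a0)" using H(2) a0n a0(2) m True by simp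
      then have "cd (sg n) (G (sg n) a') = h (g (cd (sg n) a0))" using G(2) a' True hi[OF w] by simp
      also have "\<dots> = cd (sg n) a'" using g(3) a0(1) m(1) True H(2) a0n a0(2) by simp
      finally have "G (sg n) a' = a'" using cover_model_inj[OF C] Gn(1) a' True by blast
      then show ?thesis using m True by simp
    next
      case False
      then show ?thesis using G(3) a' m by simp
    qed
  next
    fix j assume j: "j \<in> I"
    show "(c(i := (sg n, b))) j = (fst (c j), G (fst (c j)) (snd (c j)))"
    proof (cases "j = i")
      case True
      have "?hi ((x, 0), l) = ((q, 0), 0)" using hi[of "u True"] h(2) q J0 by (simp add: u_def v_def)
      then have "cd (sg n) (G (sg n) a) = cd (sg n) b"
        using G(2) a b(2) g(2) h(3) by (simp add: u_def v_def)
      then have "G (sg n) a = b" using cover_model_inj[OF C Gn(1)[OF a(1)] b(1)] by blast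
      then show ?thesis using True i(2) by simp
    next
      case False
      obtain m where m: "fst (c j) = sg m" "snd (c j) \<in> carr C (sg m)"
        using PiE_mem[OF c j] by (cases "c j") (auto simp: elems_def)
      then have "m \<noteq> n" using others[OF j False] by auto
      then show ?thesis using G(3) m False by (simp add: prod_eq_iff)
    qed
  qed
  then show ?thesis using countable_image[OF A(1)] A' by blast
qed

end

section \<open>Lascar chains around a cover and the failure of G-compactness\<close>

lemma lascar_chain_0: "a \<in> I \<rightarrow>\<^sub>E elems L C \<Longrightarrow> lascar_chain L \<kappa> C I 0 a a"
  unfolding lascar_chain_def by (rule exI[of _ "\<lambda>_. a"]) simp

lemma lascar_chain_Suc:
  assumes "lascar_chain L \<kappa> C I m a b" "b' \<in> I \<rightarrow>\<^sub>E elems L C"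
    and A: "|A| <o \<kappa>" "elementary_submodel L C A" "tp L C A I b = tp L C A I b'"
  shows "lascar_chain L \<kappa> C I (Suc m) a b'"
proof -
  obtain c where c: "c 0 = a" "c m = b" "\<forall>j\<le>m. c j \<in> I \<rightarrow>\<^sub>E elems L C"
    and st: "\<forall>j<m. \<exists>A. |A| <o \<kappa> \<and> elementary_submodel L C A \<and> tp L C A I (c j) = tp L C A I (c (Suc j))"
    using assms(1) unfolding lascar_chain_def by blast
  let ?c = "c(Suc m := b')"
  have "\<exists>A. |A| <o \<kappa> \<and> elementary_submodel L C A \<and> tp L C A I (?c j) = tp L C A I (?c (Suc j))" if "j < Suc m" for j
  proof (cases "j = m")
    case True
    then have "?c j = b" "?c (Suc j) = b'" using c(2) by simp_all
    then show ?thesis using A by metis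
  next
    case False
    then have "j < m" using that by simp
    then show ?thesis using st by simp
  qed
  moreover have "\<forall>j\<le>Suc m. ?c j \<in> I \<rightarrow>\<^sub>E elems L C" using c(3) assms(2) by (simp add: le_Suc_eq)
  ultimately show ?thesis unfolding lascar_chain_def using c(1) by (intro exI[of _ ?c]) simp
qed

lemma lascar_dist_finite:
  assumes "lascar_chain L \<kappa> C I m a b"
  shows "lascar_dist L \<kappa> C I a b < \<infinity>"
proof -
  have "lascar_dist L \<kappa> C I a b \<le> enat m"
    unfolding lascar_dist_def by (rule INF_lower) (use assms in simp)
  then show ?thesis by (rule le_less_trans) simp
qed

lemma lascar_dist_chain:
  assumes "lascar_dist L \<kappa> C I a b \<le> enat n"
  shows "\<exists>m\<le>n. lascar_chain L \<kappa> C I m a b"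
proof (rule ccontr)
  assume no: "\<not> ?thesis"
  have "enat (Suc n) \<le> lascar_dist L \<kappa> C I a b"
    unfolding lascar_dist_def
  proof (rule INF_greatest)
    fix m assume "m \<in> {m. lascar_chain L \<kappa> C I m a b}"
    then have "\<not> m \<le> n" using no by auto
    then show "enat (Suc n) \<le> enat m" by simp
  qed
  then have "enat (Suc n) \<le> enat n" using assms by (rule order_trans)
  then show False by simp
qed

text \<open>Two steps climb one sheet: from the least point of sheet \<open>h\<close> to some later
  point \<open>r\<close> of the same sheet, and from there to the least point of the next sheet.
  Both moves have \<open>delta\<close> zero.\<close>

lemma lascar_chain_around:
  fixes C :: "('s::infinite, 'f, 'r::infinite, 'b) struct"
  assumes C: "cover_model C cd (HQ \<times> J) (lex_less hless)" and J: "J = {0} \<or> J = (UNIV :: int set)"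
    and \<kappa>: "\<kappa> =o cardSuc natLeq"
    and c: "c \<in> I \<rightarrow>\<^sub>E elems osig C" and i: "i \<in> I" "fst (c i) = sg n"
    and others: "\<And>j. j \<in> I \<Longrightarrow> j \<noteq> i \<Longrightarrow> fst (c j) \<noteq> sg n"
    and z: "cd (sg n) (snd (c i)) = ((rep (\<lambda>_. 0), 0), 0)" and h: "h < n + 2"
  shows "\<exists>b\<in>carr C (sg n). cd (sg n) b = ((rep (\<lambda>_. 0), 0), h) \<and> lascar_chain osig \<kappa> C I (2 * h) c (c(i := (sg n, b)))"
  using h
proof (induction h)
  case 0
  have "snd (c i) \<in> carr C (sg n)" using PiE_mem[OF c i(1)] i(2) by (cases "c i") (auto simp: elems_def)
  moreover have "c(i := (sg n, snd (c i))) = c" using i(2) by (auto simp: fun_eq_iff prod_eq_iff)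
  ultimately show ?case using z lascar_chain_0[OF c] by (intro bexI[of _ "snd (c i)"]) simp_all
next
  case (Suc h)
  let ?z = "rep (\<lambda>_. 0) :: nat \<Rightarrow> rat"
  obtain b where b: "b \<in> carr C (sg n)" "cd (sg n) b = ((?z, 0), h)" "lascar_chain osig \<kappa> C I (2 * h) c (c(i := (sg n, b)))"
    using Suc.IH[OF Suc_lessD[OF Suc.prems]] by blast
  have J0: "0 \<in> J" using J by auto
  have zH: "?z \<in> HQ" using zero_HQ unfolding least_of_def by blast
  have "\<exists>r\<in>HQ. (\<forall>b\<in>{?z}. hless b r) \<and> (\<forall>b\<in>{}. hless r b)"
    by (rule eta_min_between[OF eta_min_HQ]) (use zH in auto)
  then obtain r where r: "r \<in> HQ" "hless ?z r" by auto
  note lin = linear_strict_HQ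
  have nr: "\<not> hless r ?z" by (rule linear_strict_asym[of HQ hless, OF lin r(2) zH r(1)])
  have zr: "?z \<noteq> r" using r(2) nr by metis
  obtain d where d: "d \<in> carr C (sg n)" "cd (sg n) d = ((r, 0), h)"
    using cover_model_surj[OF C, of "((r, 0), h)" n] r(1) J0 Suc.prems by auto
  obtain b' where b': "b' \<in> carr C (sg n)" "cd (sg n) b' = ((?z, 0), Suc h)"
    using cover_model_surj[OF C, of "((?z, 0), Suc h)" n] zH J0 Suc.prems by auto
  have mem: "c(i := (sg n, x)) \<in> I \<rightarrow>\<^sub>E elems osig C" if "x \<in> carr C (sg n)" for x
    using c i(1) that by (auto simp: PiE_iff elems_def extensional_def)
  have upd: "(c(i := (sg n, x))) i = (sg n, x)" for x by simp
  have oth: "fst ((c(i := (sg n, x))) j) \<noteq> sg n" if "j \<in> I" "j \<noteq> i" for j x using others[OF that] that by simp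
  have d1: "delta (n + 2) hless (?z, h) (r, h) = 0" using nr by (simp add: delta_def)
  have d2: "delta (n + 2) hless (r, h) (?z, Suc h) = 0" using r(2) by (simp add: delta_def)
  obtain A where A: "countable A" "elementary_submodel osig C A"
    "tp osig C A I (c(i := (sg n, b))) = tp osig C A I (c(i := (sg n, d)))"
    using lascar_step_upper[OF C J mem[OF b(1)] i(1) upd oth b(1,2) d zr d1, unfolded fun_upd_upd] by blast
  obtain A' where A': "countable A'" "elementary_submodel osig C A'"
    "tp osig C A' I (c(i := (sg n, d))) = tp osig C A' I (c(i := (sg n, b')))"
    using lascar_step_upper[OF C J mem[OF d(1)] i(1) upd oth d b' zr[symmetric] d2, unfolded fun_upd_upd] by blast
  have "lascar_chain osig \<kappa> C I (Suc (2 * h)) c (c(i := (sg n, d)))"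
    by (rule lascar_chain_Suc[OF b(3) mem[OF d(1)] _ A(2,3)]) (simp add: aleph1_countable[OF \<kappa>] A(1))
  then have "lascar_chain osig \<kappa> C I (Suc (Suc (2 * h))) c (c(i := (sg n, b')))"
    by (rule lascar_chain_Suc[OF _ mem[OF b'(1)] _ A'(2,3)]) (simp add: aleph1_countable[OF \<kappa>] A'(1))
  then show ?case unfolding mult_Suc_right add_2_eq_Suc using b' by blast
qed

text \<open>The tuple consists of one point at the origin of each cover. Against a proposed bound
  \<open>N\<close>, its entry in a cover of large degree is moved up by \<open>N + 1\<close> sheets:
  this takes finitely many steps, but more than \<open>N\<close>.\<close>

theorem not_G_compact:
  fixes A :: "('s::infinite, 'f, 'r::infinite, 'a) struct"
  assumes A: "cover_model A cdA (K \<times> J) (lex_less lt)" and K: "eta_min K lt" and sat: "countably_saturated_struct osig A"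
    and J: "J = {0} \<or> J = (UNIV :: int set)"
  shows "\<not> G_compact osig (Th osig A)"
proof
  assume G: "G_compact osig (Th osig A)"
  let ?e = "\<lambda>m. (Neg ^^ m) (Eq (Var undefined) (Var undefined)) :: ('s, 'f, 'r) fm"
  define e where "e = ?e"
  have e: "inj e" unfolding e_def by (rule inj_Neg_power)
  have "inj ((`) e)" using e by (simp add: inj_image_eq_iff inj_def)
  from ex_aleph1[OF this] obtain \<kappa> :: "('s, 'f, 'r) univ rel" where \<kappa>: "Card_order \<kappa>" "\<kappa> =o cardSuc natLeq" by blast
  let ?C = "monster_struct J :: ('s, 'f, 'r, ('s, 'f, 'r) univ) struct" and ?cd = "inv univ_code :: ('s, 'f, 'r) univ \<Rightarrow> _"
  let ?z = "rep (\<lambda>_. 0) :: nat \<Rightarrow> rat"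
  have mon: "monster osig (Th osig A) \<kappa> ?C" by (rule monster_monster[OF A K sat J \<kappa>])
  have C: "cover_model ?C (\<lambda>_. ?cd) (HQ \<times> J) (lex_less hless)" by (rule monster_struct_cover) (use J in auto)
  have zJ: "?z \<in> HQ" "0 \<in> J" using zero_HQ J unfolding least_of_def by auto
  \<comment> \<open>The definition of G-compactness takes index sets from the type
    \<open>univ\<close>; singletons provide a countable one.\<close>
  define \<iota> where "\<iota> = (\<lambda>m. {e m})"
  have \<iota>: "inj \<iota>" using e by (simp add: \<iota>_def inj_def)
  have "\<exists>a. a \<in> carr ?C (sg n) \<and> ?cd a = ((?z, 0), 0)" for n
    using cover_model_surj[OF C, of "((?z, 0), 0)" n] zJ by auto
  then obtain p where p: "\<And>n. p n \<in> carr ?C (sg n)" "\<And>n. ?cd (p n) = ((?z, 0), 0)" by metis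
  define a where "a = (\<lambda>i\<in>range \<iota>. (sg (inv \<iota> i) :: 's, p (inv \<iota> i)))"
  have a: "a (\<iota> n) = (sg n, p n)" for n using inv_f_f[OF \<iota>] by (simp add: a_def)
  have aI: "a \<in> range \<iota> \<rightarrow>\<^sub>E elems osig ?C"
    by (rule PiE_I) (use a p in \<open>auto simp: elems_def a_def\<close>)
  have I: "|range \<iota>| <o \<kappa>" by (simp add: aleph1_countable[OF \<kappa>(2)])
  obtain N :: nat where N: "\<forall>b\<in>range \<iota> \<rightarrow>\<^sub>E elems osig ?C. lascar_dist osig \<kappa> ?C (range \<iota>) a b < \<infinity> \<longrightarrow>
      lascar_dist osig \<kappa> ?C (range \<iota>) a b \<le> enat N"
    using G[unfolded G_compact_def, rule_format, OF mon conjI[OF I aI]] by blast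
  let ?n = "2 * N + 2" and ?h = "N + 1"
  have ai: "fst (a (\<iota> ?n)) = sg ?n" "?cd (snd (a (\<iota> ?n))) = ((?z, 0), 0)" using a p(2) by simp_all
  have oth: "fst (a j) \<noteq> sg ?n" if "j \<in> range \<iota>" "j \<noteq> \<iota> ?n" for j using that a by auto
  obtain b where b: "b \<in> carr ?C (sg ?n)" "?cd b = ((?z, 0), ?h)"
    and ch: "lascar_chain osig \<kappa> ?C (range \<iota>) (2 * ?h) a (a(\<iota> ?n := (sg ?n, b)))"
    using lascar_chain_around[OF C J \<kappa>(2) aI rangeI ai(1) oth ai(2), of ?h] by auto
  have "a(\<iota> ?n := (sg ?n, b)) \<in> range \<iota> \<rightarrow>\<^sub>E elems osig ?C"
    using aI b(1) by (auto simp: PiE_iff elems_def extensional_def)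
  then have "lascar_dist osig \<kappa> ?C (range \<iota>) a (a(\<iota> ?n := (sg ?n, b))) \<le> enat N"
    using N lascar_dist_finite[OF ch] by blast
  from lascar_dist_chain[OF this] obtain m where m: "m \<le> N" "lascar_chain osig \<kappa> ?C (range \<iota>) m a (a(\<iota> ?n := (sg ?n, b)))" by blast
  from lascar_chain_lower[OF C linear_strict_lex_less[OF linear_strict_HQ] m(2) rangeI ai(1)]
  obtain t where t: "\<bar>t\<bar> \<le> int m" "delta (?n + 2) (lex_less hless) ((?z, 0), 0) ((?z, 0), ?h) = t mod int (?n + 2)"
    unfolding ai(2) by (auto simp: b(2))
  have "\<not> hless ?z ?z" by (rule linear_strict_irrefl[OF linear_strict_HQ zJ(1)])
  then have "int N + 1 = t mod int (?n + 2)" using t(2) by (simp add: delta_def lex_less_def)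
  moreover have "t mod int (?n + 2) = (if t \<ge> 0 then t else t + int (?n + 2))"
  proof (cases "t \<ge> 0")
    case True
    then show ?thesis using t(1) m(1) by simp
  next
    case False
    have "t mod int (?n + 2) = (t + int (?n + 2)) mod int (?n + 2)" by simp
    also have "\<dots> = t + int (?n + 2)" by (rule mod_pos_pos_trivial) (use t(1) m(1) False in linarith)+
    finally show ?thesis using False by simp
  qed
  ultimately show False using t(1) m(1) by (auto split: if_splits)
qed

section \<open>Ultraproducts of covers\<close>

definition cover_struct :: "'k set \<Rightarrow> ('k \<Rightarrow> 'k \<Rightarrow> bool) \<Rightarrow> ('s::infinite, 'f, 'r::infinite, 'k \<times> nat) struct" where
  "cover_struct K lt = \<lparr>carr = (\<lambda>s. K \<times> {..<inv sg s + 2}), fint = (\<lambda>_ _. undefined),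
     rint = (\<lambda>r us. delta (fst (prod_decode (inv sg r)) + 2) lt (us ! 0) (us ! 1) = int (snd (prod_decode (inv sg r))))\<rparr>"

lemma cover_struct_simps [simp]:
  "carr (cover_struct K lt :: ('s::infinite, 'f, 'r::infinite, _) struct) (sg n) = K \<times> {..<n + 2}"
  "rint (cover_struct K lt :: ('s::infinite, 'f, 'r::infinite, _) struct) (rl n j) [u, v] \<longleftrightarrow> delta (n + 2) lt u v = int j"
  by (simp_all add: cover_struct_def rl_def)

lemma cover_struct_cover:
  "K \<noteq> {} \<Longrightarrow> cover_model (cover_struct K lt :: ('s::infinite, 'f, 'r::infinite, _) struct) (\<lambda>_ u. u) K lt"
  unfolding cover_model_def by (simp add: bij_betw_def)

text \<open>The ultraproduct of the covers is the cover of the ultraproduct, because the number of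
  sheets in a sort does not depend on \<open>k\<close>: a level that varies with \<open>k\<close> is
  almost everywhere constant.\<close>

lemma cover_struct_ultralimit:
  fixes P :: "nat \<Rightarrow> 'q set"
  shows "ultralimit (osig :: ('s::infinite, 'f, 'r::infinite) signature) (cover_struct (ultraproduct P) (ultra_less lt)) (\<lambda>k. cover_struct (P k) (lt k))
     (\<lambda>k u. (fst u k, snd u))"
proof
  show "wf_signature (osig :: ('s, 'f, 'r) signature)" by (rule wf_osig)
next
  fix s :: 's and a :: "(nat \<Rightarrow> 'q) \<times> nat"
  assume "s \<in> Sorts osig" "a \<in> carr (cover_struct (ultraproduct P) (ultra_less lt)) s"
  then obtain n where n: "s = sg n" "fst a \<in> ultraproduct P" "snd a < n + 2" by (auto simp: mem_Times_iff)
  show "\<forall>\<^sub>F k in \<U>. (fst a k, snd a) \<in> carr (cover_struct (P k) (lt k)) s"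
    using ultraproduct_ev[OF n(2)] by eventually_elim (use n in simp)
next
  fix s :: 's and x :: "nat \<Rightarrow> 'q \<times> nat"
  assume "s \<in> Sorts osig" and x: "\<forall>\<^sub>F k in \<U>. x k \<in> carr (cover_struct (P k) (lt k)) s"
  then obtain n where n: "s = sg n" by auto
  have "\<forall>\<^sub>F k in \<U>. fst (x k) \<in> P k" using x unfolding n by eventually_elim (auto simp: mem_Times_iff)
  then have y: "rep (\<lambda>k. fst (x k)) \<in> ultraproduct P" by (rule rep_in_ultraproduct)
  have "\<forall>\<^sub>F k in \<U>. \<exists>i\<in>{..<n + 2}. snd (x k) = i" using x unfolding n by eventually_elim (auto simp: mem_Times_iff)
  then obtain i where i: "i < n + 2" "\<forall>\<^sub>F k in \<U>. snd (x k) = i"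
    using eventually_ultra_finite_ex[of "{..<n + 2}" "\<lambda>i k. snd (x k) = i"] by auto
  show "\<exists>a\<in>carr (cover_struct (ultraproduct P) (ultra_less lt)) s. \<forall>\<^sub>F k in \<U>. (fst a k, snd a) = x k"
  proof (rule bexI[of _ "(rep (\<lambda>k. fst (x k)), i)"])
    show "\<forall>\<^sub>F k in \<U>. (fst (rep (\<lambda>k. fst (x k)), i) k, snd (rep (\<lambda>k. fst (x k)), i)) = x k"
      using rep_eq[of "\<lambda>k. fst (x k)"] i(2) by eventually_elim (simp add: prod_eq_iff)
  qed (use n y i(1) in simp)
next
  fix s :: 's and a b :: "(nat \<Rightarrow> 'q) \<times> nat"
  assume s: "s \<in> Sorts osig" and ab: "a \<in> carr (cover_struct (ultraproduct P) (ultra_less lt)) s"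
    "b \<in> carr (cover_struct (ultraproduct P) (ultra_less lt)) s" and ev: "\<forall>\<^sub>F k in \<U>. (fst a k, snd a) = (fst b k, snd b)"
  then have m: "fst a \<in> ultraproduct P" "fst b \<in> ultraproduct P" by (auto simp: mem_Times_iff)
  have "\<forall>\<^sub>F k in \<U>. fst a k = fst b k" using ev by eventually_elim simp
  then have "fst a = fst b" by (rule ultraproduct_eqI[OF m])
  moreover have "\<forall>\<^sub>F k in \<U>. snd a = snd b" using ev by eventually_elim simp
  ultimately show "a = b" by (simp add: prod_eq_iff)
next
  fix r :: 'r and us :: "((nat \<Rightarrow> 'q) \<times> nat) list"
  assume "r \<in> Rels osig" "us \<in> tuples (cover_struct (ultraproduct P) (ultra_less lt)) (rdom osig r)"
  then obtain n j u v where r: "r = rl n j" "us = [u, v]" by (auto simp: tuples_pair)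
  have "(ultra_less lt (fst v) (fst u) \<longleftrightarrow> lt k (fst v k) (fst u k)) \<Longrightarrow>
    delta (n + 2) (ultra_less lt) u v = int j \<longleftrightarrow> delta (n + 2) (lt k) (fst u k, snd u) (fst v k, snd v) = int j" for k
    by (simp add: delta_def)
  moreover have "\<forall>\<^sub>F k in \<U>. (ultra_less lt (fst v) (fst u) \<longleftrightarrow> lt k (fst v k) (fst u k))"
  proof (cases "ultra_less lt (fst v) (fst u)")
    case True
    then show ?thesis unfolding ultra_less_def by simp
  next
    case False
    then show ?thesis unfolding ultra_less_def by (simp add: eventually_ultra_not)
  qed
  ultimately have "\<forall>\<^sub>F k in \<U>. (delta (n + 2) (ultra_less lt) u v = int j) \<longleftrightarrow> delta (n + 2) (lt k) (fst u k, snd u) (fst v k, snd v) = int j"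
    by (rule eventually_mono[rotated])
  from eventually_ultra_cong[OF this]
  show "rint (cover_struct (ultraproduct P) (ultra_less lt)) r us \<longleftrightarrow>
      (\<forall>\<^sub>F k in \<U>. rint (cover_struct (P k) (lt k)) r (map (\<lambda>u. (fst u k, snd u)) us))"
    unfolding r by simp
qed simp_all

lemma (in ultralimit) countably_saturated_struct:
  assumes "is_structure L A"
  shows "countably_saturated_struct L A"
  unfolding countably_saturated_struct_def
proof (intro allI impI)
  fix y :: "'s var" and p :: "(('s, 'f, 'r) fm \<times> ('s var \<Rightarrow> 'a)) set"
  assume y: "fst y \<in> Sorts L" and p: "countable p"
    and wfp: "\<forall>(\<phi>, v)\<in>p. wf_fm L \<phi> \<and> (\<forall>x\<in>fv \<phi> - {y}. v x \<in> carr A (fst x))"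
    and fin: "\<forall>q\<subseteq>p. finite q \<longrightarrow> (\<exists>c\<in>carr A (fst y). \<forall>(\<phi>, v)\<in>q. sat A (v(y := c)) \<phi>)"
  have ne: "carr A (fst y) \<noteq> {}" using assms y unfolding is_structure_def by blast
  show "\<exists>c\<in>carr A (fst y). \<forall>(\<phi>, v)\<in>p. sat A (v(y := c)) \<phi>"
    by (rule countably_saturated[OF y p _ refl ne]) (use wfp fin in auto)
qed

lemma ultralimit_Th:
  assumes U: "ultralimit L A (\<lambda>_. B) ev" and A: "is_structure L A" and B: "is_structure L B"
  shows "Th L A = Th L B"
proof -
  have "\<phi> \<in> Th L A \<longleftrightarrow> \<phi> \<in> Th L B" for \<phi>
  proof (cases "\<phi> \<in> sentences L")
    case True
    then have w: "wf_fm L \<phi>" "fv \<phi> = {}" unfolding sentences_def by auto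
    have "(\<lambda>k. sat B (\<lambda>x. ev k (undefined x)) \<phi>) = (\<lambda>_. sat B undefined \<phi>)"
      by (intro ext sat_cong) (simp add: w(2))
    moreover have "sat A undefined \<phi> \<longleftrightarrow> (\<forall>\<^sub>F k in \<U>. sat B (\<lambda>x. ev k (undefined x)) \<phi>)"
      by (rule ultralimit.Los[OF U w(1)]) (simp add: w(2))
    ultimately have "sat A undefined \<phi> \<longleftrightarrow> sat B undefined \<phi>" by simp
    then show ?thesis using Th_iff[OF A, of \<phi> undefined] Th_iff[OF B, of \<phi> undefined] by simp
  qed (auto simp: Th_def)
  then show ?thesis by blast
qed

lemma cover_model_Th_unique:
  assumes A: "cover_model A cdA K lt" and B: "cover_model B cdB K lt"
  shows "Th osig A = Th osig B"
proof -
  have "bij_betw (\<lambda>u. u) (K \<times> {..<n + 2}) (K \<times> {..<n + 2})" for n :: nat by (simp add: bij_betw_def)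
  from cover_model_isomorphism[where G = "\<lambda>_ u. u", OF A B this refl] obtain g where "isomorphism osig A B g" by blast
  then show ?thesis
    by (rule Th_isomorphism[OF _ cover_model_structure[OF A] cover_model_structure[OF B] wf_osig])
qed

text \<open>The ultrapower of the cover has the same theory, is countably saturated and has an
  \<open>eta_min\<close> base order; the blocks are single points.\<close>

theorem dense_cover_not_G_compact:
  fixes N :: "('s::infinite, 'f, 'r::infinite, 'a) struct" and K :: "'k set"
  assumes N: "cover_model N cd K lt" and K: "dense_min K lt"
  shows "\<not> G_compact osig (Th osig N)"
proof -
  let ?P = "ultraproduct (\<lambda>_. K)" and ?lt = "ultra_less (\<lambda>_. lt)"
  let ?A = "cover_struct ?P ?lt :: ('s, 'f, 'r, _) struct" and ?B = "cover_struct K lt :: ('s, 'f, 'r, _) struct"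
  have eta: "eta_min ?P ?lt" by (rule eta_min_ultrapower[OF K])
  obtain m where m: "m \<in> K" using K unfolding dense_min_def by blast
  then have "rep (\<lambda>_. m) \<in> ?P" by (intro rep_in_ultraproduct) simp
  then have ne: "K \<noteq> {}" "?P \<noteq> {}" using m by blast+
  have A: "is_structure osig ?A" by (rule cover_model_structure[OF cover_struct_cover[OF ne(2)]])
  have B: "is_structure osig ?B" by (rule cover_model_structure[OF cover_struct_cover[OF ne(1)]])
  have U: "ultralimit osig ?A (\<lambda>_. ?B) (\<lambda>k u. (fst u k, snd u))" by (rule cover_struct_ultralimit)
  have "Th osig N = Th osig ?B" by (rule cover_model_Th_unique[OF N cover_struct_cover[OF ne(1)]])
  then have Th: "Th osig N = Th osig ?A" using ultralimit_Th[OF U A B] by simp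
  have "cover_model ?A (\<lambda>_ u. ((fst u, 0), snd u)) (?P \<times> {0}) (lex_less ?lt)"
  proof -
    have "bij_betw (\<lambda>u. ((fst u, 0 :: int), snd u)) (?P \<times> {..<n + 2}) ((?P \<times> {0}) \<times> {..<n + 2})" for n :: nat
      by (rule bij_betw_byWitness[where f' = "\<lambda>u. (fst (fst u), snd u)"]) auto
    then show ?thesis unfolding cover_model_def using ne(2) by (simp add: delta_def lex_less_def)
  qed
  from not_G_compact[OF this eta ultralimit.countably_saturated_struct[OF U A]] show ?thesis
    unfolding Th by blast
qed

subsection \<open>Hyperfinite linear orders\<close>

definition finite_distance :: "(nat \<Rightarrow> int) \<Rightarrow> (nat \<Rightarrow> int) \<Rightarrow> bool" where
  "finite_distance f g \<longleftrightarrow> (\<exists>d. \<forall>\<^sub>F k in \<U>. f k = g k + d)"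

lemma finite_distance_refl: "finite_distance f f"
  unfolding finite_distance_def by (rule exI[of _ 0]) simp

lemma finite_distance_sym: "finite_distance f g \<Longrightarrow> finite_distance g f"
  unfolding finite_distance_def
proof (elim exE)
  fix d assume "\<forall>\<^sub>F k in \<U>. f k = g k + d"
  then have "\<forall>\<^sub>F k in \<U>. g k = f k + - d" by eventually_elim simp
  then show "\<exists>d. \<forall>\<^sub>F k in \<U>. g k = f k + d" by blast
qed

lemma finite_distance_trans: "finite_distance f g \<Longrightarrow> finite_distance g h \<Longrightarrow> finite_distance f h"
  unfolding finite_distance_def
proof (elim exE)
  fix d e assume "\<forall>\<^sub>F k in \<U>. f k = g k + d" "\<forall>\<^sub>F k in \<U>. g k = h k + e"
  then have "\<forall>\<^sub>F k in \<U>. f k = h k + (e + d)" by eventually_elim simp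
  then show "\<exists>d. \<forall>\<^sub>F k in \<U>. f k = h k + d" by blast
qed

text \<open>A canonical representative of the functions at finite distance. The functions that are
  almost everywhere constant are represented by zero, which becomes the least block.\<close>

definition block_of :: "(nat \<Rightarrow> int) \<Rightarrow> nat \<Rightarrow> int" where
  "block_of f = (if finite_distance f (\<lambda>_. 0) then (\<lambda>_. 0) else SOME g. finite_distance f g)"

definition block_pos :: "(nat \<Rightarrow> int) \<Rightarrow> int" where
  "block_pos f = (SOME d. \<forall>\<^sub>F k in \<U>. f k = block_of f k + d)"

lemma finite_distance_block_of: "finite_distance f (block_of f)"
  unfolding block_of_def using someI[of "finite_distance f", OF finite_distance_refl] by simp

lemma block_pos: "\<forall>\<^sub>F k in \<U>. f k = block_of f k + block_pos f"
  unfolding block_pos_def by (rule someI_ex) (use finite_distance_block_of in \<open>simp add: finite_distance_def\<close>)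

lemma block_of_eq_iff: "block_of f = block_of g \<longleftrightarrow> finite_distance f g"
proof
  assume "block_of f = block_of g"
  then show "finite_distance f g"
    using finite_distance_block_of finite_distance_sym finite_distance_trans by metis
next
  assume fg: "finite_distance f g"
  have "finite_distance f = finite_distance g"
    using fg finite_distance_sym finite_distance_trans by (intro ext) metis
  then show "block_of f = block_of g" unfolding block_of_def by simp
qed

lemma block_of_block_of [simp]: "block_of (block_of f) = block_of f"
  unfolding block_of_eq_iff by (rule finite_distance_sym[OF finite_distance_block_of])

lemma block_of_const [simp]: "block_of (\<lambda>_. c) = (\<lambda>_. 0)"
proof -
  have "finite_distance (\<lambda>_. c) (\<lambda>_. 0)" unfolding finite_distance_def by simp
  then show ?thesis unfolding block_of_def by simp
qed

lemma block_pos_eqI: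
  assumes "\<forall>\<^sub>F k in \<U>. f k = block_of f k + d"
  shows "block_pos f = d"
proof -
  have "\<forall>\<^sub>F k in \<U>. block_pos f = d" using assms block_pos[of f] by eventually_elim simp
  then show ?thesis by simp
qed

lemma ultra_nat_interval:
  assumes "\<forall>\<^sub>F k in \<U>. 0 \<le> f k \<and> f k < (m :: int)"
  shows "\<exists>d. \<forall>\<^sub>F k in \<U>. f k = d"
proof -
  have "\<forall>\<^sub>F k in \<U>. \<exists>i\<in>{0..<m}. f k = i" using assms by eventually_elim auto
  from eventually_ultra_finite_ex[OF _ this] show ?thesis by auto
qed

abbreviation (input) ev_less :: "(nat \<Rightarrow> int) \<Rightarrow> (nat \<Rightarrow> int) \<Rightarrow> bool" where
  "ev_less \<equiv> ultra_less (\<lambda>_. (<))"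

text \<open>If the difference stayed below a constant, it would be almost everywhere constant
  itself, and the distance would be finite.\<close>

lemma far_less:
  assumes "\<not> finite_distance f g" "ev_less f g"
  shows "\<forall>\<^sub>F k in \<U>. f k + m \<le> g k"
proof (rule ccontr)
  assume "\<not> ?thesis"
  then have "\<forall>\<^sub>F k in \<U>. \<not> f k + m \<le> g k" unfolding eventually_ultra_not .
  then have "\<forall>\<^sub>F k in \<U>. 0 \<le> g k - f k \<and> g k - f k < m"
    using assms(2) unfolding ultra_less_def by eventually_elim auto
  then obtain d where "\<forall>\<^sub>F k in \<U>. g k - f k = d" using ultra_nat_interval[of "\<lambda>k. g k - f k" m] by blast
  then have "\<forall>\<^sub>F k in \<U>. g k = f k + d" by eventually_elim simp
  then show False using assms(1) finite_distance_sym unfolding finite_distance_def by blast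
qed

lemma ev_less_total: "f = g \<or> (\<forall>\<^sub>F k in \<U>. f k = g k) \<or> ev_less f g \<or> ev_less g f"
proof -
  have "\<forall>\<^sub>F k in \<U>. f k = g k \<or> f k < g k \<or> g k < f k" by (rule always_eventually) auto
  then show ?thesis unfolding eventually_ultra_disj ultra_less_def by blast
qed

lemma ev_less_trans:
  assumes "ev_less f g" "ev_less g h"
  shows "ev_less f h"
  using assms unfolding ultra_less_def by eventually_elim simp

lemma ev_less_irrefl: "\<not> ev_less f f"
  unfolding ultra_less_def by simp

lemma ev_less_block_of:
  assumes "\<not> finite_distance f g"
  shows "ev_less (block_of f) (block_of g) \<longleftrightarrow> ev_less f g"
proof -
  have imp: "ev_less (block_of f) (block_of g)" if "\<not> finite_distance f g" "ev_less f g" for f g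
    unfolding ultra_less_def
    using far_less[OF that, of "1 + block_pos g - block_pos f"] block_pos[of f] block_pos[of g]
    by eventually_elim simp
  show ?thesis
  proof
    assume l: "ev_less (block_of f) (block_of g)"
    show "ev_less f g"
    proof (rule ccontr)
      assume "\<not> ev_less f g"
      moreover have "\<not> (\<forall>\<^sub>F k in \<U>. f k = g k)"
        using assms unfolding finite_distance_def by (auto dest: spec[of _ 0])
      ultimately have "ev_less g f" using ev_less_total[of f g] by auto
      then have "ev_less (block_of g) (block_of f)" using imp[of g f] assms finite_distance_sym by blast
      then show False using l ev_less_trans ev_less_irrefl by blast
    qed
  qed (rule imp[OF assms])
qed

text \<open>Within a block, positions are compared; between blocks, the difference is infinite and
  swallows the finite positions.\<close>

lemma ev_less_lex:
  "ev_less f g \<longleftrightarrow> lex_less ev_less (block_of f, block_pos f) (block_of g, block_pos g)"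
proof (cases "finite_distance f g")
  case True
  then have b: "block_of f = block_of g" unfolding block_of_eq_iff .
  have "\<forall>\<^sub>F k in \<U>. f k < g k \<longleftrightarrow> block_pos f < block_pos g"
    using block_pos[of f] block_pos[of g] unfolding b by eventually_elim simp
  from eventually_ultra_cong[OF this] show ?thesis
    unfolding lex_less_def by (simp add: b ev_less_irrefl ultra_less_def)
next
  case False
  then have "block_of f \<noteq> block_of g" unfolding block_of_eq_iff .
  then show ?thesis unfolding lex_less_def using ev_less_block_of[OF False] by simp
qed

text \<open>The functions below represent a hyperfinite interval \<open>{0..k}\<close> in which the final segment of
  elements at finite distance from \<open>k\<close> has been moved in front of \<open>0\<close>, so that \<open>0\<close> lies in a block
  of order type \<open>\<int>\<close>.\<close>

definition rotated_interval :: "(nat \<Rightarrow> int) set" where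
  "rotated_interval = {f. finite_distance f (\<lambda>_. 0) \<or> (\<forall>m. \<forall>\<^sub>F k in \<U>. m \<le> f k \<and> f k + m \<le> int k)}"

abbreviation blocks :: "(nat \<Rightarrow> int) set" where
  "blocks \<equiv> block_of ` rotated_interval"

lemma ultra_ge_int: "\<forall>\<^sub>F k in \<U>. m \<le> int k"
  using eventually_ultra_ge[of "nat m"] by eventually_elim simp

lemma rotated_interval_close:
  assumes "f \<in> rotated_interval" "finite_distance f g"
  shows "g \<in> rotated_interval"
proof (cases "finite_distance f (\<lambda>_. 0)")
  case True
  then show ?thesis
    using assms(2) finite_distance_trans finite_distance_sym unfolding rotated_interval_def by blast
next
  case False
  then have f: "\<forall>\<^sub>F k in \<U>. m \<le> f k \<and> f k + m \<le> int k" for m using assms(1) unfolding rotated_interval_def by blast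
  obtain d where d: "\<forall>\<^sub>F k in \<U>. f k = g k + d" using assms(2) unfolding finite_distance_def by blast
  have "\<forall>\<^sub>F k in \<U>. m \<le> g k \<and> g k + m \<le> int k" for m
    using f[of "m + \<bar>d\<bar>"] d by eventually_elim auto
  then show ?thesis unfolding rotated_interval_def by blast
qed

lemma block_in_interval: "a \<in> blocks \<Longrightarrow> a \<in> rotated_interval"
  using rotated_interval_close finite_distance_block_of by blast

lemma block_bounds:
  assumes "a \<in> blocks"
  shows "\<forall>\<^sub>F k in \<U>. 0 \<le> a k" "\<forall>\<^sub>F k in \<U>. a k + m \<le> int k" "a \<noteq> (\<lambda>_. 0) \<Longrightarrow> ev_less (\<lambda>_. 0) a"
proof -
  have aV: "a \<in> rotated_interval" by (rule block_in_interval[OF assms])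
  have ba: "block_of a = a" using assms by auto
  have "(\<forall>\<^sub>F k in \<U>. 0 \<le> a k) \<and> (\<forall>\<^sub>F k in \<U>. a k + m \<le> int k) \<and> (a \<noteq> (\<lambda>_. 0) \<longrightarrow> ev_less (\<lambda>_. 0) a)"
  proof (cases "finite_distance a (\<lambda>_. 0)")
    case True
    then have "a = (\<lambda>_. 0)" using ba unfolding block_of_def by simp
    then show ?thesis using ultra_ge_int[of m] by simp
  next
    case False
    then have f: "\<forall>\<^sub>F k in \<U>. m \<le> a k \<and> a k + m \<le> int k" for m using aV unfolding rotated_interval_def by blast
    have "\<forall>\<^sub>F k in \<U>. 0 < a k" using f[of 1] by eventually_elim simp
    moreover have "\<forall>\<^sub>F k in \<U>. 0 \<le> a k" using f[of 1] by eventually_elim simp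
    moreover have "\<forall>\<^sub>F k in \<U>. a k + m \<le> int k" using f[of m] by eventually_elim simp
    ultimately show ?thesis unfolding ultra_less_def by blast
  qed
  then show "\<forall>\<^sub>F k in \<U>. 0 \<le> a k" "\<forall>\<^sub>F k in \<U>. a k + m \<le> int k" "a \<noteq> (\<lambda>_. 0) \<Longrightarrow> ev_less (\<lambda>_. 0) a" by blast+
qed

lemma blocks_far:
  assumes "a \<in> blocks" "b \<in> blocks" "a \<noteq> b"
  shows "\<not> finite_distance a b"
proof -
  have "block_of a = a" "block_of b = b" using assms(1,2) by auto
  then show ?thesis using assms(3) unfolding block_of_eq_iff[symmetric] by simp
qed

lemma zero_in_blocks: "(\<lambda>_. 0) \<in> blocks"
  by (rule image_eqI[of _ _ "\<lambda>_. 0"]) (simp_all add: rotated_interval_def finite_distance_refl)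

lemma linear_strict_blocks: "linear_strict blocks ev_less"
  unfolding linear_strict_def
proof (intro conjI ballI impI)
  fix a b assume ab: "a \<in> blocks" "b \<in> blocks"
  have "\<not> (\<forall>\<^sub>F k in \<U>. a k = b k)" if "a \<noteq> b"
    using blocks_far[OF ab that] unfolding finite_distance_def by (auto dest: spec[of _ 0])
  then show "a = b \<or> ev_less a b \<or> ev_less b a" using ev_less_total[of a b] by blast
qed (use ev_less_irrefl ev_less_trans in blast)+

text \<open>The new point must keep every finite distance from each member of \<open>A\<close> and
  of \<open>B\<close>, which is a countable set of inequalities that \<open>ultra_diagonal\<close>
  solves.\<close>

lemma eta_min_blocks: "eta_min blocks ev_less"
  unfolding eta_min_def
proof (intro conjI allI impI)
  show "linear_strict blocks ev_less" by (rule linear_strict_blocks)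
  show "\<exists>m\<in>blocks. \<forall>x\<in>blocks. x = m \<or> ev_less m x"
    by (rule bexI[OF _ zero_in_blocks]) (use block_bounds(3) in blast)
next
  fix A B assume AB: "A \<subseteq> blocks" "B \<subseteq> blocks" "countable A" "countable B" "A \<noteq> {}" "\<forall>a\<in>A. \<forall>b\<in>B. ev_less a b"
  \<comment> \<open>The function \<open>int\<close> is the top of the interval. As a further upper
    bound it keeps the new point infinitely far below the top, also when \<open>B\<close> is
    empty.\<close>
  let ?A = "A \<times> (UNIV :: int set)" and ?B = "insert int B \<times> (UNIV :: int set)"
  have c: "countable ?A" "countable ?B" "?A \<noteq> {}" "?B \<noteq> {}" using AB(3,4,5) by auto
  define p where "p = from_nat_into ?A"
  define q where "q = from_nat_into ?B"
  have p: "range p = ?A" unfolding p_def by (rule range_from_nat_into[OF c(3,1)])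
  have q: "range q = ?B" unfolding q_def by (rule range_from_nat_into[OF c(4,2)])
  have sep: "\<forall>\<^sub>F k in \<U>. a k + m + m' \<le> b k" if a: "a \<in> A" and b: "b \<in> insert int B" for a b m m'
  proof (cases "b = int")
    case True
    have "a \<in> blocks" using a AB(1) by blast
    from block_bounds(2)[OF this, of "m + m'"] show ?thesis unfolding True by eventually_elim simp
  next
    case False
    then have b: "b \<in> B" using b by blast
    have "ev_less a b" using AB(6) a b by blast
    moreover from this have "a \<noteq> b" using ev_less_irrefl by blast
    ultimately have "\<forall>\<^sub>F k in \<U>. a k + (m + m') \<le> b k"
      by (intro far_less blocks_far) (use a b AB(1,2) in blast)+
    then show ?thesis by eventually_elim simp
  qed
  have "\<exists>x. \<forall>i. \<forall>\<^sub>F k in \<U>. fst (p i) k + snd (p i) \<le> x k \<and> x k + snd (q i) \<le> fst (q i) k"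
  proof (rule ultra_diagonal)
    fix n :: nat
    have "\<forall>\<^sub>F k in \<U>. \<forall>i\<in>{..n}. \<forall>j\<in>{..n}. fst (p i) k + snd (p i) + snd (q j) \<le> fst (q j) k"
    proof (intro eventually_ball_finite ballI finite_atMost)
      fix i j :: nat
      have "p i \<in> ?A" "q j \<in> ?B" using p q by blast+
      then show "\<forall>\<^sub>F k in \<U>. fst (p i) k + snd (p i) + snd (q j) \<le> fst (q j) k"
        by (intro sep) (auto simp: mem_Times_iff)
    qed
    then show "\<forall>\<^sub>F k in \<U>. \<exists>x. \<forall>i\<le>n. fst (p i) k + snd (p i) \<le> x \<and> x + snd (q i) \<le> fst (q i) k"
    proof (rule eventually_mono)
      fix k assume H: "\<forall>i\<in>{..n}. \<forall>j\<in>{..n}. fst (p i) k + snd (p i) + snd (q j) \<le> fst (q j) k"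
      \<comment> \<open>In each coordinate the largest lower bound will do, since every lower bound
        is compatible with every upper bound.\<close>
      let ?x = "Max ((\<lambda>i. fst (p i) k + snd (p i)) ` {..n})"
      have "?x \<in> (\<lambda>i. fst (p i) k + snd (p i)) ` {..n}" by (rule Max_in) auto
      then obtain i where i: "?x = fst (p i) k + snd (p i)" "i \<in> {..n}" by (rule imageE)
      then have "?x + snd (q j) \<le> fst (q j) k" if "j \<le> n" for j
        using H[rule_format, OF i(2), of j] that unfolding i(1) by simp
      moreover have "fst (p i) k + snd (p i) \<le> ?x" if "i \<le> n" for i by (rule Max_ge) (use that in auto)
      ultimately show "\<exists>x. \<forall>i\<le>n. fst (p i) k + snd (p i) \<le> x \<and> x + snd (q i) \<le> fst (q i) k" by blast
    qed
  qed
  then obtain x where x: "\<And>i. \<forall>\<^sub>F k in \<U>. fst (p i) k + snd (p i) \<le> x k \<and> x k + snd (q i) \<le> fst (q i) k" by blast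
  have xa: "\<forall>\<^sub>F k in \<U>. a k + m \<le> x k" if "a \<in> A" for a m
  proof -
    have "(a, m) \<in> range p" unfolding p using that by blast
    then obtain i where "p i = (a, m)" by auto
    then show ?thesis using x[of i] by (auto elim: eventually_mono)
  qed
  have xb: "\<forall>\<^sub>F k in \<U>. x k + m \<le> b k" if "b \<in> insert int B" for b m
  proof -
    have "(b, m) \<in> range q" unfolding q using that by blast
    then obtain i where "q i = (b, m)" by auto
    then show ?thesis using x[of i] by (auto elim: eventually_mono)
  qed
  obtain a0 where a0: "a0 \<in> A" using AB(5) by blast
  then have a0b: "a0 \<in> blocks" using AB(1) by blast
  have "\<forall>\<^sub>F k in \<U>. m \<le> x k \<and> x k + m \<le> int k" for m
    using xa[OF a0, of m] xb[OF insertI1, of m] block_bounds(1)[OF a0b] by eventually_elim simp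
  then have xV: "x \<in> rotated_interval" unfolding rotated_interval_def by blast
  have "ev_less a (block_of x)" if a: "a \<in> A" for a
  proof -
    have "block_of a = a" using a AB(1) by auto
    moreover have "ev_less a x" unfolding ultra_less_def using xa[OF a, of 1] by eventually_elim simp
    moreover have "\<not> finite_distance a x"
    proof
      assume "finite_distance a x"
      then obtain d where "\<forall>\<^sub>F k in \<U>. a k = x k + d" unfolding finite_distance_def by blast
      then have "\<forall>\<^sub>F k in \<U>. False" using xa[OF a, of "1 - d"] by eventually_elim simp
      then show False by simp
    qed
    ultimately show ?thesis using ev_less_block_of[of a x] by simp
  qed
  moreover have "ev_less (block_of x) b" if b: "b \<in> B" for b
  proof -
    have "block_of b = b" using b AB(2) by auto
    moreover have "ev_less x b" unfolding ultra_less_def using xb[OF insertI2[OF b], of 1] by eventually_elim simp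
    moreover have "\<not> finite_distance x b"
    proof
      assume "finite_distance x b"
      then obtain d where "\<forall>\<^sub>F k in \<U>. x k = b k + d" unfolding finite_distance_def by blast
      then have "\<forall>\<^sub>F k in \<U>. False" using xb[OF insertI2[OF b], of "1 - d"] by eventually_elim simp
      then show False by simp
    qed
    ultimately show ?thesis using ev_less_block_of[of x b] by simp
  qed
  ultimately show "\<exists>x\<in>blocks. (\<forall>a\<in>A. ev_less a x) \<and> (\<forall>b\<in>B. ev_less x b)" using xV by blast
qed

section \<open>The hyperfinite interval and its rotated form\<close>

abbreviation HN :: "(nat \<Rightarrow> nat) set" where "HN \<equiv> ultraproduct (\<lambda>k. {..k})"
abbreviation (input) nless :: "(nat \<Rightarrow> nat) \<Rightarrow> (nat \<Rightarrow> nat) \<Rightarrow> bool" where "nless \<equiv> ultra_less (\<lambda>_. (<))"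

definition near_top :: "(nat \<Rightarrow> nat) \<Rightarrow> bool" where
  "near_top x \<longleftrightarrow> (\<exists>m. \<forall>\<^sub>F k in \<U>. x k + m = k)"

text \<open>Near the top the full length \<open>k + 1\<close> is subtracted, so that the last point
  becomes \<open>-1\<close> and immediately precedes \<open>0\<close>.\<close>

definition rotate_point :: "(nat \<Rightarrow> nat) \<Rightarrow> nat \<Rightarrow> int" where
  "rotate_point x k = int (x k) - (if near_top x then int k + 1 else 0)"

lemma HN_not_near_top:
  assumes x: "x \<in> HN" "\<not> near_top x"
  shows "\<forall>\<^sub>F k in \<U>. x k + m \<le> k"
proof (rule ccontr)
  assume "\<not> ?thesis"
  then have "\<forall>\<^sub>F k in \<U>. \<not> x k + m \<le> k" unfolding eventually_ultra_not .
  then have "\<forall>\<^sub>F k in \<U>. 0 \<le> int k - int (x k) \<and> int k - int (x k) < int m"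
    using ultraproduct_ev[OF x(1)] by eventually_elim auto
  from ultra_nat_interval[OF this] obtain d where d: "\<forall>\<^sub>F k in \<U>. int k - int (x k) = d" by blast
  then have "\<forall>\<^sub>F k in \<U>. x k + nat d = k" using ultraproduct_ev[OF x(1)] by eventually_elim auto
  then show False using x(2) unfolding near_top_def by blast
qed

lemma rotate_point_sign:
  assumes "x \<in> HN"
  shows "near_top x \<Longrightarrow> \<forall>\<^sub>F k in \<U>. rotate_point x k < 0" "\<not> near_top x \<Longrightarrow> \<forall>\<^sub>F k in \<U>. 0 \<le> rotate_point x k"
  using ultraproduct_ev[OF assms] unfolding rotate_point_def by (auto elim: eventually_mono)

text \<open>The order is reversed exactly for pairs with one member near the top: that member is the
  larger before the rotation and the smaller after it.\<close>

lemma rotate_point_less: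
  assumes x: "x \<in> HN" and y: "y \<in> HN"
  shows "ev_less (rotate_point x) (rotate_point y) \<longleftrightarrow>
    (if near_top x \<longleftrightarrow> near_top y then nless x y else near_top x)"
    "near_top x \<Longrightarrow> \<not> near_top y \<Longrightarrow> nless y x" "near_top x \<Longrightarrow> \<not> near_top y \<Longrightarrow> \<not> nless x y"
proof -
  have sep: "nless y x" "ev_less (rotate_point x) (rotate_point y)" if top: "near_top x" "\<not> near_top y" "x \<in> HN" "y \<in> HN" for x y
  proof -
    obtain m where m: "\<forall>\<^sub>F k in \<U>. x k + m = k" using top(1) unfolding near_top_def by blast
    show "nless y x" unfolding ultra_less_def
      using m HN_not_near_top[OF top(4,2), of "Suc m"] by eventually_elim simp
    show "ev_less (rotate_point x) (rotate_point y)" unfolding ultra_less_def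
      using rotate_point_sign(1)[OF top(3,1)] rotate_point_sign(2)[OF top(4,2)] by eventually_elim simp
  qed
  have as: "\<not> ultra_less (\<lambda>_. (<)) g f" if "ultra_less (\<lambda>_. (<)) f g" for f g :: "nat \<Rightarrow> 'c::linorder"
  proof
    assume "ultra_less (\<lambda>_. (<)) g f"
    with that have "\<forall>\<^sub>F k in \<U>. False" unfolding ultra_less_def by eventually_elim simp
    then show False by simp
  qed
  show "ev_less (rotate_point x) (rotate_point y) \<longleftrightarrow> (if near_top x \<longleftrightarrow> near_top y then nless x y else near_top x)"
  proof (cases "near_top x \<longleftrightarrow> near_top y")
    case True
    then show ?thesis unfolding ultra_less_def rotate_point_def by simp
  next
    case False
    then show ?thesis using sep[of x y] sep[of y x] as x y by (cases "near_top x") auto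
  qed
  show "near_top x \<Longrightarrow> \<not> near_top y \<Longrightarrow> nless y x" "near_top x \<Longrightarrow> \<not> near_top y \<Longrightarrow> \<not> nless x y"
    using sep(1)[of x y] as x y by blast+
qed

lemma rotate_point_interval:
  assumes x: "x \<in> HN"
  shows "rotate_point x \<in> rotated_interval"
proof (cases "near_top x")
  case True
  then obtain m where "\<forall>\<^sub>F k in \<U>. x k + m = k" unfolding near_top_def by blast
  then have "\<forall>\<^sub>F k in \<U>. rotate_point x k = 0 + (- int m - 1)" by eventually_elim (use True in \<open>auto simp: rotate_point_def\<close>)
  then show ?thesis unfolding rotated_interval_def finite_distance_def by blast
next
  case False
  show ?thesis
  proof (cases "finite_distance (rotate_point x) (\<lambda>_. 0)")
    case False
    have nn: "\<forall>\<^sub>F k in \<U>. 0 \<le> rotate_point x k" using rotate_point_sign(2)[OF x \<open>\<not> near_top x\<close>] .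
    have "\<forall>\<^sub>F k in \<U>. m \<le> rotate_point x k" for m
    proof (rule ccontr)
      assume "\<not> ?thesis"
      then have "\<forall>\<^sub>F k in \<U>. \<not> m \<le> rotate_point x k" unfolding eventually_ultra_not .
      then have "\<forall>\<^sub>F k in \<U>. 0 \<le> rotate_point x k \<and> rotate_point x k < m" using nn by eventually_elim simp
      from ultra_nat_interval[OF this] show False using False unfolding finite_distance_def by simp
    qed
    note ge = this
    have "\<forall>\<^sub>F k in \<U>. m \<le> rotate_point x k \<and> rotate_point x k + m \<le> int k" for m
      using ge[of m] HN_not_near_top[OF x \<open>\<not> near_top x\<close>, of "nat m"]
      by eventually_elim (use \<open>\<not> near_top x\<close> in \<open>auto simp: rotate_point_def\<close>)
    then show ?thesis unfolding rotated_interval_def by blast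
  qed (simp add: rotated_interval_def)
qed

text \<open>A nonnegative function is taken as it stands. A negative one is a standard negative
  constant \<open>d\<close> and comes from the point \<open>k + 1 + d\<close> near the top.\<close>

lemma rotate_point_surj:
  assumes f: "f \<in> rotated_interval"
  shows "\<exists>x\<in>HN. \<forall>\<^sub>F k in \<U>. rotate_point x k = f k"
proof (cases "\<forall>\<^sub>F k in \<U>. 0 \<le> f k")
  case True
  have up: "\<forall>\<^sub>F k in \<U>. f k + m \<le> int k" for m
  proof (cases "finite_distance f (\<lambda>_. 0)")
    case True
    then obtain d where "\<forall>\<^sub>F k in \<U>. f k = 0 + d" unfolding finite_distance_def by blast
    then show ?thesis using ultra_ge_int[of "d + m"] by eventually_elim simp
  next
    case False
    then have "\<forall>\<^sub>F k in \<U>. m \<le> f k \<and> f k + m \<le> int k" using f unfolding rotated_interval_def by blast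
    then show ?thesis by eventually_elim simp
  qed
  let ?x = "rep (\<lambda>k. nat (f k))"
  have x: "?x \<in> HN" by (rule rep_in_ultraproduct) (use up[of 0] in \<open>eventually_elim, simp\<close>)
  have nt: "\<not> near_top ?x"
  proof
    assume "near_top ?x"
    then obtain m where "\<forall>\<^sub>F k in \<U>. ?x k + m = k" unfolding near_top_def by blast
    then have "\<forall>\<^sub>F k in \<U>. False" using rep_eq[of "\<lambda>k. nat (f k)"] up[of "int m + 1"] True by eventually_elim auto
    then show False by simp
  qed
  have "\<forall>\<^sub>F k in \<U>. rotate_point ?x k = f k"
    using rep_eq[of "\<lambda>k. nat (f k)"] True by eventually_elim (use nt in \<open>simp add: rotate_point_def\<close>)
  then show ?thesis using x by blast
next
  case False
  then have neg: "\<forall>\<^sub>F k in \<U>. \<not> 0 \<le> f k" unfolding eventually_ultra_not .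
  have "finite_distance f (\<lambda>_. 0)"
  proof (rule ccontr)
    assume "\<not> ?thesis"
    then have "\<forall>\<^sub>F k in \<U>. 0 \<le> f k \<and> f k + 0 \<le> int k" using f unfolding rotated_interval_def by blast
    then have "\<forall>\<^sub>F k in \<U>. 0 \<le> f k" by eventually_elim simp
    then show False using False by blast
  qed
  then obtain d where d: "\<forall>\<^sub>F k in \<U>. f k = 0 + d" unfolding finite_distance_def by blast
  then have "\<forall>\<^sub>F k in \<U>. d < 0" using neg by eventually_elim simp
  then have d0: "d < 0" by simp
  let ?x = "rep (\<lambda>k. nat (int k + 1 + d))"
  have x: "?x \<in> HN" by (rule rep_in_ultraproduct) (rule always_eventually, use d0 in auto)
  have val: "\<forall>\<^sub>F k in \<U>. int (?x k) = int k + 1 + d"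
    using rep_eq[of "\<lambda>k. nat (int k + 1 + d)"] ultra_ge_int[of "- d"] by eventually_elim simp
  then have "\<forall>\<^sub>F k in \<U>. ?x k + nat (- d - 1) = k" by eventually_elim (use d0 in simp)
  then have nt: "near_top ?x" unfolding near_top_def by blast
  have "\<forall>\<^sub>F k in \<U>. rotate_point ?x k = f k"
    using val d by eventually_elim (use nt in \<open>simp add: rotate_point_def\<close>)
  then show ?thesis using x by blast
qed

text \<open>Points near the top pass to the bottom of the next sheet, hence the increased level,
  taken modulo \<open>n\<close> for the last sheet.\<close>

definition rotate_coord :: "nat \<Rightarrow> (nat \<Rightarrow> nat) \<times> nat \<Rightarrow> ((nat \<Rightarrow> int) \<times> int) \<times> nat" where
  "rotate_coord n u = ((block_of (rotate_point (fst u)), block_pos (rotate_point (fst u))),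
     if near_top (fst u) then (snd u + 1) mod n else snd u)"

text \<open>Moving a point to the bottom changes its order comparisons by one, and the change of
  level compensates for it. Only the starting points of the sheets on the circle have been
  changed.\<close>

lemma rotate_coord_delta:
  assumes "fst u \<in> HN" "fst v \<in> HN"
  shows "delta n (lex_less ev_less) (rotate_coord n u) (rotate_coord n v) = delta n nless u v"
proof -
  let ?t = "\<lambda>u. of_bool (near_top (fst u)) :: int"
  have s: "int (snd (rotate_coord n w)) mod int n = (int (snd w) + ?t w) mod int n" for w
    by (simp add: rotate_coord_def zmod_int add.commute)
  have l: "lex_less ev_less (fst (rotate_coord n v)) (fst (rotate_coord n u)) \<longleftrightarrow>
      ev_less (rotate_point (fst v)) (rotate_point (fst u))"
    unfolding ev_less_lex[of "rotate_point (fst v)"] by (simp add: rotate_coord_def)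
  have lt: "?t v - ?t u - of_bool (ev_less (rotate_point (fst v)) (rotate_point (fst u))) = - (of_bool (nless (fst v) (fst u)) :: int)"
    using rotate_point_less[OF assms(2,1)] rotate_point_less(2,3)[OF assms]
    by (cases "near_top (fst u)"; cases "near_top (fst v)") auto
  have "delta n (lex_less ev_less) (rotate_coord n u) (rotate_coord n v) =
      (int (snd v) + ?t v - (int (snd u) + ?t u) - of_bool (ev_less (rotate_point (fst v)) (rotate_point (fst u)))) mod int n"
    unfolding delta_def l by (intro mod_diff_cong s refl)
  also have "\<dots> = delta n nless u v"
    unfolding delta_def using lt by (intro arg_cong[of _ _ "\<lambda>x. x mod int n"]) simp
  finally show ?thesis .
qed

lemma rotate_coord_bij:
  assumes n: "n \<ge> 2"
  shows "bij_betw (rotate_coord n) (HN \<times> {..<n}) ((blocks \<times> UNIV) \<times> {..<n})"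
proof (rule bij_betw_imageI)
  show "inj_on (rotate_coord n) (HN \<times> {..<n})"
  proof (rule inj_onI)
    fix u v assume u: "u \<in> HN \<times> {..<n}" and v: "v \<in> HN \<times> {..<n}" and eq: "rotate_coord n u = rotate_coord n v"
    have m: "fst u \<in> HN" "fst v \<in> HN" using u v by auto
    have b: "block_of (rotate_point (fst u)) = block_of (rotate_point (fst v))"
      "block_pos (rotate_point (fst u)) = block_pos (rotate_point (fst v))"
      using eq by (simp_all add: rotate_coord_def)
    have ev: "\<forall>\<^sub>F k in \<U>. rotate_point (fst u) k = rotate_point (fst v) k"
      using block_pos[of "rotate_point (fst u)"] block_pos[of "rotate_point (fst v)"] unfolding b by eventually_elim simp
    have nt: "near_top (fst u) \<longleftrightarrow> near_top (fst v)"
    proof (rule ccontr)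
      assume no: "\<not> ?thesis"
      have "\<not> (near_top x \<and> \<not> near_top y)" if "x \<in> HN" "y \<in> HN" "\<forall>\<^sub>F k in \<U>. rotate_point x k = rotate_point y k" for x y
      proof
        assume "near_top x \<and> \<not> near_top y"
        then have "\<forall>\<^sub>F k in \<U>. rotate_point x k < 0" "\<forall>\<^sub>F k in \<U>. 0 \<le> rotate_point y k"
          using rotate_point_sign that(1,2) by blast+
        then have "\<forall>\<^sub>F k in \<U>. False" using that(3) by eventually_elim simp
        then show False by simp
      qed
      note sep = this
      have "\<forall>\<^sub>F k in \<U>. rotate_point (fst v) k = rotate_point (fst u) k" using ev by eventually_elim simp
      then show False using no sep[OF m ev] sep[OF m(2,1)] by blast
    qed
    have "\<forall>\<^sub>F k in \<U>. fst u k = fst v k"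
      using ev by eventually_elim (simp add: rotate_point_def nt)
    then have "fst u = fst v" by (rule ultraproduct_eqI[OF m])
    moreover have "snd u = snd v"
    proof (cases "near_top (fst u)")
      case True
      then have "(snd u + 1) mod n = (snd v + 1) mod n" using eq nt by (simp add: rotate_coord_def)
      then have "snd u mod n = snd v mod n" by (simp add: mod_Suc split: if_splits)
      then show ?thesis using u v by (simp add: mem_Times_iff)
    next
      case False
      then show ?thesis using eq nt by (simp add: rotate_coord_def)
    qed
    ultimately show "u = v" by (simp add: prod_eq_iff)
  qed
  show "rotate_coord n ` (HN \<times> {..<n}) = (blocks \<times> UNIV) \<times> {..<n}"
  proof (rule equalityI; rule subsetI)
    fix p assume "p \<in> rotate_coord n ` (HN \<times> {..<n})"
    then obtain u where u: "u \<in> HN \<times> {..<n}" "p = rotate_coord n u" by blast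
    have "rotate_point (fst u) \<in> rotated_interval" by (rule rotate_point_interval) (use u in auto)
    then show "p \<in> (blocks \<times> UNIV) \<times> {..<n}" using u n by (auto simp: rotate_coord_def)
  next
    fix p assume "p \<in> (blocks \<times> (UNIV :: int set)) \<times> {..<n}"
    then obtain b z i where p: "p = ((b, z), i)" "b \<in> blocks" "i < n" by (cases p) auto
    have bb: "block_of b = b" using p(2) by auto
    let ?f = "\<lambda>k. b k + z"
    have "finite_distance ?f b" unfolding finite_distance_def by (rule exI[of _ z]) simp
    then have f: "?f \<in> rotated_interval" "block_of ?f = b"
      using rotated_interval_close[OF block_in_interval[OF p(2)] finite_distance_sym] bb block_of_eq_iff[of ?f b] by simp_all
    obtain x where x: "x \<in> HN" "\<forall>\<^sub>F k in \<U>. rotate_point x k = ?f k" using rotate_point_surj[OF f(1)] by blast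
    have "finite_distance (rotate_point x) ?f" unfolding finite_distance_def by (rule exI[of _ 0]) (use x(2) in simp)
    then have bx: "block_of (rotate_point x) = b" using f(2) block_of_eq_iff by metis
    have px: "block_pos (rotate_point x) = z" by (rule block_pos_eqI) (use x(2) bx in simp)
    have "\<exists>j<n. (j + 1) mod n = i"
    proof (cases i)
      case 0
      then show ?thesis using n by (intro exI[of _ "n - 1"]) simp
    next
      case (Suc j)
      then show ?thesis using p(3) by (intro exI[of _ j]) simp
    qed
    then obtain j where j: "j < n" "(j + 1) mod n = i" by blast
    have "p = rotate_coord n (x, if near_top x then j else i)" using p(1) bx px j(2) by (simp add: rotate_coord_def)
    moreover have "(x, if near_top x then j else i) \<in> HN \<times> {..<n}" using x(1) j(1) p(3) by simp
    ultimately show "p \<in> rotate_coord n ` (HN \<times> {..<n})" by blast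
  qed
qed

text \<open>As an ultraproduct of covers of the finite orders \<open>{..k}\<close>, the structure is
  countably saturated. In rotated coordinates it is a cover of \<open>blocks \<times> UNIV\<close>,
  which is of the form required by \<open>not_G_compact\<close>.\<close>

theorem hyperfinite_cover_not_G_compact:
  fixes N :: "('s::infinite, 'f, 'r::infinite, 'a) struct"
  assumes N: "cover_model N cd HN nless"
  shows "\<not> G_compact osig (Th osig N)"
proof -
  let ?A = "cover_struct HN nless :: ('s, 'f, 'r, _) struct"
  have ne: "HN \<noteq> {}" using N unfolding cover_model_def by blast
  have A: "is_structure osig ?A" by (rule cover_model_structure[OF cover_struct_cover[OF ne]])
  have U: "ultralimit osig ?A (\<lambda>k. cover_struct {..k} (<)) (\<lambda>k u. (fst u k, snd u))" by (rule cover_struct_ultralimit)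
  have Th: "Th osig N = Th osig ?A" by (rule cover_model_Th_unique[OF N cover_struct_cover[OF ne]])
  have "cover_model ?A (\<lambda>s. rotate_coord (inv sg s + 2)) (blocks \<times> UNIV) (lex_less ev_less)"
    unfolding cover_model_def
  proof (intro conjI allI ballI)
    show "blocks \<times> (UNIV :: int set) \<noteq> {}" using zero_in_blocks by blast
    fix n :: nat
    show "bij_betw (rotate_coord (inv sg (sg n :: 's) + 2)) (carr ?A (sg n)) ((blocks \<times> UNIV) \<times> {..<n + 2})"
      using rotate_coord_bij[of "n + 2"] by simp
    fix j u v assume "u \<in> carr ?A (sg n)" "v \<in> carr ?A (sg n)"
    then show "rint ?A (rl n j) [u, v] \<longleftrightarrow>
      delta (n + 2) (lex_less ev_less) (rotate_coord (inv sg (sg n :: 's) + 2) u) (rotate_coord (inv sg (sg n :: 's) + 2) v) = int j"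
      using rotate_coord_delta[of u v "n + 2"] by (simp add: mem_Times_iff)
  qed
  from not_G_compact[OF this eta_min_blocks ultralimit.countably_saturated_struct[OF U A]] show ?thesis
    unfolding Th by blast
qed

section \<open>Interpreting covers in a definable order\<close>

definition definable_pred ::
  "('s, 'f, 'r) signature \<Rightarrow> ('s, 'f, 'r, 'a) struct \<Rightarrow> 's list \<Rightarrow> ('a list \<Rightarrow> bool) \<Rightarrow> bool" where
  "definable_pred L M ts P \<longleftrightarrow> definable L M ts {z \<in> tuples M ts. P z}"

lemma definable_pred_conj:
  assumes "definable_pred L M ts P" "definable_pred L M ts Q"
  shows "definable_pred L M ts (\<lambda>z. P z \<and> Q z)"
proof -
  have "{z \<in> tuples M ts. P z \<and> Q z} = {z \<in> tuples M ts. P z} \<inter> {z \<in> tuples M ts. Q z}" by auto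
  then show ?thesis using assms unfolding definable_pred_def by (simp add: definable_Int)
qed

lemma definable_pred_disj:
  assumes "definable_pred L M ts P" "definable_pred L M ts Q"
  shows "definable_pred L M ts (\<lambda>z. P z \<or> Q z)"
proof -
  have "{z \<in> tuples M ts. P z \<or> Q z} = {z \<in> tuples M ts. P z} \<union> {z \<in> tuples M ts. Q z}" by auto
  then show ?thesis using assms unfolding definable_pred_def by (simp add: definable_Un)
qed

lemma definable_pred_not:
  assumes "definable_pred L M ts P"
  shows "definable_pred L M ts (\<lambda>z. \<not> P z)"
proof -
  have "{z \<in> tuples M ts. \<not> P z} = tuples M ts - {z \<in> tuples M ts. P z}" by auto
  then show ?thesis using definable_Diff assms unfolding definable_pred_def by simp
qed

text \<open>For a false guard, the empty predicate is written as a contradiction in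
  \<open>P\<close>.\<close>

lemma definable_pred_guard:
  assumes "definable_pred L M ts P"
  shows "definable_pred L M ts (\<lambda>z. b \<and> P z)"
proof (cases b)
  case False
  have "definable_pred L M ts (\<lambda>z. P z \<and> \<not> P z)"
    by (intro definable_pred_conj definable_pred_not assms)
  then show ?thesis using False by simp
qed (use assms in simp)

lemma definable_pred_bex:
  assumes "finite I" "I \<noteq> {}" "\<And>i. i \<in> I \<Longrightarrow> definable_pred L M ts (P i)"
  shows "definable_pred L M ts (\<lambda>z. \<exists>i\<in>I. P i z)"
  using assms by (induction I rule: finite_ne_induct) (auto intro: definable_pred_disj)

lemma kernel_quotient_bij:
  assumes E: "E = {(w, w'). w \<in> D \<and> w' \<in> D \<and> c w = c w'}"
  shows "equiv D E" "bij_betw (\<lambda>X. c (SOME w. w \<in> X)) (D // E) (c ` D)"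
    "\<And>w. w \<in> D \<Longrightarrow> c (SOME w'. w' \<in> E `` {w}) = c w"
proof -
  show "equiv D E" unfolding E equiv_def refl_on_def sym_def trans_def by auto
  show cls: "c (SOME w'. w' \<in> E `` {w}) = c w" if w: "w \<in> D" for w
  proof -
    have "w \<in> E `` {w}" using w unfolding E by simp
    then have "(SOME w'. w' \<in> E `` {w}) \<in> E `` {w}" by (rule someI)
    moreover have "c w' = c w" if "w' \<in> E `` {w}" for w' using that unfolding E by simp
    ultimately show ?thesis by blast
  qed
  show "bij_betw (\<lambda>X. c (SOME w. w \<in> X)) (D // E) (c ` D)"
  proof (rule bij_betw_imageI)
    show "inj_on (\<lambda>X. c (SOME w. w \<in> X)) (D // E)"
    proof (rule inj_onI)
      fix X Y assume X: "X \<in> D // E" and Y: "Y \<in> D // E" and eq: "c (SOME w. w \<in> X) = c (SOME w. w \<in> Y)"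
      obtain x where x: "x \<in> D" "X = E `` {x}" using X by (rule quotientE)
      obtain y where y: "y \<in> D" "Y = E `` {y}" using Y by (rule quotientE)
      have "c x = c y" using eq cls[OF x(1)] cls[OF y(1)] unfolding x(2) y(2) by simp
      then show "X = Y" unfolding x(2) y(2) E using x(1) y(1) by auto
    qed
    have "D // E = (\<lambda>x. E `` {x}) ` D" unfolding quotient_def by auto
    then have "(\<lambda>X. c (SOME w. w \<in> X)) ` (D // E) = (\<lambda>x. c (SOME w. w \<in> E `` {x})) ` D"
      by (simp only: image_image)
    also have "\<dots> = c ` D" by (rule image_cong[OF refl cls])
    finally show "(\<lambda>X. c (SOME w. w \<in> X)) ` (D // E) = c ` D" .
  qed
qed

lemma is_block_replicate:
  assumes "i < k"
  shows "is_block ss (concat (replicate k ss)) (i * length ss)"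
proof -
  have "concat (replicate k ss) ! (i * length ss + j) = ss ! j" if "j < length ss" for j
    using assms
  proof (induction k arbitrary: i)
    case (Suc k)
    then show ?case using that by (cases i) (auto simp: nth_append add.assoc)
  qed simp
  moreover have "i * length ss + length ss \<le> k * length ss"
    using assms mult_le_mono1[of "Suc i" k "length ss"] by simp
  ultimately show ?thesis
    unfolding is_block_def by (simp add: length_concat sum_list_replicate)
qed

text \<open>A point of the cover of degree \<open>n + 2\<close> over the order is coded by a pair \<open>x @ y\<close>, where \<open>y\<close>
  is equivalent to the parameter \<open>e i\<close> that names the sheet \<open>i < n + 2\<close>.\<close>

theorem interpreted_cover:
  fixes M :: "('s, 'f, 'r, 'a) struct" and R :: "'a list rel" and lt :: "'k \<Rightarrow> 'k \<Rightarrow> bool"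
  assumes R: "definable_rel L M ss R" and dom: "\<And>x y. (x, y) \<in> R \<Longrightarrow> (x, x) \<in> R \<and> (y, y) \<in> R"
    and idx: "\<And>x y. (x, x) \<in> R \<Longrightarrow> (y, y) \<in> R \<Longrightarrow> (x, y) \<in> R \<longleftrightarrow> \<not> lt (idx y) (idx x)"
    and K: "idx ` {x. (x, x) \<in> R} = K" "infinite K" and lin: "linear_strict K lt"
  shows "\<exists>(N :: ('ns::infinite, 'nf, 'nr::infinite, 'a list set) struct) cd.
    interpreted_in L M osig N \<and> cover_model N cd K lt"
proof -
  define D where "D = {x. (x, x) \<in> R}"
  define m where "m = length ss"
  have RD: "x \<in> D" "y \<in> D" if "(x, y) \<in> R" for x y using dom[OF that] by (simp_all add: D_def)
  have DK: "idx x \<in> K" if "x \<in> D" for x using that K(1) by (auto simp: D_def)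
  have idxD: "(x, y) \<in> R \<longleftrightarrow> \<not> lt (idx y) (idx x)" if "x \<in> D" "y \<in> D" for x y
    using idx that by (simp add: D_def)
  have Dt: "x \<in> tuples M ss" if "x \<in> D" for x using R that unfolding definable_rel_def D_def by blast
  have eqv: "(x, y) \<in> R \<and> (y, x) \<in> R \<longleftrightarrow> x \<in> D \<and> idx x = idx y" if y: "y \<in> D" for x y
  proof
    assume xy: "(x, y) \<in> R \<and> (y, x) \<in> R"
    then have x: "x \<in> D" using RD by blast
    have "\<not> lt (idx y) (idx x)" "\<not> lt (idx x) (idx y)" using xy idxD x y by blast+
    then show "x \<in> D \<and> idx x = idx y" using linear_strict_total[OF lin DK[OF x] DK[OF y]] x by blast
  next
    assume x: "x \<in> D \<and> idx x = idx y"
    have "\<not> lt (idx y) (idx y)" by (rule linear_strict_irrefl[OF lin DK[OF y]])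
    then show "(x, y) \<in> R \<and> (y, x) \<in> R" using idxD x y by simp
  qed
  \<comment> \<open>Infinitely many points of \<open>K\<close> serve as names of the sheets;
    \<open>e i\<close> is a representative of the name of sheet \<open>i\<close>.\<close>
  obtain f :: "nat \<Rightarrow> 'k" where f: "inj f" "range f \<subseteq> K" using infinite_countable_subset[OF K(2)] by blast
  have "\<forall>i. \<exists>x. x \<in> D \<and> idx x = f i"
  proof
    fix i
    have "f i \<in> idx ` D" using f(2) K(1) unfolding D_def by blast
    then show "\<exists>x. x \<in> D \<and> idx x = f i" by auto
  qed
  from choice[OF this] obtain e where e: "\<And>i. e i \<in> D" "\<And>i. idx (e i) = f i" by blast
  have sheet: "(y, e i) \<in> R \<and> (e i, y) \<in> R \<longleftrightarrow> y \<in> D \<and> idx y = f i" for y i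
    using eqv[OF e(1)] e(2) by simp
  \<comment> \<open>Membership in the field is expressed by comparability with a parameter, since
    \<open>(x, x) \<in> R\<close> would read the same block of coordinates twice.\<close>
  have inD: "(x, e 0) \<in> R \<or> (e 0, x) \<in> R \<longleftrightarrow> x \<in> D" for x
  proof
    assume x: "x \<in> D"
    have "\<not> (lt (idx (e 0)) (idx x) \<and> lt (idx x) (idx (e 0)))"
      using linear_strict_asym[OF lin _ DK[OF x] DK[OF e(1)]] by blast
    then show "(x, e 0) \<in> R \<or> (e 0, x) \<in> R" using idxD[OF x e(1)] idxD[OF e(1) x] by blast
  qed (use RD in blast)
  have Sorts: "set ss \<subseteq> Sorts L" using definable_sorts R unfolding definable_rel_def by fastforce
  define Dn where "Dn = (\<lambda>n. {x @ y | x y. x \<in> D \<and> y \<in> D \<and> (\<exists>i\<in>{..<n + 2}. idx y = f i)})"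
  define co where "co = (\<lambda>w. (idx (take m w), inv f (idx (drop m w))))"
  have co: "co (x @ y) = (idx x, i)" if "x \<in> D" "y \<in> D" "idx y = f i" for x y i
    using tuples_length[OF Dt[OF that(1)]] that(3) inv_f_f[OF f(1)] by (simp add: co_def m_def)
  define En where "En = (\<lambda>n. {(w, w'). w \<in> Dn n \<and> w' \<in> Dn n \<and> co w = co w'})"
  note quot = kernel_quotient_bij[OF En_def[THEN fun_cong]]
  have co_image: "co ` Dn n = K \<times> {..<n + 2}" for n
  proof (rule equalityI; rule subsetI)
    fix p assume "p \<in> co ` Dn n"
    then obtain x y i where "p = co (x @ y)" "x \<in> D" "y \<in> D" "i \<in> {..<n + 2}" "idx y = f i" unfolding Dn_def by blast
    then show "p \<in> K \<times> {..<n + 2}" using co DK by simp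
  next
    fix p assume "p \<in> K \<times> {..<n + 2}"
    then obtain z i where p: "p = (z, i)" "z \<in> K" "i \<in> {..<n + 2}" by (rule SigmaE)
    obtain x where x: "x \<in> D" "idx x = z" using K(1) p(2) unfolding D_def by auto
    have "x @ e i \<in> Dn n" unfolding Dn_def using x e p(3) by blast
    moreover have "co (x @ e i) = p" using co[OF x(1) e] x(2) p(1) by simp
    ultimately show "p \<in> co ` Dn n" by blast
  qed
  define cd where "cd = (\<lambda>(s :: 'ns) X. co (SOME w. w \<in> X))"
  define N :: "('ns, 'nf, 'nr, 'a list set) struct" where
    "N = \<lparr>carr = (\<lambda>s. Dn (inv sg s) // En (inv sg s)), fint = (\<lambda>_ _. undefined),
      rint = (\<lambda>r us. delta (fst (prod_decode (inv sg r)) + 2) lt (cd undefined (us ! 0)) (cd undefined (us ! 1))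
        = int (snd (prod_decode (inv sg r))))\<rparr>"
  have Nsimps: "carr N (sg n) = Dn n // En n"
    "rint N (rl n j) [u, v] \<longleftrightarrow> delta (n + 2) lt (co (SOME w. w \<in> u)) (co (SOME w. w \<in> v)) = int j" for n j u v
    by (simp_all add: N_def rl_def cd_def)
  have "K \<noteq> {}" using K(2) by auto
  then have cover: "cover_model N cd K lt"
    unfolding cover_model_def Nsimps cd_def using quot(2) co_image by simp
  define ts where "ts = (\<lambda>k. concat (replicate k ss))"
  have blk: "is_block ss (ts k) (i * m)" if "i < k" for i k unfolding ts_def m_def by (rule is_block_replicate[OF that])
  have tsS: "set (ts k) \<subseteq> Sorts L" for k using Sorts unfolding ts_def by auto
  have dR: "definable_pred L M (ts k) (\<lambda>z. (block ss (i * m) z, block ss (j * m) z) \<in> R)" if "i < k" "j < k" "i \<noteq> j" for i j k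
  proof -
    have "i * m + m \<le> j * m \<or> j * m + m \<le> i * m"
      using that(3) mult_le_mono1[of "Suc i" j m] mult_le_mono1[of "Suc j" i m] by (cases "i < j") auto
    then show ?thesis unfolding definable_pred_def
      by (intro definable_rel_blocks[OF R tsS blk blk]) (use that in \<open>simp_all add: m_def\<close>)
  qed
  have de: "definable_pred L M (ts k) (\<lambda>z. (block ss (i * m) z, e j) \<in> R)"
    "definable_pred L M (ts k) (\<lambda>z. (e j, block ss (i * m) z) \<in> R)" if "i < k" for i j k
    unfolding definable_pred_def by (rule definable_rel_block_param[OF R tsS blk[OF that] Dt[OF e(1)]])+
  have dD: "definable_pred L M (ts k) (\<lambda>z. block ss (i * m) z \<in> D)" if "i < k" for i k
    unfolding inD[symmetric] by (intro definable_pred_disj de that)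
  have ds: "definable_pred L M (ts k) (\<lambda>z. block ss (i * m) z \<in> D \<and> idx (block ss (i * m) z) = f j)" if "i < k" for i j k
    unfolding sheet[symmetric] by (intro definable_pred_conj de that)
  have ne: "{..<n + 2} \<noteq> {}" for n :: nat by auto
  have ts2: "ts 2 = ss @ ss" and ts4: "ts 4 = (ss @ ss) @ ss @ ss" by (simp_all add: ts_def numeral_eq_Suc)
  have tapp: "x @ y \<in> tuples M (us @ vs)" if "x \<in> tuples M us" "y \<in> tuples M vs" for x y us vs
    unfolding tuples_append using that by blast
  have bl2: "block ss (0 * m) (x @ y) = x" "block ss (1 * m) (x @ y) = y" if "x \<in> tuples M ss" "y \<in> tuples M ss" for x y
    using tuples_length[OF that(1)] tuples_length[OF that(2)] by (simp_all add: m_def)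
  have bl4: "block ss (0 * m) ((x @ y) @ x' @ y') = x" "block ss (1 * m) ((x @ y) @ x' @ y') = y"
    "block ss (2 * m) ((x @ y) @ x' @ y') = x'" "block ss (3 * m) ((x @ y) @ x' @ y') = y'"
    if "x \<in> tuples M ss" "y \<in> tuples M ss" "x' \<in> tuples M ss" "y' \<in> tuples M ss" for x y x' y'
    using that[THEN tuples_length] by (simp_all add: m_def)
  have defD: "definable L M (ss @ ss) (Dn n)" for n
  proof -
    let ?P = "\<lambda>z. block ss (0 * m) z \<in> D \<and> (\<exists>i\<in>{..<n + 2}. block ss (1 * m) z \<in> D \<and> idx (block ss (1 * m) z) = f i)"
    have "definable_pred L M (ts 2) ?P"
      by (intro definable_pred_conj definable_pred_bex[OF _ ne] dD ds) simp_all
    moreover have "{z \<in> tuples M (ss @ ss). ?P z} = Dn n"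
    proof (rule equalityI; rule subsetI)
      fix z assume "z \<in> {z \<in> tuples M (ss @ ss). ?P z}"
      then obtain x y where z: "x \<in> tuples M ss" "y \<in> tuples M ss" "z = x @ y" "?P z" unfolding tuples_append by blast
      then show "z \<in> Dn n" unfolding Dn_def using bl2[OF z(1,2)] by auto
    next
      fix z assume "z \<in> Dn n"
      then obtain x y i where z: "z = x @ y" "x \<in> D" "y \<in> D" "i \<in> {..<n + 2}" "idx y = f i" unfolding Dn_def by blast
      then show "z \<in> {z \<in> tuples M (ss @ ss). ?P z}"
        using Dt bl2[OF Dt[OF z(2)] Dt[OF z(3)]] unfolding tuples_append by auto
    qed
    ultimately show ?thesis unfolding definable_pred_def ts2 by simp
  qed
  \<comment> \<open>A relation between codes is a finite disjunction over the pairs of levels, so it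
    suffices to define it for fixed levels in terms of the two base tuples.\<close>
  have def4: "definable L M ((ss @ ss) @ ss @ ss) {w @ w' | w w'. w \<in> Dn n \<and> w' \<in> Dn n \<and> Q (co w) (co w')}"
    if Q: "\<And>i i'. i < n + 2 \<Longrightarrow> i' < n + 2 \<Longrightarrow> definable_pred L M (ts 4)
        (\<lambda>z. block ss (0 * m) z \<in> D \<and> block ss (2 * m) z \<in> D \<and> Q (idx (block ss (0 * m) z), i) (idx (block ss (2 * m) z), i'))"
    for Q n
  proof -
    let ?P = "\<lambda>z. \<exists>i\<in>{..<n + 2}. \<exists>i'\<in>{..<n + 2}.
      (block ss (0 * m) z \<in> D \<and> block ss (2 * m) z \<in> D \<and> Q (idx (block ss (0 * m) z), i) (idx (block ss (2 * m) z), i')) \<and>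
      (block ss (1 * m) z \<in> D \<and> idx (block ss (1 * m) z) = f i) \<and> (block ss (3 * m) z \<in> D \<and> idx (block ss (3 * m) z) = f i')"
    have "definable_pred L M (ts 4) ?P"
      by (intro definable_pred_bex[OF _ ne] definable_pred_conj[OF Q] definable_pred_conj ds) simp_all
    moreover have "{z \<in> tuples M ((ss @ ss) @ ss @ ss). ?P z} = {w @ w' | w w'. w \<in> Dn n \<and> w' \<in> Dn n \<and> Q (co w) (co w')}"
    proof (rule equalityI; rule subsetI)
      fix z assume "z \<in> {z \<in> tuples M ((ss @ ss) @ ss @ ss). ?P z}"
      then have tz: "z \<in> tuples M ((ss @ ss) @ ss @ ss)" and Pz: "?P z" by simp_all
      obtain w w' where w: "w \<in> tuples M (ss @ ss)" "w' \<in> tuples M (ss @ ss)" "z = w @ w'"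
        using tz[unfolded tuples_append[of _ _ "ss @ ss"]] by blast
      obtain x y x' y' where z: "x \<in> tuples M ss" "y \<in> tuples M ss" "x' \<in> tuples M ss" "y' \<in> tuples M ss"
        "z = (x @ y) @ x' @ y'" using w unfolding tuples_append by blast
      from Pz obtain i i' where i: "i \<in> {..<n + 2}" "i' \<in> {..<n + 2}" "x \<in> D" "x' \<in> D" "Q (idx x, i) (idx x', i')"
        "y \<in> D" "idx y = f i" "y' \<in> D" "idx y' = f i'"
        unfolding z(5) bl4[OF z(1-4)] by blast
      have "x @ y \<in> Dn n" "x' @ y' \<in> Dn n" unfolding Dn_def using i by blast+
      moreover have "Q (co (x @ y)) (co (x' @ y'))" using i co by simp
      ultimately show "z \<in> {w @ w' | w w'. w \<in> Dn n \<and> w' \<in> Dn n \<and> Q (co w) (co w')}" unfolding z(5) by blast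
    next
      fix z assume "z \<in> {w @ w' | w w'. w \<in> Dn n \<and> w' \<in> Dn n \<and> Q (co w) (co w')}"
      then obtain w w' where w: "z = w @ w'" "w \<in> Dn n" "w' \<in> Dn n" "Q (co w) (co w')" by blast
      obtain x y i where x: "w = x @ y" "x \<in> D" "y \<in> D" "i \<in> {..<n + 2}" "idx y = f i" using w(2) unfolding Dn_def by blast
      obtain x' y' i' where x': "w' = x' @ y'" "x' \<in> D" "y' \<in> D" "i' \<in> {..<n + 2}" "idx y' = f i'" using w(3) unfolding Dn_def by blast
      have "Q (idx x, i) (idx x', i')" using w(4) x x' co by simp
      then have "?P ((x @ y) @ x' @ y')" unfolding bl4[OF Dt[OF x(2)] Dt[OF x(3)] Dt[OF x'(2)] Dt[OF x'(3)]]
        using x x' by blast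
      moreover have "(x @ y) @ x' @ y' \<in> tuples M ((ss @ ss) @ ss @ ss)" by (intro tapp Dt x(2,3) x'(2,3))
      ultimately show "z \<in> {z \<in> tuples M ((ss @ ss) @ ss @ ss). ?P z}" unfolding w(1) x(1) x'(1) by (intro CollectI conjI)
    qed
    ultimately show ?thesis unfolding definable_pred_def ts4 by simp
  qed
  have defE: "definable L M ((ss @ ss) @ ss @ ss) {w @ w' | w w'. (w, w') \<in> En n}" for n
  proof -
    have "definable L M ((ss @ ss) @ ss @ ss) {w @ w' | w w'. w \<in> Dn n \<and> w' \<in> Dn n \<and> co w = co w'}"
    proof (rule def4)
      fix i i' :: nat
      have "definable_pred L M (ts 4) (\<lambda>z. i = i' \<and> (block ss (0 * m) z, block ss (2 * m) z) \<in> R \<and> (block ss (2 * m) z, block ss (0 * m) z) \<in> R)"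
        by (intro definable_pred_guard definable_pred_conj dR) simp_all
      moreover have "(\<lambda>z. i = i' \<and> (block ss (0 * m) z, block ss (2 * m) z) \<in> R \<and> (block ss (2 * m) z, block ss (0 * m) z) \<in> R) =
        (\<lambda>z. block ss (0 * m) z \<in> D \<and> block ss (2 * m) z \<in> D \<and> (idx (block ss (0 * m) z), i) = (idx (block ss (2 * m) z), i'))"
        using eqv RD by (intro ext) auto
      ultimately show "definable_pred L M (ts 4) (\<lambda>z. block ss (0 * m) z \<in> D \<and> block ss (2 * m) z \<in> D \<and>
          (idx (block ss (0 * m) z), i) = (idx (block ss (2 * m) z), i'))" by simp
    qed
    then show ?thesis unfolding En_def by simp
  qed
  have defR: "definable L M ((ss @ ss) @ ss @ ss) {w @ w' | w w'. w \<in> Dn n \<and> w' \<in> Dn n \<and> delta (n + 2) lt (co w) (co w') = int j}" for n j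
  proof (rule def4)
    fix i i' :: nat
    \<comment> \<open>For fixed levels \<open>delta\<close> has one value if
      \<open>(x, x') \<in> R\<close> and another one if not; \<open>?c\<close> tells which of them
      equals \<open>j\<close>.\<close>
    let ?c = "\<lambda>t. (int i' - int i - t) mod int (n + 2) = int j"
    have "definable_pred L M (ts 4) (\<lambda>z. block ss (0 * m) z \<in> D \<and> block ss (2 * m) z \<in> D \<and>
      ((?c 0 \<and> (block ss (0 * m) z, block ss (2 * m) z) \<in> R) \<or> (?c 1 \<and> (block ss (0 * m) z, block ss (2 * m) z) \<notin> R)))"
      by (intro definable_pred_conj definable_pred_disj definable_pred_guard definable_pred_not dR dD) simp_all
    moreover have "(\<lambda>z. block ss (0 * m) z \<in> D \<and> block ss (2 * m) z \<in> D \<and>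
      ((?c 0 \<and> (block ss (0 * m) z, block ss (2 * m) z) \<in> R) \<or> (?c 1 \<and> (block ss (0 * m) z, block ss (2 * m) z) \<notin> R))) =
      (\<lambda>z. block ss (0 * m) z \<in> D \<and> block ss (2 * m) z \<in> D \<and>
        delta (n + 2) lt (idx (block ss (0 * m) z), i) (idx (block ss (2 * m) z), i') = int j)"
      using idxD by (intro ext conj_cong refl) (auto simp: delta_def)
    ultimately show "definable_pred L M (ts 4) (\<lambda>z. block ss (0 * m) z \<in> D \<and> block ss (2 * m) z \<in> D \<and>
        delta (n + 2) lt (idx (block ss (0 * m) z), i) (idx (block ss (2 * m) z), i') = int j)" by simp
  qed
  let ?L = "osig :: ('ns, 'nf, 'nr) signature"
  have "interpreted_in L M ?L N"
    unfolding interpreted_in_def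
  proof (intro conjI exI)
    show "is_structure ?L N" by (rule cover_model_structure[OF cover])
    show "\<forall>s\<in>Sorts ?L. definable L M ((\<lambda>_. ss @ ss) s) ((\<lambda>s. Dn (inv sg s)) s) \<and> equiv ((\<lambda>s. Dn (inv sg s)) s) ((\<lambda>s. En (inv sg s)) s) \<and>
      definable L M ((\<lambda>_. ss @ ss) s @ (\<lambda>_. ss @ ss) s) {x @ y | x y. (x, y) \<in> (\<lambda>s. En (inv sg s)) s} \<and> carr N s = (\<lambda>s. Dn (inv sg s)) s // (\<lambda>s. En (inv sg s)) s"
      using defD defE quot(1) by (auto simp: Nsimps)
    show "\<forall>f\<in>Funs ?L. definable L M (concat (map (\<lambda>_. ss @ ss) (fdom ?L f)) @ (\<lambda>_. ss @ ss) (fcod ?L f))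
      {concat ds @ d | ds d. list_all2 (\<lambda>d s. d \<in> (\<lambda>s. Dn (inv sg s)) s) ds (fdom ?L f) \<and> d \<in> (\<lambda>s. Dn (inv sg s)) (fcod ?L f) \<and>
        fint N f (map2 (\<lambda>d s. (\<lambda>s. En (inv sg s)) s `` {d}) ds (fdom ?L f)) = (\<lambda>s. En (inv sg s)) (fcod ?L f) `` {d}}" by simp
    show "\<forall>r\<in>Rels ?L. definable L M (concat (map (\<lambda>_. ss @ ss) (rdom ?L r)))
      {concat ds | ds. list_all2 (\<lambda>d s. d \<in> (\<lambda>s. Dn (inv sg s)) s) ds (rdom ?L r) \<and>
        rint N r (map2 (\<lambda>d s. (\<lambda>s. En (inv sg s)) s `` {d}) ds (rdom ?L r))}"
    proof
      fix r :: 'nr assume "r \<in> Rels ?L"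
      then obtain n j where r: "r = rl n j" by auto
      have "{concat ds | ds. list_all2 (\<lambda>d s. d \<in> (\<lambda>s. Dn (inv sg s)) s) ds [sg n, sg n :: 'ns] \<and>
          rint N r (map2 (\<lambda>d s. (\<lambda>s. En (inv sg s)) s `` {d}) ds [sg n, sg n :: 'ns])} =
        {w @ w' | w w'. w \<in> Dn n \<and> w' \<in> Dn n \<and> delta (n + 2) lt (co w) (co w') = int j}"
      proof (rule equalityI; rule subsetI)
        fix z assume "z \<in> {concat ds | ds. list_all2 (\<lambda>d s. d \<in> (\<lambda>s. Dn (inv sg s)) s) ds [sg n, sg n :: 'ns] \<and>
          rint N r (map2 (\<lambda>d s. (\<lambda>s. En (inv sg s)) s `` {d}) ds [sg n, sg n :: 'ns])}"
        then obtain w w' where w: "z = w @ w'" "w \<in> Dn n" "w' \<in> Dn n" "rint N r [En n `` {w}, En n `` {w'}]"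
          by (auto simp: list_all2_Cons2)
        then show "z \<in> {w @ w' | w w'. w \<in> Dn n \<and> w' \<in> Dn n \<and> delta (n + 2) lt (co w) (co w') = int j}"
          unfolding r Nsimps quot(3)[OF w(2)] quot(3)[OF w(3)] by blast
      next
        fix z assume "z \<in> {w @ w' | w w'. w \<in> Dn n \<and> w' \<in> Dn n \<and> delta (n + 2) lt (co w) (co w') = int j}"
        then obtain w w' where w: "z = w @ w'" "w \<in> Dn n" "w' \<in> Dn n" "delta (n + 2) lt (co w) (co w') = int j" by blast
        then have "rint N r [En n `` {w}, En n `` {w'}]" unfolding r Nsimps quot(3)[OF w(2)] quot(3)[OF w(3)] by blast
        then show "z \<in> {concat ds | ds. list_all2 (\<lambda>d s. d \<in> (\<lambda>s. Dn (inv sg s)) s) ds [sg n, sg n :: 'ns] \<and>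
          rint N r (map2 (\<lambda>d s. (\<lambda>s. En (inv sg s)) s `` {d}) ds [sg n, sg n :: 'ns])}"
          using w by (intro CollectI exI[of _ "[w, w']"]) simp
      qed
      then show "definable L M (concat (map (\<lambda>_. ss @ ss) (rdom ?L r)))
        {concat ds | ds. list_all2 (\<lambda>d s. d \<in> (\<lambda>s. Dn (inv sg s)) s) ds (rdom ?L r) \<and>
          rint N r (map2 (\<lambda>d s. (\<lambda>s. En (inv sg s)) s `` {d}) ds (rdom ?L r))}"
        using defR unfolding r by simp
    qed
  qed
  then show ?thesis using cover by blast
qed

section \<open>Transport of structures\<close>

lemma map2_inverse:
  assumes "xs \<in> tuples A ss" "\<And>s a. s \<in> set ss \<Longrightarrow> a \<in> carr A s \<Longrightarrow> h s (g s a) = a"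
  shows "map2 h ss (map2 g ss xs) = xs"
  by (rule nth_equalityI) (use assms tuples_length[OF assms(1)] tuples_nth[OF assms(1)] in auto)

lemma map2_tuples:
  assumes "xs \<in> tuples A ss" "\<And>s a. s \<in> set ss \<Longrightarrow> a \<in> carr A s \<Longrightarrow> g s a \<in> carr B s"
  shows "map2 g ss xs \<in> tuples B ss"
  by (rule tuplesI) (use assms tuples_length[OF assms(1)] tuples_nth[OF assms(1)] in auto)

lemma transport_structure:
  assumes L: "wf_signature L" and A: "is_structure L A" and inj: "\<And>s. s \<in> Sorts L \<Longrightarrow> inj_on (g s) (carr A s)"
  shows "\<exists>B. isomorphism L A B g \<and> is_structure L B"
proof -
  define h where "h = (\<lambda>s. inv_into (carr A s) (g s))"
  define B where "B = \<lparr>carr = (\<lambda>s. g s ` carr A s), fint = (\<lambda>f ys. g (fcod L f) (fint A f (map2 h (fdom L f) ys))),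
    rint = (\<lambda>r ys. rint A r (map2 h (rdom L r) ys))\<rparr>"
  have hg: "h s (g s a) = a" if "s \<in> Sorts L" "a \<in> carr A s" for s a
    unfolding h_def by (rule inv_into_f_f[OF inj[OF that(1)] that(2)])
  have hB: "h s b \<in> carr A s" if "b \<in> carr B s" for s b
    using that unfolding h_def B_def by (auto intro: inv_into_into)
  have dom: "set (fdom L f) \<subseteq> Sorts L" "fcod L f \<in> Sorts L" if "f \<in> Funs L" for f
    using L that unfolding wf_signature_def by blast+
  have rdom: "set (rdom L r) \<subseteq> Sorts L" if "r \<in> Rels L" for r
    using L that unfolding wf_signature_def by blast
  have inv: "map2 h ss (map2 g ss xs) = xs" if "set ss \<subseteq> Sorts L" "xs \<in> tuples A ss" for ss xs
    by (rule map2_inverse[OF that(2)]) (use hg that(1) in blast)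
  have "isomorphism L A B g"
    unfolding isomorphism_def
  proof (intro conjI ballI)
    fix s assume "s \<in> Sorts L"
    then show "bij_betw (g s) (carr A s) (carr B s)" using inj by (simp add: B_def bij_betw_def)
  next
    fix f xs assume "f \<in> Funs L" "xs \<in> tuples A (fdom L f)"
    then show "g (fcod L f) (fint A f xs) = fint B f (map2 g (fdom L f) xs)" using inv[OF dom(1)] by (simp add: B_def)
  next
    fix r xs assume "r \<in> Rels L" "xs \<in> tuples A (rdom L r)"
    then show "rint A r xs = rint B r (map2 g (rdom L r) xs)" using inv[OF rdom] by (simp add: B_def)
  qed
  moreover have "is_structure L B"
    unfolding is_structure_def
  proof (intro conjI ballI)
    fix s assume "s \<in> Sorts L"
    then show "carr B s \<noteq> {}" using A by (simp add: B_def is_structure_def)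
  next
    fix f ys assume f: "f \<in> Funs L" and ys: "ys \<in> tuples B (fdom L f)"
    have "map2 h (fdom L f) ys \<in> tuples A (fdom L f)" by (rule map2_tuples[OF ys hB])
    then have "fint A f (map2 h (fdom L f) ys) \<in> carr A (fcod L f)" using A f unfolding is_structure_def by blast
    then show "fint B f ys \<in> carr B (fcod L f)" by (simp add: B_def)
  qed
  ultimately show ?thesis by blast
qed

lemma isomorphism_tuples:
  assumes iso: "isomorphism L A B g" and ss: "set ss \<subseteq> Sorts L"
  shows "bij_betw (map2 g ss) (tuples A ss) (tuples B ss)"
proof -
  define h where "h = (\<lambda>s. inv_into (carr A s) (g s))"
  have bij: "bij_betw (g s) (carr A s) (carr B s)" if "s \<in> set ss" for s
    using iso ss that unfolding isomorphism_def by blast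
  have hg: "h s (g s a) = a" if "s \<in> set ss" "a \<in> carr A s" for s a
    unfolding h_def by (rule bij_betw_inv_into_left[OF bij[OF that(1)] that(2)])
  have gh: "g s (h s b) = b" if "s \<in> set ss" "b \<in> carr B s" for s b
    unfolding h_def by (rule bij_betw_inv_into_right[OF bij[OF that(1)] that(2)])
  have gB: "g s a \<in> carr B s" if "s \<in> set ss" "a \<in> carr A s" for s a
    using bij_betwE[OF bij[OF that(1)]] that(2) by blast
  have hA: "h s b \<in> carr A s" if "s \<in> set ss" "b \<in> carr B s" for s b
    using bij_betwE[OF bij_betw_inv_into[OF bij[OF that(1)]]] that(2) unfolding h_def by blast
  have 1: "map2 h ss (map2 g ss xs) = xs" if "xs \<in> tuples A ss" for xs
    using that by (rule map2_inverse) (rule hg)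
  have 2: "map2 g ss (map2 h ss xs) = xs" if "xs \<in> tuples B ss" for xs
    using that by (rule map2_inverse) (rule gh)
  have 3: "map2 g ss xs \<in> tuples B ss" if "xs \<in> tuples A ss" for xs
    using that by (rule map2_tuples) (rule gB)
  have 4: "map2 h ss xs \<in> tuples A ss" if "xs \<in> tuples B ss" for xs
    using that by (rule map2_tuples) (rule hA)
  show ?thesis by (rule bij_betw_byWitness[where f' = "map2 h ss"]) (use 1 2 3 4 in blast)+
qed

lemma assign_carr:
  assumes "is_valuation L A v" "xs \<in> tuples A ss" "fst x \<in> Sorts L"
  shows "assign ss xs v x \<in> carr A (fst x)"
  using assms tuples_nth[OF assms(2)] unfolding assign_def is_valuation_def by (cases x) auto

lemma definable_isomorphism:
  assumes iso: "isomorphism L A B g" and A: "is_structure L A" and L: "wf_signature L" and X: "definable L A ss X"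
  shows "definable L B ss (map2 g ss ` X)"
proof -
  obtain \<phi> v where \<phi>: "wf_fm L \<phi>" "is_valuation L A v" "X = {xs \<in> tuples A ss. sat A (assign ss xs v) \<phi>}"
    using X unfolding definable_def by blast
  define w where "w = (\<lambda>x. g (fst x) (v x))"
  have bij: "bij_betw (map2 g ss) (tuples A ss) (tuples B ss)" by (rule isomorphism_tuples[OF iso definable_sorts[OF X]])
  have "g s a \<in> carr B s" if "s \<in> Sorts L" "a \<in> carr A s" for s a
    using iso that bij_betwE unfolding isomorphism_def by blast
  then have w: "is_valuation L B w" using \<phi>(2) unfolding is_valuation_def w_def by simp
  have sat: "sat A (assign ss xs v) \<phi> \<longleftrightarrow> sat B (assign ss (map2 g ss xs) w) \<phi>" if xs: "xs \<in> tuples A ss" for xs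
  proof (rule sat_isomorphism[OF iso A L \<phi>(1)], rule ballI)
    fix x assume "x \<in> fv \<phi>"
    then have "assign ss xs v x \<in> carr A (fst x)" by (intro assign_carr[OF \<phi>(2) xs] fv_sorts[OF \<phi>(1)])
    moreover have "assign ss (map2 g ss xs) w x = g (fst x) (assign ss xs v x)"
      using tuples_length[OF xs] by (cases x) (auto simp: assign_def w_def)
    ultimately show "assign ss xs v x \<in> carr A (fst x) \<and> assign ss (map2 g ss xs) w x = g (fst x) (assign ss xs v x)" by blast
  qed
  have "map2 g ss ` X = {ys \<in> tuples B ss. sat B (assign ss ys w) \<phi>}"
  proof (rule equalityI; rule subsetI)
    fix ys assume "ys \<in> map2 g ss ` X"
    then obtain xs where "xs \<in> tuples A ss" "sat A (assign ss xs v) \<phi>" "ys = map2 g ss xs" unfolding \<phi>(3) by blast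
    then show "ys \<in> {ys \<in> tuples B ss. sat B (assign ss ys w) \<phi>}" using sat bij_betwE[OF bij] by simp
  next
    fix ys assume ys: "ys \<in> {ys \<in> tuples B ss. sat B (assign ss ys w) \<phi>}"
    then have "ys \<in> map2 g ss ` tuples A ss" using bij_betw_imp_surj_on[OF bij] by simp
    then obtain xs where xs: "xs \<in> tuples A ss" "ys = map2 g ss xs" by blast
    then have "xs \<in> X" unfolding \<phi>(3) using sat[OF xs(1)] ys by simp
    then show "ys \<in> map2 g ss ` X" using xs(2) by blast
  qed
  then show ?thesis using definable_sorts[OF X] \<phi>(1) w unfolding definable_def by blast
qed

lemma definable_rel_isomorphism:
  assumes iso: "isomorphism L A B g" and A: "is_structure L A" and L: "wf_signature L" and R: "definable_rel L A ss R"
  shows "definable_rel L B ss (map_prod (map2 g ss) (map2 g ss) ` R)"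
proof -
  have ss: "set ss \<subseteq> Sorts L" using R definable_sorts unfolding definable_rel_def by fastforce
  have RT: "x \<in> tuples A ss" "y \<in> tuples A ss" if "(x, y) \<in> R" for x y using R that unfolding definable_rel_def by blast+
  have app: "map2 g (ss @ ss) (x @ y) = map2 g ss x @ map2 g ss y" if "(x, y) \<in> R" for x y
    using tuples_length[OF RT(1)[OF that]] by simp
  have "{x @ y | x y. (x, y) \<in> map_prod (map2 g ss) (map2 g ss) ` R} = map2 g (ss @ ss) ` {x @ y | x y. (x, y) \<in> R}"
  proof (rule equalityI; rule subsetI)
    fix z assume "z \<in> {x @ y | x y. (x, y) \<in> map_prod (map2 g ss) (map2 g ss) ` R}"
    then obtain x y where xy: "(x, y) \<in> R" "z = map2 g ss x @ map2 g ss y" by auto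
    then show "z \<in> map2 g (ss @ ss) ` {x @ y | x y. (x, y) \<in> R}" using app[OF xy(1)] by (intro image_eqI[of _ _ "x @ y"]) auto
  next
    fix z assume "z \<in> map2 g (ss @ ss) ` {x @ y | x y. (x, y) \<in> R}"
    then obtain x y where xy: "(x, y) \<in> R" "z = map2 g (ss @ ss) (x @ y)" by blast
    have "(map2 g ss x, map2 g ss y) \<in> map_prod (map2 g ss) (map2 g ss) ` R" using xy(1) by (intro image_eqI[of _ _ "(x, y)"]) auto
    then show "z \<in> {x @ y | x y. (x, y) \<in> map_prod (map2 g ss) (map2 g ss) ` R}" unfolding xy(2) app[OF xy(1)]
      by (intro CollectI exI[of _ "map2 g ss x"] exI[of _ "map2 g ss y"] conjI refl)
  qed
  moreover have "definable L B (ss @ ss) (map2 g (ss @ ss) ` {x @ y | x y. (x, y) \<in> R})"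
    by (rule definable_isomorphism[OF iso A L]) (use R in \<open>simp add: definable_rel_def\<close>)
  moreover have "map_prod (map2 g ss) (map2 g ss) ` R \<subseteq> tuples B ss \<times> tuples B ss"
    using bij_betwE[OF isomorphism_tuples[OF iso ss]] RT by auto
  ultimately show ?thesis unfolding definable_rel_def by simp
qed

lemma map_prod_imageE:
  assumes "(y, z) \<in> map_prod h h ` R"
  obtains a b where "(a, b) \<in> R" "y = h a" "z = h b"
  using assms by auto

lemma map_prod_image_iff:
  assumes h: "inj_on h X" and R: "R \<subseteq> X \<times> X" and xy: "x \<in> X" "y \<in> X"
  shows "(h x, h y) \<in> map_prod h h ` R \<longleftrightarrow> (x, y) \<in> R"
proof
  assume "(h x, h y) \<in> map_prod h h ` R"
  then obtain x' y' where *: "(x', y') \<in> R" "h x = h x'" "h y = h y'" by (rule map_prod_imageE)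
  then have "x = x'" "y = y'" using inj_onD[OF h *(2)] inj_onD[OF h *(3)] R xy by blast+
  then show "(x, y) \<in> R" using *(1) by simp
next
  assume "(x, y) \<in> R"
  then show "(h x, h y) \<in> map_prod h h ` R" by (intro image_eqI[of _ _ "(x, y)"]) auto
qed

text \<open>Hereditary G-compactness quantifies over models on the type \<open>univ\<close> only.
  The model and its definable order are copied there along \<open>enc\<close>, and the covers are
  interpreted in the copy.\<close>

theorem cover_over_univ:
  fixes M :: "('s, 'f, 'r, 'b) struct" and enc :: "'b \<Rightarrow> ('s, 'f, 'r) univ" and lt :: "'k \<Rightarrow> 'k \<Rightarrow> bool"
  assumes L: "wf_signature L" and M: "is_model L T M" and enc: "inj enc"
    and R: "definable_rel L M ss R" and dom: "\<And>x y. (x, y) \<in> R \<Longrightarrow> (x, x) \<in> R \<and> (y, y) \<in> R"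
    and idx: "\<And>x y. (x, x) \<in> R \<Longrightarrow> (y, y) \<in> R \<Longrightarrow> (x, y) \<in> R \<longleftrightarrow> \<not> lt (idx y) (idx x)"
    and K: "idx ` {x. (x, x) \<in> R} = K" "infinite K" and lin: "linear_strict K lt"
  shows "\<exists>(M' :: ('s, 'f, 'r, ('s, 'f, 'r) univ) struct) (N :: ('ns::infinite, 'nf, 'nr::infinite, ('s, 'f, 'r) univ list set) struct) cd.
    is_model L T M' \<and> interpreted_in L M' osig N \<and> cover_model N cd K lt"
proof -
  have st: "is_structure L M" and T: "T \<subseteq> Th L M" using M unfolding is_model_def by blast+
  obtain M' where iso: "isomorphism L M M' (\<lambda>_. enc)" and M': "is_structure L M'"
    using transport_structure[OF L st, of "\<lambda>_. enc"] inj_on_subset[OF enc] by blast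
  have "Th L M = Th L M'" by (rule Th_isomorphism[OF iso st M' L])
  then have model: "is_model L T M'" using T M' unfolding is_model_def by simp
  let ?h = "map2 (\<lambda>_. enc) ss"
  let ?R = "map_prod ?h ?h ` R"
  have ss: "set ss \<subseteq> Sorts L" using R definable_sorts unfolding definable_rel_def by fastforce
  have RT: "R \<subseteq> tuples M ss \<times> tuples M ss" using R unfolding definable_rel_def by blast
  have inj: "inj_on ?h (tuples M ss)" by (rule bij_betw_imp_inj_on[OF isomorphism_tuples[OF iso ss]])
  let ?i = "\<lambda>y. idx (inv_into (tuples M ss) ?h y)"
  have i: "?i (?h x) = idx x" if "x \<in> tuples M ss" for x using inv_into_f_f[OF inj that] by simp
  have mem: "\<exists>x\<in>tuples M ss. y = ?h x \<and> (x, x) \<in> R" if yy: "(y, y) \<in> ?R" for y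
  proof -
    obtain x x' where x: "(x, x') \<in> R" "y = ?h x" using yy by (rule map_prod_imageE)
    then show ?thesis using RT dom[OF x(1)] by blast
  qed
  note iff = map_prod_image_iff[OF inj RT]
  have dR: "definable_rel L M' ss ?R" by (rule definable_rel_isomorphism[OF iso st L R])
  have "\<exists>(N :: ('ns, 'nf, 'nr, ('s, 'f, 'r) univ list set) struct) cd. interpreted_in L M' osig N \<and> cover_model N cd K lt"
  proof (rule interpreted_cover[OF dR _ _ _ K(2) lin])
    fix x y assume "(x, y) \<in> ?R"
    then obtain x' y' where xy: "(x', y') \<in> R" "x = ?h x'" "y = ?h y'" by (rule map_prod_imageE)
    then have "x' \<in> tuples M ss" "y' \<in> tuples M ss" "(x', x') \<in> R" "(y', y') \<in> R" using RT dom[OF xy(1)] by blast+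
    then show "(x, x) \<in> ?R \<and> (y, y) \<in> ?R" unfolding xy(2,3) using iff by blast
  next
    fix x y assume "(x, x) \<in> ?R" "(y, y) \<in> ?R"
    then obtain x' y' where x: "x' \<in> tuples M ss" "x = ?h x'" "(x', x') \<in> R" and y: "y' \<in> tuples M ss" "y = ?h y'" "(y', y') \<in> R"
      using mem by meson
    show "(x, y) \<in> ?R \<longleftrightarrow> \<not> lt (?i y) (?i x)"
      unfolding x(2) y(2) iff[OF x(1) y(1)] i[OF x(1)] i[OF y(1)] by (rule idx[OF x(3) y(3)])
  next
    show "?i ` {x. (x, x) \<in> ?R} = K"
    proof (rule equalityI; rule subsetI)
      fix k assume "k \<in> ?i ` {x. (x, x) \<in> ?R}"
      then obtain y where y: "k = ?i y" "y \<in> {x. (x, x) \<in> ?R}" by (rule imageE)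
      obtain x where x: "x \<in> tuples M ss" "y = ?h x" "(x, x) \<in> R" using mem[OF y(2)[unfolded mem_Collect_eq]] by blast
      have "k = idx x" using y(1) i[OF x(1)] x(2) by simp
      then show "k \<in> K" unfolding K(1)[symmetric] using x(3) by (intro image_eqI[of _ _ x] CollectI)
    next
      fix k assume "k \<in> K"
      then obtain x where x: "k = idx x" "x \<in> {x. (x, x) \<in> R}" unfolding K(1)[symmetric] by (rule imageE)
      then have xt: "x \<in> tuples M ss" using RT by blast
      show "k \<in> ?i ` {x. (x, x) \<in> ?R}"
      proof (rule image_eqI)
        show "k = ?i (?h x)" using i[OF xt] x(1) by simp
        show "?h x \<in> {x. (x, x) \<in> ?R}" unfolding mem_Collect_eq iff[OF xt xt] using x(2) by simp
      qed
    qed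
  qed
  then show ?thesis using model by blast
qed

section \<open>Small models of a definable order\<close>

lemma infinite_fm: "infinite (UNIV :: ('s, 'f, 'r) fm set)"
  using range_inj_infinite[OF inj_Neg_power] infinite_super[OF subset_UNIV] by blast

lemma total_preorder_image:
  assumes R: "total_preorder R" and h: "inj_on h X" and RX: "R \<subseteq> X \<times> X"
  shows "total_preorder (map_prod h h ` R)"
proof
  note iff = map_prod_image_iff[OF h RX]
  fix x y assume "(x, y) \<in> map_prod h h ` R"
  then obtain x' y' where xy: "(x', y') \<in> R" "x = h x'" "y = h y'" by (rule map_prod_imageE)
  then have "x' \<in> X" "y' \<in> X" "(x', x') \<in> R" "(y', y') \<in> R" using RX total_preorder.refl[OF R xy(1)] by blast+
  then show "(x, x) \<in> map_prod h h ` R \<and> (y, y) \<in> map_prod h h ` R" unfolding xy(2,3) using iff by blast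
next
  note iff = map_prod_image_iff[OF h RX]
  fix x y z assume xy0: "(x, y) \<in> map_prod h h ` R" and yz: "(y, z) \<in> map_prod h h ` R"
  obtain x' y' where xy: "(x', y') \<in> R" "x = h x'" "y = h y'" using xy0 by (rule map_prod_imageE)
  obtain y'' z' where yz': "(y'', z') \<in> R" "y = h y''" "z = h z'" using yz by (rule map_prod_imageE)
  have "y' = y''" using inj_onD[OF h, of y' y''] xy yz' RX by auto
  then have "(x', z') \<in> R" using total_preorder.trans[OF R xy(1)] yz'(1) by simp
  then show "(x, z) \<in> map_prod h h ` R" unfolding xy(2) yz'(3) by (intro image_eqI[of _ _ "(x', z')"]) auto
next
  note iff = map_prod_image_iff[OF h RX]
  fix x y assume x: "(x, x) \<in> map_prod h h ` R" and y: "(y, y) \<in> map_prod h h ` R"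
  obtain x' x'' where x': "(x', x'') \<in> R" "x = h x'" using x by (rule map_prod_imageE)
  obtain y' y'' where y': "(y', y'') \<in> R" "y = h y'" using y by (rule map_prod_imageE)
  have X: "x' \<in> X" "y' \<in> X" using x'(1) y'(1) RX by blast+
  have "(x', x') \<in> R" "(y', y') \<in> R" using total_preorder.refl[OF R x'(1)] total_preorder.refl[OF R y'(1)] by blast+
  then have "(x', y') \<in> R \<or> (y', x') \<in> R" by (rule total_preorder.total[OF R])
  then show "(x, y) \<in> map_prod h h ` R \<or> (y, x) \<in> map_prod h h ` R"
    unfolding x'(2) y'(2) iff[OF X] iff[OF X(2,1)] .
qed

text \<open>The submodel contains the parameters of the defining formula and all the tuples
  \<open>d i\<close>, so the order remains definable and infinite. The size bound by the number of
  formulas is what makes a later ultrapower fit into \<open>univ\<close>.\<close>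

theorem small_definable_order:
  fixes M :: "('s, 'f, 'r, 'm) struct" and d :: "nat \<Rightarrow> 'm list"
  assumes L: "wf_signature L" and M: "is_model L T M" and R: "definable_rel L M ss R" and pre: "total_preorder R"
    and d: "\<And>i. (d i, d i) \<in> R" "\<And>i j. i \<noteq> j \<Longrightarrow> \<not> ((d i, d j) \<in> R \<and> (d j, d i) \<in> R)"
  shows "\<exists>(M' :: ('s, 'f, 'r, ('s, 'f, 'r) fm) struct) R' d'. is_model L T M' \<and> definable_rel L M' ss R' \<and> total_preorder R' \<and>
    (\<forall>i. (d' i, d' i) \<in> R') \<and> (\<forall>i j :: nat. i \<noteq> j \<longrightarrow> \<not> ((d' i, d' j) \<in> R' \<and> (d' j, d' i) \<in> R'))"
proof -
  have st: "is_structure L M" and T: "T \<subseteq> Th L M" using M unfolding is_model_def by blast+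
  have RT: "R \<subseteq> tuples M ss \<times> tuples M ss" and dR: "definable L M (ss @ ss) {x @ y | x y. (x, y) \<in> R}"
    using R unfolding definable_rel_def by blast+
  have ss: "set ss \<subseteq> Sorts L" using definable_sorts[OF dR] by simp
  obtain \<phi> v where \<phi>: "wf_fm L \<phi>" "is_valuation L M v"
    "{x @ y | x y. (x, y) \<in> R} = {z \<in> tuples M (ss @ ss). sat M (assign (ss @ ss) z v) \<phi>}"
    using dR unfolding definable_def by blast
  define X where "X = (\<Union>i. set (zip ss (d i))) \<union> (\<lambda>x. (fst x, v x)) ` fv \<phi>"
  have dT: "d i \<in> tuples M ss" for i using d(1) RT by blast
  have X: "X \<subseteq> elems L M"
  proof
    fix p assume "p \<in> X"
    then consider i where "p \<in> set (zip ss (d i))" | x where "x \<in> fv \<phi>" "p = (fst x, v x)" unfolding X_def by blast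
    then show "p \<in> elems L M"
    proof cases
      case (1 i)
      then obtain k where "k < length ss" "p = (ss ! k, d i ! k)" by (auto simp: set_zip)
      then show ?thesis using tuples_nth[OF dT] ss unfolding elems_def by auto
    next
      case (2 x)
      then show ?thesis using fv_sorts[OF \<phi>(1) 2(1)] \<phi>(2) unfolding elems_def is_valuation_def by (cases x) auto
    qed
  qed
  have "countable X" unfolding X_def by (intro countable_Un countable_UN) (auto intro: countable_finite)
  then have "|X| \<le>o |UNIV :: nat set|" unfolding countable_card_of_nat .
  then have "|X| \<le>o |UNIV :: ('s, 'f, 'r) fm set|"
    using infinite_fm[unfolded infinite_iff_card_of_nat] by (rule ordLeq_transitive)
  from Loewenheim_Skolem[OF L st X infinite_fm this card_of_mono1[OF subset_UNIV]] obtain A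
    where A: "X \<subseteq> A" "elementary_submodel L M A" "|A| \<le>o |UNIV :: ('s, 'f, 'r) fm set|" by blast
  let ?S = "substructure_on M A"
  have S: "is_structure L ?S" and AM: "A \<subseteq> elems L M" using A(2) unfolding elementary_submodel_def by blast+
  have el: "sat ?S w \<psi> \<longleftrightarrow> sat M w \<psi>" if "wf_fm L \<psi>" "is_valuation L ?S w" for \<psi> w
    using A(2) that unfolding elementary_submodel_def by blast
  have Scarr: "a \<in> carr ?S s \<longleftrightarrow> (s, a) \<in> A" for s a by (simp add: substructure_on_def)
  have ST: "x \<in> tuples M ts" if "x \<in> tuples ?S ts" for x ts
  proof (rule tuplesI)
    show "length x = length ts" by (rule tuples_length[OF that])
    fix i assume "i < length ts"
    then have "(ts ! i, x ! i) \<in> A" using tuples_nth[OF that] Scarr by blast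
    then show "x ! i \<in> carr M (ts ! i)" using AM unfolding elems_def by blast
  qed
  obtain w where w: "is_valuation L ?S w" using ex_valuation[OF S] by blast
  \<comment> \<open>A valuation has to be total in the submodel; outside the formula the old values
    are replaced by values that lie in it.\<close>
  define v' where "v' = (\<lambda>x. if x \<in> fv \<phi> then v x else w x)"
  have v': "is_valuation L ?S v'"
    unfolding is_valuation_def
  proof (intro ballI allI)
    fix s k assume s: "s \<in> Sorts L"
    have "(s, v (s, k)) \<in> A" if "(s, k) \<in> fv \<phi>" using A(1) that unfolding X_def by force
    then show "v' (s, k) \<in> carr ?S s" using w s unfolding v'_def is_valuation_def by (simp add: Scarr)
  qed
  define RS where "RS = R \<inter> tuples ?S ss \<times> tuples ?S ss"
  have "definable L ?S (ss @ ss) {x @ y | x y. (x, y) \<in> RS}"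
  proof -
    have "{x @ y | x y. (x, y) \<in> RS} = {z \<in> tuples ?S (ss @ ss). sat ?S (assign (ss @ ss) z v') \<phi>}"
    proof -
      have "sat ?S (assign (ss @ ss) z v') \<phi> \<longleftrightarrow> sat M (assign (ss @ ss) z v) \<phi>" if z: "z \<in> tuples ?S (ss @ ss)" for z
      proof -
        have "is_valuation L ?S (assign (ss @ ss) z v')"
          unfolding is_valuation_def using assign_carr[OF v' z] by force
        then have "sat ?S (assign (ss @ ss) z v') \<phi> \<longleftrightarrow> sat M (assign (ss @ ss) z v') \<phi>" by (rule el[OF \<phi>(1)])
        also have "\<dots> \<longleftrightarrow> sat M (assign (ss @ ss) z v) \<phi>"
          by (rule sat_cong) (auto simp: assign_def v'_def)
        finally show ?thesis .
      qed
      note sat = this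
      show ?thesis
      proof (rule equalityI; rule subsetI)
        fix z assume "z \<in> {x @ y | x y. (x, y) \<in> RS}"
        then obtain x y where z: "z = x @ y" "(x, y) \<in> R" "x \<in> tuples ?S ss" "y \<in> tuples ?S ss" unfolding RS_def by blast
        then have zS: "z \<in> tuples ?S (ss @ ss)" unfolding tuples_append by blast
        have "z \<in> {x @ y | x y. (x, y) \<in> R}" using z(1,2) by blast
        then have "sat M (assign (ss @ ss) z v) \<phi>" unfolding \<phi>(3) by blast
        then show "z \<in> {z \<in> tuples ?S (ss @ ss). sat ?S (assign (ss @ ss) z v') \<phi>}" using sat[OF zS] zS by blast
      next
        fix z assume "z \<in> {z \<in> tuples ?S (ss @ ss). sat ?S (assign (ss @ ss) z v') \<phi>}"
        then have zS: "z \<in> tuples ?S (ss @ ss)" and zs: "sat ?S (assign (ss @ ss) z v') \<phi>" by blast+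
        have zR: "z \<in> {x @ y | x y. (x, y) \<in> R}" unfolding \<phi>(3) using ST[OF zS] zs sat[OF zS] by blast
        obtain x y where z: "z = x @ y" "x \<in> tuples ?S ss" "y \<in> tuples ?S ss" using zS unfolding tuples_append by blast
        have len: "length x = length ss" using tuples_length[OF z(2)] .
        have "(x, y) \<in> R" by (rule iffD1[OF definable_rel_mem[OF R len] zR[unfolded z(1)]])
        then have "(x, y) \<in> RS" unfolding RS_def using z(2,3) by simp
        then show "z \<in> {x @ y | x y. (x, y) \<in> RS}" using z(1) by blast
      qed
    qed
    moreover have "set (ss @ ss) \<subseteq> Sorts L" using ss by simp
    ultimately show ?thesis unfolding definable_def using \<phi>(1) v' by blast
  qed
  then have dRS: "definable_rel L ?S ss RS" unfolding definable_rel_def RS_def by blast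
  have preS: "total_preorder RS"
  proof
    show "(x, x) \<in> RS \<and> (y, y) \<in> RS" if "(x, y) \<in> RS" for x y
      using total_preorder.refl[OF pre, of x y] that unfolding RS_def by simp
    show "(x, z) \<in> RS" if "(x, y) \<in> RS" "(y, z) \<in> RS" for x y z
      using total_preorder.trans[OF pre, of x y z] that unfolding RS_def by simp
    show "(x, y) \<in> RS \<or> (y, x) \<in> RS" if "(x, x) \<in> RS" "(y, y) \<in> RS" for x y
      using total_preorder.total[OF pre, of x y] that unfolding RS_def by simp
  qed
  have dS: "d i \<in> tuples ?S ss" for i
  proof (rule tuplesI)
    show len: "length (d i) = length ss" by (rule tuples_length[OF dT])
    fix k assume "k < length ss"
    then have "(ss ! k, d i ! k) \<in> set (zip ss (d i))" using len by (auto simp: set_zip)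
    then have "(ss ! k, d i ! k) \<in> X" unfolding X_def by blast
    then show "d i ! k \<in> carr ?S (ss ! k)" unfolding Scarr using A(1) by blast
  qed
  obtain \<iota> :: "'s \<times> 'm \<Rightarrow> ('s, 'f, 'r) fm" where \<iota>: "inj_on \<iota> A"
    using A(3) unfolding card_of_ordLeq[symmetric] by blast
  define g where "g = (\<lambda>s a. \<iota> (s, a))"
  have "inj_on (g s) (carr ?S s)" for s
  proof (rule inj_onI)
    fix a b assume ab: "a \<in> carr ?S s" "b \<in> carr ?S s" "g s a = g s b"
    then show "a = b" using inj_onD[OF \<iota>, of "(s, a)" "(s, b)"] unfolding Scarr g_def by simp
  qed
  from transport_structure[OF L S this] obtain M' where iso: "isomorphism L ?S M' g" and M': "is_structure L M'" by blast
  have "Th L ?S = Th L M"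
  proof (rule set_eqI)
    fix \<psi>
    have "sat ?S w \<psi> \<longleftrightarrow> sat M w \<psi>" if "\<psi> \<in> sentences L"
      by (rule el[OF _ w]) (use that in \<open>simp add: sentences_def\<close>)
    then show "\<psi> \<in> Th L ?S \<longleftrightarrow> \<psi> \<in> Th L M"
      using Th_iff[OF S, of \<psi> w] Th_iff[OF st, of \<psi> w] by argo
  qed
  moreover have "Th L ?S = Th L M'" by (rule Th_isomorphism[OF iso S M' L])
  ultimately have model: "is_model L T M'" using T M' unfolding is_model_def by simp
  let ?h = "map2 g ss"
  let ?R = "map_prod ?h ?h ` RS"
  have dR': "definable_rel L M' ss ?R" by (rule definable_rel_isomorphism[OF iso S L dRS])
  have inj: "inj_on ?h (tuples ?S ss)" by (rule bij_betw_imp_inj_on[OF isomorphism_tuples[OF iso ss]])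
  have RST: "RS \<subseteq> tuples ?S ss \<times> tuples ?S ss" unfolding RS_def by blast
  have pre': "total_preorder ?R" by (rule total_preorder_image[OF preS inj RST])
  have iff: "(?h (d i), ?h (d j)) \<in> ?R \<longleftrightarrow> (d i, d j) \<in> R" for i j
    unfolding map_prod_image_iff[OF inj RST dS dS] using dS by (simp add: RS_def)
  have "\<forall>i. (?h (d i), ?h (d i)) \<in> ?R" unfolding iff using d(1) by simp
  moreover have "\<forall>i j. i \<noteq> j \<longrightarrow> \<not> ((?h (d i), ?h (d j)) \<in> ?R \<and> (?h (d j), ?h (d i)) \<in> ?R)" unfolding iff using d(2) by simp
  ultimately show ?thesis using model dR' pre'
    by (intro exI[of _ M'] exI[of _ ?R] exI[of _ "\<lambda>i. ?h (d i)"] conjI)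
qed

section \<open>Ultrapowers\<close>

definition ultrapower :: "('s, 'f, 'r, 'a) struct \<Rightarrow> ('s, 'f, 'r, nat \<Rightarrow> 'a) struct" where
  "ultrapower M = \<lparr>carr = (\<lambda>s. ultraproduct (\<lambda>_. carr M s)),
     fint = (\<lambda>f xs. rep (\<lambda>k. fint M f (map (\<lambda>a. a k) xs))),
     rint = (\<lambda>r xs. \<forall>\<^sub>F k in \<U>. rint M r (map (\<lambda>a. a k) xs))\<rparr>"

abbreviation comp_tuple :: "nat \<Rightarrow> (nat \<Rightarrow> 'a) list \<Rightarrow> 'a list" where
  "comp_tuple k \<equiv> map (\<lambda>a. a k)"

lemma ultrapower_tuples_ev:
  assumes "xs \<in> tuples (ultrapower M) ss"
  shows "\<forall>\<^sub>F k in \<U>. comp_tuple k xs \<in> tuples M ss"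
proof -
  have len: "length xs = length ss" by (rule tuples_length[OF assms])
  have "\<forall>\<^sub>F k in \<U>. \<forall>i\<in>{..<length ss}. (xs ! i) k \<in> carr M (ss ! i)"
  proof (intro eventually_ball_finite ballI finite_lessThan)
    fix i assume "i \<in> {..<length ss}"
    then have "xs ! i \<in> ultraproduct (\<lambda>_. carr M (ss ! i))"
      using tuples_nth[OF assms, of i] by (simp add: ultrapower_def)
    then show "\<forall>\<^sub>F k in \<U>. (xs ! i) k \<in> carr M (ss ! i)" by (rule ultraproduct_ev)
  qed
  then show ?thesis
  proof (rule eventually_mono)
    fix k assume k: "\<forall>i\<in>{..<length ss}. (xs ! i) k \<in> carr M (ss ! i)"
    show "comp_tuple k xs \<in> tuples M ss" by (rule tuplesI) (use k len in auto)
  qed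
qed

lemma ultrapower_tuples_lift:
  assumes x: "\<forall>\<^sub>F k in \<U>. x k \<in> tuples M ss"
  shows "\<exists>xs\<in>tuples (ultrapower M) ss. \<forall>\<^sub>F k in \<U>. comp_tuple k xs = x k"
proof
  let ?xs = "map (\<lambda>i. rep (\<lambda>k. x k ! i)) [0..<length ss]"
  show "?xs \<in> tuples (ultrapower M) ss"
  proof (rule tuplesI)
    fix i assume i: "i < length ss"
    have "\<forall>\<^sub>F k in \<U>. x k ! i \<in> carr M (ss ! i)" using x by eventually_elim (rule tuples_nth[OF _ i])
    then show "?xs ! i \<in> carr (ultrapower M) (ss ! i)" using i rep_in_ultraproduct by (simp add: ultrapower_def)
  qed simp
  have "\<forall>\<^sub>F k in \<U>. \<forall>i\<in>{..<length ss}. rep (\<lambda>k. x k ! i) k = x k ! i"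
    by (intro eventually_ball_finite ballI finite_lessThan rep_eq)
  then show "\<forall>\<^sub>F k in \<U>. comp_tuple k ?xs = x k"
    using x
  proof eventually_elim
    case (elim k)
    show ?case by (rule nth_equalityI) (use elim tuples_length[OF elim(2)] in auto)
  qed
qed

lemma ultrapower_structure:
  assumes L: "wf_signature L" and M: "is_structure L M"
  shows "is_structure L (ultrapower M)" "ultralimit L (ultrapower M) (\<lambda>_. M) (\<lambda>k a. a k)"
proof -
  have fint: "fint (ultrapower M) f xs \<in> carr (ultrapower M) (fcod L f)" if "f \<in> Funs L" "xs \<in> tuples (ultrapower M) (fdom L f)" for f xs
  proof -
    have "\<forall>\<^sub>F k in \<U>. fint M f (comp_tuple k xs) \<in> carr M (fcod L f)"
      using ultrapower_tuples_ev[OF that(2)]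
    proof (rule eventually_mono)
      fix k assume "comp_tuple k xs \<in> tuples M (fdom L f)"
      then show "fint M f (comp_tuple k xs) \<in> carr M (fcod L f)" using M that(1) unfolding is_structure_def by blast
    qed
    then have "rep (\<lambda>k. fint M f (comp_tuple k xs)) \<in> ultraproduct (\<lambda>_. carr M (fcod L f))" by (rule rep_in_ultraproduct)
    then show ?thesis by (simp add: ultrapower_def)
  qed
  have "carr (ultrapower M) s \<noteq> {}" if s: "s \<in> Sorts L" for s
  proof -
    obtain a where "a \<in> carr M s" using M s unfolding is_structure_def by blast
    then have "rep (\<lambda>_. a) \<in> ultraproduct (\<lambda>_. carr M s)" by (intro rep_in_ultraproduct) simp
    then show ?thesis by (auto simp: ultrapower_def)
  qed
  then show "is_structure L (ultrapower M)" using fint unfolding is_structure_def by simp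
  show "ultralimit L (ultrapower M) (\<lambda>_. M) (\<lambda>k a. a k)"
  proof
    show "wf_signature L" by (rule L)
  next
    fix s a assume "a \<in> carr (ultrapower M) s"
    then show "\<forall>\<^sub>F k in \<U>. a k \<in> carr M s" by (intro ultraproduct_ev) (simp add: ultrapower_def)
  next
    fix s x assume "\<forall>\<^sub>F k in \<U>. x k \<in> carr M s"
    then have "rep x \<in> carr (ultrapower M) s" using rep_in_ultraproduct by (simp add: ultrapower_def)
    then show "\<exists>a\<in>carr (ultrapower M) s. \<forall>\<^sub>F k in \<U>. a k = x k" by (rule bexI[of "\<lambda>a. \<forall>\<^sub>F k in \<U>. a k = x k", OF rep_eq])
  next
    fix s a b assume "a \<in> carr (ultrapower M) s" "b \<in> carr (ultrapower M) s" "\<forall>\<^sub>F k in \<U>. a k = b k"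
    then show "a = b" by (intro ultraproduct_eqI[of a "\<lambda>_. carr M s" b "\<lambda>_. carr M s"]) (simp_all add: ultrapower_def)
  next
    fix f xs assume f: "f \<in> Funs L" "xs \<in> tuples (ultrapower M) (fdom L f)"
    have "\<forall>\<^sub>F k in \<U>. fint (ultrapower M) f xs k = fint M f (comp_tuple k xs)" by (simp add: ultrapower_def rep_eq)
    then show "fint (ultrapower M) f xs \<in> carr (ultrapower M) (fcod L f) \<and>
        (\<forall>\<^sub>F k in \<U>. fint (ultrapower M) f xs k = fint M f (comp_tuple k xs))" using fint[OF f] by blast
  qed (simp add: ultrapower_def)
qed

definition ultrapower_rel :: "('s, 'f, 'r, 'a) struct \<Rightarrow> 's list \<Rightarrow> 'a list rel \<Rightarrow> (nat \<Rightarrow> 'a) list rel" where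
  "ultrapower_rel M ss R = {(x, y). x \<in> tuples (ultrapower M) ss \<and> y \<in> tuples (ultrapower M) ss \<and>
     (\<forall>\<^sub>F k in \<U>. (comp_tuple k x, comp_tuple k y) \<in> R)}"

text \<open>Los's theorem for the defining formula, with the parameters replaced by constant
  sequences.\<close>

lemma definable_ultrapower_rel:
  assumes L: "wf_signature L" and M: "is_structure L M" and R: "definable_rel L M ss R"
  shows "definable_rel L (ultrapower M) ss (ultrapower_rel M ss R)"
proof -
  let ?U = "ultrapower M"
  have dR: "definable L M (ss @ ss) {x @ y | x y. (x, y) \<in> R}" using R unfolding definable_rel_def by blast
  obtain \<phi> v where \<phi>: "wf_fm L \<phi>" "is_valuation L M v"
    "{x @ y | x y. (x, y) \<in> R} = {z \<in> tuples M (ss @ ss). sat M (assign (ss @ ss) z v) \<phi>}"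
    using dR unfolding definable_def by blast
  define w where "w = (\<lambda>x. rep (\<lambda>_. v x))"
  have w: "is_valuation L ?U w"
    unfolding is_valuation_def
  proof (intro ballI allI)
    fix s k assume "s \<in> Sorts L"
    then have "v (s, k) \<in> carr M s" using \<phi>(2) unfolding is_valuation_def by blast
    then have "rep (\<lambda>_. v (s, k)) \<in> ultraproduct (\<lambda>_. carr M s)" by (intro rep_in_ultraproduct) simp
    then show "w (s, k) \<in> carr ?U s" by (simp add: w_def ultrapower_def)
  qed
  have sat: "sat ?U (assign (ss @ ss) z w) \<phi> \<longleftrightarrow> (\<forall>\<^sub>F k in \<U>. comp_tuple k z \<in> {x @ y | x y. (x, y) \<in> R})"
    if z: "z \<in> tuples ?U (ss @ ss)" for z
  proof -
    have "sat ?U (assign (ss @ ss) z w) \<phi> \<longleftrightarrow> (\<forall>\<^sub>F k in \<U>. sat M (\<lambda>x. assign (ss @ ss) z w x k) \<phi>)"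
      by (rule ultralimit.Los[OF ultrapower_structure(2)[OF L M] \<phi>(1)])
        (use assign_carr[OF w z] fv_sorts[OF \<phi>(1)] in blast)
    also have "\<dots> \<longleftrightarrow> (\<forall>\<^sub>F k in \<U>. comp_tuple k z \<in> {x @ y | x y. (x, y) \<in> R})"
    proof (rule eventually_ultra_cong)
      have "\<forall>\<^sub>F k in \<U>. \<forall>x\<in>fv \<phi>. w x k = v x"
        unfolding w_def by (intro eventually_ball_finite ballI finite_fv rep_eq)
      then show "\<forall>\<^sub>F k in \<U>. sat M (\<lambda>x. assign (ss @ ss) z w x k) \<phi> \<longleftrightarrow> comp_tuple k z \<in> {x @ y | x y. (x, y) \<in> R}"
        using ultrapower_tuples_ev[OF z]
      proof eventually_elim
        case (elim k)
        have "sat M (\<lambda>x. assign (ss @ ss) z w x k) \<phi> \<longleftrightarrow> sat M (assign (ss @ ss) (comp_tuple k z) v) \<phi>"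
        proof (rule sat_cong, rule ballI)
          fix x assume x: "x \<in> fv \<phi>"
          show "assign (ss @ ss) z w x k = assign (ss @ ss) (comp_tuple k z) v x"
            using elim(1) x tuples_length[OF z] by (cases x) (auto simp: assign_def simp del: append_assoc)
        qed
        then show ?case unfolding \<phi>(3) using elim(2) by simp
      qed
    qed
    finally show ?thesis .
  qed
  have mem: "(\<forall>\<^sub>F k in \<U>. comp_tuple k (x @ y) \<in> {x @ y | x y. (x, y) \<in> R}) \<longleftrightarrow> (\<forall>\<^sub>F k in \<U>. (comp_tuple k x, comp_tuple k y) \<in> R)"
    if "x \<in> tuples ?U ss" for x y
  proof -
    have "length (comp_tuple k x) = length ss" for k using tuples_length[OF that] by simp
    from definable_rel_mem[OF R this] show ?thesis unfolding map_append by (simp only:)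
  qed
  have "{x @ y | x y. (x, y) \<in> ultrapower_rel M ss R} = {z \<in> tuples ?U (ss @ ss). sat ?U (assign (ss @ ss) z w) \<phi>}"
  proof (rule equalityI; rule subsetI)
    fix z assume "z \<in> {x @ y | x y. (x, y) \<in> ultrapower_rel M ss R}"
    then obtain x y where z: "z = x @ y" "x \<in> tuples ?U ss" "y \<in> tuples ?U ss" "\<forall>\<^sub>F k in \<U>. (comp_tuple k x, comp_tuple k y) \<in> R"
      unfolding ultrapower_rel_def by blast
    then have zU: "z \<in> tuples ?U (ss @ ss)" unfolding tuples_append by blast
    then show "z \<in> {z \<in> tuples ?U (ss @ ss). sat ?U (assign (ss @ ss) z w) \<phi>}"
      using sat[OF zU] mem[OF z(2), of y] z(1,4) by simp
  next
    fix z assume "z \<in> {z \<in> tuples ?U (ss @ ss). sat ?U (assign (ss @ ss) z w) \<phi>}"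
    then have zU: "z \<in> tuples ?U (ss @ ss)" and zs: "sat ?U (assign (ss @ ss) z w) \<phi>" by blast+
    obtain x y where z: "z = x @ y" "x \<in> tuples ?U ss" "y \<in> tuples ?U ss" using zU unfolding tuples_append by blast
    have "\<forall>\<^sub>F k in \<U>. (comp_tuple k x, comp_tuple k y) \<in> R"
      by (rule iffD1[OF mem[OF z(2)] iffD1[OF sat[OF zU] zs, unfolded z(1)]])
    then have "(x, y) \<in> ultrapower_rel M ss R" unfolding ultrapower_rel_def using z(2,3) by simp
    then show "z \<in> {x @ y | x y. (x, y) \<in> ultrapower_rel M ss R}" using z(1) by blast
  qed
  then have "definable L ?U (ss @ ss) {x @ y | x y. (x, y) \<in> ultrapower_rel M ss R}"
    unfolding definable_def using definable_sorts[OF dR] \<phi>(1) w by blast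
  moreover have "ultrapower_rel M ss R \<subseteq> tuples ?U ss \<times> tuples ?U ss" unfolding ultrapower_rel_def by blast
  ultimately show ?thesis unfolding definable_rel_def by blast
qed

section \<open>Definable intervals\<close>

lemma definable_rel_pred:
  assumes P: "definable_pred L M (ss @ ss) P"
  shows "definable_rel L M ss {(x, y). x \<in> tuples M ss \<and> y \<in> tuples M ss \<and> P (x @ y)}"
proof -
  have "{x @ y | x y. (x, y) \<in> {(x, y). x \<in> tuples M ss \<and> y \<in> tuples M ss \<and> P (x @ y)}} = {z \<in> tuples M (ss @ ss). P z}"
    unfolding tuples_append by auto
  then show ?thesis using P unfolding definable_rel_def definable_pred_def by auto
qed

lemma definable_pred_ex:
  assumes "definable_pred L M (ss @ ts) P"
  shows "definable_pred L M ss (\<lambda>xs. \<exists>ys\<in>tuples M ts. P (xs @ ys))"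
proof -
  have "{xs \<in> tuples M ss. \<exists>ys\<in>tuples M ts. xs @ ys \<in> {z \<in> tuples M (ss @ ts). P z}} =
      {xs \<in> tuples M ss. \<exists>ys\<in>tuples M ts. P (xs @ ys)}"
    unfolding tuples_append by auto
  then show ?thesis using definable_ex[OF assms[unfolded definable_pred_def]] unfolding definable_pred_def by simp
qed

locale definable_preorder = total_preorder R for R :: "'a list rel" +
  fixes L :: "('s, 'f, 'r) signature" and M :: "('s, 'f, 'r, 'a) struct" and ss
  assumes definable_R: "definable_rel L M ss R"
begin

abbreviation "m \<equiv> length ss"
abbreviation "ts k \<equiv> concat (replicate k ss)"

lemma sorts: "set ss \<subseteq> Sorts L"
  using definable_R definable_sorts unfolding definable_rel_def by fastforce

lemma R_tuples: "(x, y) \<in> R \<Longrightarrow> x \<in> tuples M ss \<and> y \<in> tuples M ss"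
  using definable_R unfolding definable_rel_def by blast

lemma ts_sorts: "set (ts k) \<subseteq> Sorts L"
  using sorts by auto

lemma pred_R:
  assumes "i < k" "j < k" "i \<noteq> j"
  shows "definable_pred L M (ts k) (\<lambda>z. (block ss (i * m) z, block ss (j * m) z) \<in> R)"
proof -
  have "i * m + m \<le> j * m \<or> j * m + m \<le> i * m"
    using assms(3) mult_le_mono1[of "Suc i" j m] mult_le_mono1[of "Suc j" i m] by (cases "i < j") auto
  then show ?thesis unfolding definable_pred_def
    by (intro definable_rel_blocks[OF definable_R ts_sorts] is_block_replicate assms(1,2))
qed

lemma pred_param:
  assumes "i < k" "e \<in> tuples M ss"
  shows "definable_pred L M (ts k) (\<lambda>z. (block ss (i * m) z, e) \<in> R)"
    and "definable_pred L M (ts k) (\<lambda>z. (e, block ss (i * m) z) \<in> R)"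
  unfolding definable_pred_def
  by (rule definable_rel_block_param[OF definable_R ts_sorts is_block_replicate[OF assms(1)] assms(2)])+

lemma pred_strict:
  assumes "i < k" "j < k" "i \<noteq> j"
  shows "definable_pred L M (ts k) (\<lambda>z. block ss (i * m) z \<prec> block ss (j * m) z)"
  unfolding lt_def by (intro definable_pred_conj definable_pred_not pred_R assms assms(3)[symmetric])

lemma ts_Suc: "ts (Suc k) = ts k @ ss"
  by (induction k) simp_all

text \<open>Blocks \<open>0\<close> and \<open>1\<close> hold the two arguments of the relation to
  be defined, block \<open>2\<close> a candidate predecessor and block \<open>3\<close> a point in
  between. The parameter \<open>a\<close> expresses membership in the field without reading a block
  twice.\<close>

lemma pred_initial:
  assumes i: "i < 2" and a: "(a, a) \<in> R"
  shows "definable_pred L M (ts 2) (\<lambda>z. block ss (i * m) z \<in> initial_points R)"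
proof -
  let ?b = "\<lambda>i z. block ss (i * m) z"
  have at: "a \<in> tuples M ss" using R_tuples[OF a] by blast
  have "definable_pred L M (ts 3 @ ss) (\<lambda>u. ?b 2 u \<prec> ?b 3 u \<and> ?b 3 u \<prec> ?b i u)"
    unfolding ts_Suc[of 3, symmetric] by (intro definable_pred_conj pred_strict) (use i in simp_all)
  from definable_pred_ex[OF this]
  have 3: "definable_pred L M (ts 2 @ ss) (\<lambda>u. \<exists>w\<in>tuples M ss. ?b 2 (u @ w) \<prec> ?b 3 (u @ w) \<and> ?b 3 (u @ w) \<prec> ?b i (u @ w))"
    using ts_Suc[of 2] by simp
  have "definable_pred L M (ts 2 @ ss) (\<lambda>u. ?b 2 u \<prec> ?b i u)"
    unfolding ts_Suc[of 2, symmetric] by (rule pred_strict) (use i in simp_all)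
  from definable_pred_ex[OF definable_pred_conj[OF this definable_pred_not[OF 3]]]
  have "definable_pred L M (ts 2) (\<lambda>z. ((?b i z, a) \<in> R \<or> (a, ?b i z) \<in> R) \<and>
      \<not> (\<exists>y\<in>tuples M ss. ?b 2 (z @ y) \<prec> ?b i (z @ y) \<and>
        \<not> (\<exists>w\<in>tuples M ss. ?b 2 ((z @ y) @ w) \<prec> ?b 3 ((z @ y) @ w) \<and> ?b 3 ((z @ y) @ w) \<prec> ?b i ((z @ y) @ w))))"
    by (intro definable_pred_conj definable_pred_disj definable_pred_not pred_param i at)
  moreover have "((?b i z, a) \<in> R \<or> (a, ?b i z) \<in> R) \<and>
      \<not> (\<exists>y\<in>tuples M ss. ?b 2 (z @ y) \<prec> ?b i (z @ y) \<and>
        \<not> (\<exists>w\<in>tuples M ss. ?b 2 ((z @ y) @ w) \<prec> ?b 3 ((z @ y) @ w) \<and> ?b 3 ((z @ y) @ w) \<prec> ?b i ((z @ y) @ w)))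
      \<longleftrightarrow> ?b i z \<in> initial_points R" if z: "z \<in> tuples M (ts 2)" for z
  proof -
    have len: "length z = 2 * m" using tuples_length[OF z] by (simp add: length_concat sum_list_replicate)
    have "i = 0 \<or> i = 1" using i by auto
    then have bi: "?b i (z @ y) = ?b i z" for y using len by (elim disjE) simp_all
    have bi2: "?b i ((z @ y) @ w) = ?b i z" for y w unfolding append_assoc by (rule bi)
    have b2: "?b 2 (z @ y) = y" "?b 2 ((z @ y) @ w) = y" "?b 3 ((z @ y) @ w) = w" if "y \<in> tuples M ss" "w \<in> tuples M ss" for y w
      using len tuples_length[OF that(1)] tuples_length[OF that(2)] by simp_all
    have "(\<exists>w\<in>tuples M ss. ?b 2 ((z @ y) @ w) \<prec> ?b 3 ((z @ y) @ w) \<and> ?b 3 ((z @ y) @ w) \<prec> ?b i ((z @ y) @ w)) \<longleftrightarrow>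
        (\<exists>w. y \<prec> w \<and> w \<prec> ?b i z)" if y: "y \<in> tuples M ss" for y
    proof
      assume "\<exists>w\<in>tuples M ss. ?b 2 ((z @ y) @ w) \<prec> ?b 3 ((z @ y) @ w) \<and> ?b 3 ((z @ y) @ w) \<prec> ?b i ((z @ y) @ w)"
      then obtain w where w: "w \<in> tuples M ss" "?b 2 ((z @ y) @ w) \<prec> ?b 3 ((z @ y) @ w)" "?b 3 ((z @ y) @ w) \<prec> ?b i ((z @ y) @ w)" by blast
      then show "\<exists>w. y \<prec> w \<and> w \<prec> ?b i z" unfolding b2(2)[OF y w(1)] b2(3)[OF y w(1)] bi2 by (intro exI[of _ w] conjI)
    next
      assume "\<exists>w. y \<prec> w \<and> w \<prec> ?b i z"
      then obtain w where w: "y \<prec> w" "w \<prec> ?b i z" by blast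
      then have wt: "w \<in> tuples M ss" using R_tuples unfolding lt_def by blast
      show "\<exists>w\<in>tuples M ss. ?b 2 ((z @ y) @ w) \<prec> ?b 3 ((z @ y) @ w) \<and> ?b 3 ((z @ y) @ w) \<prec> ?b i ((z @ y) @ w)"
        by (rule bexI[OF _ wt], unfold b2(2)[OF y wt] b2(3)[OF y wt] bi2) (rule conjI[OF w])
    qed
    note inner = this
    have "(\<exists>y\<in>tuples M ss. ?b 2 (z @ y) \<prec> ?b i (z @ y) \<and>
        \<not> (\<exists>w\<in>tuples M ss. ?b 2 ((z @ y) @ w) \<prec> ?b 3 ((z @ y) @ w) \<and> ?b 3 ((z @ y) @ w) \<prec> ?b i ((z @ y) @ w))) \<longleftrightarrow>
        (\<exists>y\<in>tuples M ss. y \<lhd> ?b i z)"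
      unfolding cov_def by (rule bex_cong[OF HOL.refl]) (simp only: inner bi b2(1))
    also have "\<dots> \<longleftrightarrow> (\<exists>y. y \<lhd> ?b i z)"
      using R_tuples cov_refl by blast
    finally have 1: "(\<exists>y\<in>tuples M ss. ?b 2 (z @ y) \<prec> ?b i (z @ y) \<and>
        \<not> (\<exists>w\<in>tuples M ss. ?b 2 ((z @ y) @ w) \<prec> ?b 3 ((z @ y) @ w) \<and> ?b 3 ((z @ y) @ w) \<prec> ?b i ((z @ y) @ w))) \<longleftrightarrow>
        (\<exists>y. y \<lhd> ?b i z)" .
    have 2: "(?b i z, a) \<in> R \<or> (a, ?b i z) \<in> R \<longleftrightarrow> (?b i z, ?b i z) \<in> R" using refl total a by blast
    show ?thesis unfolding 1 2 initial_points_def by simp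
  qed
  ultimately show ?thesis unfolding definable_pred_def by (simp cong: conj_cong)
qed

lemma definable_interval:
  assumes P: "\<And>i. i < 2 \<Longrightarrow> definable_pred L M (ts 2) (\<lambda>z. block ss (i * m) z \<in> P)"
  shows "definable_rel L M ss (R \<inter> P \<times> P)"
proof -
  have ts2: "ts 2 = ss @ ss" by (simp add: numeral_eq_Suc)
  let ?Q = "\<lambda>z. (block ss (0 * m) z, block ss (1 * m) z) \<in> R \<and> block ss (0 * m) z \<in> P \<and> block ss (1 * m) z \<in> P"
  have "definable_pred L M (ts 2) ?Q"
    by (intro definable_pred_conj pred_R P) simp_all
  from definable_rel_pred[OF this[unfolded ts2]]
  have "definable_rel L M ss {(x, y). x \<in> tuples M ss \<and> y \<in> tuples M ss \<and> ?Q (x @ y)}" .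
  moreover have "{(x, y). x \<in> tuples M ss \<and> y \<in> tuples M ss \<and> ?Q (x @ y)} = R \<inter> P \<times> P"
  proof -
    have "?Q (x @ y) \<longleftrightarrow> (x, y) \<in> R \<and> x \<in> P \<and> y \<in> P" if "x \<in> tuples M ss" "y \<in> tuples M ss" for x y
      using tuples_length[OF that(1)] tuples_length[OF that(2)] by simp
    then show ?thesis using R_tuples by auto
  qed
  ultimately show ?thesis by simp
qed

end

lemma finite_linear_strict_max:
  assumes lin: "linear_strict K lt" and "finite S" "S \<noteq> {}" "S \<subseteq> K"
  shows "\<exists>m\<in>S. \<forall>x\<in>S. \<not> lt m x"
  using assms(2-4)
proof (induction S rule: finite_ne_induct)
  case (singleton x)
  then show ?case using linear_strict_irrefl[OF lin, of x] by simp
next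
  case (insert x F)
  then obtain m where m: "m \<in> F" "\<And>y. y \<in> F \<Longrightarrow> \<not> lt m y" by auto
  have K: "x \<in> K" "m \<in> K" "\<And>y. y \<in> F \<Longrightarrow> y \<in> K" using insert.prems m(1) by auto
  show ?case
  proof (cases "lt m x")
    case True
    have "\<not> lt x y" if "y \<in> F" for y
      using linear_strict_trans[OF lin K(2,1) K(3)[OF that] True] m(2)[OF that] by blast
    then show ?thesis using linear_strict_irrefl[OF lin K(1)] by auto
  next
    case False
    then show ?thesis using m by auto
  qed
qed

lemma dense_min_infinite:
  assumes "dense_min K lt"
  shows "infinite K"
proof
  assume fin: "finite K"
  have lin: "linear_strict K lt" and ne: "K \<noteq> {}" and no_max: "\<forall>x\<in>K. \<exists>y\<in>K. lt x y"
    using assms unfolding dense_min_def by auto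
  show False using finite_linear_strict_max[OF lin fin ne subset_refl] no_max by blast
qed

lemma inj_fm_singleton: "inj (\<lambda>\<phi>. {\<phi>})"
  by (rule injI) simp

lemma Neg_power_Conj:
  "(Neg ^^ n) (Conj a b) = (Neg ^^ k) (Conj c d) \<longleftrightarrow> n = k \<and> a = c \<and> b = d"
proof (induction n arbitrary: k)
  case 0
  then show ?case by (cases k) auto
next
  case (Suc n)
  then show ?case by (cases k) auto
qed

text \<open>The number of leading negations records the argument and the conjunction below them the
  value; starting from a conjunction makes that number unambiguous.\<close>

lemma ex_sequence_code: "\<exists>enc :: (nat \<Rightarrow> ('s, 'f, 'r) fm) \<Rightarrow> ('s, 'f, 'r) univ. inj enc"
proof -
  define enc where "enc = (\<lambda>g. range (\<lambda>n. (Neg ^^ n) (Conj (g n) (g n)) :: ('s, 'f, 'r) fm))"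
  have "g = h" if eq: "enc g = enc h" for g h
  proof
    fix n
    have "(Neg ^^ n) (Conj (g n) (g n)) \<in> enc g" unfolding enc_def by (rule rangeI)
    then have "(Neg ^^ n) (Conj (g n) (g n)) \<in> enc h" unfolding eq .
    then obtain k where "(Neg ^^ n) (Conj (g n) (g n)) = (Neg ^^ k) (Conj (h k) (h k))" unfolding enc_def by (rule rangeE)
    then have "n = k" "g n = h k" unfolding Neg_power_Conj by blast+
    then show "g n = h n" by simp
  qed
  then have "inj enc" by (rule injI)
  then show ?thesis by blast
qed

section \<open>Covers over a dense interval\<close>

context definable_preorder
begin

text \<open>The base order is the half-open interval of initial points from \<open>a\<close> to
  \<open>b\<close>, taken modulo equivalence. Including \<open>a\<close> gives a least point,
  excluding \<open>b\<close> leaves no last one, and density is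
  \<open>discrete_or_dense\<close>.\<close>

theorem dense_interval_cover:
  assumes "\<And>i. (d i, d i) \<in> R" "\<And>i j :: nat. i \<noteq> j \<Longrightarrow> \<not> ((d i, d j) \<in> R \<and> (d j, d i) \<in> R)"
    and bounded: "\<And>x y. (x, y) \<notin> covers R ^^ k"
    and L: "wf_signature L" and M: "is_model L T M" and enc: "inj (enc :: 'a \<Rightarrow> ('s, 'f, 'r) univ)"
  shows "\<exists>(M' :: ('s, 'f, 'r, ('s, 'f, 'r) univ) struct) (N :: ('ns::infinite, 'nf, 'nr::infinite, ('s, 'f, 'r) univ list set) struct).
    is_model L T M' \<and> interpreted_in L M' osig N \<and> \<not> G_compact osig (Th osig N)"
proof -
  have "\<exists>a\<in>initial_points R. \<exists>b\<in>initial_points R. a \<prec> b"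
    by (rule discrete_or_dense(1)[where d = d and k = k, OF assms(1) _ bounded]) (rule assms(2))
  then obtain a b where ab: "a \<in> initial_points R" "b \<in> initial_points R" "a \<prec> b" by (elim bexE)
  note prec_def = lt_def
  have dense: "\<exists>z\<in>initial_points R. x \<prec> z \<and> z \<prec> y"
    if "x \<in> initial_points R" "y \<in> initial_points R" "x \<prec> y" for x y
    by (rule discrete_or_dense(2)[where d = d and k = k, OF assms(1) _ bounded that]) (rule assms(2))
  define P where "P = {x \<in> initial_points R. (a, x) \<in> R \<and> (b, x) \<notin> R}"
  have D: "(x, x) \<in> R" if "x \<in> initial_points R" for x using that unfolding initial_points_def by blast
  have abR: "(a, a) \<in> R" "(b, b) \<in> R" using D ab by blast+
  have at: "a \<in> tuples M ss" "b \<in> tuples M ss" using R_tuples abR by blast+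
  have dP: "definable_pred L M (ts 2) (\<lambda>z. block ss (i * m) z \<in> P)" if "i < 2" for i
  proof -
    have "definable_pred L M (ts 2) (\<lambda>z. block ss (i * m) z \<in> initial_points R \<and> (a, block ss (i * m) z) \<in> R \<and> (b, block ss (i * m) z) \<notin> R)"
      by (intro definable_pred_conj definable_pred_not pred_initial[OF that abR(1)] pred_param that at)
    then show ?thesis unfolding P_def by simp
  qed
  let ?R = "R \<inter> P \<times> P"
  have dR: "definable_rel L M ss ?R" by (rule definable_interval[OF dP])
  have PD: "(x, x) \<in> R" if "x \<in> P" for x using that D unfolding P_def by blast
  define idx where "idx = (\<lambda>x. SOME y. (x, y) \<in> R \<and> (y, x) \<in> R)"
  have idx: "(x, idx x) \<in> R" "(idx x, x) \<in> R" if "x \<in> P" for x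
    using someI[of "\<lambda>y. (x, y) \<in> R \<and> (y, x) \<in> R" x] PD[OF that] unfolding idx_def by simp_all
  have idx_eq: "idx x = idx y" if "(x, y) \<in> R" "(y, x) \<in> R" for x y
  proof -
    have "(x, z) \<in> R \<and> (z, x) \<in> R \<longleftrightarrow> (y, z) \<in> R \<and> (z, y) \<in> R" for z using that trans by blast
    then show ?thesis unfolding idx_def by simp
  qed
  define lt where "lt = (\<lambda>x y. x \<prec> y)"
  let ?K = "idx ` P"
  have lt_idx: "lt (idx x) (idx y) \<longleftrightarrow> x \<prec> y" if "x \<in> P" "y \<in> P" for x y
    unfolding lt_def using le_lt_trans lt_le_trans idx[OF that(1)] idx[OF that(2)] by blast
  have lin: "linear_strict ?K lt"
    unfolding linear_strict_def
  proof (intro conjI ballI impI)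
    fix x assume "x \<in> ?K"
    then show "\<not> lt x x" unfolding lt_def by (simp add: strict_part_def)
  next
    fix x y z assume "lt x y" "lt y z"
    then show "lt x z" unfolding lt_def by (rule lt_trans)
  next
    fix x y assume "x \<in> ?K" "y \<in> ?K"
    then obtain x' y' where x: "x' \<in> P" "x = idx x'" and y: "y' \<in> P" "y = idx y'" by blast
    show "x = y \<or> lt x y \<or> lt y x"
      unfolding x(2) y(2) lt_idx[OF x(1) y(1)] lt_idx[OF y(1) x(1)]
      using lt_cases[OF PD[OF x(1)] PD[OF y(1)]] lt_cases[OF PD[OF y(1)] PD[OF x(1)]] idx_eq by blast
  qed
  have aP: "a \<in> P" using ab abR unfolding P_def prec_def by blast
  have between: "z \<in> P" if "x \<in> P" "z \<in> initial_points R" "x \<prec> z" "z \<prec> b" for x z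
    using that trans[of a x z] unfolding P_def prec_def by blast
  have dm: "dense_min ?K lt"
    unfolding dense_min_def
  proof (intro conjI ballI impI)
    show "linear_strict ?K lt" by (rule lin)
    show "\<exists>m\<in>?K. \<forall>x\<in>?K. x = m \<or> lt m x"
    proof (rule bexI[of _ "idx a"], rule ballI)
      fix x assume "x \<in> ?K"
      then obtain x' where x: "x' \<in> P" "x = idx x'" by blast
      have "(a, x') \<in> R" using x(1) unfolding P_def by blast
      then show "x = idx a \<or> lt (idx a) x"
        unfolding x(2) lt_idx[OF aP x(1)] using idx_eq[of x' a] prec_def by blast
    qed (use aP in blast)
  next
    fix x assume "x \<in> ?K"
    then obtain x' where x: "x' \<in> P" "x = idx x'" by blast
    have x': "x' \<in> initial_points R" "(b, x') \<notin> R" using x(1) unfolding P_def by blast+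
    have "x' \<prec> b" using lt_cases[OF PD[OF x(1)] abR(2)] x'(2) by blast
    from dense[OF x'(1) ab(2) this] obtain z where z: "z \<in> initial_points R" "x' \<prec> z" "z \<prec> b" by blast
    have zP: "z \<in> P" by (rule between[OF x(1) z])
    show "\<exists>y\<in>?K. lt x y"
      by (rule bexI[of _ "idx z"]) (use z(2) zP lt_idx[OF x(1) zP] x(2) in blast)+
  next
    fix x y assume "x \<in> ?K" "y \<in> ?K" "lt x y"
    then obtain x' y' where x: "x' \<in> P" "x = idx x'" and y: "y' \<in> P" "y = idx y'" by blast
    have xy: "x' \<prec> y'" using \<open>lt x y\<close> unfolding x(2) y(2) lt_idx[OF x(1) y(1)] .
    have F: "x' \<in> initial_points R" "y' \<in> initial_points R" "(b, y') \<notin> R" using x(1) y(1) unfolding P_def by blast+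
    from dense[OF F(1,2) xy] obtain z where z: "z \<in> initial_points R" "x' \<prec> z" "z \<prec> y'" by blast
    have "y' \<prec> b" using lt_cases[OF PD[OF y(1)] abR(2)] F(3) by blast
    then have "z \<prec> b" using z(3) lt_trans by blast
    then have zP: "z \<in> P" by (rule between[OF x(1) z(1,2)])
    show "\<exists>z\<in>?K. lt x z \<and> lt z y"
      by (rule bexI[of _ "idx z"])
        (use z(2,3) zP lt_idx[OF x(1) zP] lt_idx[OF zP y(1)] x(2) y(2) in blast)+
  qed
  have dom: "{x. (x, x) \<in> ?R} = P" using PD by blast
  have "\<exists>(M' :: ('s, 'f, 'r, ('s, 'f, 'r) univ) struct) (N :: ('ns, 'nf, 'nr, ('s, 'f, 'r) univ list set) struct) cd.
    is_model L T M' \<and> interpreted_in L M' osig N \<and> cover_model N cd ?K lt"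
  proof (rule cover_over_univ[OF L M enc dR _ _ _ dense_min_infinite[OF dm] lin])
    show "(x, x) \<in> ?R \<and> (y, y) \<in> ?R" if "(x, y) \<in> ?R" for x y using that PD by blast
    show "idx ` {x. (x, x) \<in> ?R} = ?K" unfolding dom ..
    fix x y assume "(x, x) \<in> ?R" "(y, y) \<in> ?R"
    then have x: "x \<in> P" and y: "y \<in> P" by blast+
    show "(x, y) \<in> ?R \<longleftrightarrow> \<not> lt (idx y) (idx x)"
      unfolding lt_idx[OF y x] using x y lt_cases[OF PD[OF y] PD[OF x]] prec_def by blast
  qed
  then show ?thesis using dense_cover_not_G_compact[OF _ dm] by blast
qed

end

section \<open>Chains of immediate successors and hyperfinite intervals\<close>

context total_preorder
begin

lemma chain_order:
  assumes c: "\<And>i. i < k \<Longrightarrow> c i \<lhd> c (Suc i)" "(c 0, c 0) \<in> R" and ij: "i \<le> k" "j \<le> k"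
  shows "(c i, c j) \<in> R \<longleftrightarrow> i \<le> j"
proof -
  have D: "(c i, c i) \<in> R" if i: "i \<le> k" for i
  proof (cases i)
    case (Suc j)
    then show ?thesis using cov_refl[OF c(1)[of j]] i by simp
  qed (simp add: c(2))
  have le: "(c i, c (i + l)) \<in> R" if "i + l \<le> k" for i l
    using that
  proof (induction l)
    case 0
    then show ?case using D by simp
  next
    case (Suc l)
    then have "(c (i + l), c (Suc (i + l))) \<in> R" using c(1)[of "i + l"] unfolding cov_def lt_def by simp
    then show ?case using Suc trans[of "c i" "c (i + l)"] by simp
  qed
  show ?thesis
  proof
    assume "i \<le> j"
    then show "(c i, c j) \<in> R" using le[of i "j - i"] ij by simp
  next
    assume R: "(c i, c j) \<in> R"
    show "i \<le> j"
    proof (rule ccontr)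
      assume "\<not> i \<le> j"
      then have "j < i" by simp
      then have lt: "c j \<prec> c (Suc j)" using c(1)[of j] ij unfolding cov_def by simp
      have "(c (Suc j), c i) \<in> R" using le[of "Suc j" "i - Suc j"] \<open>j < i\<close> ij by simp
      then have "c j \<prec> c j" using lt_le_trans[OF lt] trans[OF _ R] by blast
      then show False unfolding lt_def by blast
    qed
  qed
qed

text \<open>Nothing lies strictly between consecutive links, so every point of the interval spanned
  by the chain is equivalent to a link.\<close>

lemma chain_cases:
  assumes c: "\<And>i. i < k \<Longrightarrow> c i \<lhd> c (Suc i)" and x: "(c 0, x) \<in> R" "(x, c k) \<in> R"
  shows "\<exists>i\<le>k. (c i, x) \<in> R \<and> (x, c i) \<in> R"
  using assms
proof (induction k)
  case 0
  then show ?case by auto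
next
  case (Suc k)
  have xx: "(x, x) \<in> R" using x refl by blast
  show ?case
  proof (cases "(x, c k) \<in> R")
    case True
    then obtain i where "i \<le> k" "(c i, x) \<in> R \<and> (x, c i) \<in> R" using Suc.IH Suc.prems by auto
    then show ?thesis by (intro exI[of _ i]) simp
  next
    case False
    have cov: "c k \<lhd> c (Suc k)" using Suc.prems(1)[of k] by simp
    have "c k \<prec> x" using False lt_cases[of "c k" x] cov_refl[OF cov] xx by blast
    then have "\<not> x \<prec> c (Suc k)" using cov unfolding cov_def by blast
    then have "(c (Suc k), x) \<in> R" using lt_cases[OF xx] cov_refl[OF cov] by blast
    then show ?thesis using Suc.prems(3) by blast
  qed
qed

end

lemma infinite_HN: "infinite HN"
proof -
  define x where "x = (\<lambda>n. rep (\<lambda>k. if n \<le> k then n else 0))"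
  have xH: "x n \<in> HN" for n unfolding x_def by (rule rep_in_ultraproduct) simp
  have ev: "\<forall>\<^sub>F k in \<U>. x n k = n" for n
    using rep_eq[of "\<lambda>k. if n \<le> k then n else 0"] eventually_ultra_ge[of n] unfolding x_def by eventually_elim simp
  have "inj x"
  proof (rule injI)
    fix n l assume "x n = x l"
    then have "\<forall>\<^sub>F k in \<U>. x n k = l" using ev[of l] by simp
    then have "\<forall>\<^sub>F k in \<U>. n = l" using ev[of n] by eventually_elim simp
    then show "n = l" by simp
  qed
  moreover have "range x \<subseteq> HN" using xH by blast
  ultimately show ?thesis using range_inj_infinite infinite_super by blast
qed

lemma linear_strict_HN: "linear_strict HN nless"
  by (rule linear_strict_ultra) (auto simp: linear_strict_def)

lemma total_preorder_ultrapower_rel: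
  assumes R: "total_preorder R"
  shows "total_preorder (ultrapower_rel M ss R)"
proof
  fix x y assume "(x, y) \<in> ultrapower_rel M ss R"
  then have xy: "x \<in> tuples (ultrapower M) ss" "y \<in> tuples (ultrapower M) ss" "\<forall>\<^sub>F k in \<U>. (comp_tuple k x, comp_tuple k y) \<in> R"
    unfolding ultrapower_rel_def by blast+
  have "\<forall>\<^sub>F k in \<U>. (comp_tuple k x, comp_tuple k x) \<in> R" "\<forall>\<^sub>F k in \<U>. (comp_tuple k y, comp_tuple k y) \<in> R"
    using xy(3) by (eventually_elim, use total_preorder.refl[OF R] in blast)+
  then show "(x, x) \<in> ultrapower_rel M ss R \<and> (y, y) \<in> ultrapower_rel M ss R" unfolding ultrapower_rel_def using xy(1,2) by simp
next
  fix x y z assume "(x, y) \<in> ultrapower_rel M ss R" "(y, z) \<in> ultrapower_rel M ss R"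
  then have xy: "x \<in> tuples (ultrapower M) ss" "z \<in> tuples (ultrapower M) ss" "\<forall>\<^sub>F k in \<U>. (comp_tuple k x, comp_tuple k y) \<in> R"
    "\<forall>\<^sub>F k in \<U>. (comp_tuple k y, comp_tuple k z) \<in> R"
    unfolding ultrapower_rel_def by blast+
  have "\<forall>\<^sub>F k in \<U>. (comp_tuple k x, comp_tuple k z) \<in> R"
    using xy(3,4) by eventually_elim (rule total_preorder.trans[OF R])
  then show "(x, z) \<in> ultrapower_rel M ss R" unfolding ultrapower_rel_def using xy(1,2) by simp
next
  fix x y assume "(x, x) \<in> ultrapower_rel M ss R" "(y, y) \<in> ultrapower_rel M ss R"
  then have xy: "x \<in> tuples (ultrapower M) ss" "y \<in> tuples (ultrapower M) ss" "\<forall>\<^sub>F k in \<U>. (comp_tuple k x, comp_tuple k x) \<in> R"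
    "\<forall>\<^sub>F k in \<U>. (comp_tuple k y, comp_tuple k y) \<in> R"
    unfolding ultrapower_rel_def by blast+
  have "\<forall>\<^sub>F k in \<U>. (comp_tuple k x, comp_tuple k y) \<in> R \<or> (comp_tuple k y, comp_tuple k x) \<in> R"
    using xy(3,4) by eventually_elim (rule total_preorder.total[OF R])
  then show "(x, y) \<in> ultrapower_rel M ss R \<or> (y, x) \<in> ultrapower_rel M ss R"
    unfolding eventually_ultra_disj ultrapower_rel_def using xy(1,2) by simp
qed

text \<open>For each \<open>k\<close> a chain of covers with links \<open>c k 0\<close> to
  \<open>c k k\<close> is chosen. In the ultrapower the sequences of first and of last links are
  points \<open>p\<close> and \<open>q\<close>, and the definable interval from \<open>p\<close> to
  \<open>q\<close> is, modulo equivalence, the ultraproduct of these finite chains.\<close>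

theorem discrete_interval_cover:
  fixes M :: "('s, 'f, 'r, 'a) struct" and enc :: "(nat \<Rightarrow> 'a) \<Rightarrow> ('s, 'f, 'r) univ"
  assumes L: "wf_signature L" and M: "is_model L T M" and R: "definable_rel L M ss R" and pre: "total_preorder R"
    and chains: "\<And>k. \<exists>x y. (x, y) \<in> covers R ^^ Suc k" and enc: "inj enc"
  shows "\<exists>(M' :: ('s, 'f, 'r, ('s, 'f, 'r) univ) struct) (N :: ('ns::infinite, 'nf, 'nr::infinite, ('s, 'f, 'r) univ list set) struct).
    is_model L T M' \<and> interpreted_in L M' osig N \<and> \<not> G_compact osig (Th osig N)"
proof -
  have st: "is_structure L M" and T: "T \<subseteq> Th L M" using M unfolding is_model_def by blast+
  interpret total_preorder R by (rule pre)
  let ?U = "ultrapower M" and ?RU = "ultrapower_rel M ss R"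
  have stU: "is_structure L ?U" by (rule ultrapower_structure(1)[OF L st])
  have "Th L ?U = Th L M" by (rule ultralimit_Th[OF ultrapower_structure(2)[OF L st] stU st])
  then have modelU: "is_model L T ?U" using stU T unfolding is_model_def by simp
  interpret U: total_preorder ?RU by (rule total_preorder_ultrapower_rel[OF pre])
  interpret U: definable_preorder ?RU L ?U ss
    by unfold_locales (rule definable_ultrapower_rel[OF L st R])
  have "\<forall>k. \<exists>c. (\<forall>i<Suc k. (c i, c (Suc i)) \<in> covers R)"
  proof
    fix k
    obtain x y where "(x, y) \<in> covers R ^^ Suc k" using chains by blast
    then show "\<exists>c. (\<forall>i<Suc k. (c i, c (Suc i)) \<in> covers R)" unfolding relpow_fun_conv by blast
  qed
  from choice[OF this] obtain c where "\<forall>k. \<forall>i<Suc k. (c k i, c k (Suc i)) \<in> covers R" by blast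
  then have c: "(c k i, c k (Suc i)) \<in> covers R" if "i \<le> k" for k i using that by simp
  have c_less: "(c k i, c k (Suc i)) \<in> covers R" if "i < k" for k i using c that by simp
  have cD: "(c k i, c k i) \<in> R" if "i \<le> k" for k i using cov_refl[OF c[OF that]] by blast
  have cT: "c k i \<in> tuples M ss" if "i \<le> k" for k i using cD[OF that] R unfolding definable_rel_def by blast
  have ord: "(c k i, c k j) \<in> R \<longleftrightarrow> i \<le> j" if "i \<le> k" "j \<le> k" for k i j
    by (rule chain_order[where k = k and c = "c k"]) (simp_all add: c_less cD that)
  have pq: "\<forall>\<^sub>F k in \<U>. c k 0 \<in> tuples M ss" "\<forall>\<^sub>F k in \<U>. c k k \<in> tuples M ss" using cT by simp_all
  obtain p where p: "p \<in> tuples ?U ss" "\<forall>\<^sub>F k in \<U>. comp_tuple k p = c k 0"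
    using ultrapower_tuples_lift[OF pq(1)] by blast
  obtain q where q: "q \<in> tuples ?U ss" "\<forall>\<^sub>F k in \<U>. comp_tuple k q = c k k"
    using ultrapower_tuples_lift[OF pq(2)] by blast
  define P where "P = {x. (p, x) \<in> ?RU \<and> (x, q) \<in> ?RU}"
  have dP: "definable_pred L ?U (U.ts 2) (\<lambda>z. block ss (i * U.m) z \<in> P)" if "i < 2" for i
  proof -
    have "definable_pred L ?U (U.ts 2) (\<lambda>z. (p, block ss (i * U.m) z) \<in> ?RU \<and> (block ss (i * U.m) z, q) \<in> ?RU)"
      by (intro definable_pred_conj U.pred_param that p(1) q(1))
    then show ?thesis unfolding P_def by simp
  qed
  let ?R = "?RU \<inter> P \<times> P"
  have dR: "definable_rel L ?U ss ?R" by (rule U.definable_interval[OF dP])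
  have PD: "(x, x) \<in> ?RU" if "x \<in> P" for x using that U.refl unfolding P_def by blast
  define near where "near = (\<lambda>x k i. i \<le> k \<and> (c k i, comp_tuple k x) \<in> R \<and> (comp_tuple k x, c k i) \<in> R)"
  \<comment> \<open>A point of the interval is sent to the sequence of the positions of its
    coordinates in the chains.\<close>
  define idx where "idx = (\<lambda>x. rep (\<lambda>k. SOME i. near x k i))"
  have idx: "\<forall>\<^sub>F k in \<U>. near x k (idx x k)" if x: "x \<in> P" for x
  proof -
    have "\<forall>\<^sub>F k in \<U>. (comp_tuple k p, comp_tuple k x) \<in> R" "\<forall>\<^sub>F k in \<U>. (comp_tuple k x, comp_tuple k q) \<in> R"
      using x unfolding P_def ultrapower_rel_def by blast+
    then have "\<forall>\<^sub>F k in \<U>. \<exists>i. near x k i"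
      using p(2) q(2)
    proof eventually_elim
      case (elim k)
      have "\<exists>i\<le>k. (c k i, comp_tuple k x) \<in> R \<and> (comp_tuple k x, c k i) \<in> R"
        by (rule chain_cases[where k = k and c = "c k"]) (use elim c_less in simp_all)
      then show ?case unfolding near_def by blast
    qed
    then have "\<forall>\<^sub>F k in \<U>. near x k (SOME i. near x k i)" by (rule eventually_mono) (rule someI_ex)
    then show ?thesis using rep_eq[of "\<lambda>k. SOME i. near x k i"] unfolding idx_def by eventually_elim simp
  qed
  have idxH: "idx x \<in> HN" if x: "x \<in> P" for x
  proof -
    have "\<forall>\<^sub>F k in \<U>. idx x k \<in> {..k}" using idx[OF x] by eventually_elim (simp add: near_def)
    from rep_in_ultraproduct[OF this] show ?thesis unfolding idx_def by simp
  qed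
  have surj: "\<exists>x\<in>P. idx x = z" if z: "z \<in> HN" for z
  proof -
    have zk: "\<forall>\<^sub>F k in \<U>. z k \<le> k" using ultraproduct_ev[OF z] by eventually_elim simp
    then have "\<forall>\<^sub>F k in \<U>. c k (z k) \<in> tuples M ss" by eventually_elim (rule cT)
    from ultrapower_tuples_lift[OF this] obtain x where x: "x \<in> tuples ?U ss" "\<forall>\<^sub>F k in \<U>. comp_tuple k x = c k (z k)" by blast
    have "\<forall>\<^sub>F k in \<U>. (comp_tuple k p, comp_tuple k x) \<in> R"
      using p(2) x(2) zk by eventually_elim (simp add: ord)
    moreover have "\<forall>\<^sub>F k in \<U>. (comp_tuple k x, comp_tuple k q) \<in> R"
      using q(2) x(2) zk by eventually_elim (simp add: ord)
    ultimately have xP: "x \<in> P" unfolding P_def ultrapower_rel_def using x(1) p(1) q(1) by simp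
    have "\<forall>\<^sub>F k in \<U>. idx x k = z k"
      using idx[OF xP] x(2) zk
    proof eventually_elim
      case (elim k)
      then have "idx x k \<le> k" "(c k (idx x k), c k (z k)) \<in> R" "(c k (z k), c k (idx x k)) \<in> R" unfolding near_def by simp_all
      then show ?case using ord elim(3) by simp
    qed
    then have "idx x = z" by (rule ultraproduct_eqI[OF idxH[OF xP] z])
    then show ?thesis using xP by blast
  qed
  have dom: "{x. (x, x) \<in> ?R} = P" using PD by blast
  have "\<exists>(M' :: ('s, 'f, 'r, ('s, 'f, 'r) univ) struct) (N :: ('ns, 'nf, 'nr, ('s, 'f, 'r) univ list set) struct) cd.
    is_model L T M' \<and> interpreted_in L M' osig N \<and> cover_model N cd HN nless"
  proof (rule cover_over_univ[OF L modelU enc dR _ _ _ infinite_HN linear_strict_HN])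
    show "(x, x) \<in> ?R \<and> (y, y) \<in> ?R" if "(x, y) \<in> ?R" for x y using that PD by blast
    show "idx ` {x. (x, x) \<in> ?R} = HN" unfolding dom
    proof (rule equalityI; rule subsetI)
      show "z \<in> HN" if "z \<in> idx ` P" for z using that idxH by auto
      show "z \<in> idx ` P" if "z \<in> HN" for z using surj[OF that] by auto
    qed
    fix x y assume "(x, x) \<in> ?R" "(y, y) \<in> ?R"
    then have x: "x \<in> P" and y: "y \<in> P" by blast+
    have xyU: "x \<in> tuples ?U ss" "y \<in> tuples ?U ss" using PD[OF x] PD[OF y] unfolding ultrapower_rel_def by blast+
    have "(x, y) \<in> ?R \<longleftrightarrow> (\<forall>\<^sub>F k in \<U>. (comp_tuple k x, comp_tuple k y) \<in> R)"
      using x y xyU unfolding ultrapower_rel_def by simp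
    also have "\<dots> \<longleftrightarrow> (\<forall>\<^sub>F k in \<U>. \<not> idx y k < idx x k)"
    proof (rule eventually_ultra_cong)
      show "\<forall>\<^sub>F k in \<U>. (comp_tuple k x, comp_tuple k y) \<in> R \<longleftrightarrow> \<not> idx y k < idx x k"
        using idx[OF x] idx[OF y]
      proof eventually_elim
        case (elim k)
        have "(comp_tuple k x, comp_tuple k y) \<in> R \<longleftrightarrow> (c k (idx x k), c k (idx y k)) \<in> R"
          using elim trans unfolding near_def by blast
        then show ?case using ord elim unfolding near_def by auto
      qed
    qed
    also have "\<dots> \<longleftrightarrow> \<not> nless (idx y) (idx x)" unfolding ultra_less_def by (rule eventually_ultra_not)
    finally show "(x, y) \<in> ?R \<longleftrightarrow> \<not> nless (idx y) (idx x)" .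
  qed
  then show ?thesis using hyperfinite_cover_not_G_compact by blast
qed

section \<open>The theorem\<close>

text \<open>Pulled back to representatives, the order of the quotient becomes a definable preorder
  on tuples, and representatives of infinitely many classes give the sequence
  \<open>d\<close>.\<close>

lemma interpreted_order_preorder:
  fixes L :: "('s, 'f, 'r) signature" and M :: "('s, 'f, 'r, 'm) struct" and N :: "(unit, unit, unit, 'm list set) struct"
  assumes int: "interpreted_in L M order_signature N" and inf: "infinite_linear_order N"
  shows "\<exists>ss R d. definable_rel L M ss R \<and> total_preorder R \<and> (\<forall>i. (d i, d i) \<in> R) \<and>
    (\<forall>i j :: nat. i \<noteq> j \<longrightarrow> \<not> ((d i, d j) \<in> R \<and> (d j, d i) \<in> R))"
proof -
  obtain ssf :: "unit \<Rightarrow> 's list" and Df Ef where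
    S: "\<forall>s\<in>Sorts order_signature. definable L M (ssf s) (Df s) \<and> equiv (Df s) (Ef s) \<and>
           definable L M (ssf s @ ssf s) {x @ y | x y. (x, y) \<in> Ef s} \<and> carr N s = Df s // Ef s"
    and Rl: "\<forall>r\<in>Rels order_signature. definable L M (concat (map ssf (rdom order_signature r)))
             {concat ds | ds. list_all2 (\<lambda>d s. d \<in> Df s) ds (rdom order_signature r) \<and>
                rint N r (map2 (\<lambda>d s. Ef s `` {d}) ds (rdom order_signature r))}"
    using int unfolding interpreted_in_def by blast
  define ss D E where "ss = ssf ()" and "D = Df ()" and "E = Ef ()"
  have DE: "definable L M ss D" "equiv D E" "carr N () = D // E"
    using S unfolding ss_def D_def E_def order_signature_def by simp_all
  define R where "R = {(x, y). x \<in> D \<and> y \<in> D \<and> rint N () [E `` {x}, E `` {y}]}"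
  have "definable L M (ss @ ss) {x @ y | x y. (x, y) \<in> R}"
  proof -
    have "{concat ds | ds. list_all2 (\<lambda>d s. d \<in> Df s) ds [(), ()] \<and> rint N () (map2 (\<lambda>d s. Ef s `` {d}) ds [(), ()])}
        = {x @ y | x y. (x, y) \<in> R}"
    proof (rule equalityI; rule subsetI)
      fix z assume "z \<in> {concat ds | ds. list_all2 (\<lambda>d s. d \<in> Df s) ds [(), ()] \<and> rint N () (map2 (\<lambda>d s. Ef s `` {d}) ds [(), ()])}"
      then obtain x y where "z = x @ y" "x \<in> D" "y \<in> D" "rint N () [E `` {x}, E `` {y}]"
        unfolding D_def E_def by (auto simp: list_all2_Cons2)
      then show "z \<in> {x @ y | x y. (x, y) \<in> R}" unfolding R_def by blast
    next
      fix z assume "z \<in> {x @ y | x y. (x, y) \<in> R}"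
      then obtain x y where "z = x @ y" "x \<in> D" "y \<in> D" "rint N () [E `` {x}, E `` {y}]" unfolding R_def by blast
      then show "z \<in> {concat ds | ds. list_all2 (\<lambda>d s. d \<in> Df s) ds [(), ()] \<and> rint N () (map2 (\<lambda>d s. Ef s `` {d}) ds [(), ()])}"
        unfolding D_def E_def by (intro CollectI exI[of _ "[x, y]"]) simp
    qed
    then show ?thesis using Rl unfolding ss_def order_signature_def by simp
  qed
  moreover have "R \<subseteq> tuples M ss \<times> tuples M ss" using definable_subset[OF DE(1)] unfolding R_def by blast
  ultimately have dR: "definable_rel L M ss R" unfolding definable_rel_def by blast
  let ?C = "carr N ()" and ?r = "{(x, y) \<in> carr N () \<times> carr N (). rint N () [x, y]}"
  have lo: "infinite ?C" "linear_order_on ?C ?r" using inf unfolding infinite_linear_order_def by blast+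
  have cls: "E `` {x} \<in> ?C" if "x \<in> D" for x unfolding DE(3) by (rule quotientI[OF that])
  have Rr: "(x, y) \<in> R \<longleftrightarrow> (E `` {x}, E `` {y}) \<in> ?r" if "x \<in> D" "y \<in> D" for x y
    unfolding R_def using that cls by simp
  have po: "refl_on ?C ?r" "trans ?r" "antisym ?r" "total_on ?C ?r"
    using lo(2) unfolding linear_order_on_def partial_order_on_def preorder_on_def by blast+
  have rr: "(u, u) \<in> ?r" if "u \<in> ?C" for u by (rule refl_onD[OF po(1) that])
  have RD: "x \<in> D" "y \<in> D" if "(x, y) \<in> R" for x y using that unfolding R_def by blast+
  have refl: "(x, x) \<in> R" if "x \<in> D" for x unfolding Rr[OF that that] by (rule rr[OF cls[OF that]])
  have "total_preorder R"
  proof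
    show "(x, x) \<in> R \<and> (y, y) \<in> R" if "(x, y) \<in> R" for x y using RD[OF that] refl by blast
    show "(x, z) \<in> R" if "(x, y) \<in> R" "(y, z) \<in> R" for x y z
    proof -
      have D: "x \<in> D" "y \<in> D" "z \<in> D" using RD that by blast+
      show ?thesis unfolding Rr[OF D(1,3)]
        by (rule transD[OF po(2) that(1)[unfolded Rr[OF D(1,2)]] that(2)[unfolded Rr[OF D(2,3)]]])
    qed
    show "(x, y) \<in> R \<or> (y, x) \<in> R" if "(x, x) \<in> R" "(y, y) \<in> R" for x y
    proof -
      have D: "x \<in> D" "y \<in> D" using RD that by blast+
      show ?thesis unfolding Rr[OF D] Rr[OF D(2,1)]
      proof (cases "E `` {x} = E `` {y}")
        case True
        then show "(E `` {x}, E `` {y}) \<in> ?r \<or> (E `` {y}, E `` {x}) \<in> ?r" using rr[OF cls[OF D(2)]] by simp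
      next
        case False
        then show "(E `` {x}, E `` {y}) \<in> ?r \<or> (E `` {y}, E `` {x}) \<in> ?r"
          by (rule po(4)[unfolded total_on_def, rule_format, OF cls[OF D(1)] cls[OF D(2)]])
      qed
    qed
  qed
  moreover obtain f :: "nat \<Rightarrow> 'm list set" where f: "inj f" "range f \<subseteq> ?C"
    using infinite_countable_subset[OF lo(1)] by blast
  have "\<forall>i. \<exists>x. x \<in> D \<and> E `` {x} = f i"
  proof
    fix i
    have "f i \<in> D // E" using f(2) unfolding DE(3) by blast
    then show "\<exists>x. x \<in> D \<and> E `` {x} = f i" by (rule quotientE) auto
  qed
  from choice[OF this] obtain d where d: "\<And>i. d i \<in> D" "\<And>i. E `` {d i} = f i" by blast
  have "\<not> ((d i, d j) \<in> R \<and> (d j, d i) \<in> R)" if "i \<noteq> j" for i j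
  proof
    assume "(d i, d j) \<in> R \<and> (d j, d i) \<in> R"
    then have "(f i, f j) \<in> ?r" "(f j, f i) \<in> ?r" using Rr[OF d(1) d(1)] unfolding d(2) by blast+
    then have "f i = f j" by (rule antisymD[OF po(3)])
    then show False using injD[OF f(1)] that by blast
  qed
  moreover have "(d i, d i) \<in> R" for i by (rule refl[OF d(1)])
  ultimately show ?thesis using dR by blast
qed

theorem mainTheorem1:
  fixes L :: "('s, 'f, 'r) signature"
    and T :: "('s, 'f, 'r) fm set"
    and N :: "(unit, unit, unit, 'm list set) struct"
  assumes "wf_signature L"
    and "complete_theory L T"
    and "interprets L T order_signature N"
    and "infinite_linear_order N"
  shows "\<not> hereditarily_G_compact TYPE('ns::infinite) TYPE('nf::infinite) TYPE('nr::infinite) L T"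
proof -
  obtain M0 :: "('s, 'f, 'r, 'm) struct" where M0: "is_model L T M0" "interpreted_in L M0 order_signature N"
    using assms(3) unfolding interprets_def by blast
  from interpreted_order_preorder[OF M0(2) assms(4)] obtain ss R0 d0
    where R0: "definable_rel L M0 ss R0" "total_preorder R0" "\<forall>i. (d0 i, d0 i) \<in> R0"
      "\<forall>i j :: nat. i \<noteq> j \<longrightarrow> \<not> ((d0 i, d0 j) \<in> R0 \<and> (d0 j, d0 i) \<in> R0)" by (elim exE conjE)
  \<comment> \<open>The model is shrunk to the type of formulas. After that, both its elements and,
    for the ultrapower, sequences of them can be coded in \<open>univ\<close>.\<close>
  have "\<exists>(M :: ('s, 'f, 'r, ('s, 'f, 'r) fm) struct) R d. is_model L T M \<and> definable_rel L M ss R \<and> total_preorder R \<and>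
    (\<forall>i. (d i, d i) \<in> R) \<and> (\<forall>i j :: nat. i \<noteq> j \<longrightarrow> \<not> ((d i, d j) \<in> R \<and> (d j, d i) \<in> R))"
    by (rule small_definable_order[OF assms(1) M0(1) R0(1,2), of d0]) (simp_all add: R0(3,4))
  then obtain M :: "('s, 'f, 'r, ('s, 'f, 'r) fm) struct" and R d
    where M: "is_model L T M" and R: "definable_rel L M ss R" "total_preorder R" and d: "\<forall>i. (d i, d i) \<in> R"
      "\<forall>i j :: nat. i \<noteq> j \<longrightarrow> \<not> ((d i, d j) \<in> R \<and> (d j, d i) \<in> R)" by (elim exE conjE)
  have "\<exists>(M' :: ('s, 'f, 'r, ('s, 'f, 'r) univ) struct) (N :: ('ns, 'nf, 'nr, ('s, 'f, 'r) univ list set) struct).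
    is_model L T M' \<and> interpreted_in L M' osig N \<and> \<not> G_compact osig (Th osig N)"
  \<comment> \<open>Either chains of immediate successors have bounded length, and the initial
    points are dense, or arbitrarily long chains yield a hyperfinite interval in an
    ultrapower.\<close>
  proof (cases "\<exists>k. \<forall>x y. (x, y) \<notin> covers R ^^ k")
    case True
    then obtain k where k: "\<forall>x y. (x, y) \<notin> covers R ^^ k" by (elim exE)
    interpret definable_preorder R L M ss
      using R by (simp add: definable_preorder_def definable_preorder_axioms_def)
    show ?thesis
      by (rule dense_interval_cover[of d k, OF _ _ _ assms(1) M inj_fm_singleton]) (simp_all add: d k)
  next
    case False
    then have chains: "\<exists>x y. (x, y) \<in> covers R ^^ Suc k" for k by blast
    obtain enc :: "(nat \<Rightarrow> ('s, 'f, 'r) fm) \<Rightarrow> ('s, 'f, 'r) univ" where enc: "inj enc" using ex_sequence_code by blast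
    show ?thesis by (rule discrete_interval_cover[OF assms(1) M R chains enc])
  qed
  then obtain M' :: "('s, 'f, 'r, ('s, 'f, 'r) univ) struct" and N' :: "('ns, 'nf, 'nr, ('s, 'f, 'r) univ list set) struct"
    where "is_model L T M'" "interpreted_in L M' osig N'" "\<not> G_compact osig (Th osig N')" by blast
  then show ?thesis unfolding hereditarily_G_compact_def using wf_osig by blast
qed

end
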